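(* Let $T>0$, let $\mathsf Q_\vartheta,\mathsf R_\vartheta$ be the homogenized strain-gradient stiffness and inertia operators with weight $\vartheta>\vartheta_0$ (so that properties (a)–(e) listed in the context hold), and consider the initial-value problem $$\mathsf Q_\vartheta U+\mathsf R_\vartheta U''=G\ \text{ in }[0,T]\times\mathbb R^d,\qquad U(0)=U_{\mathrm i},\quad U'(0)=V_{\mathrm i},$$ written for $\mathsf U=(U,V)$ with $V=U'$ as the first-order system $$\mathsf U'(t)+\mathcal A\,\mathsf U(t)=\mathsf F(t),\quad \mathsf U(0)=\mathsf U_0:=(U_{\mathrm i},V_{\mathrm i}),\qquad \mathcal A\mathsf U:=(-V,\ \mathsf R_\vartheta^{-1}\mathsf Q_\vartheta U),\quad \mathsf F:=(0,\ \mathsf R_\vartheta^{-1}G).$$ Let $\mathsf U_0\in D(\mathcal A)$ and let $G$ be such that $\mathsf R_\vartheta^{-1}G\in C^1([0,T];H^1(\mathbb R^d))$ or $\mathsf R_\vartheta^{-1}G\in C^0([0,T];H^2(\mathbb R^d))$. Then: (a) the initial-value problem has a unique solution $\mathsf U\in C^1([0,T];\mathcal H)\cap C^0([0,T];D(\mathcal A))$; (b) if $G=0$, the solution has the energy conservation property $$E(t)=E(0),\qquad E(t):=\tfrac12\mathcal Q_\vartheta(U(t),U(t))+\tfrac12\mathcal R_\vartheta(U'(t),U'(t)),\qquad t\in[0,T];$$ otherwise, the solution verifies the estimate $$\|\mathsf U(t)\|_{\mathcal H}^2\le C(T)\Big(\|\mathsf U_0\|_{\mathcal H}^2+\|\mathsf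 F\|^2_{L^2([0,T];\mathcal H)}\Big)\quad\text{with } C(T)=\exp(2T),\qquad t\in[0,T].$$
   Context: Let $d\in\{2,3\}$; repeated indices are summed. $H^s(\mathbb R^d)$ stands for $H^s(\mathbb R^d;\mathbb R^d)$; primes are time derivatives; space-time functions are treated as functions of time with values in Hilbert spaces. Cell and material. $v_1,\dots,v_d$ is a basis of $\mathbb R^d$ and $\mathcal Z=\{\sum_i n_iv_i:\ n_i\in\mathbb Z\}$. The (reference) periodicity cell $\mathcal Y\subset\mathbb R^d$ is a bounded open set (with Lebesgue-null boundary) whose translates $\mathcal Y+V$, $V\in\mathcal Z$, are pairwise disjoint and have closures covering $\mathbb R^d$; $\ell>0$ is the cell size. The elasticity tensor $C=(C_{ijkp})\in L^\infty(\mathcal Y)$ is real, has the symmetries $C_{ijkp}=C_{jikp}=C_{ijpk}=C_{kpij}$ and satisfies $\varepsilon_{ij}C_{ijkp}(y)\varepsilon_{kp}\ge\kappa_m|\varepsilon|^2$ for all symmetric $\varepsilon$ and some $\kappa_m>0$. The mass density $\rho\in L^\infty(\mathcal Y)$ satisfies $\rho\ge\rho_m>0$. $H^1_\#(\mathcal Y)$ is the space of zero-mean functions in the closure in $H^1(\mathcal Y;\mathbb R^d)$ of smooth $\mathcal Z$-periodic vector functions. $\langle f\rangle:=|\mathcal Y|^{-1}\int_{\mathcal Y}f\,dy$, $f_{,s}=\partial f/\partial y_s$, $A(w,v):=\int_{\mathcal Y}w_{i,j}C_{ijkp}v_{k,p}\,dy$, $\rho^0:=\langle\rho\rangle$, $\beta:=\rho/\rho^0$.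 Cell functions and effective tensors (each cell function is the unique element of $H^1_\#(\mathcal Y)$ satisfying the identity for all $v\in H^1_\#(\mathcal Y)$): - $A(\chi^{1kl},v)=-\int_{\mathcal Y}C_{klrs}v_{r,s}\,dy$; $\ S^{0,kl}_{ij}:=C_{ijpq}\chi^{1kl}_{p,q}+C_{ijkl}$; $\ C^0_{ijkl}:=\langle S^{0,kl}_{ij}\rangle$. - $A(\chi^{2klm},v)=\int_{\mathcal Y}\{(S^{0,kl}_{mr}-C^0_{klmr})v_r-\chi^{1kl}_pC_{pmrs}v_{r,s}\}\,dy$; $\ S^{1,klm}_{ij}:=C_{ijpq}\chi^{2klm}_{p,q}+C_{ijpm}\chi^{1kl}_p$; $\ C^1_{ijklm}:=\langle S^{1,klm}_{ij}\rangle$. - $A(\chi^{3klmn},v)=\int_{\mathcal Y}\{(S^{1,klm}_{rn}-C^1_{rnklm})v_r-\chi^{2klm}_pC_{pnrs}v_{r,s}\}\,dy$; $\ C^2_{ijnklm}:=\langle C_{ijpq}(\chi^{3klmn}_{p,q}+\chi^{2klm}_p\delta_{qn})\rangle$. - $A(\zeta^{2n},v)=\int_{\mathcal Y}(\beta-1)v_n\,dy$; $\ \phi^1_{ikl}:=C_{ilpq}\zeta^{2k}_{p,q}+\beta\chi^{1kl}_i$; $\ B^1_{ikl}:=\langle\phi^1_{ikl}\rangle$; $\ \beta^2_{ik}:=\langle\beta\zeta^{2k}_i\rangle$ (2 is a label). - $A(\zeta^{3kl},v)=\int_{\mathcal Y}(\phi^1_{rkl}-B^1_{rkl})v_r\,dy-\int_{\mathcal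 Y}\zeta^{2k}_aC_{alrs}v_{r,s}\,dy$; $\ \phi^2_{ilkm}:=C_{ilab}\zeta^{3km}_{a,b}+C_{ilam}\zeta^{2k}_a+\beta\chi^{2mkl}_i$; $\ B^2_{ilkm}:=\langle\phi^2_{ilkm}\rangle$. - $A^2_{ijnklm}(\vartheta):=\vartheta\,C^0_{ijkl}\delta_{nm}-C^2_{ijnklm}+\beta^2_{ba}C^0_{anij}C^0_{bmkl}$; $\ J^2_{ilkm}(\vartheta):=\vartheta\,\delta_{ik}\delta_{lm}-B^2_{ilkm}+\beta^2_{ia}C^0_{alkm}+\beta^2_{ka}C^0_{amil}$. Known symmetries: $C^0$ has the minor and major symmetries; $C^1_{ijklm}=C^1_{jiklm}=C^1_{ijlkm}=-C^1_{klijm}$; $C^2_{ijnklm}=C^2_{jinklm}=C^2_{ijnlkm}=C^2_{klmijn}$; $B^1_{ikl}=-B^1_{kil}$; $B^2_{ilkm}=B^2_{kmil}$; $\beta^2_{ik}=\beta^2_{ki}$. Operators: $$(\mathsf Q_\vartheta U)_i=-C^0_{ijkl}\partial_j\partial_lU_k-\ell C^1_{ijklm}\partial_j\partial_l\partial_mU_k+\ell^2A^2_{ijnklm}(\vartheta)\,\partial_j\partial_n\partial_l\partial_mU_k,$$ $$(\mathsf R_\vartheta U)_i=\rho^0\big(U_i+\ell B^1_{ikl}\partial_lU_k-\ell^2J^2_{ilkm}(\vartheta)\,\partial_l\partial_mU_k\big).$$ Associated symmetric bilinear forms, continuous on $H^2(\mathbb R^d)$ and $H^1(\mathbb R^d)$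 respectively, with $\varepsilon_{ij}(U)=\frac12(\partial_jU_i+\partial_iU_j)$, $\eta_{ijn}(U)=\partial_n\varepsilon_{ij}(U)$: $$\mathcal Q_\vartheta(U,W)=\int_{\mathbb R^d}\big(\varepsilon_{ij}(W)C^0_{ijkl}\varepsilon_{kl}(U)+\ell\,\varepsilon_{ij}(W)C^1_{ijklm}\eta_{klm}(U)+\ell^2\eta_{ijn}(W)A^2_{ijnklm}(\vartheta)\eta_{klm}(U)\big)dx,$$ $$\mathcal R_\vartheta(U,W)=\int_{\mathbb R^d}\rho^0\big(W_iU_i+\ell\,W_iB^1_{ikl}\partial_lU_k+\ell^2\partial_lW_i\,J^2_{ilkm}(\vartheta)\,\partial_mU_k\big)dx.$$ Threshold. $\vartheta_0>0$ is a number (independent of $\ell$) such that for every $\vartheta>\vartheta_0$: (a) $2e_\vartheta(\varepsilon,\eta)=\varepsilon_{ij}C^0_{ijkl}\varepsilon_{kl}+\ell\varepsilon_{ij}C^1_{ijklm}\eta_{klm}+\ell^2\eta_{ijn}A^2_{ijnklm}(\vartheta)\eta_{klm}$ is positive definite on $S^2(\mathbb R^d)\times(S^2(\mathbb R^d)\otimes\mathbb R^d)$ (where $S^2(\mathbb R^d)$ is the space of symmetric $d\times d$ tensors) and $\mathcal Q_\vartheta$ is positive; (b) $2k_\vartheta(u,\gamma)=\rho^0\{|u|^2+\ell u_iB^1_{ikl}\gamma_{kl}+\ell^2\gamma_{il}J^2_{ilkm}(\vartheta)\gamma_{km}\}$ is positive definite on $\mathbb R^d\times(\mathbb R^d\otimes\mathbb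 R^d)$ and $\mathcal R_\vartheta$ is positive; (c) the Fourier symbols $\mathsf Q_\vartheta(\mathrm i\xi)$, $\mathsf R_\vartheta(\mathrm i\xi)$ (obtained by replacing $\partial$ with $\mathrm i\xi$) are positive definite Hermitian for $\xi\in\mathbb R^d\setminus\{0\}$; (d) $\mathcal Q_\vartheta(U,U)\ge C(\|U\|_{H^2}^2-\|U\|_{L^2}^2)\ge0$ for all $U\in H^2(\mathbb R^d)$ and some $C>0$; (e) $\mathcal R_\vartheta(W,W)\ge C\|W\|_{H^1}^2$ for all $W\in H^1(\mathbb R^d)$ and some $C>0$. Functional framework. $\mathsf R_\vartheta^{-1}$ is defined variationally: $z=\mathsf R_\vartheta^{-1}f$ iff $z\in H^1(\mathbb R^d)$ and $\mathcal R_\vartheta(z,W)=(f,W)$ for all $W\in H^1(\mathbb R^d)$, with $(\cdot,\cdot)$ the $L^2$ product (for $f\in H^{-1}(\mathbb R^d)$, the $H^{-1}$–$H^1$ duality). $\mathcal H:=H^2(\mathbb R^d)\times H^1(\mathbb R^d)$, equipped with the scalar product $$(\mathsf U_1,\mathsf U_2)_{\mathcal H}:=\mathcal Q_\vartheta(U_1,U_2)+\mathcal R_\vartheta(U_1,U_2)+\mathcal R_\vartheta(V_1,V_2),\qquad \mathsf U_i=(U_i,V_i),$$ whose norm is equivalent to the standard one. $D(\mathcal A):=\{W\in H^2(\mathbb R^d):\ \mathsf Q_\vartheta W\in H^{-1}(\mathbb R^d)\}\times H^2(\mathbb R^d)$, equipped with the scalar product $(\mathsf U_1,\mathsf U_2)_{\mathcal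 H}+(\mathcal A\mathsf U_1,\mathcal A\mathsf U_2)_{\mathcal H}$. *)

theory Defs
  imports "HOL-Analysis.Analysis" "HOL-Library.Function_Algebras"
begin

section \<open>Function spaces\<close>

text \<open>
  Elements of Lebesgue and Sobolev spaces are represented by measurable functions; equality in
  these spaces is equality almost everywhere. Consequently the norms below are seminorms on
  functions. Functions form a real vector space under the pointwise operations, so that
  paths with values in a function space can be treated as maps into a type of class
  \<^class>\<open>real_vector\<close>.
\<close>

instantiation "fun" :: (type, scaleR) scaleR
begin
definition "scaleR c f = (\<lambda>x. c *\<^sub>R f x)"
instance ..
end

lemma scaleR_fun_apply [simp]: "(c *\<^sub>R f) x = c *\<^sub>R f x"
  by (simp add: scaleR_fun_def)

instance "fun" :: (type, real_vector) real_vector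
  by standard (simp_all add: fun_eq_iff scaleR_add_left scaleR_add_right)

type_synonym 'd field = "real ^ 'd \<Rightarrow> real ^ 'd"

definition pd :: "'d::finite \<Rightarrow> (real ^ 'd \<Rightarrow> 'b::real_normed_vector) \<Rightarrow> real ^ 'd \<Rightarrow> 'b" where
  "pd j f x = frechet_derivative f (at x) (axis j 1)"

primrec Ck :: "nat \<Rightarrow> (real ^ 'd::finite \<Rightarrow> 'b::real_normed_vector) \<Rightarrow> bool" where
  "Ck 0 f \<longleftrightarrow> continuous_on UNIV f"
| "Ck (Suc n) f \<longleftrightarrow> (\<forall>x. f differentiable (at x)) \<and> (\<forall>j. Ck n (pd j f))"

definition smooth :: "(real ^ 'd::finite \<Rightarrow> 'b::real_normed_vector) \<Rightarrow> bool" where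
  "smooth f \<longleftrightarrow> (\<forall>n. Ck n f)"

definition test_fun :: "(real ^ 'd::finite) set \<Rightarrow> (real ^ 'd \<Rightarrow> 'b::real_normed_vector) \<Rightarrow> bool" where
  "test_fun \<Omega> \<phi> \<longleftrightarrow> smooth \<phi> \<and> compact (closure {x. \<phi> x \<noteq> 0}) \<and> closure {x. \<phi> x \<noteq> 0} \<subseteq> \<Omega>"

definition Linf :: "(real ^ 'd::finite) set \<Rightarrow> (real ^ 'd \<Rightarrow> real) \<Rightarrow> bool" where
  "Linf \<Omega> f \<longleftrightarrow> f \<in> borel_measurable (lebesgue_on \<Omega>) \<and> (\<exists>K. AE x in lebesgue_on \<Omega>. \<bar>f x\<bar> \<le> K)"

definition L2 :: "(real ^ 'd::finite) set \<Rightarrow> (real ^ 'd \<Rightarrow> 'b::euclidean_space) \<Rightarrow> bool" where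
  "L2 \<Omega> f \<longleftrightarrow> f \<in> borel_measurable (lebesgue_on \<Omega>) \<and>
     integrable (lebesgue_on \<Omega>) (\<lambda>x. (norm (f x))\<^sup>2)"

definition has_weak_pd ::
  "(real ^ 'd::finite) set \<Rightarrow> 'd \<Rightarrow> (real ^ 'd \<Rightarrow> 'b::euclidean_space) \<Rightarrow> (real ^ 'd \<Rightarrow> 'b) \<Rightarrow> bool" where
  "has_weak_pd \<Omega> j f g \<longleftrightarrow> L2 \<Omega> f \<and> L2 \<Omega> g \<and>
     (\<forall>\<phi>::real ^ 'd \<Rightarrow> real. test_fun \<Omega> \<phi> \<longrightarrow>
        (\<integral>x. pd j \<phi> x *\<^sub>R f x \<partial>lebesgue_on \<Omega>) = - (\<integral>x. \<phi> x *\<^sub>R g x \<partial>lebesgue_on \<Omega>))"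

definition wpd ::
  "(real ^ 'd::finite) set \<Rightarrow> 'd \<Rightarrow> (real ^ 'd \<Rightarrow> 'b::euclidean_space) \<Rightarrow> real ^ 'd \<Rightarrow> 'b" where
  "wpd \<Omega> j f = (SOME g. has_weak_pd \<Omega> j f g)"

primrec sobolev :: "nat \<Rightarrow> (real ^ 'd::finite) set \<Rightarrow> (real ^ 'd \<Rightarrow> 'b::euclidean_space) set" where
  "sobolev 0 \<Omega> = {f. L2 \<Omega> f}"
| "sobolev (Suc k) \<Omega> = {f. L2 \<Omega> f \<and> (\<forall>j. \<exists>g\<in>sobolev k \<Omega>. has_weak_pd \<Omega> j f g)}"

text \<open>The square of the norm is the sum of the squared norms of \<open>f\<close>, \<open>\<nabla>f\<close>, \dots, \<open>\<nabla>\<^sup>k f\<close> in \<open>L\<^sup>2\<close>.\<close>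

primrec sobolev_sqnorm :: "nat \<Rightarrow> (real ^ 'd::finite) set \<Rightarrow> (real ^ 'd \<Rightarrow> 'b::euclidean_space) \<Rightarrow> real" where
  "sobolev_sqnorm 0 \<Omega> f = (\<integral>x. (norm (f x))\<^sup>2 \<partial>lebesgue_on \<Omega>)"
| "sobolev_sqnorm (Suc k) \<Omega> f =
     (\<integral>x. (norm (f x))\<^sup>2 \<partial>lebesgue_on \<Omega>) + (\<Sum>j\<in>UNIV. sobolev_sqnorm k \<Omega> (wpd \<Omega> j f))"

definition sobolev_norm :: "nat \<Rightarrow> (real ^ 'd::finite) set \<Rightarrow> (real ^ 'd \<Rightarrow> 'b::euclidean_space) \<Rightarrow> real" where
  "sobolev_norm k \<Omega> f = sqrt (sobolev_sqnorm k \<Omega> f)"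

abbreviation L2space :: "'d::finite field set" where "L2space \<equiv> sobolev 0 UNIV"
abbreviation H1 :: "'d::finite field set" where "H1 \<equiv> sobolev 1 UNIV"
abbreviation H2 :: "'d::finite field set" where "H2 \<equiv> sobolev 2 UNIV"

abbreviation H1norm :: "'d::finite field \<Rightarrow> real" where "H1norm \<equiv> sobolev_norm 1 UNIV"
abbreviation H2norm :: "'d::finite field \<Rightarrow> real" where "H2norm \<equiv> sobolev_norm 2 UNIV"
abbreviation L2norm :: "'d::finite field \<Rightarrow> real" where "L2norm \<equiv> sobolev_norm 0 UNIV"

definition C0_path :: "'a::real_vector set \<Rightarrow> ('a \<Rightarrow> real) \<Rightarrow> real set \<Rightarrow> (real \<Rightarrow> 'a) \<Rightarrow> bool" where
  "C0_path X N I u \<longleftrightarrow> (\<forall>t\<in>I. u t \<in> X \<and> ((\<lambda>s. N (u s - u t)) \<longlongrightarrow> 0) (at t within I))"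

text \<open>\<open>u\<close> is continuously differentiable with derivative \<open>u'\<close>, both in the norm \<open>N\<close> (one-sided at the
  end points of the interval \<open>I\<close>).\<close>

definition C1_path ::
  "'a::real_vector set \<Rightarrow> ('a \<Rightarrow> real) \<Rightarrow> real set \<Rightarrow> (real \<Rightarrow> 'a) \<Rightarrow> (real \<Rightarrow> 'a) \<Rightarrow> bool" where
  "C1_path X N I u u' \<longleftrightarrow> C0_path X N I u \<and> C0_path X N I u' \<and>
     (\<forall>t\<in>I. ((\<lambda>s. N ((u s - u t) /\<^sub>R (s - t) - u' t)) \<longlongrightarrow> 0) (at t within I))"

section \<open>Distributions and the dual of the first-order Sobolev space\<close>

definition dist_of :: "(real ^ 'd::finite \<Rightarrow> real) \<Rightarrow> (real ^ 'd \<Rightarrow> real) \<Rightarrow> real" where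
  "dist_of f \<phi> = (\<integral>x. f x * \<phi> x \<partial>lebesgue)"

definition dpd :: "'d::finite \<Rightarrow> ((real ^ 'd \<Rightarrow> real) \<Rightarrow> real) \<Rightarrow> (real ^ 'd \<Rightarrow> real) \<Rightarrow> real" where
  "dpd j T \<phi> = - T (pd j \<phi>)"

definition vdist :: "('d \<Rightarrow> (real ^ 'd \<Rightarrow> real) \<Rightarrow> real) \<Rightarrow> 'd::finite field \<Rightarrow> real" where
  "vdist T \<phi> = (\<Sum>i\<in>UNIV. T i (\<lambda>x. \<phi> x $ i))"

definition Hm1 :: "('d::finite field \<Rightarrow> real) set" where
  "Hm1 = {f. (\<forall>a. \<forall>U\<in>H1. \<forall>W\<in>H1. f (a *\<^sub>R U + W) = a * f U + f W) \<and>
             (\<exists>K. \<forall>W\<in>H1. \<bar>f W\<bar> \<le> K * H1norm W)}"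

text \<open>A vector distribution \<open>T\<close> belongs to \<open>H\<^sup>-\<^sup>1\<close> iff it is the restriction to test fields of
  a (necessarily unique) element of \<^const>\<open>Hm1\<close>, which gives its duality pairing with \<open>H\<^sup>1\<close>.\<close>

definition dist_extends :: "('d \<Rightarrow> (real ^ 'd \<Rightarrow> real) \<Rightarrow> real) \<Rightarrow> ('d::finite field \<Rightarrow> real) \<Rightarrow> bool" where
  "dist_extends T f \<longleftrightarrow> f \<in> Hm1 \<and> (\<forall>\<phi>. test_fun UNIV \<phi> \<longrightarrow> f \<phi> = vdist T \<phi>)"

definition in_Hm1 :: "('d \<Rightarrow> (real ^ 'd::finite \<Rightarrow> real) \<Rightarrow> real) \<Rightarrow> bool" where
  "in_Hm1 T \<longleftrightarrow> (\<exists>f. dist_extends T f)"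

definition Hm1_of :: "('d \<Rightarrow> (real ^ 'd \<Rightarrow> real) \<Rightarrow> real) \<Rightarrow> 'd::finite field \<Rightarrow> real" where
  "Hm1_of T = (SOME f. dist_extends T f)"

section \<open>Cell, material and cell functions\<close>

text \<open>
  For the stresses \<open>S0\<close> and \<open>S1\<close> the superscript indices precede the subscript indices:
  \<open>S0 M k l i j\<close> is the component \<open>i j\<close> of the stress of the cell function \<open>chi1 M k l\<close>,
  and \<open>S1 M k l m i j\<close> that of \<open>chi2 M k l m\<close>.
\<close>

record ('d::finite) cell_model =
  lattice_basis :: "'d \<Rightarrow> real ^ 'd"
  Ycell :: "(real ^ 'd) set"
  elast :: "'d \<Rightarrow> 'd \<Rightarrow> 'd \<Rightarrow> 'd \<Rightarrow> real ^ 'd \<Rightarrow> real"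
  mass_density :: "real ^ 'd \<Rightarrow> real"
  chi1 :: "'d \<Rightarrow> 'd \<Rightarrow> real ^ 'd \<Rightarrow> real ^ 'd"
  chi2 :: "'d \<Rightarrow> 'd \<Rightarrow> 'd \<Rightarrow> real ^ 'd \<Rightarrow> real ^ 'd"
  chi3 :: "'d \<Rightarrow> 'd \<Rightarrow> 'd \<Rightarrow> 'd \<Rightarrow> real ^ 'd \<Rightarrow> real ^ 'd"
  zeta2 :: "'d \<Rightarrow> real ^ 'd \<Rightarrow> real ^ 'd"
  zeta3 :: "'d \<Rightarrow> 'd \<Rightarrow> real ^ 'd \<Rightarrow> real ^ 'd"

definition lattice :: "'d::finite cell_model \<Rightarrow> (real ^ 'd) set" where
  "lattice M = {V. \<exists>n::'d \<Rightarrow> int. V = (\<Sum>i\<in>UNIV. of_int (n i) *\<^sub>R lattice_basis M i)}"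

definition periodicity_cell :: "'d::finite cell_model \<Rightarrow> bool" where
  "periodicity_cell M \<longleftrightarrow>
     inj (lattice_basis M) \<and> independent (range (lattice_basis M)) \<and> span (range (lattice_basis M)) = UNIV \<and>
     bounded (Ycell M) \<and> open (Ycell M) \<and> negligible (frontier (Ycell M)) \<and>
     (\<forall>V\<in>lattice M. \<forall>V'\<in>lattice M. V \<noteq> V' \<longrightarrow> (+) V ` Ycell M \<inter> (+) V' ` Ycell M = {}) \<and>
     (\<Union>V\<in>lattice M. closure ((+) V ` Ycell M)) = UNIV"

definition material :: "'d::finite cell_model \<Rightarrow> bool" where
  "material M \<longleftrightarrow>
     (\<forall>i j k p. Linf (Ycell M) (elast M i j k p)) \<and>
     (AE y in lebesgue_on (Ycell M). \<forall>i j k p.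
        elast M i j k p y = elast M j i k p y \<and>
        elast M i j k p y = elast M i j p k y \<and>
        elast M i j k p y = elast M k p i j y) \<and>
     (\<exists>\<kappa>>0. AE y in lebesgue_on (Ycell M). \<forall>\<epsilon>::'d \<Rightarrow> 'd \<Rightarrow> real. (\<forall>i j. \<epsilon> i j = \<epsilon> j i) \<longrightarrow>
        (\<Sum>(i,j,k,p)\<in>UNIV. \<epsilon> i j * elast M i j k p y * \<epsilon> k p) \<ge> \<kappa> * (\<Sum>(i,j)\<in>UNIV. (\<epsilon> i j)\<^sup>2)) \<and>
     Linf (Ycell M) (mass_density M) \<and>
     (\<exists>\<rho>m>0. AE y in lebesgue_on (Ycell M). mass_density M y \<ge> \<rho>m)"

definition avg :: "'d::finite cell_model \<Rightarrow> (real ^ 'd \<Rightarrow> real) \<Rightarrow> real" where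
  "avg M f = (\<integral>y. f y \<partial>lebesgue_on (Ycell M)) / measure lebesgue (Ycell M)"

definition H1per :: "'d::finite cell_model \<Rightarrow> 'd field set" where
  "H1per M = {w \<in> sobolev 1 (Ycell M).
     (\<integral>y. w y \<partial>lebesgue_on (Ycell M)) = 0 \<and>
     (\<forall>e>0. \<exists>\<phi>::'d field. smooth \<phi> \<and> (\<forall>x. \<forall>V\<in>lattice M. \<phi> (x + V) = \<phi> x) \<and>
        sobolev_norm 1 (Ycell M) (w - \<phi>) < e)}"

text \<open>The cell derivative \<open>w\<^sub>i\<^sub>,\<^sub>j\<close>.\<close>

definition cd :: "'d::finite cell_model \<Rightarrow> 'd field \<Rightarrow> 'd \<Rightarrow> 'd \<Rightarrow> real ^ 'd \<Rightarrow> real" where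
  "cd M w i j y = wpd (Ycell M) j w y $ i"

definition Aform :: "'d::finite cell_model \<Rightarrow> 'd field \<Rightarrow> 'd field \<Rightarrow> real" where
  "Aform M w v =
     (\<integral>y. (\<Sum>(i,j,k,p)\<in>UNIV. cd M w i j y * elast M i j k p y * cd M v k p y) \<partial>lebesgue_on (Ycell M))"

definition rho0 :: "'d::finite cell_model \<Rightarrow> real" where
  "rho0 M = avg M (mass_density M)"

definition beta :: "'d::finite cell_model \<Rightarrow> real ^ 'd \<Rightarrow> real" where
  "beta M y = mass_density M y / rho0 M"

definition kd :: "'d \<Rightarrow> 'd \<Rightarrow> real" where
  "kd i j = (if i = j then 1 else 0)"

definition S0 :: "'d::finite cell_model \<Rightarrow> 'd \<Rightarrow> 'd \<Rightarrow> 'd \<Rightarrow> 'd \<Rightarrow> real ^ 'd \<Rightarrow> real" where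
  "S0 M k l i j y = (\<Sum>(p,q)\<in>UNIV. elast M i j p q y * cd M (chi1 M k l) p q y) + elast M i j k l y"

definition C0 :: "'d::finite cell_model \<Rightarrow> 'd \<Rightarrow> 'd \<Rightarrow> 'd \<Rightarrow> 'd \<Rightarrow> real" where
  "C0 M i j k l = avg M (S0 M k l i j)"

definition S1 :: "'d::finite cell_model \<Rightarrow> 'd \<Rightarrow> 'd \<Rightarrow> 'd \<Rightarrow> 'd \<Rightarrow> 'd \<Rightarrow> real ^ 'd \<Rightarrow> real" where
  "S1 M k l m i j y = (\<Sum>(p,q)\<in>UNIV. elast M i j p q y * cd M (chi2 M k l m) p q y) +
     (\<Sum>p\<in>UNIV. elast M i j p m y * chi1 M k l y $ p)"

definition C1 :: "'d::finite cell_model \<Rightarrow> 'd \<Rightarrow> 'd \<Rightarrow> 'd \<Rightarrow> 'd \<Rightarrow> 'd \<Rightarrow> real" where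
  "C1 M i j k l m = avg M (S1 M k l m i j)"

definition C2 :: "'d::finite cell_model \<Rightarrow> 'd \<Rightarrow> 'd \<Rightarrow> 'd \<Rightarrow> 'd \<Rightarrow> 'd \<Rightarrow> 'd \<Rightarrow> real" where
  "C2 M i j n k l m = avg M (\<lambda>y. \<Sum>(p,q)\<in>UNIV.
     elast M i j p q y * (cd M (chi3 M k l m n) p q y + chi2 M k l m y $ p * kd q n))"

definition phi1 :: "'d::finite cell_model \<Rightarrow> 'd \<Rightarrow> 'd \<Rightarrow> 'd \<Rightarrow> real ^ 'd \<Rightarrow> real" where
  "phi1 M i k l y = (\<Sum>(p,q)\<in>UNIV. elast M i l p q y * cd M (zeta2 M k) p q y) +
     beta M y * chi1 M k l y $ i"

definition B1 :: "'d::finite cell_model \<Rightarrow> 'd \<Rightarrow> 'd \<Rightarrow> 'd \<Rightarrow> real" where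
  "B1 M i k l = avg M (phi1 M i k l)"

definition beta2 :: "'d::finite cell_model \<Rightarrow> 'd \<Rightarrow> 'd \<Rightarrow> real" where
  "beta2 M i k = avg M (\<lambda>y. beta M y * zeta2 M k y $ i)"

definition phi2 :: "'d::finite cell_model \<Rightarrow> 'd \<Rightarrow> 'd \<Rightarrow> 'd \<Rightarrow> 'd \<Rightarrow> real ^ 'd \<Rightarrow> real" where
  "phi2 M i l k m y = (\<Sum>(a,b)\<in>UNIV. elast M i l a b y * cd M (zeta3 M k m) a b y) +
     (\<Sum>a\<in>UNIV. elast M i l a m y * zeta2 M k y $ a) + beta M y * chi2 M m k l y $ i"

definition B2 :: "'d::finite cell_model \<Rightarrow> 'd \<Rightarrow> 'd \<Rightarrow> 'd \<Rightarrow> 'd \<Rightarrow> real" where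
  "B2 M i l k m = avg M (phi2 M i l k m)"

definition A2 :: "'d::finite cell_model \<Rightarrow> real \<Rightarrow> 'd \<Rightarrow> 'd \<Rightarrow> 'd \<Rightarrow> 'd \<Rightarrow> 'd \<Rightarrow> 'd \<Rightarrow> real" where
  "A2 M \<theta> i j n k l m = \<theta> * C0 M i j k l * kd n m - C2 M i j n k l m +
     (\<Sum>(a,b)\<in>UNIV. beta2 M b a * C0 M a n i j * C0 M b m k l)"

definition J2 :: "'d::finite cell_model \<Rightarrow> real \<Rightarrow> 'd \<Rightarrow> 'd \<Rightarrow> 'd \<Rightarrow> 'd \<Rightarrow> real" where
  "J2 M \<theta> i l k m = \<theta> * kd i k * kd l m - B2 M i l k m +
     (\<Sum>a\<in>UNIV. beta2 M i a * C0 M a l k m) + (\<Sum>a\<in>UNIV. beta2 M k a * C0 M a m i l)"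

definition unique_cell_solution :: "'d::finite cell_model \<Rightarrow> 'd field \<Rightarrow> ('d field \<Rightarrow> real) \<Rightarrow> bool" where
  "unique_cell_solution M w F \<longleftrightarrow>
     w \<in> H1per M \<and> (\<forall>v\<in>H1per M. Aform M w v = F v) \<and>
     (\<forall>w'\<in>H1per M. (\<forall>v\<in>H1per M. Aform M w' v = F v) \<longrightarrow>
        (AE y in lebesgue_on (Ycell M). w' y = w y))"

definition cell_functions :: "'d::finite cell_model \<Rightarrow> bool" where
  "cell_functions M \<longleftrightarrow>
     (\<forall>k l. unique_cell_solution M (chi1 M k l) (\<lambda>v.
        - (\<integral>y. (\<Sum>(r,s)\<in>UNIV. elast M k l r s y * cd M v r s y) \<partial>lebesgue_on (Ycell M)))) \<and>
     (\<forall>k l m. unique_cell_solution M (chi2 M k l m) (\<lambda>v.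
        (\<integral>y. (\<Sum>r\<in>UNIV. (S0 M k l m r y - C0 M k l m r) * v y $ r) -
             (\<Sum>(p,r,s)\<in>UNIV. chi1 M k l y $ p * elast M p m r s y * cd M v r s y)
           \<partial>lebesgue_on (Ycell M)))) \<and>
     (\<forall>k l m n. unique_cell_solution M (chi3 M k l m n) (\<lambda>v.
        (\<integral>y. (\<Sum>r\<in>UNIV. (S1 M k l m r n y - C1 M r n k l m) * v y $ r) -
             (\<Sum>(p,r,s)\<in>UNIV. chi2 M k l m y $ p * elast M p n r s y * cd M v r s y)
           \<partial>lebesgue_on (Ycell M)))) \<and>
     (\<forall>n. unique_cell_solution M (zeta2 M n) (\<lambda>v.
        (\<integral>y. (beta M y - 1) * v y $ n \<partial>lebesgue_on (Ycell M)))) \<and>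
     (\<forall>k l. unique_cell_solution M (zeta3 M k l) (\<lambda>v.
        (\<integral>y. (\<Sum>r\<in>UNIV. (phi1 M r k l y - B1 M r k l) * v y $ r) \<partial>lebesgue_on (Ycell M)) -
        (\<integral>y. (\<Sum>(a,r,s)\<in>UNIV. zeta2 M k y $ a * elast M a l r s y * cd M v r s y)
           \<partial>lebesgue_on (Ycell M))))"

section \<open>Homogenized operators, symbols and bilinear forms\<close>

definition Qop ::
  "'d::finite cell_model \<Rightarrow> real \<Rightarrow> real \<Rightarrow> 'd field \<Rightarrow> 'd \<Rightarrow> (real ^ 'd \<Rightarrow> real) \<Rightarrow> real" where
  "Qop M ell \<theta> U i \<phi> =
     - (\<Sum>(j,k,l)\<in>UNIV. C0 M i j k l * dpd j (dpd l (dist_of (\<lambda>x. U x $ k))) \<phi>)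
     - ell * (\<Sum>(j,k,l,m)\<in>UNIV. C1 M i j k l m * dpd j (dpd l (dpd m (dist_of (\<lambda>x. U x $ k)))) \<phi>)
     + ell\<^sup>2 * (\<Sum>(j,n,k,l,m)\<in>UNIV. A2 M \<theta> i j n k l m *
         dpd j (dpd n (dpd l (dpd m (dist_of (\<lambda>x. U x $ k))))) \<phi>)"

definition Rop ::
  "'d::finite cell_model \<Rightarrow> real \<Rightarrow> real \<Rightarrow> 'd field \<Rightarrow> 'd \<Rightarrow> (real ^ 'd \<Rightarrow> real) \<Rightarrow> real" where
  "Rop M ell \<theta> U i \<phi> = rho0 M *
     (dist_of (\<lambda>x. U x $ i) \<phi>
      + ell * (\<Sum>(k,l)\<in>UNIV. B1 M i k l * dpd l (dist_of (\<lambda>x. U x $ k)) \<phi>)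
      - ell\<^sup>2 * (\<Sum>(l,k,m)\<in>UNIV. J2 M \<theta> i l k m * dpd l (dpd m (dist_of (\<lambda>x. U x $ k))) \<phi>))"

definition isym :: "real ^ 'd \<Rightarrow> 'd \<Rightarrow> complex" where
  "isym \<xi> j = \<i> * complex_of_real (\<xi> $ j)"

definition Qsym :: "'d::finite cell_model \<Rightarrow> real \<Rightarrow> real \<Rightarrow> real ^ 'd \<Rightarrow> 'd \<Rightarrow> 'd \<Rightarrow> complex" where
  "Qsym M ell \<theta> \<xi> i k =
     - (\<Sum>(j,l)\<in>UNIV. of_real (C0 M i j k l) * isym \<xi> j * isym \<xi> l)
     - of_real ell * (\<Sum>(j,l,m)\<in>UNIV. of_real (C1 M i j k l m) * isym \<xi> j * isym \<xi> l * isym \<xi> m)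
     + (of_real ell)\<^sup>2 * (\<Sum>(j,n,l,m)\<in>UNIV. of_real (A2 M \<theta> i j n k l m) *
         isym \<xi> j * isym \<xi> n * isym \<xi> l * isym \<xi> m)"

definition Rsym :: "'d::finite cell_model \<Rightarrow> real \<Rightarrow> real \<Rightarrow> real ^ 'd \<Rightarrow> 'd \<Rightarrow> 'd \<Rightarrow> complex" where
  "Rsym M ell \<theta> \<xi> i k = of_real (rho0 M) *
     (of_real (kd i k)
      + of_real ell * (\<Sum>l\<in>UNIV. of_real (B1 M i k l) * isym \<xi> l)
      - (of_real ell)\<^sup>2 * (\<Sum>(l,m)\<in>UNIV. of_real (J2 M \<theta> i l k m) * isym \<xi> l * isym \<xi> m))"

definition herm_pos_def :: "('d::finite \<Rightarrow> 'd \<Rightarrow> complex) \<Rightarrow> bool" where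
  "herm_pos_def H \<longleftrightarrow> (\<forall>i k. H i k = cnj (H k i)) \<and>
     (\<forall>z::'d \<Rightarrow> complex. z \<noteq> 0 \<longrightarrow> Re (\<Sum>(i,k)\<in>UNIV. cnj (z i) * H i k * z k) > 0)"

text \<open>
  Polarized densities: \<open>e_dens\<close> and \<open>k_dens\<close> on the diagonal are twice the strain and kinetic energy
  densities \<open>e\<^sub>\<theta>\<close> and \<open>k\<^sub>\<theta>\<close>.
\<close>

definition e_dens ::
  "'d::finite cell_model \<Rightarrow> real \<Rightarrow> real \<Rightarrow> ('d \<Rightarrow> 'd \<Rightarrow> real) \<Rightarrow> ('d \<Rightarrow> 'd \<Rightarrow> 'd \<Rightarrow> real) \<Rightarrow>
    ('d \<Rightarrow> 'd \<Rightarrow> real) \<Rightarrow> ('d \<Rightarrow> 'd \<Rightarrow> 'd \<Rightarrow> real) \<Rightarrow> real" where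
  "e_dens M ell \<theta> \<epsilon>' \<eta>' \<epsilon> \<eta> =
     (\<Sum>(i,j,k,l)\<in>UNIV. \<epsilon>' i j * C0 M i j k l * \<epsilon> k l)
     + ell * (\<Sum>(i,j,k,l,m)\<in>UNIV. \<epsilon>' i j * C1 M i j k l m * \<eta> k l m)
     + ell\<^sup>2 * (\<Sum>(i,j,n,k,l,m)\<in>UNIV. \<eta>' i j n * A2 M \<theta> i j n k l m * \<eta> k l m)"

definition k_dens ::
  "'d::finite cell_model \<Rightarrow> real \<Rightarrow> real \<Rightarrow> ('d \<Rightarrow> real) \<Rightarrow> ('d \<Rightarrow> 'd \<Rightarrow> real) \<Rightarrow>
    ('d \<Rightarrow> real) \<Rightarrow> ('d \<Rightarrow> 'd \<Rightarrow> real) \<Rightarrow> real" where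
  "k_dens M ell \<theta> u' \<gamma>' u \<gamma> = rho0 M *
     ((\<Sum>i\<in>UNIV. u' i * u i)
      + ell * (\<Sum>(i,k,l)\<in>UNIV. u' i * B1 M i k l * \<gamma> k l)
      + ell\<^sup>2 * (\<Sum>(i,l,k,m)\<in>UNIV. \<gamma>' i l * J2 M \<theta> i l k m * \<gamma> k m))"

text \<open>\<open>grad U x k l\<close> is \<open>\<partial>\<^sub>l U\<^sub>k(x)\<close>.\<close>

definition grad :: "'d::finite field \<Rightarrow> real ^ 'd \<Rightarrow> 'd \<Rightarrow> 'd \<Rightarrow> real" where
  "grad U x k l = wpd UNIV l U x $ k"

definition strain :: "'d::finite field \<Rightarrow> real ^ 'd \<Rightarrow> 'd \<Rightarrow> 'd \<Rightarrow> real" where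
  "strain U x i j = (grad U x i j + grad U x j i) / 2"

definition strain_grad :: "'d::finite field \<Rightarrow> real ^ 'd \<Rightarrow> 'd \<Rightarrow> 'd \<Rightarrow> 'd \<Rightarrow> real" where
  "strain_grad U x i j n = wpd UNIV n (\<lambda>y. strain U y i j) x"

definition Qform :: "'d::finite cell_model \<Rightarrow> real \<Rightarrow> real \<Rightarrow> 'd field \<Rightarrow> 'd field \<Rightarrow> real" where
  "Qform M ell \<theta> U W =
     (\<integral>x. e_dens M ell \<theta> (strain W x) (strain_grad W x) (strain U x) (strain_grad U x) \<partial>lebesgue)"

definition Rform :: "'d::finite cell_model \<Rightarrow> real \<Rightarrow> real \<Rightarrow> 'd field \<Rightarrow> 'd field \<Rightarrow> real" where
  "Rform M ell \<theta> U W =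
     (\<integral>x. k_dens M ell \<theta> (($) (W x)) (grad W x) (($) (U x)) (grad U x) \<partial>lebesgue)"

text \<open>Positivity of a form means nonnegativity on the diagonal; strictness follows from the
  definiteness of the density. The coercivity constants may depend on \<open>ell\<close> and \<open>\<theta>\<close>.\<close>

definition admissible_weight :: "'d::finite cell_model \<Rightarrow> real \<Rightarrow> real \<Rightarrow> bool" where
  "admissible_weight M ell \<theta> \<longleftrightarrow>
     (\<forall>\<epsilon> \<eta>. (\<forall>i j. \<epsilon> i j = \<epsilon> j i) \<and> (\<forall>i j n. \<eta> i j n = \<eta> j i n) \<and> (\<epsilon> \<noteq> 0 \<or> \<eta> \<noteq> 0) \<longrightarrow>
        e_dens M ell \<theta> \<epsilon> \<eta> \<epsilon> \<eta> > 0) \<and>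
     (\<forall>U\<in>H2. Qform M ell \<theta> U U \<ge> 0) \<and>
     (\<forall>u \<gamma>. u \<noteq> 0 \<or> \<gamma> \<noteq> 0 \<longrightarrow> k_dens M ell \<theta> u \<gamma> u \<gamma> > 0) \<and>
     (\<forall>W\<in>H1. Rform M ell \<theta> W W \<ge> 0) \<and>
     (\<forall>\<xi>. \<xi> \<noteq> 0 \<longrightarrow> herm_pos_def (Qsym M ell \<theta> \<xi>) \<and> herm_pos_def (Rsym M ell \<theta> \<xi>)) \<and>
     (\<exists>c>0. \<forall>U\<in>H2. Qform M ell \<theta> U U \<ge> c * ((H2norm U)\<^sup>2 - (L2norm U)\<^sup>2) \<and>
        c * ((H2norm U)\<^sup>2 - (L2norm U)\<^sup>2) \<ge> 0) \<and>
     (\<exists>c>0. \<forall>W\<in>H1. Rform M ell \<theta> W W \<ge> c * (H1norm W)\<^sup>2)"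

definition weight_threshold :: "'d::finite cell_model \<Rightarrow> real \<Rightarrow> bool" where
  "weight_threshold M \<theta>0 \<longleftrightarrow> \<theta>0 > 0 \<and> (\<forall>ell>0. \<forall>\<theta>>\<theta>0. admissible_weight M ell \<theta>)"

section \<open>The evolution problem\<close>

definition Rinv :: "'d::finite cell_model \<Rightarrow> real \<Rightarrow> real \<Rightarrow> ('d field \<Rightarrow> real) \<Rightarrow> 'd field" where
  "Rinv M ell \<theta> f = (SOME z. z \<in> H1 \<and> (\<forall>W\<in>H1. Rform M ell \<theta> z W = f W))"

type_synonym 'd state = "'d field \<times> 'd field"

definition state_eq :: "'d::finite state \<Rightarrow> 'd state \<Rightarrow> bool" where
  "state_eq u w \<longleftrightarrow> (AE x in lebesgue. fst u x = fst w x) \<and> (AE x in lebesgue. snd u x = snd w x)"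

definition Hspace :: "'d::finite state set" where
  "Hspace = H2 \<times> H1"

definition Hip :: "'d::finite cell_model \<Rightarrow> real \<Rightarrow> real \<Rightarrow> 'd state \<Rightarrow> 'd state \<Rightarrow> real" where
  "Hip M ell \<theta> u w =
     Qform M ell \<theta> (fst u) (fst w) + Rform M ell \<theta> (fst u) (fst w) + Rform M ell \<theta> (snd u) (snd w)"

definition Hnorm :: "'d::finite cell_model \<Rightarrow> real \<Rightarrow> real \<Rightarrow> 'd state \<Rightarrow> real" where
  "Hnorm M ell \<theta> u = sqrt (Hip M ell \<theta> u u)"

definition Aop :: "'d::finite cell_model \<Rightarrow> real \<Rightarrow> real \<Rightarrow> 'd state \<Rightarrow> 'd state" where
  "Aop M ell \<theta> u = (- snd u, Rinv M ell \<theta> (Hm1_of (Qop M ell \<theta> (fst u))))"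

definition DA :: "'d::finite cell_model \<Rightarrow> real \<Rightarrow> real \<Rightarrow> 'd state set" where
  "DA M ell \<theta> = {W \<in> H2. in_Hm1 (Qop M ell \<theta> W)} \<times> H2"

definition DAip :: "'d::finite cell_model \<Rightarrow> real \<Rightarrow> real \<Rightarrow> 'd state \<Rightarrow> 'd state \<Rightarrow> real" where
  "DAip M ell \<theta> u w = Hip M ell \<theta> u w + Hip M ell \<theta> (Aop M ell \<theta> u) (Aop M ell \<theta> w)"

definition DAnorm :: "'d::finite cell_model \<Rightarrow> real \<Rightarrow> real \<Rightarrow> 'd state \<Rightarrow> real" where
  "DAnorm M ell \<theta> u = sqrt (DAip M ell \<theta> u u)"

definition source :: "'d::finite cell_model \<Rightarrow> real \<Rightarrow> real \<Rightarrow> (real \<Rightarrow> 'd field \<Rightarrow> real) \<Rightarrow> real \<Rightarrow> 'd state" where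
  "source M ell \<theta> G t = (0, Rinv M ell \<theta> (G t))"

text \<open>\<open>u'\<close> is the time derivative of the state \<open>u = (U, V)\<close>; hence \<open>fst (u' t)\<close> is \<open>U'(t)\<close> and, as
  \<open>V = U'\<close> by the first equation of the system, \<open>snd (u' t)\<close> is \<open>U''(t)\<close>.\<close>

definition ivp_solution ::
  "'d::finite cell_model \<Rightarrow> real \<Rightarrow> real \<Rightarrow> real \<Rightarrow> (real \<Rightarrow> 'd field \<Rightarrow> real) \<Rightarrow> 'd state \<Rightarrow>
    (real \<Rightarrow> 'd state) \<Rightarrow> (real \<Rightarrow> 'd state) \<Rightarrow> bool" where
  "ivp_solution M ell \<theta> T G u0 u u' \<longleftrightarrow>
     C1_path Hspace (Hnorm M ell \<theta>) {0..T} u u' \<and>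
     C0_path (DA M ell \<theta>) (DAnorm M ell \<theta>) {0..T} u \<and>
     (\<forall>t\<in>{0..T}. state_eq (u' t + Aop M ell \<theta> (u t)) (source M ell \<theta> G t)) \<and>
     state_eq (u 0) u0"

definition energy :: "'d::finite cell_model \<Rightarrow> real \<Rightarrow> real \<Rightarrow> 'd field \<Rightarrow> 'd field \<Rightarrow> real" where
  "energy M ell \<theta> U U' = 1/2 * Qform M ell \<theta> U U + 1/2 * Rform M ell \<theta> U' U'"

end

theory Submission
  imports Defs "HOL-Computational_Algebra.Polynomial"
begin

text \<open>
  Put \<open>u = (U, V)\<close>. The energy product \<open>b\<close> of two states, that is \<open>Q(U, U') + R(U, U') + R(V, V')\<close>,
  is equivalent to the product norm of \<open>H\<^sup>2 \<times> H\<^sup>1\<close>: coercivity of \<open>R\<close> on \<open>H\<^sup>1\<close> absorbs the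
  \<open>L\<^sup>2\<close> term by which \<open>Q\<close> fails to be coercive on \<open>H\<^sup>2\<close>. For \<open>u\<close> in the domain the two
  terms of \<open>b(A u, u)\<close> coming from \<open>Q\<close> cancel, because \<open>R(z, W) = Q(U, W)\<close> for
  \<open>z = R\<^sup>-\<^sup>1 Q U\<close>, and what is left is \<open>- R(V, U)\<close>, at most half of \<open>b(u, u)\<close> in absolute value.
  Hence \<open>A + 1/2\<close> is monotone. It is maximal monotone: eliminating \<open>V\<close> from
  \<open>u + \<kappa> A u = f\<close> leaves the variational problem \<open>R(U, W) + \<kappa>\<^sup>2 Q(U, W) = R(h, W)\<close> for
  all \<open>W\<close> in \<open>H\<^sup>2\<close>, which the Riesz theorem solves (\<open>resolvent\<close>).

  Existence is then the generation theorem for maximal monotone linear operators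
  (\<open>monotone_evolution_exists\<close>), applied after the substitution \<open>v(t) = e\<^sup>-\<^sup>t\<^sup>/\<^sup>2 u(t)\<close>. It is proved
  by Yosida approximation. The two alternatives for the source are the two cases in which
  \<open>A u\<close> is seen to converge along the approximations: either the time derivative of the
  approximation solves the same equation with the differentiated source, or the operator
  applied to the approximation solves it with the operator applied to the source.
  Uniqueness and the estimate both come from \<open>d/dt b(u, u) = 2 b(F - A u, u) \<le> b(F, F) + 2 b(u, u)\<close>
  and the Gronwall inequality. Dropping the term \<open>R(U, U')\<close> from \<open>b\<close> gives the form behind
  the energy, for which \<open>A\<close> is exactly skew; hence conservation.

  Three facts link these abstract statements to the concrete operators. Symmetry of the two
  forms is read off from the Hermitian symbols (\<open>Q_symbol_symmetry\<close>, \<open>R_symbol_symmetry\<close>): a symbol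
  determines the coefficients up to permutations of the derivative indices, and on test fields
  integration by parts makes the pairings of derivatives invariant under these permutations
  (\<open>Bq_sym\<close>, \<open>Br_sym\<close>). Integration by parts also identifies the distributions with the forms
  on test fields (\<open>Qop_eq\<close>, \<open>Rop_eq\<close>); the minor symmetries of the effective tensors, consequences of the
  uniqueness of the cell functions, allow the strain to be replaced by the full gradient.
  Density of test fields in \<open>H\<^sup>k\<close> (\<open>test_fun_dense_sobolev\<close>) extends identities between bounded forms from test
  fields to the Sobolev spaces. The Hilbert space itself is the quotient of pairs of fields by equality almost
  everywhere, complete by the Riesz-Fischer theorem.
\<close>

section \<open>The Gronwall inequality and symmetric coercive forms\<close>

text \<open>The function \<open>exp (- a t) * y t\<close> minus the integral of \<open>g\<close> is decreasing, since \<open>exp (- a t) \<le> 1\<close> and \<open>g \<ge> 0\<close>.\<close>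

lemma gronwall_interval:
  fixes y y' g :: "real \<Rightarrow> real"
  assumes T: "0 \<le> T" and a: "0 \<le> a"
    and der: "\<And>t. t \<in> {0..T} \<Longrightarrow> (y has_vector_derivative y' t) (at t within {0..T})"
    and le: "\<And>t. t \<in> {0..T} \<Longrightarrow> y' t \<le> a * y t + g t"
    and g: "continuous_on {0..T} g" "\<And>t. t \<in> {0..T} \<Longrightarrow> 0 \<le> g t"
    and t: "t \<in> {0..T}"
  shows "y t \<le> exp (a * t) * (y 0 + integral {0..t} g)"
proof -
  define z where "z s = exp (- a * s) * y s - integral {0..s} g" for s
  define z' where "z' s = exp (- a * s) * y' s - a * exp (- a * s) * y s - g s" for s
  have dz: "(z has_real_derivative z' s) (at s within {0..T})" if s: "s \<in> {0..T}" for s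
  proof -
    have 1: "(y has_real_derivative y' s) (at s within {0..T})"
      using der[OF s] by (simp add: has_real_derivative_iff_has_vector_derivative)
    have 2: "((\<lambda>x. integral {0..x} g) has_real_derivative g s) (at s within {0..T})"
      by (rule integral_has_real_derivative[OF g(1) s])
    show ?thesis unfolding z_def z'_def
      by (auto intro!: derivative_eq_intros 1 2)
  qed
  have z'_le: "z' s \<le> 0" if s: "s \<in> {0..T}" for s
  proof -
    have "exp (- a * s) * y' s \<le> exp (- a * s) * (a * y s + g s)"
      using le[OF s] by (intro mult_left_mono) auto
    moreover have "exp (- a * s) * g s \<le> 1 * g s"
      using g(2)[OF s] a s by (intro mult_right_mono) (auto simp: mult_nonneg_nonneg)
    ultimately show ?thesis unfolding z'_def by (simp add: algebra_simps)
  qed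
  have "\<exists>x\<in>{0..t}. z t - z 0 = (\<lambda>h. z' x * h) (t - 0)"
  proof (rule mvt_very_simple)
    show "0 \<le> t" using t by auto
    fix x assume "0 \<le> x" "x \<le> t"
    then have "(z has_real_derivative z' x) (at x within {0..T})" using dz t by auto
    then have "(z has_real_derivative z' x) (at x within {0..t})"
      by (rule DERIV_subset) (use t in auto)
    then show "(z has_derivative (\<lambda>h. z' x * h)) (at x within {0..t})"
      by (simp add: has_field_derivative_def)
  qed
  then obtain x where "x \<in> {0..t}" "z t - z 0 = z' x * t" by auto
  moreover have "z' x * t \<le> 0" if "x \<in> {0..t}"
    using z'_le[of x] that t by (simp add: mult_nonpos_nonneg)
  ultimately have "z t \<le> z 0" by auto
  then have "exp (- a * t) * y t \<le> y 0 + integral {0..t} g" by (simp add: z_def)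
  then have "exp (a * t) * (exp (- a * t) * y t) \<le> exp (a * t) * (y 0 + integral {0..t} g)"
    by (intro mult_left_mono) auto
  then show ?thesis by (simp add: mult.assoc[symmetric] exp_add[symmetric])
qed

text \<open>All estimates are made with the form \<open>b\<close>, in which the evolution operator has its monotonicity.\<close>

locale equiv_form =
  fixes b :: "'h::banach \<Rightarrow> 'h \<Rightarrow> real" and c :: real
  assumes bilin: "bounded_bilinear b" and sym: "b x y = b y x"
    and c_pos: "0 < c" and coercive: "c * (norm x)\<^sup>2 \<le> b x x"
begin

sublocale bounded_bilinear b by (rule bilin)

lemma nonneg: "0 \<le> b x x"
  using coercive[of x] c_pos by (meson mult_nonneg_nonneg less_imp_le order_trans zero_le_power2)

lemma young: "2 * b x y \<le> b x x + b y y"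
  using nonneg[of "x - y"] by (simp add: diff_left diff_right sym[of y x])

lemma young_minus: "- 2 * b x y \<le> b x x + b y y"
  using nonneg[of "x + y"] by (simp add: add_left add_right sym[of y x])

lemma sum_bound: "b (x + y) (x + y) \<le> 2 * (b x x + b y y)"
  using young[of x y] by (simp add: add_left add_right sym[of y x])

lemma diff_bound: "b (x - y) (x - y) \<le> 2 * (b x x + b y y)"
  using young_minus[of x y] by (simp add: diff_left diff_right sym[of y x])

lemma form_bound: obtains K where "0 < K" "\<And>x. b x x \<le> K * (norm x)\<^sup>2"
proof -
  obtain K where "0 < K" "\<And>x y. norm (b x y) \<le> norm x * norm y * K" using pos_bounded by blast
  then show ?thesis using that[of K] by (auto simp: power2_eq_square mult.commute abs_le_iff)
qed

lemma zero_iff: "b x x = 0 \<longleftrightarrow> x = 0"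
proof
  assume "b x x = 0"
  then have "c * (norm x)\<^sup>2 \<le> 0" using coercive[of x] by simp
  then show "x = 0" using c_pos by (simp add: mult_le_0_iff)
qed (simp add: zero_left)

lemma norm_le_form: "(norm x)\<^sup>2 \<le> b x x / c"
  using coercive[of x] c_pos by (simp add: field_simps)

text \<open>The functional \<open>J\<close> is strictly convex and bounded below; minimizing sequences are Cauchy by the parallelogram identity, and the stationarity condition at the limit is the claim.\<close>

lemma riesz:
  assumes "bounded_linear f"
  shows "\<exists>x. \<forall>y. b x y = f y"
proof -
  interpret f: bounded_linear f by fact
  define J where "J x = b x x - 2 * f x" for x
  obtain K where K: "\<And>x. norm (f x) \<le> norm x * K" "0 < K" using f.pos_bounded by blast
  have low: "- K\<^sup>2 / c \<le> J x" for x
  proof -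
    have "0 \<le> (c * norm x - K)\<^sup>2" by simp
    then have "0 \<le> c * (c * (norm x)\<^sup>2) - 2 * c * (norm x * K) + K\<^sup>2"
      by (simp add: power2_eq_square algebra_simps)
    also have "\<dots> \<le> c * b x x - 2 * c * f x + K\<^sup>2"
      using K(1)[of x] c_pos coercive[of x]
      by (intro add_mono diff_mono mult_left_mono) auto
    finally have "0 \<le> c * J x + K\<^sup>2" by (simp add: J_def algebra_simps)
    then show ?thesis using c_pos by (simp add: field_simps)
  qed
  define m where "m = Inf (range J)"
  have bdd: "bdd_below (range J)" using low by (auto simp: bdd_below_def)
  have mle: "m \<le> J x" for x unfolding m_def using bdd by (simp add: cInf_lower)
  have "\<exists>x. J x < m + inverse (real (Suc n))" for n
  proof -
    have "\<exists>z\<in>range J. z < m + inverse (real (Suc n))"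
      unfolding m_def by (rule cInf_lessD) (auto simp: inverse_positive_iff_positive)
    then show ?thesis by auto
  qed
  then obtain x where x: "\<And>n. J (x n) < m + inverse (real (Suc n))" by metis
  have par: "b (u - v) (u - v) \<le> 2 * (J u - m) + 2 * (J v - m)" for u v
    using mle[of "(1/2) *\<^sub>R (u + v)"] unfolding J_def
    by (simp add: diff_left diff_right add_left add_right scaleR_left scaleR_right
        f.scaleR f.add sym[of v u] algebra_simps)
  have "Cauchy x"
  proof (rule metric_CauchyI)
    fix e :: real assume e: "0 < e"
    obtain N where N: "inverse (real (Suc N)) < c * e\<^sup>2 / 4" 
      using reals_Archimedean[of "c * e\<^sup>2 / 4"] e c_pos by auto
    show "\<exists>M. \<forall>p\<ge>M. \<forall>n\<ge>M. dist (x p) (x n) < e"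
    proof (intro exI allI impI)
      fix p n assume "N \<le> p" "N \<le> n"
      then have "inverse (real (Suc p)) \<le> inverse (real (Suc N))" "inverse (real (Suc n)) \<le> inverse (real (Suc N))"
        by (auto intro!: le_imp_inverse_le)
      then have "b (x p - x n) (x p - x n) < c * e\<^sup>2"
        using par[of "x p" "x n"] x[of p] x[of n] N by (simp only: mult_2 field_sum_of_halves)
      then have "c * (norm (x p - x n))\<^sup>2 < c * e\<^sup>2" using coercive by (rule order_le_less_trans[rotated])
      then have "(norm (x p - x n))\<^sup>2 < e\<^sup>2" using c_pos by simp
      then show "dist (x p) (x n) < e" using e by (simp add: dist_norm power_less_imp_less_base)
    qed
  qed
  then obtain z where z: "x \<longlonglongrightarrow> z" using Cauchy_convergent_iff convergent_def by blast
  have "(\<lambda>n. J (x n)) \<longlonglongrightarrow> J z" unfolding J_def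
    by (intro tendsto_intros tendsto[OF z z] f.tendsto z)
  moreover have "(\<lambda>n. m + inverse (real (Suc n))) \<longlonglongrightarrow> m + 0"
    by (intro tendsto_intros LIMSEQ_inverse_real_of_nat)
  ultimately have "J z \<le> m + 0"
    by (rule LIMSEQ_le) (use x in \<open>auto intro: less_imp_le\<close>)
  then have min: "J z \<le> J y" for y using mle[of y] by simp
  have "b z y = f y" for y
  proof (rule ccontr)
    assume ne: "b z y \<noteq> f y"
    define d where "d = b z y - f y"
    have q: "0 \<le> 2 * t * d + t\<^sup>2 * b y y" for t
      using min[of "z + t *\<^sub>R y"] unfolding J_def d_def
      by (simp add: add_left add_right scaleR_left scaleR_right f.add f.scaleR sym[of y z]
        power2_eq_square algebra_simps)
    have "d \<noteq> 0" using ne by (simp add: d_def)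
    have yp: "0 < b y y"
    proof -
      have "y \<noteq> 0" using ne by (auto simp: zero_right f.zero)
      then show ?thesis using nonneg[of y] zero_iff[of y] by linarith
    qed
    have "2 * (- d / b y y) * d + (- d / b y y)\<^sup>2 * b y y = - d\<^sup>2 / b y y"
      using yp by (simp add: power2_eq_square field_simps)
    moreover have "- d\<^sup>2 / b y y < 0" using yp \<open>d \<noteq> 0\<close> by simp
    ultimately show False using q[of "- d / b y y"] by simp
  qed
  then show ?thesis by blast
qed

lemma energy_derivative:
  assumes "(u has_vector_derivative u') (at t within S)"
  shows "((\<lambda>t. b (u t) (u t)) has_vector_derivative 2 * b u' (u t)) (at t within S)"
  using has_vector_derivative[OF assms assms] by (simp add: sym[of "u t" u'])

end

text \<open>Picard iteration. Weighting the norm by \<open>exp (- \<mu> t)\<close> with \<open>\<mu>\<close> twice a bound of \<open>Y\<close> makes the iteration a contraction on the whole interval at once.\<close>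

lemma bounded_linear_ode_exists:
  fixes Y :: "'h::banach \<Rightarrow> 'h"
  assumes Y: "bounded_linear Y" and T: "0 \<le> T" and f: "continuous_on {0..T} f"
  obtains u where "u 0 = x0"
    "\<And>t. t \<in> {0..T} \<Longrightarrow> (u has_vector_derivative f t - Y (u t)) (at t within {0..T})"
proof -
  interpret Y: bounded_linear Y by fact
  obtain K where K: "\<And>x. norm (Y x) \<le> norm x * K" "0 < K" using Y.pos_bounded by blast
  define \<mu> where "\<mu> = 2 * K"
  have mu: "0 < \<mu>" using K by (simp add: \<mu>_def)
  define p where "p = rec_nat (\<lambda>t::real. x0) (\<lambda>_ v t. x0 + integral {0..t} (\<lambda>s. f s - Y (v s)))"
  have p0: "p 0 = (\<lambda>t. x0)" and pS: "p (Suc k) = (\<lambda>t. x0 + integral {0..t} (\<lambda>s. f s - Y (p k s)))" for k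
    by (auto simp: p_def)
  have pder: "(p (Suc k) has_vector_derivative f t - Y (p k t)) (at t within {0..T})"
    if "continuous_on {0..T} (p k)" "t \<in> {0..T}" for k t
    unfolding pS using that
    by (auto intro!: derivative_eq_intros integral_has_vector_derivative continuous_intros f Y.continuous_on)
  have pcont: "continuous_on {0..T} (p k)" for k
  proof (induction k)
    case (Suc k)
    then show ?case using pder[OF Suc] has_vector_derivative_continuous continuous_on_eq_continuous_within by blast
  qed (simp add: p0)
  define M where "M = Sup ((\<lambda>t. norm (p 1 t - p 0 t)) ` {0..T})"
  have Mb: "norm (p 1 t - p 0 t) \<le> M" if "t \<in> {0..T}" for t
    unfolding M_def using that
    by (intro cSup_upper bounded_imp_bdd_above compact_imp_bounded compact_continuous_image
        continuous_intros pcont) auto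
  have M0: "0 \<le> M" using Mb[of 0] T norm_ge_zero order_trans by (metis atLeastAtMost_iff order_refl)
  have step: "norm (p (Suc k) t - p k t) \<le> M * (1/2)^k * exp (\<mu> * t)" if "t \<in> {0..T}" for k t
    using that
  proof (induction k arbitrary: t)
    case 0
    have "norm (p 1 t - p 0 t) \<le> M * 1" using Mb 0 by simp
    also have "\<dots> \<le> M * exp (\<mu> * t)" using M0 mu 0 by (intro mult_left_mono) auto
    finally show ?case by simp
  next
    case (Suc k)
    have cont: "continuous_on {0..t} (\<lambda>s. f s - Y (p j s))" for j
      using Suc.prems by (intro continuous_intros Y.continuous_on continuous_on_subset[OF pcont] continuous_on_subset[OF f]) auto
    have "p (Suc (Suc k)) t - p (Suc k) t = integral {0..t} (\<lambda>s. f s - Y (p (Suc k) s)) - integral {0..t} (\<lambda>s. f s - Y (p k s))"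
      by (simp add: pS)
    also have "\<dots> = integral {0..t} (\<lambda>s. (f s - Y (p (Suc k) s)) - (f s - Y (p k s)))"
      by (rule integral_diff[symmetric]) (intro integrable_continuous_real cont)+
    also have "norm \<dots> \<le> integral {0..t} (\<lambda>s. K * M * (1/2)^k * exp (\<mu> * s))"
    proof (rule integral_norm_bound_integral)
      show "(\<lambda>s. (f s - Y (p (Suc k) s)) - (f s - Y (p k s))) integrable_on {0..t}"
        by (intro integrable_diff integrable_continuous_real cont)
      show "(\<lambda>s. K * M * (1/2)^k * exp (\<mu> * s)) integrable_on {0..t}"
        by (intro integrable_continuous_real continuous_intros)
      fix s assume "s \<in> {0..t}"
      then have "s \<in> {0..T}" using Suc.prems by auto
      have "norm ((f s - Y (p (Suc k) s)) - (f s - Y (p k s))) = norm (Y (p (Suc k) s - p k s))"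
        by (simp add: Y.diff norm_minus_commute)
      also have "\<dots> \<le> norm (p (Suc k) s - p k s) * K" by (rule K)
      also have "\<dots> \<le> (M * (1/2)^k * exp (\<mu> * s)) * K"
        using Suc.IH[OF \<open>s \<in> {0..T}\<close>] K(2) by (intro mult_right_mono) auto
      finally show "norm ((f s - Y (p (Suc k) s)) - (f s - Y (p k s))) \<le> K * M * (1/2)^k * exp (\<mu> * s)"
        by (simp add: mult_ac)
    qed
    also have "integral {0..t} (\<lambda>s. K * M * (1/2)^k * exp (\<mu> * s)) = K * M * (1/2)^k * (exp (\<mu> * t) - 1) / \<mu>"
    proof (rule integral_unique)
      have "((\<lambda>s. K * M * (1/2)^k * exp (\<mu> * s)) has_integral
        K * M * (1/2)^k * exp (\<mu> * t) / \<mu> - K * M * (1/2)^k * exp (\<mu> * 0) / \<mu>) {0..t}"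
        using Suc.prems mu
        by (intro fundamental_theorem_of_calculus)
          (auto simp: has_real_derivative_iff_has_vector_derivative[symmetric] intro!: derivative_eq_intros)
      then show "((\<lambda>s. K * M * (1/2)^k * exp (\<mu> * s)) has_integral K * M * (1/2)^k * (exp (\<mu> * t) - 1) / \<mu>) {0..t}"
        by (simp add: algebra_simps diff_divide_distrib)
    qed
    also have "\<dots> = M * (1/2)^(Suc k) * (exp (\<mu> * t) - 1)" using K(2) by (simp add: \<mu>_def)
    also have "\<dots> \<le> M * (1/2)^(Suc k) * exp (\<mu> * t)" using M0 by (intro mult_left_mono) auto
    finally show ?case .
  qed
  have "uniform_limit {0..T} (\<lambda>n t. \<Sum>k<n. p (Suc k) t - p k t) (\<lambda>t. suminf (\<lambda>k. p (Suc k) t - p k t)) sequentially"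
  proof (rule Weierstrass_m_test)
    show "summable (\<lambda>k. M * exp (\<mu> * T) * (1/2)^k)" by (intro summable_mult summable_geometric) auto
    fix k t assume t: "t \<in> {0..T}"
    have "norm (p (Suc k) t - p k t) \<le> M * (1/2)^k * exp (\<mu> * t)" by (rule step[OF t])
    also have "\<dots> \<le> M * (1/2)^k * exp (\<mu> * T)" using t mu M0 by (intro mult_left_mono) auto
    finally show "norm (p (Suc k) t - p k t) \<le> M * exp (\<mu> * T) * (1/2)^k" by (simp add: mult_ac)
  qed
  then have ul0: "uniform_limit {0..T} (\<lambda>n t. p n t - x0) (\<lambda>t. suminf (\<lambda>k. p (Suc k) t - p k t)) sequentially"
    using sum_lessThan_telescope[of "\<lambda>k. p k t" for t] by (simp add: p0)
  define u where "u t = x0 + suminf (\<lambda>k. p (Suc k) t - p k t)" for t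
  have "uniform_limit {0..T} (\<lambda>n t. x0 + (p n t - x0)) u sequentially"
    unfolding u_def by (intro uniform_limit_intros ul0)
  then have ul: "uniform_limit {0..T} p u sequentially" by simp
  have ucont: "continuous_on {0..T} u"
    by (rule uniform_limit_theorem[OF _ ul]) (auto simp: pcont)
  have fix_u: "u t = x0 + integral {0..t} (\<lambda>s. f s - Y (u s))" if t: "t \<in> {0..T}" for t
  proof -
    have ult: "uniform_limit {0..t} p u sequentially" by (rule uniform_limit_on_subset[OF ul]) (use t in auto)
    have A: "uniform_limit {0..t} (\<lambda>n s. f s - Y (p n s)) (\<lambda>s. f s - Y (u s)) sequentially"
      by (intro uniform_limit_intros bounded_linear.uniform_limit[OF Y ult])
    have C: "continuous_on {0..t} (\<lambda>s. f s - Y (p n s))" for n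
      using t by (intro continuous_intros Y.continuous_on continuous_on_subset[OF pcont] continuous_on_subset[OF f]) auto
    obtain I L where I: "\<And>n. ((\<lambda>s. f s - Y (p n s)) has_integral I n) {0..t}"
      "((\<lambda>s. f s - Y (u s)) has_integral L) {0..t}" "I \<longlonglongrightarrow> L"
      by (rule uniform_limit_integral[OF A C sequentially_bot]) blast
    have "(\<lambda>n. p (Suc n) t) \<longlonglongrightarrow> x0 + L"
      using I by (auto simp: pS integral_unique[OF I(1)] intro!: tendsto_intros)
    moreover have "(\<lambda>n. p (Suc n) t) \<longlonglongrightarrow> u t"
      using tendsto_uniform_limitI[OF ul t] by (rule LIMSEQ_Suc)
    ultimately show ?thesis using I(2) LIMSEQ_unique integral_unique by blast
  qed
  have "(u has_vector_derivative f t - Y (u t)) (at t within {0..T})" if t: "t \<in> {0..T}" for t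
  proof (rule has_vector_derivative_transform[OF t])
    show "((\<lambda>t. x0 + integral {0..t} (\<lambda>s. f s - Y (u s))) has_vector_derivative f t - Y (u t)) (at t within {0..T})"
      using t by (auto intro!: derivative_eq_intros integral_has_vector_derivative continuous_intros f Y.continuous_on ucont)
    show "\<And>x. x \<in> {0..T} \<Longrightarrow> u x = x0 + integral {0..x} (\<lambda>s. f s - Y (u s))" by (rule fix_u)
  qed
  moreover have "u 0 = x0" using fix_u[of 0] T by auto
  ultimately show ?thesis using that by blast
qed

section \<open>Linear evolution equations with maximal monotone operators\<close>

text \<open>Maximality is encoded by solvability of all resolvent equations, as is usual for unbounded operators on a Hilbert space.\<close>

locale maximal_monotone = equiv_form b c
  for b :: "'h::banach \<Rightarrow> 'h \<Rightarrow> real" and c +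
  fixes D :: "'h set" and B :: "'h \<Rightarrow> 'h"
  assumes D: "subspace D"
    and B_add: "x \<in> D \<Longrightarrow> y \<in> D \<Longrightarrow> B (x + y) = B x + B y"
    and B_scale: "x \<in> D \<Longrightarrow> B (r *\<^sub>R x) = r *\<^sub>R B x"
    and mono: "x \<in> D \<Longrightarrow> 0 \<le> b (B x) x"
    and surj: "0 < \<kappa> \<Longrightarrow> \<exists>x\<in>D. x + \<kappa> *\<^sub>R B x = f"
begin

lemma B_diff: "x \<in> D \<Longrightarrow> y \<in> D \<Longrightarrow> B (x - y) = B x - B y"
  using B_add[of x "(-1) *\<^sub>R y"] B_scale[of y "-1"] subspace_scale[OF D, of y "-1"] by simp

lemma B_zero: "B 0 = 0"
  using B_scale[of 0 0] subspace_0[OF D] by simp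

lemma resolvent_unique:
  assumes "0 < \<kappa>" "x \<in> D" "y \<in> D" "x + \<kappa> *\<^sub>R B x = y + \<kappa> *\<^sub>R B y"
  shows "x = y"
proof -
  have d: "x - y \<in> D" using assms D by (simp add: subspace_diff)
  have "(x - y) + \<kappa> *\<^sub>R B (x - y) = 0" using assms by (simp add: B_diff algebra_simps)
  then have "b (x - y) (x - y) + \<kappa> * b (B (x - y)) (x - y) = 0"
    by (metis add_left scaleR_left zero_left real_scaleR_def)
  moreover have "0 \<le> \<kappa> * b (B (x - y)) (x - y)" using mono[OF d] assms(1) by simp
  ultimately have "b (x - y) (x - y) = 0" using nonneg[of "x - y"] by linarith
  then show ?thesis by (simp add: zero_iff)
qed

text \<open>The resolvent.\<close>

definition J :: "real \<Rightarrow> 'h \<Rightarrow> 'h" where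
  "J \<kappa> f = (THE x. x \<in> D \<and> x + \<kappa> *\<^sub>R B x = f)"

text \<open>The Yosida approximation, a bounded operator.\<close>

definition Y :: "real \<Rightarrow> 'h \<Rightarrow> 'h" where
  "Y \<kappa> f = (1 / \<kappa>) *\<^sub>R (f - J \<kappa> f)"

lemma J_props:
  assumes "0 < \<kappa>"
  shows J_in: "J \<kappa> f \<in> D" and J_eq: "J \<kappa> f + \<kappa> *\<^sub>R B (J \<kappa> f) = f"
proof -
  have "\<exists>!x. x \<in> D \<and> x + \<kappa> *\<^sub>R B x = f"
    using surj[OF assms, of f] resolvent_unique[OF assms] by metis
  then have "J \<kappa> f \<in> D \<and> J \<kappa> f + \<kappa> *\<^sub>R B (J \<kappa> f) = f" unfolding J_def by (rule theI')
  then show "J \<kappa> f \<in> D" "J \<kappa> f + \<kappa> *\<^sub>R B (J \<kappa> f) = f" by auto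
qed

lemma J_I: "0 < \<kappa> \<Longrightarrow> x \<in> D \<Longrightarrow> x + \<kappa> *\<^sub>R B x = f \<Longrightarrow> J \<kappa> f = x"
  using resolvent_unique J_props by metis

lemma Y_eq: "0 < \<kappa> \<Longrightarrow> Y \<kappa> f = B (J \<kappa> f)"
  using J_eq[of \<kappa> f] unfolding Y_def
  by (metis (no_types, lifting) add_diff_cancel_left' divide_self_if less_irrefl scaleR_one scaleR_scaleR times_divide_eq_left mult_1)

lemma J_linear: "0 < \<kappa> \<Longrightarrow> linear (J \<kappa>)"
proof (rule linearI)
  fix x y :: 'h and r :: real assume l: "0 < \<kappa>"
  note J = J_in[OF l] J_eq[OF l]
  show "J \<kappa> (x + y) = J \<kappa> x + J \<kappa> y"
  proof (rule J_I[OF l])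
    show "J \<kappa> x + J \<kappa> y \<in> D" using J D by (simp add: subspace_add)
    have "J \<kappa> x + J \<kappa> y + \<kappa> *\<^sub>R B (J \<kappa> x + J \<kappa> y)
        = (J \<kappa> x + \<kappa> *\<^sub>R B (J \<kappa> x)) + (J \<kappa> y + \<kappa> *\<^sub>R B (J \<kappa> y))"
      by (simp only: B_add[OF J(1) J(1)] scaleR_add_right add_ac)
    then show "J \<kappa> x + J \<kappa> y + \<kappa> *\<^sub>R B (J \<kappa> x + J \<kappa> y) = x + y" by (simp only: J(2))
  qed
  have "r *\<^sub>R J \<kappa> x + \<kappa> *\<^sub>R B (r *\<^sub>R J \<kappa> x) = r *\<^sub>R (J \<kappa> x + \<kappa> *\<^sub>R B (J \<kappa> x))"
    by (simp add: B_scale[OF J(1)] scaleR_add_right mult.commute)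
  then show "J \<kappa> (r *\<^sub>R x) = r *\<^sub>R J \<kappa> x"
    using J[of x] D by (intro J_I l) (auto simp: subspace_scale)
qed

lemma J_contraction: "0 < \<kappa> \<Longrightarrow> b (J \<kappa> f) (J \<kappa> f) \<le> b f f"
proof -
  assume l: "0 < \<kappa>"
  let ?x = "J \<kappa> f"
  have "b f ?x = b ?x ?x + \<kappa> * b (B ?x) ?x"
    by (metis J_eq[OF l] add_left scaleR_left real_scaleR_def)
  moreover have "0 \<le> \<kappa> * b (B ?x) ?x" using mono[OF J_in[OF l]] l by simp
  ultimately show ?thesis using young[of f ?x] by linarith
qed

lemma J_bounded_linear: assumes l: "0 < \<kappa>" shows "bounded_linear (J \<kappa>)"
proof -
  obtain K where K: "0 < K" "\<And>x. b x x \<le> K * (norm x)\<^sup>2" using form_bound by blast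
  show ?thesis
  proof (rule bounded_linear_intro)
    show "norm (J \<kappa> x) \<le> norm x * sqrt (K / c)" for x
    proof -
      have "(norm (J \<kappa> x))\<^sup>2 \<le> b (J \<kappa> x) (J \<kappa> x) / c" by (rule norm_le_form)
      also have "\<dots> \<le> K * (norm x)\<^sup>2 / c"
        using J_contraction[OF l, of x] K(2)[of x] c_pos by (intro divide_right_mono) auto
      also have "\<dots> = (norm x * sqrt (K / c))\<^sup>2" using K(1) c_pos by (simp add: power_mult_distrib)
      finally show ?thesis by (rule power2_le_imp_le) (use K(1) c_pos in auto)
    qed
  qed (auto simp: linear_add[OF J_linear[OF l]] linear_scale[OF J_linear[OF l]])
qed

lemma Y_bounded_linear: "0 < \<kappa> \<Longrightarrow> bounded_linear (Y \<kappa>)"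
  unfolding Y_def[abs_def]
  by (intro bounded_linear_intros J_bounded_linear)

lemma Y_monotone: "0 < \<kappa> \<Longrightarrow> 0 \<le> b (Y \<kappa> f) f"
proof -
  assume l: "0 < \<kappa>"
  have "b (Y \<kappa> f) f = b (B (J \<kappa> f)) (J \<kappa> f) + \<kappa> * b (B (J \<kappa> f)) (B (J \<kappa> f))"
    unfolding Y_eq[OF l] by (metis J_eq[OF l] add_right scaleR_right real_scaleR_def)
  then show ?thesis using mono[OF J_in[OF l]] nonneg l by simp
qed

lemma Y_on_domain: assumes l: "0 < \<kappa>" and x: "x \<in> D" shows "Y \<kappa> x = J \<kappa> (B x)"
proof -
  let ?y = "J \<kappa> x"
  note J = J_in[OF l, of x] J_eq[OF l, of x]
  have "Y \<kappa> x \<in> D" unfolding Y_def using x J D by (simp add: subspace_scale subspace_diff)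
  then have z: "B ?y \<in> D" by (simp add: Y_eq[OF l])
  have "B ?y + \<kappa> *\<^sub>R B (B ?y) = B (?y + \<kappa> *\<^sub>R B ?y)"
    using z J(1) D by (simp add: B_add B_scale subspace_scale)
  also have "\<dots> = B x" using J(2) by simp
  finally have "J \<kappa> (B x) = B ?y" by (rule J_I[OF l z])
  then show ?thesis by (simp add: Y_eq[OF l])
qed

text \<open>Splitting \<open>u\<close> and \<open>v\<close> into resolvent and remainder, the resolvent part is nonnegative by monotonicity; the remainders carry the small factors \<open>\<kappa>\<close> and \<open>\<mu>\<close>.\<close>

lemma Y_cross:
  assumes l: "0 < \<kappa>" and m: "0 < \<mu>"
    and K: "b (Y \<kappa> u) (Y \<kappa> u) \<le> K" "b (Y \<mu> v) (Y \<mu> v) \<le> K"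
  shows "- 2 * b (Y \<kappa> u - Y \<mu> v) (u - v) \<le> 2 * (\<kappa> + \<mu>) * K"
proof -
  let ?x = "J \<kappa> u" and ?z = "J \<mu> v"
  let ?p = "Y \<kappa> u" and ?q = "Y \<mu> v"
  have u: "u = ?x + \<kappa> *\<^sub>R ?p" and v: "v = ?z + \<mu> *\<^sub>R ?q" using l m by (simp_all add: Y_eq J_eq)
  have "0 \<le> b (B (?x - ?z)) (?x - ?z)" using J_in l m D by (intro mono) (simp add: subspace_diff)
  then have 1: "0 \<le> b (?p - ?q) (?x - ?z)" using J_in l m by (simp add: B_diff Y_eq)
  have e: "u - v = (?x - ?z) + (\<kappa> *\<^sub>R ?p - \<mu> *\<^sub>R ?q)" by (subst (1) u, subst (1) v) simp
  have "b (?p - ?q) (u - v) = b (?p - ?q) (?x - ?z) + b (?p - ?q) (\<kappa> *\<^sub>R ?p - \<mu> *\<^sub>R ?q)"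
    by (subst e) (rule add_right)
  also have "b (?p - ?q) (\<kappa> *\<^sub>R ?p - \<mu> *\<^sub>R ?q) = \<kappa> * b ?p ?p + \<mu> * b ?q ?q - (\<kappa> + \<mu>) * b ?p ?q"
    by (simp add: diff_left diff_right scaleR_right sym[of ?q ?p] algebra_simps)
  finally have 2: "- b (?p - ?q) (u - v) \<le> (\<kappa> + \<mu>) * b ?p ?q"
    using 1 mult_nonneg_nonneg[OF less_imp_le[OF l] nonneg[of ?p]]
      mult_nonneg_nonneg[OF less_imp_le[OF m] nonneg[of ?q]] by simp
  have "b ?p ?q \<le> K" using young[of ?p ?q] K by linarith
  then have "(\<kappa> + \<mu>) * b ?p ?q \<le> (\<kappa> + \<mu>) * K" using l m by (intro mult_left_mono) auto
  then have "- b (?p - ?q) (u - v) \<le> (\<kappa> + \<mu>) * K" using 2 by (rule order_trans[rotated])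
  then have "2 * (- b (?p - ?q) (u - v)) \<le> 2 * ((\<kappa> + \<mu>) * K)" by (rule mult_left_mono) simp
  then show ?thesis by (simp only: mult.assoc mult_minus_left mult_minus_right)
qed

text \<open>The resolvent \<open>J 1\<close> is continuous and inverts \<open>1 + B\<close>, so limits may be taken in \<open>x = J 1 (x + B x)\<close>.\<close>

lemma closed_graph:
  assumes x: "\<And>n. x n \<in> D" "x \<longlonglongrightarrow> x'" and y: "(\<lambda>n. B (x n)) \<longlonglongrightarrow> y'"
  shows "x' \<in> D" "B x' = y'"
proof -
  interpret J: bounded_linear "J 1" by (rule J_bounded_linear) simp
  have "(\<lambda>n. J 1 (x n + B (x n))) \<longlonglongrightarrow> J 1 (x' + y')" by (intro J.tendsto tendsto_intros x y)
  moreover have "J 1 (x n + B (x n)) = x n" for n by (rule J_I) (use x in auto)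
  ultimately have "x' = J 1 (x' + y')" using x(2) LIMSEQ_unique by fastforce
  then show "x' \<in> D" "B x' = y'" using J_in[of 1 "x' + y'"] J_eq[of 1 "x' + y'"] by auto
qed

definition lam :: "nat \<Rightarrow> real" where "lam n = inverse (real (Suc n))"

lemma lam_pos [simp]: "0 < lam n" by (simp add: lam_def)
lemma lam_lim: "lam \<longlonglongrightarrow> 0" unfolding lam_def[abs_def] by (rule LIMSEQ_inverse_real_of_nat)

lemma form_tendsto_zero_iff: "((\<lambda>x. b (f x) (f x)) \<longlongrightarrow> 0) F \<longleftrightarrow> (f \<longlongrightarrow> 0) F"
proof
  assume "(f \<longlongrightarrow> 0) F"
  from tendsto[OF this this] show "((\<lambda>x. b (f x) (f x)) \<longlongrightarrow> 0) F" by (simp add: zero_left)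
next
  assume "((\<lambda>x. b (f x) (f x)) \<longlongrightarrow> 0) F"
  then have 1: "((\<lambda>x. b (f x) (f x) / c) \<longlongrightarrow> 0) F" by (rule tendsto_divide_zero)
  have "((\<lambda>x. (norm (f x))\<^sup>2) \<longlongrightarrow> 0) F"
    by (rule tendsto_sandwich[OF _ _ tendsto_const 1]) (auto simp: norm_le_form)
  then have "((\<lambda>x. sqrt ((norm (f x))\<^sup>2)) \<longlongrightarrow> sqrt 0) F" by (rule tendsto_real_sqrt)
  then show "(f \<longlongrightarrow> 0) F" by (simp add: tendsto_norm_zero_iff)
qed

text \<open>Density of the domain is a consequence of maximality. The residuals \<open>w n\<close> form a Cauchy sequence because their energies decrease, and the closed graph identifies their limit as zero.\<close>

lemma J_lim: "(\<lambda>n. J (lam n) y) \<longlonglongrightarrow> y"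
proof -
  define z where "z n = J (lam n) y" for n
  define w where "w n = y - z n" for n
  have zD: "z n \<in> D" for n by (simp add: z_def J_in)
  have w: "w n = lam n *\<^sub>R B (z n)" for n
    using J_eq[of "lam n" y] by (simp add: w_def z_def) (metis add_diff_cancel_left')
  have Bz: "B (z n) = real (Suc n) *\<^sub>R w n" for n by (simp add: w lam_def)
  define q where "q n = b (w n) (w n)" for n
  \<comment> \<open>Monotonicity applied to \<open>z m - z n\<close>, with the weights \<open>1 / lam\<close>.\<close>
  have key: "b (w m - w n) (w m - w n) \<le> q n - q m" if "n \<le> m" for n m
  proof -
    define a e where "a = real (Suc m)" "e = real (Suc n)"
    have ae: "0 < e" "e \<le> a" using that by (auto simp: a_e_def)
    have "0 \<le> b (B (z m - z n)) (z m - z n)" using zD D by (intro mono) (simp add: subspace_diff)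
    also have "z m - z n = w n - w m" by (simp add: w_def)
    also have "B (w n - w m) = a *\<^sub>R w m - e *\<^sub>R w n"
      using B_diff[OF zD zD, of m n] \<open>z m - z n = w n - w m\<close> by (simp add: Bz a_e_def)
    finally have 1: "0 \<le> b (a *\<^sub>R w m - e *\<^sub>R w n) (w n - w m)" .
    define d where "d = b (w m - w n) (w m - w n)"
    have id: "2 * b (a *\<^sub>R w m - e *\<^sub>R w n) (w n - w m) = (a - e) * (q n - q m) - (a + e) * d"
      unfolding d_def q_def
      by (simp add: diff_left diff_right scaleR_left sym[of "w n" "w m"] algebra_simps)
    have 2: "(a + e) * d \<le> (a - e) * (q n - q m)" using 1 id by linarith
    have d0: "0 \<le> d" by (simp add: d_def nonneg)
    show ?thesis
    proof (cases "a = e")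
      case True
      then have "2 * e * d \<le> 0" using 2 by simp
      then have "d \<le> 0" using ae by (simp add: mult_le_0_iff)
      moreover have "m = n" using True by (simp add: a_e_def)
      ultimately show ?thesis by (simp add: d_def)
    next
      case False
      have "0 \<le> (a - e) * (q n - q m)" using 2 d0 ae by (meson add_nonneg_nonneg le_less mult_nonneg_nonneg order_trans)
      then have "0 \<le> q n - q m" using False ae by (simp add: zero_le_mult_iff)
      then have "(a - e) * (q n - q m) \<le> (a + e) * (q n - q m)" using ae by (intro mult_right_mono) auto
      then have "(a + e) * d \<le> (a + e) * (q n - q m)" using 2 by linarith
      then show ?thesis using ae by (simp add: d_def)
    qed
  qed
  have "decseq q" unfolding decseq_def using key nonneg by (metis diff_ge_0_iff_ge order_trans)
  then have "convergent q" by (rule decseq_convergent[of q 0]) (auto simp: q_def nonneg convergent_def)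
  then have qC: "Cauchy q" by (rule convergent_Cauchy)
  have "Cauchy w"
  proof (rule metric_CauchyI)
    fix r :: real assume r: "0 < r"
    then obtain N where N: "\<And>m n. N \<le> m \<Longrightarrow> N \<le> n \<Longrightarrow> dist (q m) (q n) < c * r\<^sup>2"
      using metric_CauchyD[OF qC, of "c * r\<^sup>2"] c_pos by auto
    have *: "norm (w m - w n) < r" if "N \<le> n" "n \<le> m" for m n
    proof -
      have "c * (norm (w m - w n))\<^sup>2 \<le> q n - q m" using key[OF that(2)] coercive order_trans by blast
      also have "\<dots> < c * r\<^sup>2" using N[of n m] that by (auto simp: dist_real_def)
      finally have "(norm (w m - w n))\<^sup>2 < r\<^sup>2" using c_pos by simp
      then show ?thesis using r by (simp add: power_less_imp_less_base)
    qed
    show "\<exists>M. \<forall>m\<ge>M. \<forall>n\<ge>M. dist (w m) (w n) < r"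
      by (rule exI[of _ N]) (metis * dist_norm norm_minus_commute nat_le_linear)
  qed
  then obtain w' where w': "w \<longlonglongrightarrow> w'" using Cauchy_convergent_iff convergent_def by blast
  have zl: "z \<longlonglongrightarrow> y - w'"
  proof -
    have "z = (\<lambda>n. y - w n)" by (auto simp: w_def)
    then show ?thesis using w' by (auto intro: tendsto_intros)
  qed
  have ge: "0 \<le> b w' ((y - w') - x)" if x: "x \<in> D" for x
  proof -
    have "(\<lambda>n. b (w n - lam n *\<^sub>R B x) (z n - x)) \<longlonglongrightarrow> b (w' - 0 *\<^sub>R B x) (y - w' - x)"
      by (intro tendsto tendsto_intros w' zl lam_lim)
    moreover have "0 \<le> b (w n - lam n *\<^sub>R B x) (z n - x)" for n
    proof -
      have "w n - lam n *\<^sub>R B x = lam n *\<^sub>R B (z n - x)" by (simp add: w B_diff zD x scaleR_diff_right)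
      moreover have "0 \<le> b (B (z n - x)) (z n - x)" using zD x D by (intro mono) (simp add: subspace_diff)
      ultimately show ?thesis by (simp add: scaleR_left mult_nonneg_nonneg less_imp_le)
    qed
    ultimately show ?thesis by (auto intro: LIMSEQ_le_const)
  qed
  have orth: "b w' x = 0" if x: "x \<in> D" for x
  proof (rule ccontr)
    assume ne: "b w' x \<noteq> 0"
    define t where "t = (b w' (y - w') + 1) / b w' x"
    have "0 \<le> b w' ((y - w') - t *\<^sub>R x)" by (rule ge) (use x D in \<open>simp add: subspace_scale\<close>)
    then have "t * b w' x \<le> b w' (y - w')" by (simp add: diff_right scaleR_right)
    then show False using ne by (simp add: t_def)
  qed
  obtain x where x: "x \<in> D" "x + B x = w'" using surj[of 1 w'] by auto
  have "0 = b x x + b (B x) x" using orth[OF x(1)] x(2)[symmetric] by (simp add: add_left)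
  then have "b x x = 0" using mono[OF x(1)] nonneg[of x] by linarith
  then have "w' = 0" using x(2) by (simp add: zero_iff B_zero)
  then show ?thesis using zl by (simp add: z_def[abs_def])
qed

lemma J_defect: "b (v - J (lam n) v) (v - J (lam n) v) \<le> 4 * b v v"
  using diff_bound[of v "J (lam n) v"] J_contraction[of "lam n" v] by simp

text \<open>Pointwise convergence is uniform on the compact range of \<open>f\<close>, since the maps \<open>1 - J\<close> are equibounded (\<open>J_defect\<close>).\<close>

lemma J_lim_uniform:
  fixes T :: real
  assumes f: "continuous_on {0..T} f" and e: "0 < (e::real)"
  shows "\<exists>N. \<forall>n\<ge>N. \<forall>t\<in>{0..T}. b (f t - J (lam n) (f t)) (f t - J (lam n) (f t)) < e"
proof (rule ccontr)
  define q where "q n v = b (v - J (lam n) v) (v - J (lam n) v)" for n v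
  assume "\<not> ?thesis"
  then have "\<forall>N. \<exists>n t. N \<le> n \<and> t \<in> {0..T} \<and> e \<le> q n (f t)" unfolding q_def by (meson not_le)
  then obtain n t where nt: "\<And>N. N \<le> n N" "\<And>N. t N \<in> {0..T}" "\<And>N. e \<le> q (n N) (f (t N))" by metis
  have "seq_compact {0..T}" by (rule compact_imp_seq_compact) (rule compact_Icc)
  then obtain l r where l: "l \<in> {0..T}" "strict_mono r" "(t \<circ> r) \<longlonglongrightarrow> l"
    using nt(2) unfolding seq_compact_def by blast
  have fl: "(\<lambda>k. f (t (r k))) \<longlonglongrightarrow> f l"
    using continuous_on_tendsto_compose[OF f l(3) l(1)] nt(2) by (auto simp: o_def)
  have r_ge: "filterlim (\<lambda>k. n (r k)) at_top sequentially"
    by (rule filterlim_at_top_mono[OF filterlim_subseq[OF l(2)]]) (auto simp: nt)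
  have 1: "(\<lambda>k. q k (f l)) \<longlonglongrightarrow> 0" unfolding q_def form_tendsto_zero_iff
    using tendsto_diff[OF tendsto_const J_lim[of "f l"], of "f l"] by simp
  have 1: "(\<lambda>k. q (n (r k)) (f l)) \<longlonglongrightarrow> 0" by (rule filterlim_compose[OF 1 r_ge])
  have 2: "(\<lambda>k. b (f (t (r k)) - f l) (f (t (r k)) - f l)) \<longlonglongrightarrow> 0" unfolding form_tendsto_zero_iff
    using tendsto_diff[OF fl tendsto_const[of "f l"]] by simp
  have "(\<lambda>k. 2 * (4 * b (f (t (r k)) - f l) (f (t (r k)) - f l) + q (n (r k)) (f l))) \<longlonglongrightarrow> 2 * (4 * 0 + 0)"
    by (intro tendsto_intros 1 2)
  moreover have "e \<le> 2 * (4 * b (f (t (r k)) - f l) (f (t (r k)) - f l) + q (n (r k)) (f l))" for k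
  proof -
    let ?n = "n (r k)" and ?v = "f (t (r k))"
    have "J (lam ?n) ?v = J (lam ?n) (?v - f l) + J (lam ?n) (f l)"
      by (simp add: linear_add[OF J_linear[OF lam_pos], symmetric])
    then have "q ?n ?v = b ((?v - f l - J (lam ?n) (?v - f l)) + (f l - J (lam ?n) (f l)))
      ((?v - f l - J (lam ?n) (?v - f l)) + (f l - J (lam ?n) (f l)))"
      by (simp add: q_def algebra_simps)
    also have "\<dots> \<le> 2 * (4 * b (?v - f l) (?v - f l) + q ?n (f l))"
      unfolding q_def by (rule order_trans[OF sum_bound]) (intro mult_left_mono add_mono J_defect order_refl, simp)
    finally show ?thesis using nt(3)[of "r k"] by linarith
  qed
  ultimately have "e \<le> 2 * (4 * 0 + 0)" by (auto intro: LIMSEQ_le_const)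
  then show False using e by simp
qed

definition yosida_solution :: "real \<Rightarrow> nat \<Rightarrow> (real \<Rightarrow> 'h) \<Rightarrow> (real \<Rightarrow> 'h) \<Rightarrow> bool" where
  "yosida_solution T n f u \<longleftrightarrow>
     (\<forall>t\<in>{0..T}. (u has_vector_derivative f t - Y (lam n) (u t)) (at t within {0..T}))"

lemma yosida_solution_exists:
  assumes "0 \<le> T" "continuous_on {0..T} f"
  obtains u where "u 0 = x" "yosida_solution T n f u"
  using bounded_linear_ode_exists[OF Y_bounded_linear[OF lam_pos] assms] unfolding yosida_solution_def by metis

lemma yosida_solution_continuous: "yosida_solution T n f u \<Longrightarrow> continuous_on {0..T} u"
  unfolding yosida_solution_def continuous_on_eq_continuous_within
  using has_vector_derivative_continuous by blast

lemma yosida_solution_diff: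
  assumes "yosida_solution T n f u" "yosida_solution T n g v"
  shows "yosida_solution T n (\<lambda>t. f t - g t) (\<lambda>t. u t - v t)"
proof -
  interpret Y: bounded_linear "Y (lam n)" by (rule Y_bounded_linear) simp
  show ?thesis using assms unfolding yosida_solution_def
    by (auto simp: Y.diff intro!: derivative_eq_intros)
qed

lemma yosida_estimate:
  assumes u: "yosida_solution T n f u" and K: "\<And>t. t \<in> {0..T} \<Longrightarrow> b (f t) (f t) \<le> K"
    and t: "t \<in> {0..T}"
  shows "b (u t) (u t) \<le> exp T * (b (u 0) (u 0) + T * K)"
proof -
  have T: "0 \<le> T" using t by auto
  have K0: "0 \<le> K" using K[OF t] nonneg[of "f t"] by linarith
  have "b (u t) (u t) \<le> exp (1 * t) * (b (u 0) (u 0) + integral {0..t} (\<lambda>_. K))"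
  proof (rule gronwall_interval[OF T _ _ _ _ _ t])
    fix s assume s: "s \<in> {0..T}"
    show "((\<lambda>t. b (u t) (u t)) has_vector_derivative 2 * b (f s - Y (lam n) (u s)) (u s)) (at s within {0..T})"
      using u s unfolding yosida_solution_def by (intro energy_derivative) auto
    show "2 * b (f s - Y (lam n) (u s)) (u s) \<le> 1 * b (u s) (u s) + K"
      using young[of "f s" "u s"] K[OF s] Y_monotone[OF lam_pos, of n "u s"] by (simp add: diff_left)
  qed (use K0 in auto)
  also have "integral {0..t} (\<lambda>_. K) = t * K" using t by simp
  also have "exp (1 * t) * (b (u 0) (u 0) + t * K) \<le> exp T * (b (u 0) (u 0) + T * K)"
    using t K0 nonneg[of "u 0"] by (intro mult_mono add_mono mult_right_mono) auto
  finally show ?thesis .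
qed

text \<open>The approximation commutes with the equation, so the bound for solutions also bounds \<open>Y u\<close>.\<close>

lemma yosida_image_solution:
  assumes u: "yosida_solution T n f u"
  shows "yosida_solution T n (\<lambda>t. Y (lam n) (f t)) (\<lambda>t. Y (lam n) (u t))"
proof -
  interpret Y: bounded_linear "Y (lam n)" by (rule Y_bounded_linear) simp
  show ?thesis using u Y.has_vector_derivative[of u] unfolding yosida_solution_def
    by (auto simp: Y.diff[symmetric])
qed

text \<open>With data in the domain, \<open>Y u\<close> stays bounded, and \<open>Y_cross\<close> turns this bound into the rate \<open>lam n + lam m\<close>.\<close>

lemma yosida_cauchy_regular:
  assumes T: "0 \<le> T" and x: "x \<in> D" and f: "\<And>t. t \<in> {0..T} \<Longrightarrow> f t \<in> D"
    and K: "\<And>t. t \<in> {0..T} \<Longrightarrow> b (B (f t)) (B (f t)) \<le> K"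
    and u: "\<And>n. yosida_solution T n f (u n)" "\<And>n. u n 0 = x"
  shows "\<exists>L. \<forall>n m. \<forall>t\<in>{0..T}. b (u n t - u m t) (u n t - u m t) \<le> L * (lam n + lam m)"
proof -
  define M where "M = exp T * (b (B x) (B x) + T * K)"
  have "0 \<in> {0..T}" using T by simp
  have K0: "0 \<le> K" using K[OF \<open>0 \<in> {0..T}\<close>] nonneg order_trans by blast
  have M0: "0 \<le> M" unfolding M_def using K0 T nonneg by (intro mult_nonneg_nonneg add_nonneg_nonneg) auto
  have y: "b (Y (lam n) (u n t)) (Y (lam n) (u n t)) \<le> M" if t: "t \<in> {0..T}" for n t
  proof -
    have "b (Y (lam n) (u n t)) (Y (lam n) (u n t)) \<le> exp T * (b (Y (lam n) (u n 0)) (Y (lam n) (u n 0)) + T * K)"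
    proof (rule yosida_estimate[OF yosida_image_solution[OF u(1)] _ t])
      fix s assume "s \<in> {0..T}"
      then show "b (Y (lam n) (f s)) (Y (lam n) (f s)) \<le> K"
        using J_contraction[OF lam_pos, of n "B (f s)"] K[of s] f[of s] by (simp add: Y_on_domain)
    qed
    also have "\<dots> \<le> M" unfolding M_def u(2) Y_on_domain[OF lam_pos x]
      using J_contraction[OF lam_pos, of n "B x"] by simp
    finally show ?thesis .
  qed
  have "b (u n t - u m t) (u n t - u m t) \<le> (exp T * T * 2 * M) * (lam n + lam m)" if t: "t \<in> {0..T}" for n m t
  proof -
    let ?G = "2 * (lam n + lam m) * M"
    have G0: "0 \<le> ?G" using M0 lam_pos by (intro mult_nonneg_nonneg) (auto simp: add_nonneg_nonneg less_imp_le)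
    have "b (u n t - u m t) (u n t - u m t) \<le> exp (0 * t) * (b (u n 0 - u m 0) (u n 0 - u m 0) + integral {0..t} (\<lambda>_. ?G))"
    proof (rule gronwall_interval[OF T _ _ _ _ _ t])
      fix s assume s: "s \<in> {0..T}"
      have d: "((\<lambda>t. u n t - u m t) has_vector_derivative (f s - Y (lam n) (u n s)) - (f s - Y (lam m) (u m s))) (at s within {0..T})"
        using u(1) s unfolding yosida_solution_def by (intro has_vector_derivative_diff) auto
      show "((\<lambda>t. b (u n t - u m t) (u n t - u m t)) has_vector_derivative
          2 * b ((f s - Y (lam n) (u n s)) - (f s - Y (lam m) (u m s))) (u n s - u m s)) (at s within {0..T})"
        by (rule energy_derivative[OF d])
      have "(f s - Y (lam n) (u n s)) - (f s - Y (lam m) (u m s)) = - (Y (lam n) (u n s) - Y (lam m) (u m s))" by simp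
      then show "2 * b ((f s - Y (lam n) (u n s)) - (f s - Y (lam m) (u m s))) (u n s - u m s) \<le> 0 * b (u n s - u m s) (u n s - u m s) + ?G"
        using Y_cross[OF lam_pos lam_pos y[OF s, of n] y[OF s, of m]] by (simp only: minus_left)
    qed (use G0 in auto)
    also have "\<dots> = t * ?G" using t by (simp add: u(2) zero_left)
    also have "\<dots> \<le> T * ?G" using t G0 by (intro mult_right_mono) auto
    also have "\<dots> \<le> exp T * (T * ?G)" 
      using mult_right_mono[of 1 "exp T" "T * ?G"] T mult_nonneg_nonneg[OF T G0] by (simp only: mult_1 one_le_exp_iff)
    finally show ?thesis by (simp add: mult_ac)
  qed
  then show ?thesis by blast
qed

text \<open>General data are replaced by their images under one fixed resolvent. These lie in the domain with bounded image under \<open>B\<close>, so \<open>yosida_cauchy_regular\<close> applies, and the error is controlled by \<open>yosida_estimate\<close> uniformly in the approximation index.\<close>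

lemma yosida_cauchy:
  assumes T: "0 \<le> T" and x: "x \<longlonglongrightarrow> x'" and f: "continuous_on {0..T} f'"
    and fn: "uniform_limit {0..T} f f' sequentially"
    and u: "\<And>n. yosida_solution T n (f n) (u n)" "\<And>n. u n 0 = x n"
  shows "uniformly_Cauchy_on {0..T} u"
proof (rule uniformly_Cauchy_onI)
  fix r :: real assume r: "0 < r"
  obtain K where K: "0 < K" "\<And>x. b x x \<le> K * (norm x)\<^sup>2" using form_bound by blast
  define L where "L = exp T * (4 + 4 * T)"
  have L: "0 < L" using T by (simp add: L_def add_pos_nonneg)
  define e where "e = c * r\<^sup>2 / (16 * L)"
  have e: "0 < e" using r L c_pos by (simp add: e_def)
  have xl: "(\<lambda>n. b (x' - J (lam n) x') (x' - J (lam n) x')) \<longlonglongrightarrow> 0"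
    unfolding form_tendsto_zero_iff using tendsto_diff[OF tendsto_const J_lim[of x'], of x'] by simp
  obtain N1 where N1: "\<And>n. N1 \<le> n \<Longrightarrow> b (x' - J (lam n) x') (x' - J (lam n) x') < e"
    using order_tendstoD(2)[OF xl e] unfolding eventually_sequentially by auto
  obtain N2 where N2: "\<And>n t. N2 \<le> n \<Longrightarrow> t \<in> {0..T} \<Longrightarrow> b (f' t - J (lam n) (f' t)) (f' t - J (lam n) (f' t)) < e"
    using J_lim_uniform[OF f e] by blast
  define \<nu> where "\<nu> = lam (max N1 N2)"
  have nu: "0 < \<nu>" by (simp add: \<nu>_def)
  define \<xi> g where "\<xi> = J \<nu> x'" and "g t = J \<nu> (f' t)" for t
  have xi: "b (x' - \<xi>) (x' - \<xi>) < e" using N1[of "max N1 N2"] by (simp add: \<xi>_def \<nu>_def)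
  have g: "b (f' t - g t) (f' t - g t) < e" if "t \<in> {0..T}" for t using N2[of "max N1 N2" t] that by (simp add: g_def \<nu>_def)
  have gc: "continuous_on {0..T} g" unfolding g_def
    by (intro bounded_linear.continuous_on[OF J_bounded_linear[OF nu]] f)
  have Bg: "B (g t) = Y \<nu> (f' t)" for t by (simp add: g_def Y_eq nu)
  have "continuous_on {0..T} (\<lambda>t. b (B (g t)) (B (g t)))" unfolding Bg
    by (intro continuous_on bounded_linear.continuous_on[OF Y_bounded_linear[OF nu]] f)
  then have "bounded ((\<lambda>t. b (B (g t)) (B (g t))) ` {0..T})"
    by (intro compact_imp_bounded compact_continuous_image) auto
  then obtain M where "\<forall>y\<in>(\<lambda>t. b (B (g t)) (B (g t))) ` {0..T}. norm y \<le> M" unfolding bounded_iff by blast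
  then have M: "b (B (g t)) (B (g t)) \<le> M" if "t \<in> {0..T}" for t
    using that by (auto simp: abs_le_iff)
  have "\<exists>v. v 0 = \<xi> \<and> yosida_solution T n g v" for n using yosida_solution_exists[OF T gc] by metis
  then obtain v where v: "\<And>n. v n 0 = \<xi>" "\<And>n. yosida_solution T n g (v n)" by metis
  have xiD: "\<xi> \<in> D" and gD: "g t \<in> D" for t by (simp_all add: \<xi>_def g_def J_in nu)
  obtain L' where L': "\<And>n m t. t \<in> {0..T} \<Longrightarrow> b (v n t - v m t) (v n t - v m t) \<le> L' * (lam n + lam m)"
    using yosida_cauchy_regular[OF T xiD gD M v(2) v(1)] by blast
  have xl': "(\<lambda>n. b (x n - x') (x n - x')) \<longlonglongrightarrow> 0" unfolding form_tendsto_zero_iff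
    using x by (simp add: LIM_zero_iff)
  then obtain N3 where N3: "\<And>n. N3 \<le> n \<Longrightarrow> b (x n - x') (x n - x') < e"
    using order_tendstoD(2)[OF xl' e] unfolding eventually_sequentially by auto
  have "0 < sqrt (e / K)" using e K by simp
  then obtain N4 where N4: "\<And>n t. N4 \<le> n \<Longrightarrow> t \<in> {0..T} \<Longrightarrow> dist (f n t) (f' t) < sqrt (e / K)"
    using fn unfolding uniform_limit_iff eventually_sequentially by blast
  have fb: "b (f n t - f' t) (f n t - f' t) \<le> e" if "N4 \<le> n" "t \<in> {0..T}" for n t
  proof -
    have "norm (f n t - f' t) \<le> sqrt (e / K)" using N4[OF that] by (simp add: dist_norm)
    then have "(norm (f n t - f' t))\<^sup>2 \<le> (sqrt (e / K))\<^sup>2" by (intro power_mono) auto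
    then have "K * (norm (f n t - f' t))\<^sup>2 \<le> e" using e K by (simp add: field_simps)
    then show ?thesis using K(2) order_trans by blast
  qed
  have close: "b (u n t - v n t) (u n t - v n t) \<le> L * e" if n: "N3 \<le> n" "N4 \<le> n" and t: "t \<in> {0..T}" for n t
  proof -
    have "b (u n t - v n t) (u n t - v n t) \<le> exp T * (b (u n 0 - v n 0) (u n 0 - v n 0) + T * (4 * e))"
    proof (rule yosida_estimate[OF yosida_solution_diff[OF u(1) v(2)] _ t])
      fix s assume s: "s \<in> {0..T}"
      show "b (f n s - g s) (f n s - g s) \<le> 4 * e"
        using sum_bound[of "f n s - f' s" "f' s - g s"] fb[OF n(2) s] g[OF s] by simp
    qed
    also have "\<dots> \<le> exp T * (4 * e + T * (4 * e))"
      using sum_bound[of "x n - x'" "x' - \<xi>"] N3[OF n(1)] xi by (simp add: u(2) v(1))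
    finally show ?thesis by (simp add: L_def algebra_simps)
  qed
  have "(\<lambda>n. \<bar>L'\<bar> * (lam n + lam n)) \<longlonglongrightarrow> \<bar>L'\<bar> * (0 + 0)" by (intro tendsto_intros lam_lim)
  then have ll: "(\<lambda>n. \<bar>L'\<bar> * (lam n + lam n)) \<longlonglongrightarrow> 0" by simp
  have "0 < L * e" using L e by simp
  then obtain N5 where N5: "\<bar>L'\<bar> * (lam N5 + lam N5) < L * e"
    using order_tendstoD(2)[OF ll] unfolding eventually_sequentially by (meson order_refl)
  have lam_mono: "lam n \<le> lam m" if "m \<le> n" for m n using that by (auto simp: lam_def intro!: le_imp_inverse_le)
  show "\<exists>M. \<forall>t\<in>{0..T}. \<forall>m\<ge>M. \<forall>n\<ge>M. dist (u m t) (u n t) < r"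
  proof (intro exI ballI allI impI)
    fix t m n assume t: "t \<in> {0..T}" and mn: "max N3 (max N4 N5) \<le> m" "max N3 (max N4 N5) \<le> n"
    have "L' * (lam m + lam n) \<le> \<bar>L'\<bar> * (lam N5 + lam N5)"
      using lam_mono[of N5 m] lam_mono[of N5 n] mn lam_pos[of m] lam_pos[of n] 
      by (intro mult_mono) (auto simp: add_nonneg_nonneg less_imp_le)
    then have 2: "b (v m t - v n t) (v m t - v n t) \<le> L * e" using L'[OF t, of m n] N5 by linarith
    have 1: "b (u m t - v m t) (u m t - v m t) \<le> L * e" and 3: "b (u n t - v n t) (u n t - v n t) \<le> L * e"
      using close t mn by auto
    have 4: "b ((u m t - v m t) - (u n t - v n t)) ((u m t - v m t) - (u n t - v n t)) \<le> 2 * (L * e + L * e)"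
      by (rule order_trans[OF diff_bound]) (intro mult_left_mono add_mono 1 3, simp)
    have "b (((u m t - v m t) - (u n t - v n t)) + (v m t - v n t)) (((u m t - v m t) - (u n t - v n t)) + (v m t - v n t))
        \<le> 2 * (2 * (L * e + L * e) + L * e)"
      by (rule order_trans[OF sum_bound]) (intro mult_left_mono add_mono 4 2, simp)
    then have "b (u m t - u n t) (u m t - u n t) \<le> 2 * (2 * (L * e + L * e) + L * e)" by simp
    also have "\<dots> < 16 * (L * e)" using L e by simp
    also have "\<dots> = c * r\<^sup>2" using L by (simp add: e_def)
    finally have "c * (norm (u m t - u n t))\<^sup>2 < c * r\<^sup>2" using coercive order_le_less_trans by blast
    then have "(norm (u m t - u n t))\<^sup>2 < r\<^sup>2" using c_pos by simp
    then show "dist (u m t) (u n t) < r" using r by (simp add: dist_norm power_less_imp_less_base)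
  qed
qed

text \<open>For differentiable \<open>f\<close> the derivative \<open>w = f - Y u\<close> of the approximation solves the equation with source \<open>f'\<close>; for \<open>f\<close> in the domain, \<open>Y u\<close> solves it with source \<open>J (B f)\<close>, which tends to \<open>B f\<close>. Either way \<open>yosida_cauchy\<close> applies to a new sequence of solutions.\<close>

lemma yosida_image_cauchy:
  assumes T: "0 \<le> T" and x: "x \<in> D" and fc: "continuous_on {0..T} f"
    and reg: "(\<exists>f'. continuous_on {0..T} f' \<and>
        (\<forall>t\<in>{0..T}. (f has_vector_derivative f' t) (at t within {0..T}))) \<or>
      ((\<forall>t\<in>{0..T}. f t \<in> D) \<and> continuous_on {0..T} (\<lambda>t. B (f t)))"
    and u: "\<And>n. yosida_solution T n f (u n)" "\<And>n. u n 0 = x"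
  shows "uniformly_Cauchy_on {0..T} (\<lambda>n t. Y (lam n) (u n t))"
  using reg
proof (elim disjE exE conjE)
  fix f' assume f': "continuous_on {0..T} f'"
    "\<forall>t\<in>{0..T}. (f has_vector_derivative f' t) (at t within {0..T})"
  define w where "w n t = f t - Y (lam n) (u n t)" for n t
  have "uniformly_Cauchy_on {0..T} w"
  proof (rule yosida_cauchy[OF T _ f'(1)])
    show "yosida_solution T n f' (w n)" for n
    proof -
      interpret Y: bounded_linear "Y (lam n)" by (rule Y_bounded_linear) simp
      show ?thesis unfolding yosida_solution_def w_def
        using f'(2) u(1)[of n] Y.has_vector_derivative[of "u n"] unfolding yosida_solution_def
        by (auto intro!: has_vector_derivative_diff)
    qed
    show "(\<lambda>n. f 0 - J (lam n) (B x)) \<longlonglongrightarrow> f 0 - B x" by (intro tendsto_intros J_lim)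
    show "w n 0 = f 0 - J (lam n) (B x)" for n by (simp add: w_def u(2) Y_on_domain x)
  qed (rule uniform_limit_const)
  moreover have "dist (Y (lam m) (u m t)) (Y (lam n) (u n t)) = dist (w m t) (w n t)" for m n t
    by (simp add: w_def dist_norm norm_minus_commute)
  ultimately show ?thesis by (simp add: uniformly_Cauchy_on_def)
next
  assume fD: "\<forall>t\<in>{0..T}. f t \<in> D" and Bf: "continuous_on {0..T} (\<lambda>t. B (f t))"
  show ?thesis
  proof (rule yosida_cauchy[OF T J_lim[of "B x"] Bf _ yosida_image_solution[OF u(1)]])
    show "Y (lam n) (u n 0) = J (lam n) (B x)" for n by (simp add: u(2) Y_on_domain x)
    show "uniform_limit {0..T} (\<lambda>n t. Y (lam n) (f t)) (\<lambda>t. B (f t)) sequentially"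
    proof (rule uniform_limitI)
      fix e :: real assume e: "0 < e"
      then obtain N where N: "\<And>n t. N \<le> n \<Longrightarrow> t \<in> {0..T} \<Longrightarrow>
          b (B (f t) - J (lam n) (B (f t))) (B (f t) - J (lam n) (B (f t))) < c * e\<^sup>2"
        using J_lim_uniform[OF Bf, of "c * e\<^sup>2"] c_pos by (metis mult_pos_pos zero_less_power)
      have "dist (Y (lam n) (f t)) (B (f t)) < e" if "N \<le> n" "t \<in> {0..T}" for n t
      proof -
        have "c * (norm (B (f t) - J (lam n) (B (f t))))\<^sup>2 < c * e\<^sup>2"
          using N[OF that] coercive order_le_less_trans by blast
        then have "(norm (B (f t) - J (lam n) (B (f t))))\<^sup>2 < e\<^sup>2" using c_pos by simp
        then have "norm (B (f t) - J (lam n) (B (f t))) < e" using e by (simp add: power_less_imp_less_base)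
        then show ?thesis using fD that by (simp add: Y_on_domain dist_norm norm_minus_commute)
      qed
      then show "\<forall>\<^sub>F n in sequentially. \<forall>t\<in>{0..T}. dist (Y (lam n) (f t)) (B (f t)) < e"
        unfolding eventually_sequentially by blast
    qed
  qed
qed

text \<open>The approximations converge by \<open>yosida_cauchy\<close>, their images by \<open>yosida_image_cauchy\<close>; the closed graph places the limit in the domain, and the integrated equation passes to the limit.\<close>

theorem monotone_evolution_exists:
  assumes T: "0 \<le> T" and x: "x \<in> D" and fc: "continuous_on {0..T} f"
    and reg: "(\<exists>f'. continuous_on {0..T} f' \<and>
        (\<forall>t\<in>{0..T}. (f has_vector_derivative f' t) (at t within {0..T}))) \<or>
      ((\<forall>t\<in>{0..T}. f t \<in> D) \<and> continuous_on {0..T} (\<lambda>t. B (f t)))"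
  obtains u where "u 0 = x" "\<And>t. t \<in> {0..T} \<Longrightarrow> u t \<in> D"
    "\<And>t. t \<in> {0..T} \<Longrightarrow> (u has_vector_derivative f t - B (u t)) (at t within {0..T})"
    "continuous_on {0..T} (\<lambda>t. B (u t))"
proof -
  have "\<exists>v. v 0 = x \<and> yosida_solution T n f v" for n using yosida_solution_exists[OF T fc] by metis
  then obtain v where v: "\<And>n. yosida_solution T n f (v n)" "\<And>n. v n 0 = x" by metis
  have "uniformly_Cauchy_on {0..T} v" 
    by (rule yosida_cauchy[OF T tendsto_const fc uniform_limit_const v])
  then obtain u where u: "uniform_limit {0..T} v u sequentially"
    using Cauchy_uniformly_convergent uniformly_convergent_on_def by blast
  obtain y where y: "uniform_limit {0..T} (\<lambda>n t. Y (lam n) (v n t)) y sequentially"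
    using yosida_image_cauchy[OF T x fc reg v] Cauchy_uniformly_convergent uniformly_convergent_on_def by blast
  have yc: "continuous_on {0..T} y"
    by (rule uniform_limit_theorem[OF _ y])
      (auto intro!: always_eventually bounded_linear.continuous_on[OF Y_bounded_linear] intro: yosida_solution_continuous v)
  have uD: "u t \<in> D" "B (u t) = y t" if t: "t \<in> {0..T}" for t
  proof -
    have yt: "(\<lambda>n. Y (lam n) (v n t)) \<longlonglongrightarrow> y t" and ut: "(\<lambda>n. v n t) \<longlonglongrightarrow> u t"
      using tendsto_uniform_limitI[OF y t] tendsto_uniform_limitI[OF u t] by auto
    have "(\<lambda>n. v n t - lam n *\<^sub>R Y (lam n) (v n t)) \<longlonglongrightarrow> u t - 0 *\<^sub>R y t"
      by (intro tendsto_intros yt ut lam_lim)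
    moreover have "v n t - lam n *\<^sub>R Y (lam n) (v n t) = J (lam n) (v n t)" for n
      using lam_pos[of n] by (simp add: Y_def del: lam_pos)
    ultimately have "(\<lambda>n. J (lam n) (v n t)) \<longlonglongrightarrow> u t" by simp
    moreover have "(\<lambda>n. B (J (lam n) (v n t))) \<longlonglongrightarrow> y t" using yt by (simp add: Y_eq)
    ultimately show "u t \<in> D" "B (u t) = y t" by (auto intro!: closed_graph[of "\<lambda>n. J (lam n) (v n t)"] J_in)
  qed
  have "(0::real) \<in> {0..T}" using T by simp
  then have u0: "(\<lambda>n. v n 0) \<longlonglongrightarrow> u 0" by (rule tendsto_uniform_limitI[OF u])
  have "\<exists>g. \<forall>t\<in>{0..T}. (\<lambda>n. v n t) \<longlonglongrightarrow> g t \<and> (g has_derivative (\<lambda>h. h *\<^sub>R (f t - y t))) (at t within {0..T})"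
  proof (rule has_derivative_sequence[where f' = "\<lambda>n t h. h *\<^sub>R (f t - Y (lam n) (v n t))"])
    show "(v n has_derivative (\<lambda>h. h *\<^sub>R (f t - Y (lam n) (v n t)))) (at t within {0..T})" if "t \<in> {0..T}" for n t
      using v(1)[of n] that by (simp add: yosida_solution_def has_vector_derivative_def)
    fix e :: real assume "0 < e"
    then have "\<forall>\<^sub>F n in sequentially. \<forall>t\<in>{0..T}. dist (Y (lam n) (v n t)) (y t) < e"
      using y by (simp add: uniform_limit_iff)
    then show "\<forall>\<^sub>F n in sequentially. \<forall>t\<in>{0..T}. \<forall>h. norm (h *\<^sub>R (f t - Y (lam n) (v n t)) - h *\<^sub>R (f t - y t)) \<le> e * norm h"
    proof (rule eventually_mono, intro ballI allI)
      fix n t h assume a: "\<forall>t\<in>{0..T}. dist (Y (lam n) (v n t)) (y t) < e" and t: "t \<in> {0..T}"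
      have "norm (h *\<^sub>R (f t - Y (lam n) (v n t)) - h *\<^sub>R (f t - y t)) = \<bar>h\<bar> * dist (Y (lam n) (v n t)) (y t)"
        by (simp add: scaleR_diff_right[symmetric] dist_norm norm_minus_commute)
      also have "\<dots> \<le> \<bar>h\<bar> * e" using a t by (intro mult_left_mono) (auto intro: less_imp_le)
      finally show "norm (h *\<^sub>R (f t - Y (lam n) (v n t)) - h *\<^sub>R (f t - y t)) \<le> e * norm h" by (simp add: mult.commute)
    qed
  qed (use T u0 in auto)
  then obtain g where g: "\<And>t. t \<in> {0..T} \<Longrightarrow> (\<lambda>n. v n t) \<longlonglongrightarrow> g t"
    "\<And>t. t \<in> {0..T} \<Longrightarrow> (g has_vector_derivative (f t - y t)) (at t within {0..T})"
    unfolding has_vector_derivative_def by blast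
  have gu: "g t = u t" if "t \<in> {0..T}" for t
    using g(1)[OF that] tendsto_uniform_limitI[OF u that] LIMSEQ_unique by blast
  show ?thesis
  proof
    show "u 0 = x" using u0 v(2) by (simp add: LIMSEQ_const_iff)
    show "u t \<in> D" if "t \<in> {0..T}" for t using uD that by blast
    show "(u has_vector_derivative f t - B (u t)) (at t within {0..T})" if t: "t \<in> {0..T}" for t
      unfolding uD(2)[OF t] by (rule has_vector_derivative_transform[OF t _ g(2)[OF t]]) (simp add: gu)
    show "continuous_on {0..T} (\<lambda>t. B (u t))"
      by (rule continuous_on_eq[OF yc]) (simp add: uD)
  qed
qed

end

section \<open>Square integrable functions\<close>

text \<open>Measure-theoretic constructions on products are available for Borel functions, whereas the function spaces are defined with Lebesgue measurability.\<close>

lemma borel_representative: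
  fixes f :: "'a::euclidean_space \<Rightarrow> 'b::euclidean_space"
  assumes f: "f \<in> borel_measurable lebesgue"
  obtains g where "g \<in> borel_measurable borel" "AE x in lebesgue. f x = g x"
proof -
  have "\<exists>h. h \<in> borel_measurable borel \<and> (AE x in lborel. f x \<bullet> b = h x)" for b
  proof -
    have "\<exists>h\<in>borel_measurable lborel. AE x in lborel. f x \<bullet> b = h x"
      by (rule completion_ex_borel_measurable_real) (use f in measurable)
    then show ?thesis by auto
  qed
  then have "\<forall>b. \<exists>h. h \<in> borel_measurable borel \<and> (AE x in lborel. f x \<bullet> b = h x)" by blast
  from choice[OF this] obtain h
    where h: "\<And>b. h b \<in> borel_measurable borel" "\<And>b. AE x in lborel. f x \<bullet> b = h b x" by auto
  define g where "g x = (\<Sum>b\<in>Basis. h b x *\<^sub>R b)" for x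
  have "g \<in> borel_measurable borel" unfolding g_def using h(1) by measurable
  moreover have "AE x in lborel. \<forall>b\<in>Basis. f x \<bullet> b = h b x" by (rule AE_finite_allI) (use h in auto)
  then have "AE x in lborel. f x = g x"
  proof (rule eventually_mono)
    fix x assume a: "\<forall>b\<in>Basis. f x \<bullet> b = h b x"
    have "g x = (\<Sum>b\<in>Basis. (f x \<bullet> b) *\<^sub>R b)" unfolding g_def by (intro sum.cong) (use a in auto)
    then show "f x = g x" by (simp add: euclidean_representation)
  qed
  then have "AE x in lebesgue. f x = g x" by (rule AE_completion)
  ultimately show ?thesis using that by blast
qed

lemma L2_UNIV:
  "L2 UNIV f \<longleftrightarrow> f \<in> borel_measurable lebesgue \<and> integrable lebesgue (\<lambda>x. (norm (f x))\<^sup>2)"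
  by (simp add: L2_def lebesgue_on_UNIV_eq)

lemma L2_measurable: "L2 UNIV f \<Longrightarrow> f \<in> borel_measurable lebesgue"
  and L2_integrable: "L2 UNIV f \<Longrightarrow> integrable lebesgue (\<lambda>x. (norm (f x))\<^sup>2)"
  by (simp_all add: L2_UNIV)

lemma L2_bound:
  assumes "L2 UNIV f" "g \<in> borel_measurable lebesgue" "AE x in lebesgue. norm (g x) \<le> K * norm (f x)"
  shows "L2 UNIV g"
  unfolding L2_UNIV
proof
  show "integrable lebesgue (\<lambda>x. (norm (g x))\<^sup>2)"
  proof (rule Bochner_Integration.integrable_bound)
    show "integrable lebesgue (\<lambda>x. K\<^sup>2 * (norm (f x))\<^sup>2)" using assms(1) by (simp add: L2_UNIV)
    show "(\<lambda>x. (norm (g x))\<^sup>2) \<in> borel_measurable lebesgue" using assms(2) by measurable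
    show "AE x in lebesgue. norm ((norm (g x))\<^sup>2) \<le> norm (K\<^sup>2 * (norm (f x))\<^sup>2)"
      using assms(3)
    proof (rule eventually_mono)
      fix x assume "norm (g x) \<le> K * norm (f x)"
      then have "(norm (g x))\<^sup>2 \<le> (K * norm (f x))\<^sup>2" by (rule power_mono) simp
      then show "norm ((norm (g x))\<^sup>2) \<le> norm (K\<^sup>2 * (norm (f x))\<^sup>2)" by (simp add: power_mult_distrib)
    qed
  qed
qed (rule assms)

lemma L2_add:
  assumes f: "L2 UNIV f" and g: "L2 UNIV g" shows "L2 UNIV (f + g)"
  unfolding L2_UNIV
proof
  have [measurable]: "f \<in> borel_measurable lebesgue" "g \<in> borel_measurable lebesgue"
    using f g by (auto simp: L2_UNIV)
  have m: "(\<lambda>x. f x + g x) \<in> borel_measurable lebesgue" by measurable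
  then show "f + g \<in> borel_measurable lebesgue" by (simp add: plus_fun_def)
  show "integrable lebesgue (\<lambda>x. (norm ((f + g) x))\<^sup>2)"
  proof (rule Bochner_Integration.integrable_bound)
    show "integrable lebesgue (\<lambda>x. 2 * ((norm (f x))\<^sup>2 + (norm (g x))\<^sup>2))"
      using f g by (auto simp: L2_UNIV)
    show "(\<lambda>x. (norm ((f + g) x))\<^sup>2) \<in> borel_measurable lebesgue" using m by simp
    show "AE x in lebesgue. norm ((norm ((f + g) x))\<^sup>2) \<le> norm (2 * ((norm (f x))\<^sup>2 + (norm (g x))\<^sup>2))"
    proof (rule AE_I2)
      fix x
      have "(norm (f x + g x))\<^sup>2 \<le> (norm (f x) + norm (g x))\<^sup>2" by (simp add: norm_triangle_ineq power_mono)
      also have "\<dots> \<le> 2 * ((norm (f x))\<^sup>2 + (norm (g x))\<^sup>2)"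
        using zero_le_power2[of "norm (f x) - norm (g x)"] by (simp add: power2_eq_square algebra_simps)
      finally show "norm ((norm ((f + g) x))\<^sup>2) \<le> norm (2 * ((norm (f x))\<^sup>2 + (norm (g x))\<^sup>2))" by simp
    qed
  qed
qed

lemma L2_scaleR: assumes f: "L2 UNIV f" shows "L2 UNIV (r *\<^sub>R f)"
proof (rule L2_bound[OF f, where K="\<bar>r\<bar>"])
  have [measurable]: "f \<in> borel_measurable lebesgue" using f by (simp add: L2_UNIV)
  show "r *\<^sub>R f \<in> borel_measurable lebesgue" unfolding scaleR_fun_def by measurable
qed auto

lemma L2_diff: "L2 UNIV f \<Longrightarrow> L2 UNIV g \<Longrightarrow> L2 UNIV (f - g)"
  using L2_add[of f "(-1) *\<^sub>R g"] L2_scaleR[of g "-1"] by simp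

lemma L2_zero: "L2 UNIV 0"
  by (simp add: L2_UNIV zero_fun_def)

lemma L2_cong_AE:
  assumes "L2 UNIV f" "AE x in lebesgue. f x = g x" shows "L2 UNIV g"
proof (rule L2_bound[OF assms(1), where K=1])
  show "g \<in> borel_measurable lebesgue"
    by (rule borel_measurable_AE[OF L2_measurable[OF assms(1)] assms(2)])
qed (use assms(2) in auto)

text \<open>For the complete Lebesgue measure, functions equal almost everywhere are measurable together; if they are not measurable, both integrals are zero.\<close>

lemma integral_lebesgue_cong_AE:
  fixes f g :: "'a::euclidean_space \<Rightarrow> 'b::euclidean_space"
  assumes "AE x in lebesgue. f x = g x"
  shows "integral\<^sup>L lebesgue f = integral\<^sup>L lebesgue g"
proof (cases "f \<in> borel_measurable lebesgue")
  case True
  then have "g \<in> borel_measurable lebesgue" using assms by (rule borel_measurable_AE)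
  then show ?thesis using True assms by (intro integral_cong_AE)
next
  case False
  have "g \<notin> borel_measurable lebesgue"
  proof
    assume g: "g \<in> borel_measurable lebesgue"
    have "AE x in lebesgue. g x = f x" using assms by (rule eventually_mono) simp
    then show False using False borel_measurable_AE[OF g] by blast
  qed
  then show ?thesis using False by (metis borel_measurable_integrable not_integrable_integral_eq)
qed

definition l2ip :: "(real ^ 'd::finite \<Rightarrow> 'b::euclidean_space) \<Rightarrow> (real ^ 'd \<Rightarrow> 'b) \<Rightarrow> real" where
  "l2ip f g = (\<integral>x. f x \<bullet> g x \<partial>lebesgue)"

lemma L2_norm_mult_integrable:
  assumes f: "L2 UNIV f" and g: "L2 UNIV g"
  shows "integrable lebesgue (\<lambda>x. norm (f x) * norm (g x))"
proof (rule Bochner_Integration.integrable_bound)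
  have [measurable]: "f \<in> borel_measurable lebesgue" "g \<in> borel_measurable lebesgue"
    using f g by (auto simp: L2_UNIV)
  show "integrable lebesgue (\<lambda>x. (norm (f x))\<^sup>2 + (norm (g x))\<^sup>2)" using f g by (auto simp: L2_UNIV)
  show "(\<lambda>x. norm (f x) * norm (g x)) \<in> borel_measurable lebesgue" by measurable
  show "AE x in lebesgue. norm (norm (f x) * norm (g x)) \<le> norm ((norm (f x))\<^sup>2 + (norm (g x))\<^sup>2)"
  proof (rule AE_I2)
    fix x
    have "2 * (norm (f x) * norm (g x)) \<le> (norm (f x))\<^sup>2 + (norm (g x))\<^sup>2"
      using zero_le_power2[of "norm (f x) - norm (g x)"] by (simp add: power2_eq_square algebra_simps)
    moreover have "0 \<le> norm (f x) * norm (g x)" by simp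
    ultimately have "norm (f x) * norm (g x) \<le> (norm (f x))\<^sup>2 + (norm (g x))\<^sup>2" by linarith
    then show "norm (norm (f x) * norm (g x)) \<le> norm ((norm (f x))\<^sup>2 + (norm (g x))\<^sup>2)" by simp
  qed
qed

lemma L2_bilinear_integrable:
  fixes h :: "'b::euclidean_space \<Rightarrow> 'c::euclidean_space \<Rightarrow> 'e::euclidean_space"
  assumes h: "bounded_bilinear h" and f: "L2 UNIV f" and g: "L2 UNIV g"
    and m: "(\<lambda>x. h (f x) (g x)) \<in> borel_measurable lebesgue"
  shows "integrable lebesgue (\<lambda>x. h (f x) (g x))"
proof -
  obtain K where K: "\<And>a b. norm (h a b) \<le> norm a * norm b * K" "0 < K"
    using bounded_bilinear.pos_bounded[OF h] by blast
  show ?thesis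
  proof (rule Bochner_Integration.integrable_bound[OF _ m])
    show "integrable lebesgue (\<lambda>x. K * (norm (f x) * norm (g x)))"
      using L2_norm_mult_integrable[OF f g] by simp
    show "AE x in lebesgue. norm (h (f x) (g x)) \<le> norm (K * (norm (f x) * norm (g x)))"
      using K by (intro AE_I2) (simp add: abs_mult mult_ac)
  qed
qed

lemma L2_inner_integrable:
  assumes f: "L2 UNIV f" and g: "L2 UNIV g"
  shows "integrable lebesgue (\<lambda>x. f x \<bullet> g x)"
proof -
  have [measurable]: "f \<in> borel_measurable lebesgue" "g \<in> borel_measurable lebesgue"
    using f g by (auto simp: L2_UNIV)
  show ?thesis by (rule L2_bilinear_integrable[OF bounded_bilinear_inner f g]) measurable
qed

lemma l2ip_add_left: "L2 UNIV f \<Longrightarrow> L2 UNIV g \<Longrightarrow> L2 UNIV h \<Longrightarrow> l2ip (f + g) h = l2ip f h + l2ip g h"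
  by (simp add: l2ip_def inner_add_left L2_inner_integrable)

lemma l2ip_scaleR_left: "l2ip (r *\<^sub>R f) h = r * l2ip f h"
  by (simp add: l2ip_def)

lemma l2ip_commute: "l2ip f g = l2ip g f"
  by (simp add: l2ip_def inner_commute)

lemma l2ip_self: "l2ip f f = sobolev_sqnorm 0 UNIV f"
  by (simp add: l2ip_def power2_norm_eq_inner lebesgue_on_UNIV_eq)

lemma l2ip_nonneg: "0 \<le> l2ip f f"
  by (simp add: l2ip_def)

lemma l2ip_cong_AE:
  assumes "AE x in lebesgue. f x = f' x" "AE x in lebesgue. g x = g' x"
  shows "l2ip f g = l2ip f' g'"
  unfolding l2ip_def
proof (rule integral_lebesgue_cong_AE)
  show "AE x in lebesgue. f x \<bullet> g x = f' x \<bullet> g' x" using assms by eventually_elim simp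
qed

lemma l2ip_zero_AE:
  assumes f: "L2 UNIV f" and z: "l2ip f f = 0"
  shows "AE x in lebesgue. f x = 0"
proof -
  have "AE x in lebesgue. (norm (f x))\<^sup>2 = 0"
    using z integral_nonneg_eq_0_iff_AE[of lebesgue "\<lambda>x. (norm (f x))\<^sup>2"] L2_integrable[OF f]
    by (simp add: l2ip_def power2_norm_eq_inner)
  then show ?thesis by (rule eventually_mono) simp
qed

lemma l2_nn_integral:
  assumes f: "L2 UNIV f"
  shows "(\<integral>\<^sup>+x. ennreal ((norm (f x))\<^sup>2) \<partial>lebesgue) = ennreal (l2ip f f)"
  using nn_integral_eq_integral[OF L2_integrable[OF f]] by (simp add: l2ip_def power2_norm_eq_inner)

text \<open>The Riesz-Fischer theorem: a subsequence with geometrically decaying increments converges almost everywhere, and Fatou's lemma makes the limit a limit in \<open>L\<^sup>2\<close>.\<close>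

theorem L2_complete:
  fixes f :: "nat \<Rightarrow> real ^ 'd::finite \<Rightarrow> 'b::euclidean_space"
  assumes f: "\<And>n. L2 UNIV (f n)"
    and C: "\<And>e. 0 < e \<Longrightarrow> \<exists>N. \<forall>m\<ge>N. \<forall>n\<ge>N. l2ip (f m - f n) (f m - f n) < e"
  obtains g where "L2 UNIV g" "(\<lambda>n. l2ip (f n - g) (f n - g)) \<longlonglongrightarrow> 0"
proof -
  have [measurable]: "f n \<in> borel_measurable lebesgue" for n using f by (simp add: L2_UNIV)
  have "\<exists>N. \<forall>m\<ge>N. \<forall>n\<ge>N. l2ip (f m - f n) (f m - f n) < (1/8)^k" for k :: nat by (rule C) simp
  then obtain N where N: "\<And>k m n. N k \<le> m \<Longrightarrow> N k \<le> n \<Longrightarrow> l2ip (f m - f n) (f m - f n) < (1/8)^k" by metis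
  define r where "r k = (\<Sum>i\<le>k. N i) + k" for k
  have rN: "N j \<le> r k" if "j \<le> k" for j k
    using member_le_sum[of j "{..k}" N] that by (simp add: r_def)
  have r_ge: "k \<le> r k" for k by (simp add: r_def)
  define h where "h k = f (r k)" for k
  have [measurable]: "h k \<in> borel_measurable lebesgue" for k by (simp add: h_def)
  define d where "d k x = norm (h (Suc k) x - h k x)" for k x
  have [measurable]: "d k \<in> borel_measurable lebesgue" for k unfolding d_def by measurable
  have dk: "(\<integral>\<^sup>+x. ennreal ((d k x)\<^sup>2) \<partial>lebesgue) \<le> ennreal ((1/8)^k)" for k
  proof -
    have "(\<integral>\<^sup>+x. ennreal ((d k x)\<^sup>2) \<partial>lebesgue) = ennreal (l2ip (h (Suc k) - h k) (h (Suc k) - h k))"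
      using l2_nn_integral[OF L2_diff[OF f f], of "r (Suc k)" "r k"] by (simp add: d_def h_def)
    also have "\<dots> \<le> ennreal ((1/8)^k)"
      unfolding h_def by (intro ennreal_leI less_imp_le[OF N] rN) auto
    finally show ?thesis .
  qed
  have "(\<integral>\<^sup>+x. (\<Sum>k. ennreal (4^k * (d k x)\<^sup>2)) \<partial>lebesgue) = (\<Sum>k. \<integral>\<^sup>+x. ennreal (4^k * (d k x)\<^sup>2) \<partial>lebesgue)"
    by (rule nn_integral_suminf) measurable
  also have "\<dots> \<le> (\<Sum>k. ennreal ((1/2)^k))"
  proof (rule suminf_le)
    fix k
    have "(\<integral>\<^sup>+x. ennreal (4^k * (d k x)\<^sup>2) \<partial>lebesgue) = ennreal (4^k) * (\<integral>\<^sup>+x. ennreal ((d k x)\<^sup>2) \<partial>lebesgue)"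
      by (subst nn_integral_cmult[symmetric]) (auto simp: ennreal_mult)
    also have "\<dots> \<le> ennreal (4^k) * ennreal ((1/8)^k)" by (intro mult_left_mono dk) auto
    also have "\<dots> = ennreal ((1/2)^k)"
      by (subst ennreal_mult[symmetric]) (auto simp: power_mult_distrib[symmetric])
    finally show "(\<integral>\<^sup>+x. ennreal (4^k * (d k x)\<^sup>2) \<partial>lebesgue) \<le> ennreal ((1/2)^k)" .
  qed auto
  also have "\<dots> = ennreal (\<Sum>k. (1/2)^k)" by (rule suminf_ennreal2) (auto intro!: summable_geometric)
  also have "\<dots> < \<infinity>" by simp
  finally have fin: "(\<integral>\<^sup>+x. (\<Sum>k. ennreal (4^k * (d k x)\<^sup>2)) \<partial>lebesgue) \<noteq> \<infinity>" by simp
  have "AE x in lebesgue. (\<Sum>k. ennreal (4^k * (d k x)\<^sup>2)) \<noteq> \<infinity>"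
    by (rule nn_integral_PInf_AE[OF _ fin]) measurable
  then have conv: "AE x in lebesgue. convergent (\<lambda>k. h k x)"
  proof (rule eventually_mono)
    fix x assume a: "(\<Sum>k. ennreal (4^k * (d k x)\<^sup>2)) \<noteq> \<infinity>"
    define F where "F k = ennreal (4^k * (d k x)\<^sup>2)" for k
    define W where "W = enn2real (suminf F)"
    have aF: "suminf F \<noteq> \<infinity>" using a unfolding F_def .
    have "F k \<le> suminf F" for k
      using sum_le_suminf[of F "{k}"] by simp
    also have "suminf F = ennreal W" unfolding W_def using aF
      by (intro ennreal_enn2real[symmetric]) (simp only: top.not_eq_extremum infinity_ennreal_def)
    finally have W: "4^k * (d k x)\<^sup>2 \<le> W" for k
      unfolding F_def using ennreal_le_iff[of W] by (simp add: W_def)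
    have dle: "d k x \<le> sqrt W * (1/2)^k" for k
    proof (rule power2_le_imp_le)
      have W0: "0 \<le> W" by (simp add: W_def)
      have q: "((1/2)^k)\<^sup>2 * 4^k = (1::real)"
        by (simp add: power2_eq_square power_mult_distrib[symmetric])
      have "(d k x)\<^sup>2 = ((1/2)^k)\<^sup>2 * (4^k * (d k x)\<^sup>2)" using q by (simp only: mult.assoc[symmetric] mult_1)
      also have "\<dots> \<le> ((1/2)^k)\<^sup>2 * W" by (intro mult_left_mono W) simp
      also have "\<dots> = (sqrt W * (1/2)^k)\<^sup>2" using W0 by (simp only: power_mult_distrib real_sqrt_pow2 mult.commute)
      finally show "(d k x)\<^sup>2 \<le> (sqrt W * (1/2)^k)\<^sup>2" .
    qed (simp add: W_def)
    have "summable (\<lambda>k. h (Suc k) x - h k x)"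
    proof (rule summable_comparison_test')
      show "summable (\<lambda>k. sqrt W * (1/2)^k)"
        by (intro summable_mult summable_geometric) simp
      show "norm (h (Suc k) x - h k x) \<le> sqrt W * (1/2)^k" for k
        using dle[of k] by (simp add: d_def)
    qed
    then have "convergent (\<lambda>n. \<Sum>k<n. h (Suc k) x - h k x)" by (simp add: summable_iff_convergent)
    then have "convergent (\<lambda>n. h n x - h 0 x)" using sum_lessThan_telescope[of "\<lambda>k. h k x"] by simp
    then have "convergent (\<lambda>n. (h n x - h 0 x) + h 0 x)" by (intro convergent_add convergent_const)
    then show "convergent (\<lambda>k. h k x)" by simp
  qed
  define g where "g x = lim (\<lambda>k. h k x)" for x
  have gm [measurable]: "g \<in> borel_measurable lebesgue"
    unfolding g_def[abs_def] by (rule borel_measurable_lim_metric) simp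
  have lim: "AE x in lebesgue. (\<lambda>k. h k x) \<longlonglongrightarrow> g x"
    using conv by (rule eventually_mono) (simp add: g_def convergent_LIMSEQ_iff)
  have close: "(\<integral>\<^sup>+x. ennreal ((norm (f n x - g x))\<^sup>2) \<partial>lebesgue) \<le> ennreal ((1/8)^j)" if n: "N j \<le> n" for n j
  proof -
    have "(\<integral>\<^sup>+x. ennreal ((norm (f n x - g x))\<^sup>2) \<partial>lebesgue)
        = (\<integral>\<^sup>+x. liminf (\<lambda>k. ennreal ((norm (f n x - h k x))\<^sup>2)) \<partial>lebesgue)"
    proof (rule nn_integral_cong_AE)
      show "AE x in lebesgue. ennreal ((norm (f n x - g x))\<^sup>2) = liminf (\<lambda>k. ennreal ((norm (f n x - h k x))\<^sup>2))"
        using lim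
      proof (rule eventually_mono)
        fix x assume "(\<lambda>k. h k x) \<longlonglongrightarrow> g x"
        then have "(\<lambda>k. ennreal ((norm (f n x - h k x))\<^sup>2)) \<longlonglongrightarrow> ennreal ((norm (f n x - g x))\<^sup>2)"
          by (intro tendsto_intros)
        then show "ennreal ((norm (f n x - g x))\<^sup>2) = liminf (\<lambda>k. ennreal ((norm (f n x - h k x))\<^sup>2))"
          by (intro lim_imp_Liminf[symmetric]) auto
      qed
    qed
    also have "\<dots> \<le> liminf (\<lambda>k. \<integral>\<^sup>+x. ennreal ((norm (f n x - h k x))\<^sup>2) \<partial>lebesgue)"
      by (rule nn_integral_liminf) measurable
    also have "\<dots> \<le> ennreal ((1/8)^j)"
    proof (rule Liminf_le)
      show "\<forall>\<^sub>F k in sequentially. (\<integral>\<^sup>+x. ennreal ((norm (f n x - h k x))\<^sup>2) \<partial>lebesgue) \<le> ennreal ((1/8)^j)"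
        unfolding eventually_sequentially
      proof (intro exI allI impI)
        fix k assume "j \<le> k"
        have "(\<integral>\<^sup>+x. ennreal ((norm (f n x - h k x))\<^sup>2) \<partial>lebesgue) = ennreal (l2ip (f n - h k) (f n - h k))"
          using l2_nn_integral[OF L2_diff[OF f f], of n "r k"] by (simp add: h_def)
        also have "\<dots> \<le> ennreal ((1/8)^j)"
          unfolding h_def using n rN[OF \<open>j \<le> k\<close>] by (intro ennreal_leI less_imp_le[OF N]) auto
        finally show "(\<integral>\<^sup>+x. ennreal ((norm (f n x - h k x))\<^sup>2) \<partial>lebesgue) \<le> ennreal ((1/8)^j)" .
      qed
    qed simp
    finally show ?thesis .
  qed
  have dL2: "L2 UNIV (f n - g)" if "N j \<le> n" for n j
    unfolding L2_UNIV
  proof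
    have m: "(\<lambda>x. f n x - g x) \<in> borel_measurable lebesgue" by measurable
    then show "f n - g \<in> borel_measurable lebesgue" by (simp add: fun_diff_def)
    have "(\<integral>\<^sup>+x. ennreal ((norm (f n x - g x))\<^sup>2) \<partial>lebesgue) < \<infinity>"
      using close[OF that] by (rule order_le_less_trans) simp
    then show "integrable lebesgue (\<lambda>x. (norm ((f n - g) x))\<^sup>2)"
      using m by (intro integrableI_nonneg) auto
  qed
  have "f (N 0) - (f (N 0) - g) = g" by simp
  then have gL2: "L2 UNIV g" using L2_diff[OF f dL2[OF order_refl], of "N 0" 0] by simp
  have "(\<lambda>n. l2ip (f n - g) (f n - g)) \<longlonglongrightarrow> 0"
  proof (rule LIMSEQ_I)
    fix e :: real assume "0 < e"
    then obtain j :: nat where j: "(1/8)^j < e" using real_arch_pow_inv[of e "1/8"] by auto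
    have "l2ip (f n - g) (f n - g) \<le> (1/8)^j" if "N j \<le> n" for n
    proof -
      have "ennreal (l2ip (f n - g) (f n - g)) \<le> ennreal ((1/8)^j)"
        using close[OF that] l2_nn_integral[OF dL2[OF that]] by simp
      then show ?thesis by (simp add: ennreal_le_iff)
    qed
    then show "\<exists>no. \<forall>n\<ge>no. norm (l2ip (f n - g) (f n - g) - 0) < e"
    proof (intro exI[of _ "N j"] allI impI)
      fix n assume "N j \<le> n"
      then have "l2ip (f n - g) (f n - g) < e" using j \<open>\<And>n. N j \<le> n \<Longrightarrow> l2ip (f n - g) (f n - g) \<le> (1/8)^j\<close> by force
      then show "norm (l2ip (f n - g) (f n - g) - 0) < e" by (simp add: l2ip_nonneg)
    qed
  qed
  then show ?thesis using that gL2 by blast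
qed

section \<open>Smooth functions and test functions\<close>

lemma pd_has_derivative: "(f has_derivative f') (at x) \<Longrightarrow> pd j f x = f' (axis j 1)"
  unfolding pd_def by (metis frechet_derivative_at)

lemma Ck_Suc_D: "Ck (Suc n) f \<Longrightarrow> Ck n f"
proof (induction n arbitrary: f)
  case 0
  then have "f differentiable_on UNIV" by (simp add: differentiable_on_def)
  then show ?case by (simp add: differentiable_imp_continuous_on)
next
  case (Suc n)
  then show ?case using Suc.IH[of "pd _ f"] by (simp only: Ck.simps(2)) blast
qed

lemma Ck_differentiable: "Ck (Suc n) f \<Longrightarrow> f differentiable (at x)"
  and Ck_pd: "Ck (Suc n) f \<Longrightarrow> Ck n (pd j f)"
  by simp_all

lemma Ck_continuous: "Ck n f \<Longrightarrow> continuous_on UNIV f"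
proof (induction n)
  case (Suc n)
  then show ?case using Ck_Suc_D by blast
qed simp

lemma pd_zero: "pd j (\<lambda>x. 0) = (\<lambda>x. 0)"
  by (rule ext) (simp add: pd_has_derivative[OF has_derivative_const])

lemma Ck_zero: "Ck n (\<lambda>x. 0)"
  by (induction n) (auto simp: pd_zero)

lemma Ck_const: "Ck n (\<lambda>x::real ^ 'd::finite. c)"
proof (cases n)
  case (Suc m)
  have "pd j (\<lambda>x::real ^ 'd. c) = (\<lambda>x. 0)" for j
    by (rule ext) (simp add: pd_has_derivative[OF has_derivative_const])
  then show ?thesis using Suc by (simp add: Ck_zero)
qed simp

lemma pd_add:
  assumes "f differentiable (at x)" "g differentiable (at x)"
  shows "pd j (\<lambda>x. f x + g x) x = pd j f x + pd j g x"
  using assms[unfolded frechet_derivative_works] unfolding pd_def[of j f] pd_def[of j g]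
  by (subst pd_has_derivative[OF has_derivative_add]) auto

lemma Ck_add: "Ck n f \<Longrightarrow> Ck n g \<Longrightarrow> Ck n (\<lambda>x. f x + g x)"
proof (induction n arbitrary: f g)
  case (Suc n)
  have "pd j (\<lambda>x. f x + g x) = (\<lambda>x. pd j f x + pd j g x)" for j
    by (rule ext, rule pd_add) (use Suc.prems in auto)
  then show ?case using Suc by (auto intro: differentiable_add)
qed (auto intro: continuous_intros)

lemma pd_bounded_linear:
  assumes "bounded_linear h" "f differentiable (at x)"
  shows "pd j (\<lambda>x. h (f x)) x = h (pd j f x)"
  using assms(2)[unfolded frechet_derivative_works] unfolding pd_def[of j f]
  by (subst pd_has_derivative[OF bounded_linear.has_derivative[OF assms(1)]]) auto

lemma Ck_bounded_linear: "bounded_linear h \<Longrightarrow> Ck n f \<Longrightarrow> Ck n (\<lambda>x. h (f x))"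
proof (induction n arbitrary: f)
  case 0
  then show ?case by (simp add: bounded_linear.continuous_on)
next
  case (Suc n)
  have "pd j (\<lambda>x. h (f x)) = (\<lambda>x. h (pd j f x))" for j
    by (rule ext, rule pd_bounded_linear) (use Suc.prems in auto)
  moreover have "(\<lambda>x. h (f x)) differentiable at x" for x
    using Suc.prems differentiable_chain_at[of f x h] bounded_linear_imp_differentiable[of h]
    by (simp add: o_def)
  ultimately show ?case using Suc by auto
qed

lemma pd_scaleR:
  assumes "f differentiable (at x)" "g differentiable (at x)"
  shows "pd j (\<lambda>x. f x *\<^sub>R g x) x = pd j f x *\<^sub>R g x + f x *\<^sub>R pd j g x"
  using assms[unfolded frechet_derivative_works] unfolding pd_def[of j f] pd_def[of j g]
  by (subst pd_has_derivative[OF has_derivative_scaleR]) (auto simp: add.commute)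

lemma Ck_scaleR:
  fixes f :: "real ^ 'd::finite \<Rightarrow> real"
  shows "Ck n f \<Longrightarrow> Ck n g \<Longrightarrow> Ck n (\<lambda>x. f x *\<^sub>R g x)"
proof (induction n arbitrary: f g)
  case (Suc n)
  have "pd j (\<lambda>x. f x *\<^sub>R g x) = (\<lambda>x. pd j f x *\<^sub>R g x + f x *\<^sub>R pd j g x)" for j
    by (rule ext, rule pd_scaleR) (use Suc.prems in auto)
  moreover have "Ck n (\<lambda>x. pd j f x *\<^sub>R g x + f x *\<^sub>R pd j g x)" for j
    using Suc.prems Ck_Suc_D[OF Suc.prems(1)] Ck_Suc_D[OF Suc.prems(2)] by (intro Ck_add Suc.IH) auto
  ultimately show ?case using Suc.prems by (auto intro: differentiable_scaleR)
qed (auto intro: continuous_intros)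

lemma pd_affine:
  assumes "f differentiable (at (r *\<^sub>R x + a))"
  shows "pd j (\<lambda>x. f (r *\<^sub>R x + a)) x = r *\<^sub>R pd j f (r *\<^sub>R x + a)"
proof -
  have d: "(f has_derivative frechet_derivative f (at (r *\<^sub>R x + a))) (at (r *\<^sub>R x + a))"
    using assms by (simp add: frechet_derivative_works)
  have "((\<lambda>x. r *\<^sub>R x + a) has_derivative (\<lambda>h. r *\<^sub>R h)) (at x)"
    by (auto intro!: derivative_eq_intros)
  from has_derivative_compose[OF this d]
  have "((\<lambda>x. f (r *\<^sub>R x + a)) has_derivative (\<lambda>h. frechet_derivative f (at (r *\<^sub>R x + a)) (r *\<^sub>R h))) (at x)" .
  from pd_has_derivative[OF this, of j] show ?thesis
    unfolding pd_def[of j f] by (simp add: linear_scale[OF has_derivative_linear[OF d]])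
qed

lemma Ck_affine: "Ck n f \<Longrightarrow> Ck n (\<lambda>x. f (r *\<^sub>R x + a))"
proof (induction n arbitrary: f)
  case 0
  have "continuous_on UNIV (\<lambda>x. f (r *\<^sub>R x + a))"
  proof (rule continuous_on_compose2[where g = f and t = UNIV])
    show "continuous_on UNIV f" using 0 by simp
    show "continuous_on UNIV (\<lambda>x. r *\<^sub>R x + a)" by (intro continuous_intros)
  qed simp
  then show ?case by simp
next
  case (Suc n)
  have "pd j (\<lambda>x. f (r *\<^sub>R x + a)) = (\<lambda>x. r *\<^sub>R pd j f (r *\<^sub>R x + a))" for j
    by (rule ext, rule pd_affine) (use Suc.prems in auto)
  moreover have "Ck n (\<lambda>x. r *\<^sub>R pd j f (r *\<^sub>R x + a))" for j
    using Suc by (intro Ck_bounded_linear[OF bounded_linear_scaleR_right] Suc.IH) auto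
  moreover have "(\<lambda>x. f (r *\<^sub>R x + a)) differentiable at x" for x
  proof -
    have "(\<lambda>x. r *\<^sub>R x + a) differentiable at x"
      by (intro differentiable_add differentiable_const differentiable_scaleR differentiable_ident)
    then show ?thesis
      using Suc.prems differentiable_chain_at[of "\<lambda>x. r *\<^sub>R x + a" x f] by (simp add: o_def)
  qed
  ultimately show ?case by simp
qed

lemma Ck_component_chain:
  fixes g :: "nat \<Rightarrow> real \<Rightarrow> real"
  assumes g: "\<And>k x. (g k has_real_derivative g (Suc k) x) (at x)"
  shows "Ck n (\<lambda>x::real ^ 'd::finite. g k (x $ i))"
proof (induction n arbitrary: k)
  case 0
  have "continuous_on UNIV (g k)"
    using g DERIV_isCont by (blast intro: continuous_at_imp_continuous_on)
  then have "continuous_on UNIV (\<lambda>x::real ^ 'd. g k (x $ i))"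
    by (rule continuous_on_compose2) (auto intro: continuous_intros)
  then show ?case by simp
next
  case (Suc n)
  have d: "((\<lambda>x::real ^ 'd. g k (x $ i)) has_derivative (\<lambda>h. g (Suc k) (x $ i) * (h $ i))) (at x)" for x
    using has_derivative_compose[OF bounded_linear_imp_has_derivative[OF bounded_linear_vec_nth]
      g[unfolded has_field_derivative_def]] .
  have "pd j (\<lambda>x::real ^ 'd. g k (x $ i)) = (\<lambda>x. axis j 1 $ i *\<^sub>R g (Suc k) (x $ i))" for j
    by (rule ext) (simp add: pd_has_derivative[OF d] mult.commute)
  then show ?case using Suc d by (auto simp: differentiable_def intro!: Ck_bounded_linear[OF bounded_linear_mult_right] Suc)
qed

lemma Ck_mult:
  fixes f g :: "real ^ 'd::finite \<Rightarrow> real"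
  shows "Ck n f \<Longrightarrow> Ck n g \<Longrightarrow> Ck n (\<lambda>x. f x * g x)"
  using Ck_scaleR[of n f g] by simp

lemma Ck_prod:
  fixes f :: "'i \<Rightarrow> real ^ 'd::finite \<Rightarrow> real"
  assumes "finite A" "\<And>i. i \<in> A \<Longrightarrow> Ck n (f i)"
  shows "Ck n (\<lambda>x. \<Prod>i\<in>A. f i x)"
  using assms by (induction A rule: finite_induct) (auto simp: Ck_const intro: Ck_mult)

lemma smooth_continuous: "smooth f \<Longrightarrow> continuous_on UNIV f"
  by (meson Ck_continuous smooth_def)

lemma smooth_differentiable: "smooth f \<Longrightarrow> f differentiable (at x)"
  unfolding smooth_def by (meson Ck_differentiable)

lemma smooth_pd: "smooth f \<Longrightarrow> smooth (pd j f)"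
  unfolding smooth_def by (meson Ck_pd)

lemma continuous_lebesgue_measurable:
  fixes f :: "'a::euclidean_space \<Rightarrow> 'b::euclidean_space"
  shows "continuous_on UNIV f \<Longrightarrow> f \<in> borel_measurable lebesgue"
  by (intro measurable_completion) (simp add: borel_measurable_continuous_onI)

lemma smooth_measurable:
  fixes f :: "real ^ 'd::finite \<Rightarrow> 'b::euclidean_space"
  shows "smooth f \<Longrightarrow> f \<in> borel_measurable lebesgue"
  by (intro continuous_lebesgue_measurable smooth_continuous)

lemma test_fun_iff: "test_fun UNIV \<phi> \<longleftrightarrow> smooth \<phi> \<and> bounded {x. \<phi> x \<noteq> 0}"
  by (simp add: test_fun_def compact_closure)

lemma test_fun_smooth: "test_fun UNIV \<phi> \<Longrightarrow> smooth \<phi>"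
  and test_fun_support: "test_fun UNIV \<phi> \<Longrightarrow> bounded {x. \<phi> x \<noteq> 0}"
  by (simp_all add: test_fun_iff)

lemma test_fun_supportE:
  assumes "test_fun UNIV \<phi>"
  obtains R where "0 < R" "\<And>x. R < norm x \<Longrightarrow> \<phi> x = 0"
  using test_fun_support[OF assms] unfolding bounded_pos
  by (metis (mono_tags, lifting) mem_Collect_eq not_le)

lemma pd_eq_0_outside:
  assumes "\<And>x. R < norm x \<Longrightarrow> f x = 0" "R < norm x"
  shows "pd j f x = 0"
proof -
  have "(f has_derivative (\<lambda>h. 0)) (at x)"
  proof (rule has_derivative_transform_within_open[OF has_derivative_const[of 0]])
    show "open {x. R < norm x}" by (intro open_Collect_less continuous_intros)
  qed (use assms in auto)
  then show ?thesis by (rule pd_has_derivative)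
qed

lemma test_fun_pd: assumes t: "test_fun UNIV \<phi>" shows "test_fun UNIV (pd j \<phi>)"
proof -
  obtain R where "0 < R" "\<And>x. R < norm x \<Longrightarrow> \<phi> x = 0" using test_fun_supportE[OF t] by blast
  then have "pd j \<phi> x = 0" if "R < norm x" for x using pd_eq_0_outside that by blast
  then have "{x. pd j \<phi> x \<noteq> 0} \<subseteq> cball 0 R" by (auto intro!: leI)
  then have "bounded {x. pd j \<phi> x \<noteq> 0}" by (rule bounded_subset[OF bounded_cball])
  then show ?thesis using t by (simp add: test_fun_iff smooth_pd)
qed

lemma test_fun_scaleR:
  fixes \<phi> :: "real ^ 'd::finite \<Rightarrow> real" and f :: "real ^ 'd \<Rightarrow> 'b::real_normed_vector"
  assumes "test_fun UNIV \<phi>" "smooth f"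
  shows "test_fun UNIV (\<lambda>x. \<phi> x *\<^sub>R f x)"
  using assms unfolding test_fun_iff smooth_def
  by (auto intro: Ck_scaleR bounded_subset[of "{x. \<phi> x \<noteq> 0}"])

lemma test_fun_bounded_linear:
  assumes h: "bounded_linear h" and t: "test_fun UNIV \<phi>" shows "test_fun UNIV (\<lambda>x. h (\<phi> x))"
proof -
  have "{x. h (\<phi> x) \<noteq> 0} \<subseteq> {x. \<phi> x \<noteq> 0}" using linear_0[OF bounded_linear.linear[OF h]] by auto
  then show ?thesis
    using t h bounded_subset unfolding test_fun_iff smooth_def by (auto intro: Ck_bounded_linear)
qed

lemma test_fun_component: "test_fun UNIV \<phi> \<Longrightarrow> test_fun UNIV (\<lambda>x. \<phi> x $ i)"
  by (rule test_fun_bounded_linear[OF bounded_linear_vec_nth])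

lemma test_fun_add: "test_fun UNIV \<phi> \<Longrightarrow> test_fun UNIV \<psi> \<Longrightarrow> test_fun UNIV (\<lambda>x. \<phi> x + \<psi> x)"
  unfolding test_fun_iff smooth_def
  by (auto intro: Ck_add bounded_subset[of "{x. \<phi> x \<noteq> 0} \<union> {x. \<psi> x \<noteq> 0}"])

lemma test_fun_affine:
  assumes "test_fun UNIV \<phi>" "r \<noteq> 0" shows "test_fun UNIV (\<lambda>x. \<phi> (r *\<^sub>R x + a))"
proof -
  obtain R where R: "0 < R" "\<And>x. R < norm x \<Longrightarrow> \<phi> x = 0" using test_fun_supportE[OF assms(1)] by blast
  have "norm x \<le> (R + norm a) / \<bar>r\<bar>" if "\<phi> (r *\<^sub>R x + a) \<noteq> 0" for x
  proof -
    have "norm (r *\<^sub>R x + a) \<le> R" using R that not_le by blast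
    then have "norm (r *\<^sub>R x) \<le> R + norm a" using norm_triangle_ineq4[of "r *\<^sub>R x + a" a] by simp
    then show ?thesis using assms(2) by (simp add: field_simps)
  qed
  then have "bounded {x. \<phi> (r *\<^sub>R x + a) \<noteq> 0}" by (auto simp: bounded_iff)
  then show ?thesis using assms(1) by (auto simp: test_fun_iff smooth_def intro: Ck_affine)
qed

lemma test_fun_norm_bound:
  assumes "test_fun UNIV \<phi>"
  obtains K where "0 < K" "\<And>x. norm (\<phi> x) \<le> K"
proof -
  have "compact (\<phi> ` closure {x. \<phi> x \<noteq> 0})"
    using assms by (intro compact_continuous_image continuous_on_subset[OF smooth_continuous])
      (auto simp: test_fun_def)
  then obtain K where K: "0 < K" "\<And>y. y \<in> \<phi> ` closure {x. \<phi> x \<noteq> 0} \<Longrightarrow> norm y \<le> K"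
    using compact_imp_bounded bounded_pos by metis
  have "norm (\<phi> x) \<le> K" for x
  proof (cases "\<phi> x = 0")
    case False
    then have "x \<in> closure {x. \<phi> x \<noteq> 0}" by (intro subsetD[OF closure_subset]) simp
    then show ?thesis using K(2) by blast
  qed (use K in simp)
  then show ?thesis using that K(1) by blast
qed

lemma bounded_support_integrable:
  fixes f :: "real ^ 'd::finite \<Rightarrow> 'b::euclidean_space"
  assumes m: "f \<in> borel_measurable lebesgue" and K: "\<And>x. norm (f x) \<le> K"
    and R: "\<And>x. R < norm x \<Longrightarrow> f x = 0"
  shows "integrable lebesgue f"
proof (rule Bochner_Integration.integrable_bound[OF _ m])
  show "integrable lebesgue (\<lambda>x. K * indicator (cball (0::real ^ 'd) R) x :: real)"
    using lmeasurable_cball[of "0::real ^ 'd" R]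
    by (intro integrable_mult_right integrable_real_indicator) (auto simp: fmeasurable_def)
  show "AE x in lebesgue. norm (f x) \<le> norm (K * indicator (cball (0::real ^ 'd) R) x :: real)"
  proof (rule AE_I2)
    fix x
    have "0 \<le> K" using K[of x] norm_ge_zero order_trans by blast
    then show "norm (f x) \<le> norm (K * indicator (cball (0::real ^ 'd) R) x :: real)"
      using K[of x] R[of x] by (auto simp: indicator_def abs_mult not_le)
  qed
qed

lemma test_fun_measurable:
  fixes \<phi> :: "real ^ 'd::finite \<Rightarrow> 'b::euclidean_space"
  shows "test_fun UNIV \<phi> \<Longrightarrow> \<phi> \<in> borel_measurable lebesgue"
  by (intro smooth_measurable test_fun_smooth)

lemma test_fun_integrable:
  fixes \<phi> :: "real ^ 'd::finite \<Rightarrow> 'b::euclidean_space"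
  assumes t: "test_fun UNIV \<phi>" shows "integrable lebesgue \<phi>"
proof -
  obtain R where "\<And>x. R < norm x \<Longrightarrow> \<phi> x = 0" using test_fun_supportE[OF t] by blast
  moreover obtain K where "\<And>x. norm (\<phi> x) \<le> K" using test_fun_norm_bound[OF t] by blast
  ultimately show ?thesis by (intro bounded_support_integrable test_fun_measurable[OF t])
qed

lemma test_fun_L2:
  fixes \<phi> :: "real ^ 'd::finite \<Rightarrow> 'b::euclidean_space"
  assumes t: "test_fun UNIV \<phi>" shows "L2 UNIV \<phi>"
  unfolding L2_UNIV
proof
  obtain R where R: "\<And>x. R < norm x \<Longrightarrow> \<phi> x = 0" using test_fun_supportE[OF t] by blast
  obtain K where K: "\<And>x. norm (\<phi> x) \<le> K" using test_fun_norm_bound[OF t] by blast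
  show "integrable lebesgue (\<lambda>x. (norm (\<phi> x))\<^sup>2)"
  proof (rule bounded_support_integrable)
    show "(\<lambda>x. (norm (\<phi> x))\<^sup>2) \<in> borel_measurable lebesgue" using test_fun_measurable[OF t] by measurable
    show "norm ((norm (\<phi> x))\<^sup>2) \<le> K\<^sup>2" for x using K[of x] by (simp add: power_mono)
  qed (use R in auto)
qed (rule test_fun_measurable[OF t])

subsection \<open>Bump functions\<close>

lemma poly_exp_tendsto_0: "((\<lambda>y. poly p y * exp (- y)) \<longlongrightarrow> (0::real)) at_top"
proof -
  have "((\<lambda>y. y ^ k * poly p y * exp (- y)) \<longlongrightarrow> (0::real)) at_top" for k
  proof (induction p arbitrary: k)
    case (pCons a p)
    have "((\<lambda>y. a * (y ^ k / exp y) + y ^ Suc k * poly p y * exp (- y)) \<longlongrightarrow> a * 0 + 0) at_top"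
      by (intro tendsto_intros tendsto_power_div_exp_0 pCons.IH)
    then show ?case by (simp add: algebra_simps exp_minus divide_inverse)
  qed simp
  from this[of 0] show ?thesis by simp
qed

text \<open>Closed under differentiation (\<open>expo_derivative\<close>), which gives smoothness of \<open>exp (- 1 / x)\<close> extended by zero.\<close>

definition expo :: "real poly \<Rightarrow> real \<Rightarrow> real" where
  "expo p x = (if 0 < x then poly p (1 / x) * exp (- (1 / x)) else 0)"

lemma expo_derivative: "(expo p has_real_derivative expo ([:0, 0, 1:] * (p - pderiv p)) x) (at x)"
proof (cases x "0::real" rule: linorder_cases)
  case greater
  have "((\<lambda>x. poly p (1 / x) * exp (- (1 / x))) has_real_derivative
      expo ([:0, 0, 1:] * (p - pderiv p)) x) (at x)"
    using greater unfolding expo_def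
    by (auto intro!: derivative_eq_intros DERIV_chain2[OF poly_DERIV] simp: field_simps power2_eq_square)
  then show ?thesis
    by (rule DERIV_cong_ev[THEN iffD1, rotated -1])
      (use greater in \<open>auto simp: expo_def intro!: eventually_mono[OF eventually_gt_at_top]
        eventually_nhds_in_open[of "{0<..}" x, THEN eventually_mono]\<close>)
next
  case less
  have "((\<lambda>x. 0) has_real_derivative expo ([:0, 0, 1:] * (p - pderiv p)) x) (at x)"
    using less by (simp add: expo_def)
  then show ?thesis
    by (rule DERIV_cong_ev[THEN iffD1, rotated -1])
      (use less in \<open>auto simp: expo_def intro!: eventually_nhds_in_open[of "{..<0}" x, THEN eventually_mono]\<close>)
next
  case equal
  have r: "((\<lambda>h. expo p h / h) \<longlongrightarrow> 0) (at_right 0)"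
  proof -
    have "((\<lambda>h. poly (pCons 0 p) (inverse h) * exp (- inverse h)) \<longlongrightarrow> 0) (at_right (0::real))"
      by (rule filterlim_compose[OF poly_exp_tendsto_0 filterlim_inverse_at_top_right])
    then show ?thesis
      by (rule Lim_transform_eventually) (auto simp: expo_def field_simps eventually_at_right_less
        intro!: eventually_at_right_less[THEN eventually_mono])
  qed
  have l: "((\<lambda>h. expo p h / h) \<longlongrightarrow> 0) (at_left 0)"
    by (rule Lim_transform_eventually[OF tendsto_const])
      (auto simp: expo_def eventually_at_left_field intro: exI[of _ "-1"])
  from l r have "((\<lambda>h. expo p h / h) \<longlongrightarrow> 0) (at 0)" by (simp add: filterlim_at_split)
  then show ?thesis using equal by (simp add: has_field_derivative_iff expo_def)
qed

definition bump :: "real \<Rightarrow> real" where "bump = expo 1"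

lemma bump_eq: "bump x = (if 0 < x then exp (- (1 / x)) else 0)"
  by (simp add: bump_def expo_def)

lemma bump_bounds: "0 \<le> bump x" "bump x \<le> 1" "bump x \<noteq> 0 \<longleftrightarrow> 0 < x"
  by (auto simp: bump_eq)

lemma Ck_bump_component: "Ck n (\<lambda>x::real ^ 'd::finite. bump (x $ i))"
proof -
  define g where "g k = expo (((\<lambda>p. [:0, 0, 1:] * (p - pderiv p)) ^^ k) 1)" for k
  have "Ck n (\<lambda>x::real ^ 'd. g 0 (x $ i))"
    by (rule Ck_component_chain) (unfold g_def funpow.simps o_apply, rule expo_derivative)
  then show ?thesis by (simp add: g_def bump_def)
qed

text \<open>Test functions that tend to the indicator of the box as \<open>s\<close> tends to infinity.\<close>

definition box_bump :: "real \<Rightarrow> real ^ 'd::finite \<Rightarrow> real ^ 'd \<Rightarrow> real ^ 'd \<Rightarrow> real" where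
  "box_bump s a b x = (\<Prod>i\<in>UNIV. bump (s * (x $ i - a $ i)) * bump (s * (b $ i - x $ i)))"

lemma box_bump_bounds: "0 \<le> box_bump s a b x" "box_bump s a b x \<le> 1"
  unfolding box_bump_def
  by (auto intro!: prod_nonneg prod_le_1 mult_le_one simp: bump_bounds)

lemma box_bump_nonzero: "0 < s \<Longrightarrow> box_bump s a b x \<noteq> 0 \<longleftrightarrow> x \<in> box a b"
  unfolding box_bump_def by (auto simp: mem_box_cart bump_bounds zero_less_mult_iff)

lemma box_bump_test_fun: assumes s: "0 < s" shows "test_fun UNIV (box_bump s a b)"
proof -
  have 1: "Ck n (\<lambda>x::real ^ 'a. bump (s * (x $ i - a $ i)))" for n i
    using Ck_affine[OF Ck_bump_component[of n i], of s "- (s *\<^sub>R a)"] by (simp add: algebra_simps)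
  have 2: "Ck n (\<lambda>x::real ^ 'a. bump (s * (b $ i - x $ i)))" for n i
    using Ck_affine[OF Ck_bump_component[of n i], of "-s" "s *\<^sub>R b"] by (simp add: algebra_simps)
  have "smooth (box_bump s a b)" unfolding smooth_def box_bump_def
    by (intro allI Ck_prod Ck_mult 1 2) auto
  moreover have "{x. box_bump s a b x \<noteq> 0} = box a b" using box_bump_nonzero[OF s] by auto
  ultimately show ?thesis by (simp add: test_fun_iff bounded_box)
qed

lemma bump_scaled_tendsto: "(\<lambda>n. bump (real (Suc n) * x)) \<longlonglongrightarrow> (if 0 < x then 1 else 0)"
proof (cases "0 < x")
  case True
  have "(\<lambda>n. exp (- (inverse (real (Suc n)) * (1 / x)))) \<longlonglongrightarrow> exp (- (0 * (1 / x)))"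
    by (intro tendsto_intros LIMSEQ_inverse_real_of_nat)
  then show ?thesis using True by (simp add: bump_eq divide_inverse mult.commute)
next
  case False
  then have "bump (real (Suc n) * x) = 0" for n by (simp add: bump_eq zero_less_mult_iff)
  then show ?thesis using False by simp
qed

lemma box_bump_tendsto: "(\<lambda>n. box_bump (real (Suc n)) a b x) \<longlonglongrightarrow> indicator (box a b) x"
proof -
  have "(\<lambda>n. box_bump (real (Suc n)) a b x) \<longlonglongrightarrow>
    (\<Prod>i\<in>UNIV. (if 0 < x $ i - a $ i then 1 else 0) * (if 0 < b $ i - x $ i then 1 else 0))"
    unfolding box_bump_def by (intro tendsto_prod tendsto_mult bump_scaled_tendsto)
  also have "(\<Prod>i\<in>UNIV. (if 0 < x $ i - a $ i then 1 else 0) * (if 0 < b $ i - x $ i then 1 else 0)) = (indicator (box a b) x :: real)"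
  proof (cases "x \<in> box a b")
    case True
    then show ?thesis by (simp add: mem_box_cart)
  next
    case False
    then obtain i where "\<not> (a $ i < x $ i \<and> x $ i < b $ i)" by (auto simp: mem_box_cart)
    then have "(if 0 < x $ i - a $ i then 1 else 0) * (if 0 < b $ i - x $ i then 1 else 0) = (0::real)" by auto
    then show ?thesis using False by (simp, intro exI[of _ i]) auto
  qed
  finally show ?thesis .
qed

section \<open>The fundamental lemma and weak derivatives\<close>

text \<open>Boxes form a generator, stable under intersection, of the Borel sets.\<close>

lemma integral_boxes_zero_imp_AE_zero:
  fixes g :: "real ^ 'd::finite \<Rightarrow> 'b::euclidean_space"
  assumes m: "g \<in> borel_measurable lebesgue"
    and int: "\<And>R. integrable lebesgue (\<lambda>x. indicator (cball 0 R) x *\<^sub>R g x)"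
    and zero: "\<And>a b. (\<integral>x. indicator (box a b) x *\<^sub>R g x \<partial>lebesgue) = 0"
  shows "AE x in lebesgue. g x = 0"
proof -
  obtain g' where g' [measurable]: "g' \<in> borel_measurable borel" and gg: "AE x in lebesgue. g x = g' x"
    using borel_representative[OF m] by blast
  define B where "B n = box (- (real n *\<^sub>R One)) (real n *\<^sub>R (One :: real ^ 'd))" for n
  have "AE x in lborel. indicator (B n) x *\<^sub>R g' x = 0" for n
  proof (rule sigma_finite_measure.density_zero[OF sigma_finite_lborel])
    define h where "h x = indicator (B n) x *\<^sub>R g' x" for x
    have [measurable]: "B n \<in> sets borel" by (simp add: B_def)
    have hm [measurable]: "h \<in> borel_measurable borel" unfolding h_def by measurable
    obtain R where R: "B n \<subseteq> cball 0 R" using bounded_box unfolding B_def bounded_iff by (meson mem_cball_0 subsetI)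
    have AEh: "AE x in lebesgue. indicator (B n) x *\<^sub>R (indicator (cball 0 R) x *\<^sub>R g x) = h x"
      using gg R by (elim eventually_mono) (auto simp: h_def indicator_def)
    have "integrable lebesgue (\<lambda>x. indicator (B n) x *\<^sub>R (indicator (cball 0 R) x *\<^sub>R g x))"
      by (intro integrable_mult_indicator int) simp
    then have "integrable lebesgue h"
      by (rule Bochner_Integration.integrable_cong_AE_imp) (use AEh in \<open>auto intro: measurable_completion elim: eventually_mono\<close>)
    then show hi: "integrable lborel h" by (simp add: integrable_completion)
    have hbox: "(\<integral>x. indicator (box a b) x *\<^sub>R h x \<partial>lborel) = 0" for a b
    proof -
      obtain c d where cd: "box a b \<inter> B n = box c d" unfolding B_def box_Int_box by blast
      have "(\<integral>x. indicator (box a b) x *\<^sub>R h x \<partial>lborel) = (\<integral>x. indicator (box c d) x *\<^sub>R g' x \<partial>lborel)"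
        by (rule Bochner_Integration.integral_cong) (auto simp: h_def cd[symmetric] indicator_def)
      also have "\<dots> = (\<integral>x. indicator (box c d) x *\<^sub>R g' x \<partial>lebesgue)"
        by (rule integral_completion[symmetric]) measurable
      also have "\<dots> = (\<integral>x. indicator (box c d) x *\<^sub>R g x \<partial>lebesgue)"
        by (rule integral_lebesgue_cong_AE) (use gg in \<open>auto elim: eventually_mono\<close>)
      finally show ?thesis by (simp add: zero)
    qed
    have hB: "indicator (B n) x *\<^sub>R h x = h x" for x by (simp add: h_def indicator_def)
    have tot: "(\<integral>x. h x \<partial>lborel) = 0"
      using hbox[of "- (real n *\<^sub>R One)" "real n *\<^sub>R One"] hB by (simp add: B_def)
    fix A :: "(real ^ 'd) set" assume "A \<in> sets lborel"
    then have A: "A \<in> sigma_sets UNIV (range (\<lambda>(a, b). box a b))" by (simp add: borel_eq_box)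
    have stable: "Int_stable (range (\<lambda>(a, b). box a b :: (real ^ 'd) set))"
      by (auto simp: Int_stable_def box_Int_box)
    have sub: "range (\<lambda>(a, b). box a b :: (real ^ 'd) set) \<subseteq> Pow UNIV" by simp
    from stable sub A show "set_lebesgue_integral lborel A h = 0"
    proof (induction A rule: sigma_sets_induct_disjoint)
      case (basic A)
      then show ?case by (auto simp: set_lebesgue_integral_def hbox)
    next
      case empty
      show ?case by (simp add: set_lebesgue_integral_def)
    next
      case (compl A)
      then have [measurable]: "A \<in> sets borel" by (simp add: borel_eq_box)
      have "(\<integral>x. indicator (UNIV - A) x *\<^sub>R h x \<partial>lborel) = (\<integral>x. h x - indicator A x *\<^sub>R h x \<partial>lborel)"
        by (rule Bochner_Integration.integral_cong) (auto simp: indicator_def)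
      also have "\<dots> = (\<integral>x. h x \<partial>lborel) - (\<integral>x. indicator A x *\<^sub>R h x \<partial>lborel)"
        by (intro Bochner_Integration.integral_diff hi integrable_mult_indicator) auto
      finally show ?case using compl tot by (simp add: set_lebesgue_integral_def)
    next
      case (union A)
      have A: "A i \<in> sets borel" for i using union(2) by (auto simp: borel_eq_box)
      have "set_lebesgue_integral lborel (\<Union>i. A i) h = (\<Sum>i. set_lebesgue_integral lborel (A i) h)"
      proof (rule lebesgue_integral_countable_add)
        show "A i \<in> sets lborel" for i using A by simp
        show "A i \<inter> A j = {}" if "i \<noteq> j" for i j using union(1) that by (auto simp: disjoint_family_on_def)
        show "set_integrable lborel (\<Union>i. A i) h"
          unfolding set_integrable_def using A by (intro integrable_mult_indicator hi) auto
      qed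
      then show ?case using union(3) by simp
    qed
  qed
  then have "AE x in lborel. \<forall>n::nat. indicator (B n) x *\<^sub>R g' x = 0" unfolding AE_all_countable by blast
  then have "AE x in lborel. g' x = 0"
  proof (rule eventually_mono)
    fix x assume a: "\<forall>n. indicator (B n) x *\<^sub>R g' x = 0"
    obtain n :: nat where n: "norm x < real n" using reals_Archimedean2 by blast
    have "x \<in> B n" unfolding B_def mem_box
    proof
      fix i :: "real ^ 'd" assume i: "i \<in> Basis"
      have "\<bar>x \<bullet> i\<bar> < real n" using Basis_le_norm[OF i, of x] n by linarith
      then show "- (real n *\<^sub>R One) \<bullet> i < x \<bullet> i \<and> x \<bullet> i < (real n *\<^sub>R One) \<bullet> i" using i by (auto simp: abs_less_iff)
    qed
    then show "g' x = 0" using a[rule_format, of n] by simp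
  qed
  then have "AE x in lebesgue. g' x = 0" by (rule AE_completion)
  with gg show ?thesis by eventually_elim simp
qed

lemma indicator_cball_L2: "L2 UNIV (indicator (cball (0::real ^ 'd::finite) R) :: _ \<Rightarrow> real)"
  unfolding L2_UNIV
proof
  show m: "(indicator (cball (0::real ^ 'd) R) :: _ \<Rightarrow> real) \<in> borel_measurable lebesgue"
    using lmeasurable_cball[of "0::real ^ 'd" R] by (intro borel_measurable_indicator) (auto simp: fmeasurable_def)
  have "integrable lebesgue (indicator (cball (0::real ^ 'd) R) :: _ \<Rightarrow> real)"
    by (rule bounded_support_integrable[OF m, where K=1 and R=R]) (auto simp: indicator_def)
  moreover have "(\<lambda>x. (norm (indicator (cball (0::real ^ 'd) R) x :: real))\<^sup>2) = indicator (cball 0 R)"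
    by (auto simp: indicator_def)
  ultimately show "integrable lebesgue (\<lambda>x. (norm (indicator (cball (0::real ^ 'd) R) x :: real))\<^sup>2)" by simp
qed

lemma L2_scaleR_integrable:
  fixes f :: "real ^ 'd::finite \<Rightarrow> real" and g :: "real ^ 'd \<Rightarrow> 'b::euclidean_space"
  assumes f: "L2 UNIV f" and g: "L2 UNIV g"
  shows "integrable lebesgue (\<lambda>x. f x *\<^sub>R g x)"
proof -
  have [measurable]: "f \<in> borel_measurable lebesgue" "g \<in> borel_measurable lebesgue"
    using f g by (auto simp: L2_UNIV)
  show ?thesis by (rule L2_bilinear_integrable[OF bounded_bilinear_scaleR f g]) measurable
qed

text \<open>Testing with bumps that tend to the indicator of a box reduces the claim to vanishing integrals over boxes.\<close>

theorem fundamental_lemma: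
  fixes g :: "real ^ 'd::finite \<Rightarrow> 'b::euclidean_space"
  assumes g: "L2 UNIV g"
    and zero: "\<And>\<phi>. test_fun UNIV \<phi> \<Longrightarrow> (\<integral>x. \<phi> x *\<^sub>R g x \<partial>lebesgue) = 0"
  shows "AE x in lebesgue. g x = 0"
proof (rule integral_boxes_zero_imp_AE_zero)
  show m [measurable]: "g \<in> borel_measurable lebesgue" using g by (rule L2_measurable)
  show int: "integrable lebesgue (\<lambda>x. indicator (cball 0 R) x *\<^sub>R g x)" for R
    by (rule L2_scaleR_integrable[OF indicator_cball_L2 g])
  fix a b :: "real ^ 'd"
  obtain R where R: "box a b \<subseteq> cball 0 R" using bounded_box[of a b] unfolding bounded_iff by (meson mem_cball_0 subsetI)
  have "(\<lambda>n. \<integral>x. box_bump (real (Suc n)) a b x *\<^sub>R g x \<partial>lebesgue) \<longlonglongrightarrow> (\<integral>x. indicator (box a b) x *\<^sub>R g x \<partial>lebesgue)"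
  proof (rule integral_dominated_convergence)
    show "integrable lebesgue (\<lambda>x. norm (indicator (cball 0 R) x *\<^sub>R g x))" using int by (rule integrable_norm)
    show "AE x in lebesgue. (\<lambda>n. box_bump (real (Suc n)) a b x *\<^sub>R g x) \<longlonglongrightarrow> indicator (box a b) x *\<^sub>R g x"
      by (intro AE_I2 tendsto_intros box_bump_tendsto)
    show "(\<lambda>x. box_bump (real (Suc n)) a b x *\<^sub>R g x) \<in> borel_measurable lebesgue" for n
      using test_fun_measurable[OF box_bump_test_fun[of "real (Suc n)" a b]] by measurable
    show "AE x in lebesgue. norm (box_bump (real (Suc n)) a b x *\<^sub>R g x) \<le> norm (indicator (cball 0 R) x *\<^sub>R g x)" for n
    proof (rule AE_I2)
      fix x
      show "norm (box_bump (real (Suc n)) a b x *\<^sub>R g x) \<le> norm (indicator (cball 0 R) x *\<^sub>R g x)"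
      proof (cases "x \<in> box a b")
        case True
        then have "x \<in> cball 0 R" using R by blast
        then show ?thesis using box_bump_bounds[of "real (Suc n)" a b x]
          by (simp add: mult_left_le_one_le)
      next
        case False
        then have "box_bump (real (Suc n)) a b x = 0" using box_bump_nonzero[of "real (Suc n)" a b x] by simp
        then show ?thesis by simp
      qed
    qed
    have "(indicator (box a b) :: _ \<Rightarrow> real) \<in> borel_measurable lebesgue" by (intro borel_measurable_indicator) simp
    then show "(\<lambda>x. indicator (box a b) x *\<^sub>R g x) \<in> borel_measurable lebesgue" by measurable
  qed
  moreover have "(\<integral>x. box_bump (real (Suc n)) a b x *\<^sub>R g x \<partial>lebesgue) = 0" for n
    by (intro zero box_bump_test_fun) simp
  ultimately show "(\<integral>x. indicator (box a b) x *\<^sub>R g x \<partial>lebesgue) = 0" by (simp add: LIMSEQ_const_iff)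
qed

lemma l2_cauchy_schwarz:
  fixes f :: "real ^ 'd::finite \<Rightarrow> 'b::euclidean_space" and g :: "real ^ 'd \<Rightarrow> 'c::euclidean_space"
  assumes f: "L2 UNIV f" and g: "L2 UNIV g"
  shows "(\<integral>x. norm (f x) * norm (g x) \<partial>lebesgue)\<^sup>2 \<le> l2ip f f * l2ip g g"
proof -
  define A B C where "A = l2ip f f" "B = (\<integral>x. norm (f x) * norm (g x) \<partial>lebesgue)" "C = l2ip g g"
  have q: "0 \<le> t\<^sup>2 * A - 2 * t * B + C" for t
  proof -
    have "0 \<le> (\<integral>x. (t * norm (f x) - norm (g x))\<^sup>2 \<partial>lebesgue)" by (rule integral_nonneg_AE) simp
    also have "\<dots> = (\<integral>x. t\<^sup>2 * (norm (f x))\<^sup>2 - 2 * t * (norm (f x) * norm (g x)) + (norm (g x))\<^sup>2 \<partial>lebesgue)"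
      by (rule Bochner_Integration.integral_cong) (auto simp: power2_eq_square algebra_simps)
    also have "\<dots> = t\<^sup>2 * A - 2 * t * B + C"
      using L2_integrable[OF f] L2_integrable[OF g] L2_norm_mult_integrable[OF f g]
      by (simp add: A_B_C_def l2ip_def power2_norm_eq_inner[symmetric])
    finally show ?thesis .
  qed
  have A0: "0 \<le> A" and C0: "0 \<le> C" by (simp_all add: A_B_C_def l2ip_nonneg)
  have "B\<^sup>2 \<le> A * C"
  proof (cases "A = 0")
    case True
    have "B = 0"
    proof (rule ccontr)
      assume "B \<noteq> 0"
      then show False using q[of "(C + 1) / (2 * B)"] True C0 by (simp add: field_simps)
    qed
    then show ?thesis using A0 C0 by simp
  next
    case False
    then have "0 < A" using A0 by simp
    have "(B / A)\<^sup>2 * A - 2 * (B / A) * B + C = C - B\<^sup>2 / A"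
      using \<open>0 < A\<close> by (simp add: power2_eq_square field_simps)
    then have "B\<^sup>2 / A \<le> C" using q[of "B / A"] by simp
    then show ?thesis using \<open>0 < A\<close> by (simp add: field_simps)
  qed
  then show ?thesis by (simp add: A_B_C_def)
qed

lemma l2_scaleR_bound:
  fixes f :: "real ^ 'd::finite \<Rightarrow> real" and g :: "real ^ 'd \<Rightarrow> 'c::euclidean_space"
  assumes f: "L2 UNIV f" and g: "L2 UNIV g"
  shows "(norm (\<integral>x. f x *\<^sub>R g x \<partial>lebesgue))\<^sup>2 \<le> l2ip f f * l2ip g g"
proof -
  have "norm (\<integral>x. f x *\<^sub>R g x \<partial>lebesgue) \<le> (\<integral>x. norm (f x *\<^sub>R g x) \<partial>lebesgue)" by (rule integral_norm_bound)
  also have "\<dots> = (\<integral>x. norm (f x) * norm (g x) \<partial>lebesgue)" by simp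
  finally have "(norm (\<integral>x. f x *\<^sub>R g x \<partial>lebesgue))\<^sup>2 \<le> (\<integral>x. norm (f x) * norm (g x) \<partial>lebesgue)\<^sup>2"
    by (intro power_mono) auto
  then show ?thesis using l2_cauchy_schwarz[OF f g] by linarith
qed

lemma l2_tendsto_scaleR_integral:
  fixes \<phi> :: "real ^ 'd::finite \<Rightarrow> real" and g :: "real ^ 'd \<Rightarrow> 'c::euclidean_space"
  assumes p: "L2 UNIV \<phi>" and f: "\<And>n. L2 UNIV (f n)" and g: "L2 UNIV g"
    and lim: "(\<lambda>n. l2ip (f n - g) (f n - g)) \<longlonglongrightarrow> 0"
  shows "(\<lambda>n. \<integral>x. \<phi> x *\<^sub>R f n x \<partial>lebesgue) \<longlonglongrightarrow> (\<integral>x. \<phi> x *\<^sub>R g x \<partial>lebesgue)"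
proof -
  have d: "(\<integral>x. \<phi> x *\<^sub>R f n x \<partial>lebesgue) - (\<integral>x. \<phi> x *\<^sub>R g x \<partial>lebesgue) = (\<integral>x. \<phi> x *\<^sub>R (f n - g) x \<partial>lebesgue)" for n
    by (simp add: scaleR_diff_right L2_scaleR_integrable[OF p f] L2_scaleR_integrable[OF p g])
  have "(\<lambda>n. l2ip \<phi> \<phi> * l2ip (f n - g) (f n - g)) \<longlonglongrightarrow> l2ip \<phi> \<phi> * 0" by (intro tendsto_intros lim)
  then have "(\<lambda>n. sqrt (l2ip \<phi> \<phi> * l2ip (f n - g) (f n - g))) \<longlonglongrightarrow> sqrt 0" by (intro tendsto_real_sqrt) simp
  then have s: "(\<lambda>n. sqrt (l2ip \<phi> \<phi> * l2ip (f n - g) (f n - g))) \<longlonglongrightarrow> 0" by simp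
  have "(\<lambda>n. (\<integral>x. \<phi> x *\<^sub>R f n x \<partial>lebesgue) - (\<integral>x. \<phi> x *\<^sub>R g x \<partial>lebesgue)) \<longlonglongrightarrow> 0"
  proof (rule Lim_null_comparison[OF _ s])
    show "\<forall>\<^sub>F n in sequentially. norm ((\<integral>x. \<phi> x *\<^sub>R f n x \<partial>lebesgue) - (\<integral>x. \<phi> x *\<^sub>R g x \<partial>lebesgue))
        \<le> sqrt (l2ip \<phi> \<phi> * l2ip (f n - g) (f n - g))"
      unfolding d by (intro always_eventually allI real_le_rsqrt l2_scaleR_bound p L2_diff f g)
  qed
  then show ?thesis by (simp add: LIM_zero_iff)
qed

subsection \<open>Weak derivatives\<close>

lemma has_weak_pd_UNIV:
  "has_weak_pd UNIV j f g \<longleftrightarrow> L2 UNIV f \<and> L2 UNIV g \<and>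
     (\<forall>\<phi>::real ^ 'd::finite \<Rightarrow> real. test_fun UNIV \<phi> \<longrightarrow>
        (\<integral>x. pd j \<phi> x *\<^sub>R f x \<partial>lebesgue) = - (\<integral>x. \<phi> x *\<^sub>R g x \<partial>lebesgue))"
  by (simp add: has_weak_pd_def lebesgue_on_UNIV_eq)

lemma weak_pd_unique:
  assumes "has_weak_pd UNIV j f g" "has_weak_pd UNIV j f g'"
  shows "AE x in lebesgue. g x = g' x"
proof -
  have g: "L2 UNIV g" and g': "L2 UNIV g'" using assms by (auto simp: has_weak_pd_UNIV)
  have "AE x in lebesgue. (g - g') x = 0"
  proof (rule fundamental_lemma[OF L2_diff[OF g g']])
    fix \<phi> :: "real ^ 'a \<Rightarrow> real" assume t: "test_fun UNIV \<phi>"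
    have "(\<integral>x. \<phi> x *\<^sub>R g x \<partial>lebesgue) = (\<integral>x. \<phi> x *\<^sub>R g' x \<partial>lebesgue)"
    proof -
      have "(\<integral>x. pd j \<phi> x *\<^sub>R f x \<partial>lebesgue) = - (\<integral>x. \<phi> x *\<^sub>R g x \<partial>lebesgue)"
        "(\<integral>x. pd j \<phi> x *\<^sub>R f x \<partial>lebesgue) = - (\<integral>x. \<phi> x *\<^sub>R g' x \<partial>lebesgue)"
        using assms t by (auto simp only: has_weak_pd_UNIV)
      then show ?thesis by (simp only: neg_equal_iff_equal)
    qed
    then show "(\<integral>x. \<phi> x *\<^sub>R (g - g') x \<partial>lebesgue) = 0"
      by (simp add: scaleR_diff_right L2_scaleR_integrable[OF test_fun_L2[OF t] g] L2_scaleR_integrable[OF test_fun_L2[OF t] g'])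
  qed
  then show ?thesis by (rule eventually_mono) simp
qed

lemma AE_scaleR_integral_cong:
  fixes f g :: "real ^ 'd::finite \<Rightarrow> 'b::euclidean_space"
  assumes "AE x in lebesgue. f x = g x"
  shows "(\<integral>x. \<phi> x *\<^sub>R f x \<partial>lebesgue) = (\<integral>x. \<phi> x *\<^sub>R g x \<partial>lebesgue)"
  by (rule integral_lebesgue_cong_AE) (use assms in \<open>auto elim: eventually_mono\<close>)

lemma L2_cong_iff:
  assumes "AE x in lebesgue. f x = f' x" shows "L2 UNIV f \<longleftrightarrow> L2 UNIV f'"
proof
  have "AE x in lebesgue. f' x = f x" using assms by (rule eventually_mono) simp
  then show "L2 UNIV f' \<Longrightarrow> L2 UNIV f" using L2_cong_AE by blast
qed (use L2_cong_AE assms in blast)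

lemma has_weak_pd_cong:
  assumes "AE x in lebesgue. f x = f' x" shows "has_weak_pd UNIV j f = has_weak_pd UNIV j f'"
  by (intro ext) (simp add: has_weak_pd_UNIV L2_cong_iff[OF assms] AE_scaleR_integral_cong[OF assms])

text \<open>The choice in \<open>wpd\<close> depends on the field only through the set of its weak derivatives, so that the values agree literally and not only almost everywhere.\<close>

lemma wpd_cong: "AE x in lebesgue. f x = f' x \<Longrightarrow> wpd UNIV j f = wpd UNIV j f'"
  by (simp add: wpd_def has_weak_pd_cong)

lemma wpd_weak: "has_weak_pd UNIV j f g \<Longrightarrow> has_weak_pd UNIV j f (wpd UNIV j f)"
  unfolding wpd_def by (rule someI[where P = "has_weak_pd UNIV j f"])

lemma wpd_unique: "has_weak_pd UNIV j f g \<Longrightarrow> AE x in lebesgue. wpd UNIV j f x = g x"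
  using weak_pd_unique[OF wpd_weak] by blast

lemma has_weak_pd_add:
  assumes "has_weak_pd UNIV j f g" "has_weak_pd UNIV j f' g'"
  shows "has_weak_pd UNIV j (f + f') (g + g')"
  unfolding has_weak_pd_UNIV
proof (intro conjI allI impI)
  have L: "L2 UNIV f" "L2 UNIV f'" "L2 UNIV g" "L2 UNIV g'" using assms by (auto simp: has_weak_pd_UNIV)
  then show "L2 UNIV (f + f')" "L2 UNIV (g + g')" by (auto intro: L2_add)
  fix \<phi> :: "real ^ 'a \<Rightarrow> real" assume t: "test_fun UNIV \<phi>"
  show "(\<integral>x. pd j \<phi> x *\<^sub>R (f + f') x \<partial>lebesgue) = - (\<integral>x. \<phi> x *\<^sub>R (g + g') x \<partial>lebesgue)"
    using assms t L test_fun_L2[OF t] test_fun_L2[OF test_fun_pd[OF t]]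
    by (simp add: has_weak_pd_UNIV scaleR_add_right L2_scaleR_integrable)
qed

lemma has_weak_pd_scaleR:
  assumes "has_weak_pd UNIV j f g" shows "has_weak_pd UNIV j (r *\<^sub>R f) (r *\<^sub>R g)"
  using assms unfolding has_weak_pd_UNIV
  by (auto intro: L2_scaleR simp: scaleR_left_commute[of _ r] simp del: scaleR_scaleR)

lemma has_weak_pd_bounded_linear:
  fixes h :: "'b::euclidean_space \<Rightarrow> 'c::euclidean_space"
  assumes h: "bounded_linear h" and w: "has_weak_pd UNIV j f g"
  shows "has_weak_pd UNIV j (\<lambda>x. h (f x)) (\<lambda>x. h (g x))"
  unfolding has_weak_pd_UNIV
proof (intro conjI allI impI)
  have L: "L2 UNIV f" "L2 UNIV g" using w by (auto simp: has_weak_pd_UNIV)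
  obtain K where K: "\<And>x. norm (h x) \<le> norm x * K" using bounded_linear.bounded[OF h] by blast
  have hm: "h \<in> borel_measurable borel"
    by (intro borel_measurable_continuous_onI linear_continuous_on h)
  have Lh: "L2 UNIV (\<lambda>x. h (f x))" if "L2 UNIV f" for f :: "real ^ 'a \<Rightarrow> 'b"
    by (rule L2_bound[OF that, where K=K])
      (use measurable_compose[OF L2_measurable[OF that] hm] K in \<open>auto simp: mult.commute\<close>)
  then show "L2 UNIV (\<lambda>x. h (f x))" "L2 UNIV (\<lambda>x. h (g x))" using L by auto
  fix \<phi> :: "real ^ 'a \<Rightarrow> real" assume t: "test_fun UNIV \<phi>"
  have eq: "(\<integral>x. \<psi> x *\<^sub>R h (f x) \<partial>lebesgue) = h (\<integral>x. \<psi> x *\<^sub>R f x \<partial>lebesgue)"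
    if "L2 UNIV \<psi>" "L2 UNIV f" for \<psi> :: "real ^ 'a \<Rightarrow> real" and f :: "real ^ 'a \<Rightarrow> 'b"
    using integral_bounded_linear[OF h L2_scaleR_integrable[OF that]]
    by (simp add: linear_scale[OF bounded_linear.linear[OF h]])
  show "(\<integral>x. pd j \<phi> x *\<^sub>R h (f x) \<partial>lebesgue) = - (\<integral>x. \<phi> x *\<^sub>R h (g x) \<partial>lebesgue)"
    using w t unfolding has_weak_pd_UNIV
    by (simp add: eq L test_fun_L2 test_fun_pd linear_neg[OF bounded_linear.linear[OF h]])
qed

text \<open>The identity defining a weak derivative is continuous in \<open>L\<^sup>2\<close> on both sides.\<close>

lemma has_weak_pd_closed:
  assumes w: "\<And>n. has_weak_pd UNIV j (f n) (g n)" and L: "L2 UNIV f'" "L2 UNIV g'"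
    and lim: "(\<lambda>n. l2ip (f n - f') (f n - f')) \<longlonglongrightarrow> 0" "(\<lambda>n. l2ip (g n - g') (g n - g')) \<longlonglongrightarrow> 0"
  shows "has_weak_pd UNIV j f' g'"
  unfolding has_weak_pd_UNIV
proof (intro conjI allI impI L)
  fix \<phi> :: "real ^ 'a \<Rightarrow> real" assume t: "test_fun UNIV \<phi>"
  have Ln: "L2 UNIV (f n)" "L2 UNIV (g n)" for n using w by (auto simp: has_weak_pd_UNIV)
  have "(\<lambda>n. \<integral>x. pd j \<phi> x *\<^sub>R f n x \<partial>lebesgue) \<longlonglongrightarrow> (\<integral>x. pd j \<phi> x *\<^sub>R f' x \<partial>lebesgue)"
    by (rule l2_tendsto_scaleR_integral[OF test_fun_L2[OF test_fun_pd[OF t]] Ln(1) L(1) lim(1)])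
  moreover have "(\<lambda>n. - (\<integral>x. \<phi> x *\<^sub>R g n x \<partial>lebesgue)) \<longlonglongrightarrow> - (\<integral>x. \<phi> x *\<^sub>R g' x \<partial>lebesgue)"
    by (intro tendsto_minus l2_tendsto_scaleR_integral[OF test_fun_L2[OF t] Ln(2) L(2) lim(2)])
  moreover have "(\<integral>x. pd j \<phi> x *\<^sub>R f n x \<partial>lebesgue) = - (\<integral>x. \<phi> x *\<^sub>R g n x \<partial>lebesgue)" for n
    using w t by (auto simp: has_weak_pd_UNIV)
  ultimately show "(\<integral>x. pd j \<phi> x *\<^sub>R f' x \<partial>lebesgue) = - (\<integral>x. \<phi> x *\<^sub>R g' x \<partial>lebesgue)"
    by (simp add: LIMSEQ_unique)
qed

subsection \<open>Sobolev spaces on the whole space\<close>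

text \<open>Specialized to the whole space, where integrals over \<open>UNIV\<close> become plain Lebesgue integrals.\<close>

lemma sobolev_0_iff [simp]: "f \<in> sobolev 0 UNIV \<longleftrightarrow> L2 UNIV f"
  and sobolev_Suc_iff [simp]: "f \<in> sobolev (Suc k) UNIV \<longleftrightarrow>
    L2 UNIV f \<and> (\<forall>j. \<exists>g\<in>sobolev k UNIV. has_weak_pd UNIV j f g)"
  and sobolev_sqnorm_0 [simp]: "sobolev_sqnorm 0 UNIV f = l2ip f f"
  and sobolev_sqnorm_Suc [simp]: "sobolev_sqnorm (Suc k) UNIV f =
    l2ip f f + (\<Sum>j\<in>UNIV. sobolev_sqnorm k UNIV (wpd UNIV j f))"
  by (simp_all add: l2ip_self)

declare sobolev.simps [simp del] sobolev_sqnorm.simps [simp del]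

lemma sobolev_L2: "f \<in> sobolev k UNIV \<Longrightarrow> L2 UNIV f"
  by (cases k) auto

lemma sobolev_cong_AE:
  assumes "f \<in> sobolev k UNIV" "AE x in lebesgue. f x = f' x" shows "f' \<in> sobolev k UNIV"
  using assms L2_cong_iff[OF assms(2)] has_weak_pd_cong[OF assms(2)] by (cases k) auto

lemma sobolev_SucD:
  assumes "f \<in> sobolev (Suc k) UNIV"
  shows wpd_has_weak_pd: "has_weak_pd UNIV j f (wpd UNIV j f)" and wpd_sobolev: "wpd UNIV j f \<in> sobolev k UNIV"
proof -
  obtain g where g: "g \<in> sobolev k UNIV" "has_weak_pd UNIV j f g" using assms by auto
  show "has_weak_pd UNIV j f (wpd UNIV j f)" using wpd_weak[OF g(2)] .
  have "AE x in lebesgue. g x = wpd UNIV j f x" using wpd_unique[OF g(2)] by (rule eventually_mono) simp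
  then show "wpd UNIV j f \<in> sobolev k UNIV" using sobolev_cong_AE[OF g(1)] by blast
qed

lemma sobolev_Suc_I:
  assumes "L2 UNIV f" "\<And>j. has_weak_pd UNIV j f (g j)" "\<And>j. g j \<in> sobolev k UNIV"
  shows "f \<in> sobolev (Suc k) UNIV"
  using assms by auto

lemma sobolev_Suc_D: "f \<in> sobolev (Suc k) UNIV \<Longrightarrow> f \<in> sobolev k UNIV"
proof (induction k arbitrary: f)
  case (Suc k)
  show ?case
    by (rule sobolev_Suc_I[OF sobolev_L2[OF Suc.prems] wpd_has_weak_pd[OF Suc.prems]])
      (rule Suc.IH[OF wpd_sobolev[OF Suc.prems]])
qed auto

lemma sobolev_add: "f \<in> sobolev k UNIV \<Longrightarrow> g \<in> sobolev k UNIV \<Longrightarrow> f + g \<in> sobolev k UNIV"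
proof (induction k arbitrary: f g)
  case (Suc k)
  show ?case
    by (rule sobolev_Suc_I[OF L2_add[OF Suc.prems[THEN sobolev_L2]] has_weak_pd_add[OF Suc.prems[THEN wpd_has_weak_pd]]])
      (intro Suc.IH wpd_sobolev Suc.prems)
qed (auto intro: L2_add)

lemma sobolev_scaleR: "f \<in> sobolev k UNIV \<Longrightarrow> r *\<^sub>R f \<in> sobolev k UNIV"
proof (induction k arbitrary: f)
  case (Suc k)
  show ?case
    by (rule sobolev_Suc_I[OF L2_scaleR[OF sobolev_L2[OF Suc.prems]] has_weak_pd_scaleR[OF wpd_has_weak_pd[OF Suc.prems]]])
      (intro Suc.IH wpd_sobolev Suc.prems)
qed (auto intro: L2_scaleR)

lemma sobolev_minus: "f \<in> sobolev k UNIV \<Longrightarrow> - f \<in> sobolev k UNIV"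
  using sobolev_scaleR[of f k "-1"] by simp

lemma sobolev_diff: "f \<in> sobolev k UNIV \<Longrightarrow> g \<in> sobolev k UNIV \<Longrightarrow> f - g \<in> sobolev k UNIV"
  using sobolev_add[of f k "- g"] sobolev_minus[of g k] by simp

lemma has_weak_pd_zero: "has_weak_pd UNIV j 0 0"
  by (simp add: has_weak_pd_UNIV L2_zero)

lemma sobolev_zero: "(0 :: real ^ 'd::finite \<Rightarrow> 'b::euclidean_space) \<in> sobolev k UNIV"
proof (induction k)
  case 0
  show "(0 :: real ^ 'd \<Rightarrow> 'b) \<in> sobolev 0 UNIV" by (simp add: L2_zero)
next
  case (Suc k)
  show "(0 :: real ^ 'd \<Rightarrow> 'b) \<in> sobolev (Suc k) UNIV"
    by (rule sobolev_Suc_I[OF L2_zero has_weak_pd_zero Suc])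
qed

lemma wpd_add:
  assumes "f \<in> sobolev (Suc k) UNIV" "g \<in> sobolev (Suc k) UNIV"
  shows "AE x in lebesgue. wpd UNIV j (f + g) x = (wpd UNIV j f + wpd UNIV j g) x"
  by (rule wpd_unique[OF has_weak_pd_add[OF assms[THEN wpd_has_weak_pd]]])

lemma wpd_scaleR:
  assumes "f \<in> sobolev (Suc k) UNIV"
  shows "AE x in lebesgue. wpd UNIV j (r *\<^sub>R f) x = (r *\<^sub>R wpd UNIV j f) x"
  by (rule wpd_unique[OF has_weak_pd_scaleR[OF wpd_has_weak_pd[OF assms]]])

primrec sip :: "nat \<Rightarrow> (real ^ 'd::finite \<Rightarrow> 'b::euclidean_space) \<Rightarrow> (real ^ 'd \<Rightarrow> 'b) \<Rightarrow> real" where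
  "sip 0 f g = l2ip f g"
| "sip (Suc k) f g = l2ip f g + (\<Sum>j\<in>UNIV. sip k (wpd UNIV j f) (wpd UNIV j g))"

lemma sip_0 [simp]: "sip 0 f g = l2ip f g"
  and sip_Suc [simp]: "sip (Suc k) f g = l2ip f g + (\<Sum>j\<in>UNIV. sip k (wpd UNIV j f) (wpd UNIV j g))"
  by simp_all

declare sip.simps [simp del]

lemma sip_self: "sip k f f = sobolev_sqnorm k UNIV f"
  by (induction k arbitrary: f) simp_all

lemma sip_commute: "sip k f g = sip k g f"
  by (induction k arbitrary: f g) (simp_all add: l2ip_commute)

lemma sip_nonneg: "0 \<le> sip k f f"
  by (induction k arbitrary: f) (auto simp: l2ip_nonneg intro!: add_nonneg_nonneg sum_nonneg)

lemma sip_cong_AE: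
  assumes "AE x in lebesgue. f x = f' x" "AE x in lebesgue. g x = g' x"
  shows "sip k f g = sip k f' g'"
  by (cases k) (simp_all add: l2ip_cong_AE[OF assms] wpd_cong[OF assms(1)] wpd_cong[OF assms(2)])

lemma sip_add_left:
  "f \<in> sobolev k UNIV \<Longrightarrow> g \<in> sobolev k UNIV \<Longrightarrow> h \<in> sobolev k UNIV \<Longrightarrow> sip k (f + g) h = sip k f h + sip k g h"
proof (induction k arbitrary: f g h)
  case (Suc k)
  have "sip k (wpd UNIV j (f + g)) (wpd UNIV j h) = sip k (wpd UNIV j f) (wpd UNIV j h) + sip k (wpd UNIV j g) (wpd UNIV j h)" for j
    by (subst sip_cong_AE[OF wpd_add[OF Suc.prems(1,2)] AE_I2[OF refl]])
      (intro Suc.IH wpd_sobolev Suc.prems)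
  then show "sip (Suc k) (f + g) h = sip (Suc k) f h + sip (Suc k) g h" using Suc.prems
    by (simp add: l2ip_add_left[OF sobolev_L2 sobolev_L2 sobolev_L2] sum.distrib del: sobolev_Suc_iff)
qed (simp add: l2ip_add_left)

lemma sip_scaleR_left:
  "f \<in> sobolev k UNIV \<Longrightarrow> sip k (r *\<^sub>R f) h = r * sip k f h"
proof (induction k arbitrary: f h)
  case (Suc k)
  have "sip k (wpd UNIV j (r *\<^sub>R f)) (wpd UNIV j h) = r * sip k (wpd UNIV j f) (wpd UNIV j h)" for j
    by (subst sip_cong_AE[OF wpd_scaleR[OF Suc.prems] AE_I2[OF refl]])
      (intro Suc.IH wpd_sobolev Suc.prems)
  then show "sip (Suc k) (r *\<^sub>R f) h = r * sip (Suc k) f h"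
    by (simp add: l2ip_scaleR_left sum_distrib_left distrib_left)
qed (simp add: l2ip_scaleR_left)

lemma sip_ge_l2ip: "l2ip f f \<le> sip k f f"
  by (cases k) (auto intro!: sum_nonneg sip_nonneg)

lemma sip_ge_wpd: "sip k (wpd UNIV j f) (wpd UNIV j f) \<le> sip (Suc k) f f"
proof -
  have "sip k (wpd UNIV j f) (wpd UNIV j f) \<le> (\<Sum>j\<in>UNIV. sip k (wpd UNIV j f) (wpd UNIV j f))"
    by (rule member_le_sum) (auto simp: sip_nonneg)
  then show ?thesis using l2ip_nonneg[of f] by simp
qed

lemma sip_zero_AE: "f \<in> sobolev k UNIV \<Longrightarrow> sip k f f = 0 \<Longrightarrow> AE x in lebesgue. f x = 0"
  using sip_ge_l2ip[of f k] l2ip_nonneg[of f] l2ip_zero_AE[OF sobolev_L2] by fastforce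

text \<open>By induction on the order: the functions and their weak derivatives converge in \<open>L\<^sup>2\<close> and in the lower Sobolev space, and the limits are again related by differentiation because it is closed.\<close>

theorem sobolev_complete:
  fixes f :: "nat \<Rightarrow> real ^ 'd::finite \<Rightarrow> 'b::euclidean_space"
  assumes "\<And>n. f n \<in> sobolev k UNIV"
    and "\<And>e. 0 < e \<Longrightarrow> \<exists>N. \<forall>m\<ge>N. \<forall>n\<ge>N. sip k (f m - f n) (f m - f n) < e"
  shows "\<exists>g. g \<in> sobolev k UNIV \<and> (\<lambda>n. sip k (f n - g) (f n - g)) \<longlonglongrightarrow> 0"
  using assms
proof (induction k arbitrary: f)
  case 0
  have "\<And>n. L2 UNIV (f n)" using 0(1) by simp
  moreover have "\<exists>N. \<forall>m\<ge>N. \<forall>n\<ge>N. l2ip (f m - f n) (f m - f n) < e" if "0 < e" for e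
    using 0(2)[OF that] unfolding sip_0 .
  ultimately obtain g where "L2 UNIV g" "(\<lambda>n. l2ip (f n - g) (f n - g)) \<longlonglongrightarrow> 0"
    using L2_complete[of f] by blast
  then show "\<exists>g. g \<in> sobolev 0 UNIV \<and> (\<lambda>n. sip 0 (f n - g) (f n - g)) \<longlonglongrightarrow> 0"
    by (intro exI[of _ g]) simp
next
  case (Suc k)
  note f = Suc.prems(1) and C = Suc.prems(2)
  have wd: "AE x in lebesgue. wpd UNIV j (p - q) x = (wpd UNIV j p - wpd UNIV j q) x"
    if "p \<in> sobolev (Suc k) UNIV" "q \<in> sobolev (Suc k) UNIV" for p q :: "real ^ 'd \<Rightarrow> 'b" and j
    using wpd_add[OF that(1) sobolev_scaleR[OF that(2), of "-1"], of j] wpd_scaleR[OF that(2), of j "-1"]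
    by eventually_elim simp
  have wsip: "sip k (wpd UNIV j (p - q)) (wpd UNIV j (p - q)) = sip k (wpd UNIV j p - wpd UNIV j q) (wpd UNIV j p - wpd UNIV j q)"
    if "p \<in> sobolev (Suc k) UNIV" "q \<in> sobolev (Suc k) UNIV" for p q :: "real ^ 'd \<Rightarrow> 'b" and j
    by (rule sip_cong_AE[OF wd[OF that] wd[OF that]])
  have Cl: "\<exists>N. \<forall>m\<ge>N. \<forall>n\<ge>N. l2ip (f m - f n) (f m - f n) < e" if "0 < e" for e
  proof -
    from C[OF that] obtain N where N: "\<And>m n. N \<le> m \<Longrightarrow> N \<le> n \<Longrightarrow> sip (Suc k) (f m - f n) (f m - f n) < e" by blast
    then have "l2ip (f m - f n) (f m - f n) < e" if "N \<le> m" "N \<le> n" for m n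
      using that sip_ge_l2ip[of "f m - f n" "Suc k"] by (meson order_le_less_trans)
    then show ?thesis by blast
  qed
  obtain g where g: "L2 UNIV g" "(\<lambda>n. l2ip (f n - g) (f n - g)) \<longlonglongrightarrow> 0"
    by (rule L2_complete[OF sobolev_L2[OF f] Cl])
  have "\<exists>h. h \<in> sobolev k UNIV \<and> (\<lambda>n. sip k (wpd UNIV j (f n) - h) (wpd UNIV j (f n) - h)) \<longlonglongrightarrow> 0" for j
  proof (rule Suc.IH)
    show "wpd UNIV j (f n) \<in> sobolev k UNIV" for n by (rule wpd_sobolev[OF f])
    fix e :: real assume "0 < e"
    from C[OF this] obtain N where N: "\<And>m n. N \<le> m \<Longrightarrow> N \<le> n \<Longrightarrow> sip (Suc k) (f m - f n) (f m - f n) < e" by blast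
    have "sip k (wpd UNIV j (f m) - wpd UNIV j (f n)) (wpd UNIV j (f m) - wpd UNIV j (f n)) < e" if "N \<le> m" "N \<le> n" for m n
      unfolding wsip[OF f f, symmetric] using sip_ge_wpd N[OF that] by (rule order_le_less_trans)
    then show "\<exists>N. \<forall>m\<ge>N. \<forall>n\<ge>N. sip k (wpd UNIV j (f m) - wpd UNIV j (f n)) (wpd UNIV j (f m) - wpd UNIV j (f n)) < e" by blast
  qed
  then have "\<forall>j. \<exists>h. h \<in> sobolev k UNIV \<and> (\<lambda>n. sip k (wpd UNIV j (f n) - h) (wpd UNIV j (f n) - h)) \<longlonglongrightarrow> 0" by blast
  from choice[OF this] obtain h where h: "\<And>j. h j \<in> sobolev k UNIV"
    "\<And>j. (\<lambda>n. sip k (wpd UNIV j (f n) - h j) (wpd UNIV j (f n) - h j)) \<longlonglongrightarrow> 0" by blast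
  have w: "has_weak_pd UNIV j g (h j)" for j
  proof (rule has_weak_pd_closed[OF wpd_has_weak_pd[OF f] g(1) sobolev_L2[OF h(1)] g(2)])
    show "(\<lambda>n. l2ip (wpd UNIV j (f n) - h j) (wpd UNIV j (f n) - h j)) \<longlonglongrightarrow> 0"
      by (rule tendsto_sandwich[OF _ _ tendsto_const h(2)[of j]]) (auto simp: l2ip_nonneg sip_ge_l2ip)
  qed
  have gS: "g \<in> sobolev (Suc k) UNIV" by (rule sobolev_Suc_I[OF g(1) w h(1)])
  have "sip k (wpd UNIV j (f n - g)) (wpd UNIV j (f n - g)) = sip k (wpd UNIV j (f n) - h j) (wpd UNIV j (f n) - h j)" for n j
  proof (rule sip_cong_AE)
    show "AE x in lebesgue. wpd UNIV j (f n - g) x = (wpd UNIV j (f n) - h j) x"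
      using wd[OF f gS, of j n] wpd_unique[OF w[of j]] by eventually_elim simp
    then show "AE x in lebesgue. wpd UNIV j (f n - g) x = (wpd UNIV j (f n) - h j) x" .
  qed
  then have "(\<lambda>n. sip (Suc k) (f n - g) (f n - g)) \<longlonglongrightarrow> 0 + (\<Sum>j\<in>(UNIV::'d set). 0)"
    by (simp only: sip_Suc) (intro tendsto_intros g(2) h(2))
  then have "(\<lambda>n. sip (Suc k) (f n - g) (f n - g)) \<longlonglongrightarrow> 0" by (simp only: sum.neutral_const add_0)
  then show ?case using gS by blast
qed

section \<open>Semi-inner products\<close>

text \<open>Inner products on spaces of functions are only semi-definite, and only linear on a subspace of the type of all functions.\<close>

locale semi_inner =
  fixes X :: "'v::real_vector set" and ip :: "'v \<Rightarrow> 'v \<Rightarrow> real"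
  assumes X: "subspace X"
    and ip_add: "x \<in> X \<Longrightarrow> y \<in> X \<Longrightarrow> z \<in> X \<Longrightarrow> ip (x + y) z = ip x z + ip y z"
    and ip_scale: "x \<in> X \<Longrightarrow> ip (r *\<^sub>R x) z = r * ip x z"
    and ip_commute: "ip x y = ip y x"
    and ip_nonneg: "x \<in> X \<Longrightarrow> 0 \<le> ip x x"
begin

lemma in_X: "x \<in> X \<Longrightarrow> y \<in> X \<Longrightarrow> x + y \<in> X" "x \<in> X \<Longrightarrow> r *\<^sub>R x \<in> X" "x \<in> X \<Longrightarrow> y \<in> X \<Longrightarrow> x - y \<in> X" "0 \<in> X"
  using X by (auto simp: subspace_add subspace_scale subspace_diff subspace_0)

lemma ip_scale_right: "x \<in> X \<Longrightarrow> ip z (r *\<^sub>R x) = r * ip z x"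
  by (metis ip_commute ip_scale)

lemma ip_add_right: "x \<in> X \<Longrightarrow> y \<in> X \<Longrightarrow> z \<in> X \<Longrightarrow> ip z (x + y) = ip z x + ip z y"
  by (metis ip_commute ip_add)

lemma ip_quad: "x \<in> X \<Longrightarrow> y \<in> X \<Longrightarrow> ip (x + t *\<^sub>R y) (x + t *\<^sub>R y) = ip x x + 2 * t * ip x y + t\<^sup>2 * ip y y"
  by (simp add: ip_add ip_add_right ip_scale ip_scale_right in_X ip_commute[of y x] power2_eq_square algebra_simps)

lemma ip_diff_self: "x \<in> X \<Longrightarrow> y \<in> X \<Longrightarrow> ip (x - y) (x - y) = ip x x - 2 * ip x y + ip y y"
  using ip_quad[of x y "-1"] by simp

lemma ip_sum_bound: "x \<in> X \<Longrightarrow> y \<in> X \<Longrightarrow> ip (x + y) (x + y) \<le> 2 * (ip x x + ip y y)"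
  using ip_quad[of x y 1] ip_diff_self[of x y] ip_nonneg[of "x - y"] in_X by simp

lemma ip_minus_commute: "x \<in> X \<Longrightarrow> y \<in> X \<Longrightarrow> ip (x - y) (x - y) = ip (y - x) (y - x)"
  by (simp add: ip_diff_self ip_commute[of y x])

lemma ip_tendsto_zero_add:
  assumes "\<And>n. x n \<in> X" "\<And>n. y n \<in> X" "(\<lambda>n. ip (x n) (x n)) \<longlonglongrightarrow> 0" "(\<lambda>n. ip (y n) (y n)) \<longlonglongrightarrow> 0"
  shows "(\<lambda>n. ip (x n + y n) (x n + y n)) \<longlonglongrightarrow> 0"
proof -
  have "(\<lambda>n. 2 * (ip (x n) (x n) + ip (y n) (y n))) \<longlonglongrightarrow> 2 * (0 + 0)" by (intro tendsto_intros assms)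
  then have "(\<lambda>n. 2 * (ip (x n) (x n) + ip (y n) (y n))) \<longlonglongrightarrow> 0" by simp
  then show ?thesis
    by (rule tendsto_sandwich[OF _ _ tendsto_const, rotated 2])
      (intro always_eventually allI ip_nonneg ip_sum_bound in_X assms)+
qed

lemma ip_cauchy_schwarz: assumes x: "x \<in> X" and y: "y \<in> X" shows "(ip x y)\<^sup>2 \<le> ip x x * ip y y"
proof (cases "ip y y = 0")
  case True
  have "ip x y = 0"
  proof (rule ccontr)
    assume "ip x y \<noteq> 0"
    then have "ip (x + (- (ip x x + 1) / (2 * ip x y)) *\<^sub>R y) (x + (- (ip x x + 1) / (2 * ip x y)) *\<^sub>R y) = - 1"
      using ip_quad[OF x y, of "- (ip x x + 1) / (2 * ip x y)"] True by (simp add: field_simps)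
    then show False using ip_nonneg[of "x + (- (ip x x + 1) / (2 * ip x y)) *\<^sub>R y"] in_X x y by simp
  qed
  then show ?thesis using True by simp
next
  case False
  then have p: "0 < ip y y" using ip_nonneg[OF y] by simp
  have "0 \<le> ip (x + (- ip x y / ip y y) *\<^sub>R y) (x + (- ip x y / ip y y) *\<^sub>R y)" using x y by (intro ip_nonneg in_X)
  also have "\<dots> = ip x x - (ip x y)\<^sup>2 / ip y y"
    unfolding ip_quad[OF x y] using p by (simp add: power2_eq_square field_simps)
  finally show ?thesis using p by (simp add: field_simps)
qed

lemma ip_tendsto:
  assumes x: "\<And>n. x n \<in> X" "x' \<in> X" and y: "y \<in> X" and l: "(\<lambda>n. ip (x n - x') (x n - x')) \<longlonglongrightarrow> 0"
  shows "(\<lambda>n. ip (x n) y) \<longlonglongrightarrow> ip x' y"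
proof -
  have "(\<lambda>n. sqrt (ip (x n - x') (x n - x') * ip y y)) \<longlonglongrightarrow> sqrt (0 * ip y y)"
    by (intro tendsto_intros l)
  then have s: "(\<lambda>n. sqrt (ip (x n - x') (x n - x') * ip y y)) \<longlonglongrightarrow> 0" by simp
  have d: "ip (x n) y - ip x' y = ip (x n - x') y" for n
    using ip_add[of "x n - x'" x' y] x y in_X by simp
  have "(\<lambda>n. ip (x n) y - ip x' y) \<longlonglongrightarrow> 0"
  proof (rule Lim_null_comparison[OF _ s])
    show "\<forall>\<^sub>F n in sequentially. norm (ip (x n) y - ip x' y) \<le> sqrt (ip (x n - x') (x n - x') * ip y y)"
      unfolding d using ip_cauchy_schwarz x y in_X by (intro always_eventually allI) (auto intro!: real_le_rsqrt)
  qed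
  then show ?thesis by (simp add: LIM_zero_iff)
qed

end

lemma sobolev_subspace: "subspace (sobolev k UNIV)"
  by (simp add: subspace_def sobolev_zero sobolev_add sobolev_scaleR del: sobolev_Suc_iff)

interpretation sob: semi_inner "sobolev k UNIV" "sip k" for k
proof
  show "subspace (sobolev k UNIV)" by (rule sobolev_subspace)
qed (rule sip_add_left sip_scaleR_left sip_commute sip_nonneg; assumption?)+

interpretation l2: semi_inner "Collect (L2 UNIV)" l2ip
proof -
  have X: "sobolev 0 UNIV = Collect (L2 UNIV)" by auto
  have ip: "sip 0 = l2ip" by (intro ext) simp
  show "semi_inner (Collect (L2 UNIV)) l2ip" using sob.semi_inner_axioms[of 0] unfolding X ip .
qed

section \<open>Density of test functions\<close>

lemma minimizing_residual_vanishes: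
  fixes d q :: real
  assumes "\<And>t. 0 \<le> 2 * t * d + t\<^sup>2 * q" shows "d = 0"
proof (rule ccontr)
  assume "d \<noteq> 0"
  define s where "s = \<bar>q\<bar> + 1"
  have s: "0 < s" "q < s" by (auto simp: s_def)
  have "0 \<le> 2 * (- d / s) * d + (- d / s)\<^sup>2 * q" by (rule assms)
  also have "\<dots> \<le> 2 * (- d / s) * d + (- d / s)\<^sup>2 * s" using s by (intro add_left_mono mult_left_mono) auto
  also have "\<dots> = - (d\<^sup>2 / s)" using s by (simp add: power2_eq_square field_simps)
  finally have "d\<^sup>2 / s \<le> 0" by simp
  moreover have "0 < d\<^sup>2 / s" using s \<open>d \<noteq> 0\<close> by simp
  ultimately show False by linarith
qed

lemma test_fun_subspace: "test_fun UNIV \<phi> \<Longrightarrow> test_fun UNIV \<psi> \<Longrightarrow> test_fun UNIV (\<phi> + t *\<^sub>R \<psi>)"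
  using test_fun_add[of \<phi> "\<lambda>x. t *\<^sub>R \<psi> x"] test_fun_bounded_linear[OF bounded_linear_scaleR_right, of \<psi> t]
  by (simp add: plus_fun_def scaleR_fun_def)

lemma test_fun_zero: "test_fun UNIV 0"
  by (simp add: test_fun_iff smooth_def Ck_zero zero_fun_def)

text \<open>By orthogonality: a minimizing sequence of test functions converges to some \<open>g\<close>, the residual \<open>f - g\<close> is orthogonal to all test functions, and the fundamental lemma makes it zero.\<close>

theorem test_fun_dense_L2:
  fixes f :: "real ^ 'd::finite \<Rightarrow> 'b::euclidean_space"
  assumes f: "L2 UNIV f" and e: "0 < e"
  shows "\<exists>\<phi>. test_fun UNIV \<phi> \<and> l2ip (f - \<phi>) (f - \<phi>) < e"
proof -
  define S where "S = {l2ip (f - \<phi>) (f - \<phi>) | \<phi>. test_fun UNIV \<phi>}"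
  define m where "m = Inf S"
  have bdd: "bdd_below S" unfolding S_def by (rule bdd_belowI[of _ 0]) (auto simp: l2ip_nonneg)
  have ne: "S \<noteq> {}" unfolding S_def using test_fun_zero by blast
  have mle: "m \<le> l2ip (f - \<phi>) (f - \<phi>)" if "test_fun UNIV \<phi>" for \<phi>
    unfolding m_def using that by (intro cInf_lower bdd) (auto simp: S_def)
  have "\<exists>\<phi>. test_fun UNIV \<phi> \<and> l2ip (f - \<phi>) (f - \<phi>) < m + inverse (real (Suc n))" for n
  proof -
    have "\<exists>z\<in>S. z < m + inverse (real (Suc n))"
      unfolding m_def by (rule cInf_lessD[OF ne]) (simp add: inverse_positive_iff_positive)
    then show ?thesis by (auto simp: S_def)
  qed
  then have "\<forall>n. \<exists>\<phi>. test_fun UNIV \<phi> \<and> l2ip (f - \<phi>) (f - \<phi>) < m + inverse (real (Suc n))" by blast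
  from choice[OF this] obtain p where p: "\<And>n. test_fun UNIV (p n)"
    "\<And>n. l2ip (f - p n) (f - p n) < m + inverse (real (Suc n))" by blast
  have pL: "L2 UNIV (p n)" for n by (rule test_fun_L2[OF p(1)])
  have quad: "0 \<le> 2 * t * l2ip (f - p n) \<psi> + t\<^sup>2 * l2ip \<psi> \<psi> + inverse (real (Suc n))" if "test_fun UNIV \<psi>" for \<psi> t n
  proof -
    have "m \<le> l2ip (f - (p n + (- t) *\<^sub>R \<psi>)) (f - (p n + (- t) *\<^sub>R \<psi>))"
      by (rule mle[OF test_fun_subspace[OF p(1) that]])
    also have "f - (p n + (- t) *\<^sub>R \<psi>) = (f - p n) + t *\<^sub>R \<psi>" by (simp add: algebra_simps)
    also have "l2ip \<dots> \<dots> = l2ip (f - p n) (f - p n) + 2 * t * l2ip (f - p n) \<psi> + t\<^sup>2 * l2ip \<psi> \<psi>"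
      by (rule l2.ip_quad) (auto intro: L2_diff f pL test_fun_L2[OF that])
    finally show ?thesis using p(2)[of n] by linarith
  qed
  have C: "\<exists>N. \<forall>i\<ge>N. \<forall>k\<ge>N. l2ip (p i - p k) (p i - p k) < r" if r: "0 < r" for r
  proof -
    obtain N where N: "inverse (real (Suc N)) < r / 4" using reals_Archimedean[of "r / 4"] r by auto
    have "l2ip (p i - p k) (p i - p k) < r" if "N \<le> i" "N \<le> k" for i k
    proof -
      define x y where "x = f - p i" and "y = f - p k"
      have L: "x \<in> Collect (L2 UNIV)" "y \<in> Collect (L2 UNIV)" by (auto simp: x_def y_def intro: L2_diff f pL)
      have "f - (1/2) *\<^sub>R (p i + p k) = (1/2) *\<^sub>R (x + y)"
      proof -
        have "x + y = (f + f) - (p i + p k)" by (simp add: x_def y_def)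
        then show ?thesis by (simp only: scaleR_diff_right scaleR_half_double)
      qed
      moreover have "test_fun UNIV ((1/2) *\<^sub>R (p i + p k))"
      proof -
        have "test_fun UNIV (p i + 1 *\<^sub>R p k)" by (rule test_fun_subspace[OF p(1) p(1)])
        then show ?thesis using test_fun_subspace[OF test_fun_zero, of "p i + p k" "1/2"] by simp
      qed
      ultimately have "m \<le> l2ip ((1/2) *\<^sub>R (x + y)) ((1/2) *\<^sub>R (x + y))" using mle by metis
      also have "\<dots> = (1/4) * l2ip (x + y) (x + y)" 
        by (subst l2.ip_scale[OF l2.in_X(1)[OF L]], subst l2.ip_scale_right[OF l2.in_X(1)[OF L]]) simp
      also have "l2ip (x + y) (x + y) = 2 * l2ip x x + 2 * l2ip y y - l2ip (x - y) (x - y)"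
        using l2.ip_quad[OF L, of 1] l2.ip_diff_self[OF L] by simp
      finally have "l2ip (x - y) (x - y) \<le> 2 * (l2ip x x - m) + 2 * (l2ip y y - m)" by simp
      moreover have "l2ip x x - m < inverse (real (Suc i))" "l2ip y y - m < inverse (real (Suc k))"
        using p(2) by (auto simp: x_def y_def algebra_simps)
      moreover have "inverse (real (Suc i)) \<le> inverse (real (Suc N))" "inverse (real (Suc k)) \<le> inverse (real (Suc N))"
        using that by (auto intro!: le_imp_inverse_le)
      moreover have "X < r" if "X \<le> 2 * a + 2 * c" "a < u" "c < v" "u \<le> w" "v \<le> w" "w < r / 4" for X a c u v w :: real
        using that by linarith
      ultimately have "l2ip (x - y) (x - y) < r" using N by blast
      moreover have "l2ip (x - y) (x - y) = l2ip (p i - p k) (p i - p k)"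
      proof -
        have "x - y = p k - p i" by (simp add: x_def y_def)
        then show ?thesis using l2.ip_minus_commute[of "p k" "p i"] pL by simp
      qed
      ultimately show ?thesis by simp
    qed
    then show ?thesis by blast
  qed
  obtain h where h: "L2 UNIV h" "(\<lambda>n. l2ip (p n - h) (p n - h)) \<longlonglongrightarrow> 0" by (rule L2_complete[OF pL C])
  have lim: "(\<lambda>n. l2ip ((f - p n) - (f - h)) ((f - p n) - (f - h))) \<longlonglongrightarrow> 0"
  proof -
    have "(f - p n) - (f - h) = h - p n" for n by simp
    then show ?thesis using h l2.ip_minus_commute[of h] pL by simp
  qed
  have orth: "l2ip (f - h) \<psi> = 0" if t: "test_fun UNIV \<psi>" for \<psi>
  proof (rule minimizing_residual_vanishes)
    fix t
    have "(\<lambda>n. 2 * t * l2ip (f - p n) \<psi> + t\<^sup>2 * l2ip \<psi> \<psi> + inverse (real (Suc n)))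
        \<longlonglongrightarrow> 2 * t * l2ip (f - h) \<psi> + t\<^sup>2 * l2ip \<psi> \<psi> + 0"
      by (intro tendsto_intros l2.ip_tendsto LIMSEQ_inverse_real_of_nat)
        (auto intro: L2_diff f pL h test_fun_L2[OF that] simp del: minus_apply intro!: lim[simplified])
    then show "0 \<le> 2 * t * l2ip (f - h) \<psi> + t\<^sup>2 * l2ip \<psi> \<psi>"
      using quad[OF that] by (auto intro: LIMSEQ_le_const)
  qed
  have fh: "L2 UNIV (f - h)" by (rule L2_diff[OF f h(1)])
  have "AE x in lebesgue. (f - h) x = 0"
  proof (rule fundamental_lemma[OF fh])
    fix \<phi> :: "real ^ 'd \<Rightarrow> real" assume t: "test_fun UNIV \<phi>"
    show "(\<integral>x. \<phi> x *\<^sub>R (f - h) x \<partial>lebesgue) = 0"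
    proof (rule euclidean_eqI)
      fix b :: 'b assume "b \<in> Basis"
      have "(\<integral>x. \<phi> x *\<^sub>R (f - h) x \<partial>lebesgue) \<bullet> b = (\<integral>x. (\<phi> x *\<^sub>R (f - h) x) \<bullet> b \<partial>lebesgue)"
        by (rule integral_inner_left[symmetric]) (rule L2_scaleR_integrable[OF test_fun_L2[OF t] fh])
      also have "\<dots> = l2ip (f - h) (\<lambda>x. \<phi> x *\<^sub>R b)"
        unfolding l2ip_def by (simp add: inner_commute)
      also have "\<dots> = 0"
        by (rule orth) (rule test_fun_bounded_linear[OF bounded_linear_scaleR_left t])
      finally show "(\<integral>x. \<phi> x *\<^sub>R (f - h) x \<partial>lebesgue) \<bullet> b = 0 \<bullet> b" by simp
    qed
  qed
  then have z: "l2ip (f - h) \<psi> = 0" for \<psi>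
    using l2ip_cong_AE[of "f - h" "\<lambda>x. 0" \<psi> \<psi>] by (simp add: l2ip_def)
  have pl: "(\<lambda>n. l2ip (f - p n) (f - p n)) \<longlonglongrightarrow> 0"
  proof -
    have "l2ip (f - p n) (f - p n) = l2ip (p n - h) (p n - h)" for n
    proof (rule l2ip_cong_AE[of "f - p n" "h - p n" "f - p n" "h - p n", THEN trans])
      show "AE x in lebesgue. (f - p n) x = (h - p n) x" 
        using \<open>AE x in lebesgue. (f - h) x = 0\<close> by (rule eventually_mono) simp
      then show "AE x in lebesgue. (f - p n) x = (h - p n) x" .
      show "l2ip (h - p n) (h - p n) = l2ip (p n - h) (p n - h)"
        using l2.ip_minus_commute[of h "p n"] pL h by simp
    qed
    then show ?thesis using h(2) by simp
  qed
  obtain n where "l2ip (f - p n) (f - p n) < e"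
    using order_tendstoD(2)[OF pl e] unfolding eventually_sequentially by (meson order_refl)
  then show ?thesis using p(1) by blast
qed

section \<open>Mollification\<close>

lemma has_derivative_pd:
  fixes f :: "real ^ 'd::finite \<Rightarrow> 'b::real_normed_vector"
  assumes "f differentiable (at x)"
  shows "(f has_derivative (\<lambda>h. \<Sum>j\<in>UNIV. (h $ j) *\<^sub>R pd j f x)) (at x)"
proof -
  have d: "(f has_derivative frechet_derivative f (at x)) (at x)" using assms by (simp add: frechet_derivative_works)
  interpret D: linear "frechet_derivative f (at x)" by (rule has_derivative_linear[OF d])
  have "frechet_derivative f (at x) h = (\<Sum>j\<in>UNIV. (h $ j) *\<^sub>R pd j f x)" for h
  proof -
    have "h = (\<Sum>j\<in>UNIV. (h $ j) *\<^sub>R axis j 1)"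
      using basis_expansion[of h] by (simp add: scalar_mult_eq_scaleR)
    then have "frechet_derivative f (at x) h = frechet_derivative f (at x) (\<Sum>j\<in>UNIV. (h $ j) *\<^sub>R axis j 1)" by simp
    then show ?thesis by (simp add: D.sum D.scale pd_def)
  qed
  then have "frechet_derivative f (at x) = (\<lambda>h. \<Sum>j\<in>UNIV. (h $ j) *\<^sub>R pd j f x)" by (rule ext)
  with d show ?thesis by (simp only:)
qed

lemma test_fun_gradient_bound:
  fixes \<phi> :: "real ^ 'd::finite \<Rightarrow> 'b::euclidean_space"
  assumes t: "test_fun UNIV \<phi>"
  obtains L where "0 < L" "\<And>x h. norm (\<Sum>j\<in>UNIV. (h $ j) *\<^sub>R pd j \<phi> x) \<le> L * norm h"
    "\<And>x y. norm (\<phi> x - \<phi> y) \<le> L * norm (x - y)"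
proof -
  have "\<exists>K. 0 < K \<and> (\<forall>x. norm (pd j \<phi> x) \<le> K)" for j
    using test_fun_norm_bound[OF test_fun_pd[OF t]] by metis
  then have "\<forall>j. \<exists>K. 0 < K \<and> (\<forall>x. norm (pd j \<phi> x) \<le> K)" by blast
  from choice[OF this] obtain K where K: "\<And>j. 0 < K j" "\<And>j x. norm (pd j \<phi> x) \<le> K j" by blast
  define L where "L = (\<Sum>j\<in>UNIV. K j)"
  have L: "0 < L" unfolding L_def by (intro sum_pos) (auto simp: K)
  have g: "norm (\<Sum>j\<in>UNIV. (h $ j) *\<^sub>R pd j \<phi> x) \<le> L * norm h" for x h
  proof -
    have "norm (\<Sum>j\<in>UNIV. (h $ j) *\<^sub>R pd j \<phi> x) \<le> (\<Sum>j\<in>UNIV. norm ((h $ j) *\<^sub>R pd j \<phi> x))" by (rule norm_sum)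
    also have "\<dots> \<le> (\<Sum>j\<in>UNIV. norm h * K j)"
      using K component_le_norm_cart[of h] by (intro sum_mono) (auto intro!: mult_mono)
    finally show ?thesis by (simp add: L_def sum_distrib_left mult.commute)
  qed
  have "norm (\<phi> x - \<phi> y) \<le> L * norm (x - y)" for x y
  proof (rule differentiable_bound[of UNIV])
    fix z show "(\<phi> has_derivative (\<lambda>h. \<Sum>j\<in>UNIV. (h $ j) *\<^sub>R pd j \<phi> z)) (at z within UNIV)"
      using has_derivative_pd[OF smooth_differentiable[OF test_fun_smooth[OF t]]] by simp
    show "onorm (\<lambda>h. \<Sum>j\<in>UNIV. (h $ j) *\<^sub>R pd j \<phi> z) \<le> L" by (rule onorm_bound) (use g L in auto)
  qed auto
  then show ?thesis using that L g by blast
qed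

lemma scaled_cball_integrable:
  fixes f :: "real ^ 'd::finite \<Rightarrow> 'b::euclidean_space"
  assumes f: "L2 UNIV f"
  shows "integrable lebesgue (\<lambda>x. K * indicator (cball 0 R) x * norm (f x))"
proof -
  have "integrable lebesgue (\<lambda>x. norm (indicator (cball 0 R) x :: real) * norm (f x))"
    by (rule L2_norm_mult_integrable[OF indicator_cball_L2 f])
  then have "integrable lebesgue (\<lambda>x. K * (norm (indicator (cball 0 R) x :: real) * norm (f x)))" by simp
  then show ?thesis by (simp add: mult.assoc)
qed

definition conv :: "(real ^ 'd::finite \<Rightarrow> real) \<Rightarrow> (real ^ 'd \<Rightarrow> 'b::euclidean_space) \<Rightarrow> real ^ 'd \<Rightarrow> 'b" where
  "conv \<eta> f x = (\<integral>y. \<eta> (x - y) *\<^sub>R f y \<partial>lebesgue)"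

lemma test_fun_reflect: "test_fun UNIV \<eta> \<Longrightarrow> test_fun UNIV (\<lambda>y. \<eta> (x - y))"
  using test_fun_affine[of \<eta> "-1" x] by simp

lemma conv_integrable: "test_fun UNIV \<eta> \<Longrightarrow> L2 UNIV f \<Longrightarrow> integrable lebesgue (\<lambda>y. \<eta> (x - y) *\<^sub>R f y)"
  by (rule L2_scaleR_integrable[OF test_fun_L2[OF test_fun_reflect]])

lemma conv_diff: "test_fun UNIV \<eta> \<Longrightarrow> L2 UNIV f \<Longrightarrow> L2 UNIV g \<Longrightarrow> conv \<eta> (f - g) = conv \<eta> f - conv \<eta> g"
  by (rule ext) (simp add: conv_def scaleR_diff_right conv_integrable)

lemma conv_cong_AE: "AE x in lebesgue. f x = g x \<Longrightarrow> conv \<eta> f = conv \<eta> g"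
  unfolding conv_def by (intro ext AE_scaleR_integral_cong)

text \<open>Differentiation under the integral, by dominated convergence; all difference quotients of a test function are bounded by a multiple of the indicator of one ball.\<close>

lemma conv_has_derivative:
  fixes f :: "real ^ 'd::finite \<Rightarrow> 'b::euclidean_space"
  assumes t: "test_fun UNIV \<eta>" and f: "L2 UNIV f"
  shows "(conv \<eta> f has_derivative (\<lambda>h. \<Sum>j\<in>UNIV. (h $ j) *\<^sub>R conv (pd j \<eta>) f x)) (at x)"
  unfolding has_derivative_at
proof
  show "bounded_linear (\<lambda>h. \<Sum>j\<in>UNIV. (h $ j) *\<^sub>R conv (pd j \<eta>) f x)"
    by (intro bounded_linear_sum bounded_linear_scaleR_left[THEN bounded_linear_compose] bounded_linear_vec_nth)
  obtain L where L: "0 < L" "\<And>x h. norm (\<Sum>j\<in>UNIV. (h $ j) *\<^sub>R pd j \<eta> x) \<le> L * norm h"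
    "\<And>x y. norm (\<eta> x - \<eta> y) \<le> L * norm (x - y)" using test_fun_gradient_bound[OF t] by blast
  obtain R where R: "0 < R" "\<And>x. R < norm x \<Longrightarrow> \<eta> x = 0" using test_fun_supportE[OF t] by blast
  have Rp: "pd j \<eta> x = 0" if "R < norm x" for x j by (rule pd_eq_0_outside[of R \<eta>, OF R(2) that])
  have [measurable]: "f \<in> borel_measurable lebesgue" by (rule L2_measurable[OF f])
  show "((\<lambda>h. norm (conv \<eta> f (x + h) - conv \<eta> f x - (\<Sum>j\<in>UNIV. (h $ j) *\<^sub>R conv (pd j \<eta>) f x)) / norm h) \<longlongrightarrow> 0) (at 0)"
    unfolding tendsto_at_iff_sequentially
  proof (intro allI impI)
    fix X :: "nat \<Rightarrow> real ^ 'd" assume X: "\<forall>i. X i \<in> UNIV - {0}" and X0: "X \<longlonglongrightarrow> 0"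
    have Xn: "X n \<noteq> 0" for n using X by auto
    obtain H where "\<forall>y\<in>range X. norm y \<le> H" using convergent_imp_bounded[OF X0] unfolding bounded_iff by blast
    then have H: "norm (X n) \<le> H" for n by blast
    define r where "r n y = (\<eta> (x + X n - y) - \<eta> (x - y) - (\<Sum>j\<in>UNIV. (X n $ j) * pd j \<eta> (x - y))) / norm (X n)" for n y
    have eq: "(conv \<eta> f (x + X n) - conv \<eta> f x - (\<Sum>j\<in>UNIV. (X n $ j) *\<^sub>R conv (pd j \<eta>) f x)) /\<^sub>R norm (X n)
        = (\<integral>y. r n y *\<^sub>R f y \<partial>lebesgue)" for n
    proof -
      note I = conv_integrable[OF t f] conv_integrable[OF test_fun_pd[OF t] f]
      have "(\<integral>y. r n y *\<^sub>R f y \<partial>lebesgue) = (\<integral>y. (\<eta> (x + X n - y) *\<^sub>R f y - \<eta> (x - y) *\<^sub>R f y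
          - (\<Sum>j\<in>UNIV. (X n $ j) *\<^sub>R (pd j \<eta> (x - y) *\<^sub>R f y))) /\<^sub>R norm (X n) \<partial>lebesgue)"
      proof (rule Bochner_Integration.integral_cong[OF refl])
        fix y
        have "r n y *\<^sub>R f y = ((\<eta> (x + X n - y) - \<eta> (x - y) - (\<Sum>j\<in>UNIV. (X n $ j) * pd j \<eta> (x - y))) *\<^sub>R f y) /\<^sub>R norm (X n)"
          by (simp only: r_def divide_inverse scaleR_scaleR mult.commute)
        then show "r n y *\<^sub>R f y = (\<eta> (x + X n - y) *\<^sub>R f y - \<eta> (x - y) *\<^sub>R f y
          - (\<Sum>j\<in>UNIV. (X n $ j) *\<^sub>R (pd j \<eta> (x - y) *\<^sub>R f y))) /\<^sub>R norm (X n)"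
          by (simp only: scaleR_diff_left scaleR_sum_left scaleR_scaleR)
      qed
      also have "\<dots> = (\<integral>y. \<eta> (x + X n - y) *\<^sub>R f y - \<eta> (x - y) *\<^sub>R f y
          - (\<Sum>j\<in>UNIV. (X n $ j) *\<^sub>R (pd j \<eta> (x - y) *\<^sub>R f y)) \<partial>lebesgue) /\<^sub>R norm (X n)"
        by (rule integral_scaleR_right)
      also have "(\<integral>y. \<eta> (x + X n - y) *\<^sub>R f y - \<eta> (x - y) *\<^sub>R f y
          - (\<Sum>j\<in>UNIV. (X n $ j) *\<^sub>R (pd j \<eta> (x - y) *\<^sub>R f y)) \<partial>lebesgue) =
          conv \<eta> f (x + X n) - conv \<eta> f x - (\<Sum>j\<in>UNIV. (X n $ j) *\<^sub>R conv (pd j \<eta>) f x)"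
        unfolding conv_def using I
        by (simp add: Bochner_Integration.integral_diff Bochner_Integration.integral_sum Bochner_Integration.integrable_sum
          integrable_scaleR_right del: scaleR_scaleR)
      finally show ?thesis by simp
    qed
    have rm: "r n \<in> borel_measurable lebesgue" for n
    proof -
      note [measurable] = test_fun_measurable[OF test_fun_reflect[OF t]]
        test_fun_measurable[OF test_fun_reflect[OF test_fun_pd[OF t]]]
      have "(\<lambda>y. (\<eta> (x + X n - y) - \<eta> (x - y) - (\<Sum>j\<in>UNIV. (X n $ j) * pd j \<eta> (x - y))) / norm (X n))
          \<in> borel_measurable lebesgue"
        by (intro borel_measurable_divide borel_measurable_diff borel_measurable_sum borel_measurable_times
            borel_measurable_const) measurable
      then show ?thesis by (simp only: r_def[abs_def])
    qed
    have rb: "norm (r n y) \<le> 2 * L" for n y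
    proof -
      have "norm (\<eta> (x + X n - y) - \<eta> (x - y) - (\<Sum>j\<in>UNIV. (X n $ j) * pd j \<eta> (x - y))) \<le> L * norm (X n) + L * norm (X n)"
      proof (rule order_trans[OF norm_triangle_ineq4 add_mono])
        have "(x + X n - y) - (x - y) = X n" by simp
        then show "norm (\<eta> (x + X n - y) - \<eta> (x - y)) \<le> L * norm (X n)"
          using L(3)[of "x + X n - y" "x - y"] by (simp only:)
        show "norm (\<Sum>j\<in>UNIV. (X n $ j) * pd j \<eta> (x - y)) \<le> L * norm (X n)"
          using L(2)[of "X n" "x - y"] by simp
      qed
      then show ?thesis using Xn[of n] by (simp add: r_def field_simps)
    qed
    have rs: "r n y = 0" if "R + norm x + H < norm y" for n y
    proof -
      have "R < norm (x - y)" using norm_triangle_ineq2[of y x] that H[of n] norm_ge_zero[of "X n"] norm_minus_commute[of x y] by linarith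
      moreover have "R < norm (x + X n - y)"
        using norm_triangle_ineq2[of y "x + X n"] norm_triangle_ineq[of x "X n"] that H[of n] norm_minus_commute[of "x + X n" y] by linarith
      ultimately show ?thesis by (simp add: r_def R Rp)
    qed
    have rl: "(\<lambda>n. r n y) \<longlonglongrightarrow> 0" for y
    proof -
      have "((\<lambda>h. norm (\<eta> ((x - y) + h) - \<eta> (x - y) - (\<Sum>j\<in>UNIV. (h $ j) *\<^sub>R pd j \<eta> (x - y))) / norm h) \<longlongrightarrow> 0) (at 0)"
        using has_derivative_pd[OF smooth_differentiable[OF test_fun_smooth[OF t]], of "x - y"] by (simp add: has_derivative_at)
      then have "((\<lambda>h. norm (\<eta> ((x - y) + h) - \<eta> (x - y) - (\<Sum>j\<in>UNIV. (h $ j) *\<^sub>R pd j \<eta> (x - y))) / norm h) \<circ> X) \<longlonglongrightarrow> 0"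
        unfolding tendsto_at_iff_sequentially using X X0 by blast
      then have "(\<lambda>n. norm (r n y)) \<longlonglongrightarrow> 0" by (simp add: o_def r_def add_diff_eq diff_add_eq)
      then show ?thesis by (rule tendsto_norm_zero_cancel)
    qed
    have "(\<lambda>n. \<integral>y. r n y *\<^sub>R f y \<partial>lebesgue) \<longlonglongrightarrow> (\<integral>y. 0 *\<^sub>R f y \<partial>lebesgue)"
    proof (rule integral_dominated_convergence)
      show "integrable lebesgue (\<lambda>y. (2 * L) * indicator (cball 0 (R + norm x + H)) y * norm (f y))"
        by (rule scaled_cball_integrable[OF f])
      show "AE y in lebesgue. (\<lambda>n. r n y *\<^sub>R f y) \<longlonglongrightarrow> 0 *\<^sub>R f y" by (intro AE_I2 tendsto_intros rl)
      show "(\<lambda>y. r n y *\<^sub>R f y) \<in> borel_measurable lebesgue" for n using rm[of n] by measurable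
      show "AE y in lebesgue. norm (r n y *\<^sub>R f y) \<le> (2 * L) * indicator (cball 0 (R + norm x + H)) y * norm (f y)" for n
      proof (rule AE_I2)
        fix y
        show "norm (r n y *\<^sub>R f y) \<le> (2 * L) * indicator (cball 0 (R + norm x + H)) y * norm (f y)"
          using rs[of y n] rb[of n y] by (cases "norm y \<le> R + norm x + H") (auto simp: not_le intro!: mult_right_mono)
      qed
    qed measurable
    then have "(\<lambda>n. norm ((conv \<eta> f (x + X n) - conv \<eta> f x - (\<Sum>j\<in>UNIV. (X n $ j) *\<^sub>R conv (pd j \<eta>) f x)) /\<^sub>R norm (X n))) \<longlonglongrightarrow> 0"
      unfolding eq by (intro tendsto_norm_zero) simp
    then show "((\<lambda>h. norm (conv \<eta> f (x + h) - conv \<eta> f x - (\<Sum>j\<in>UNIV. (h $ j) *\<^sub>R conv (pd j \<eta>) f x)) / norm h) \<circ> X) \<longlonglongrightarrow> 0"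
      by (simp add: o_def divide_inverse mult.commute)
  qed
qed

lemma conv_differentiable: "test_fun UNIV \<eta> \<Longrightarrow> L2 UNIV f \<Longrightarrow> conv \<eta> f differentiable (at x)"
  using conv_has_derivative unfolding differentiable_def by blast

lemma pd_conv: "test_fun UNIV \<eta> \<Longrightarrow> L2 UNIV f \<Longrightarrow> pd j (conv \<eta> f) = conv (pd j \<eta>) f"
proof (rule ext)
  fix x assume "test_fun UNIV \<eta>" "L2 UNIV f"
  have "pd j (conv \<eta> f) x = (\<Sum>i\<in>UNIV. (axis j 1 $ i) *\<^sub>R conv (pd i \<eta>) f x)"
    by (rule pd_has_derivative[OF conv_has_derivative]) fact+
  also have "\<dots> = (\<Sum>i\<in>UNIV. if i = j then conv (pd i \<eta>) f x else 0)"
    by (rule sum.cong) (auto simp: axis_def)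
  finally show "pd j (conv \<eta> f) x = conv (pd j \<eta>) f x" by simp
qed

lemma conv_smooth: assumes "test_fun UNIV \<eta>" "L2 UNIV f" shows "smooth (conv \<eta> f)"
  unfolding smooth_def
proof
  fix n show "Ck n (conv \<eta> f)" using assms(1)
  proof (induction n arbitrary: \<eta>)
    case 0
    have "conv \<eta> f differentiable_on UNIV" using conv_differentiable[OF 0 assms(2)] by (simp add: differentiable_on_def)
    then show ?case by (simp add: differentiable_imp_continuous_on)
  next
    case (Suc n)
    then show ?case using pd_conv[OF Suc.prems assms(2)] conv_differentiable[OF Suc.prems assms(2)]
      by (simp add: test_fun_pd)
  qed
qed

lemma pd_reflect:
  assumes "test_fun UNIV \<eta>" shows "pd j (\<lambda>y. \<eta> (x - y)) y = - pd j \<eta> (x - y)"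
  using pd_affine[of \<eta> "-1" y x j] smooth_differentiable[OF test_fun_smooth[OF assms]] by simp

text \<open>A derivative of the kernel can be moved to \<open>f\<close>, because the reflected kernel is a test function in the variable of integration.\<close>

lemma conv_weak_pd:
  fixes f :: "real ^ 'd::finite \<Rightarrow> 'b::euclidean_space"
  assumes t: "test_fun UNIV \<eta>" and w: "has_weak_pd UNIV j f g"
  shows "conv (pd j \<eta>) f = conv \<eta> g"
proof (rule ext)
  fix x
  have "(\<integral>y. pd j (\<lambda>y. \<eta> (x - y)) y *\<^sub>R f y \<partial>lebesgue) = - (\<integral>y. \<eta> (x - y) *\<^sub>R g y \<partial>lebesgue)"
    using w test_fun_reflect[OF t, of x] by (auto simp: has_weak_pd_UNIV)
  then show "conv (pd j \<eta>) f x = conv \<eta> g x"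
    unfolding conv_def pd_reflect[OF t] by simp
qed

lemma difference_quotients:
  fixes \<psi> :: "real ^ 'd::finite \<Rightarrow> 'b::euclidean_space" and j :: 'd
  assumes t: "test_fun UNIV \<psi>"
  defines "q \<equiv> \<lambda>n x. (\<psi> (x + inverse (real (Suc n)) *\<^sub>R axis j 1) - \<psi> x) /\<^sub>R inverse (real (Suc n))"
  obtains L R where "\<And>n x. norm (q n x) \<le> L * indicator (cball 0 R) x" "\<And>n. test_fun UNIV (q n)"
    "\<And>x. (\<lambda>n. q n x) \<longlonglongrightarrow> pd j \<psi> x"
proof -
  obtain L where L: "0 < L" "\<And>x y. norm (\<psi> x - \<psi> y) \<le> L * norm (x - y)" using test_fun_gradient_bound[OF t] by metis
  obtain R where R: "0 < R" "\<And>x. R < norm x \<Longrightarrow> \<psi> x = 0" using test_fun_supportE[OF t] by blast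
  define h where "h n = inverse (real (Suc n))" for n
  have h: "0 < h n" "h n \<le> 1" for n by (auto simp: h_def field_simps)
  define e where "e = (axis j 1 :: real ^ 'd)"
  have e: "norm e = 1" by (simp add: e_def)
  have q_def: "q n x = (\<psi> (x + h n *\<^sub>R e) - \<psi> x) /\<^sub>R h n" for n x by (simp add: q_def h_def e_def)
  have bound: "norm (q n x) \<le> L * indicator (cball 0 (R + 1)) x" for n x
  proof -
    have "norm (\<psi> (x + h n *\<^sub>R e) - \<psi> x) \<le> L * h n" using L(2)[of "x + h n *\<^sub>R e" x] h[of n] e by simp
    moreover have "norm (q n x) = norm (\<psi> (x + h n *\<^sub>R e) - \<psi> x) / h n"
      unfolding q_def norm_scaleR using h(1)[of n] by (simp add: divide_inverse mult.commute)
    ultimately have 1: "norm (q n x) \<le> L" using h(1)[of n] by (simp add: pos_divide_le_eq)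
    have 2: "q n x = 0" if "R + 1 < norm x"
    proof -
      have "norm x \<le> norm (x + h n *\<^sub>R e) + norm (h n *\<^sub>R e)"
        using norm_triangle_ineq4[of "x + h n *\<^sub>R e" "h n *\<^sub>R e"] by simp
      then have "R < norm (x + h n *\<^sub>R e)" using that h[of n] e by simp
      then show ?thesis using R(2) that by (simp add: q_def)
    qed
    show ?thesis using 1 2 by (cases "norm x \<le> R + 1") (auto simp: not_le)
  qed
  have test: "test_fun UNIV (q n)" for n
  proof -
    have "test_fun UNIV (\<lambda>x. \<psi> (1 *\<^sub>R x + h n *\<^sub>R e))" by (rule test_fun_affine[OF t]) simp
    then have "test_fun UNIV (\<lambda>x. (\<psi> (1 *\<^sub>R x + h n *\<^sub>R e) + (-1) *\<^sub>R \<psi> x) /\<^sub>R h n)"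
      by (intro test_fun_bounded_linear[OF bounded_linear_scaleR_right] test_fun_add t)
    then show ?thesis unfolding q_def[abs_def] by simp
  qed
  have lim: "(\<lambda>n. q n x) \<longlonglongrightarrow> pd j \<psi> x" for x
  proof -
    have "((\<lambda>y. norm (\<psi> (x + y) - \<psi> x - (\<Sum>i\<in>UNIV. (y $ i) *\<^sub>R pd i \<psi> x)) / norm y) \<longlongrightarrow> 0) (at 0)"
      using has_derivative_pd[OF smooth_differentiable[OF test_fun_smooth[OF t]], of x] by (simp add: has_derivative_at)
    moreover have "(\<lambda>n. h n *\<^sub>R e) \<longlonglongrightarrow> 0 *\<^sub>R e" unfolding h_def by (intro tendsto_intros LIMSEQ_inverse_real_of_nat)
    moreover have "h n *\<^sub>R e \<noteq> 0" for n using h(1)[of n] e by auto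
    ultimately have *: "((\<lambda>y. norm (\<psi> (x + y) - \<psi> x - (\<Sum>i\<in>UNIV. (y $ i) *\<^sub>R pd i \<psi> x)) / norm y) \<circ> (\<lambda>n. h n *\<^sub>R e)) \<longlonglongrightarrow> 0"
      unfolding tendsto_at_iff_sequentially by simp
    have s: "(\<Sum>i\<in>UNIV. ((h n *\<^sub>R e) $ i) *\<^sub>R pd i \<psi> x) = h n *\<^sub>R pd j \<psi> x" for n
    proof -
      have "(\<Sum>i\<in>UNIV. ((h n *\<^sub>R e) $ i) *\<^sub>R pd i \<psi> x) = (\<Sum>i\<in>UNIV. if i = j then h n *\<^sub>R pd i \<psi> x else 0)"
        by (rule sum.cong) (auto simp: e_def axis_def)
      then show ?thesis by simp
    qed
    have "norm (\<psi> (x + h n *\<^sub>R e) - \<psi> x - h n *\<^sub>R pd j \<psi> x) / norm (h n *\<^sub>R e) = norm (q n x - pd j \<psi> x)" for n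
    proof -
      have "q n x - pd j \<psi> x = (\<psi> (x + h n *\<^sub>R e) - \<psi> x - h n *\<^sub>R pd j \<psi> x) /\<^sub>R h n"
        using h(1)[of n] by (simp add: q_def scaleR_diff_right)
      then show ?thesis using h(1)[of n] e by (simp add: divide_inverse mult.commute)
    qed
    then have "(\<lambda>n. norm (q n x - pd j \<psi> x)) \<longlonglongrightarrow> 0" using * by (simp only: o_def s)
    then show "(\<lambda>n. q n x) \<longlonglongrightarrow> pd j \<psi> x" by (simp only: tendsto_norm_zero_iff LIM_zero_iff)
  qed
  show ?thesis by (rule that[OF bound test lim])
qed

lemma difference_quotient_integral:
  fixes \<psi> :: "real ^ 'd::finite \<Rightarrow> 'b::euclidean_space" and g :: "real ^ 'd \<Rightarrow> real" and j :: 'd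
  assumes t: "test_fun UNIV \<psi>" and g: "continuous_on UNIV g"
  defines "q \<equiv> \<lambda>n x. (\<psi> (x + inverse (real (Suc n)) *\<^sub>R axis j 1) - \<psi> x) /\<^sub>R inverse (real (Suc n))"
  shows "(\<lambda>n. \<integral>x. g x *\<^sub>R q n x \<partial>lebesgue) \<longlonglongrightarrow> (\<integral>x. g x *\<^sub>R pd j \<psi> x \<partial>lebesgue)"
proof -
  obtain L R where q: "\<And>n x. norm (q n x) \<le> L * indicator (cball 0 R) x" "\<And>n. test_fun UNIV (q n)"
    "\<And>x. (\<lambda>n. q n x) \<longlonglongrightarrow> pd j \<psi> x"
    unfolding q_def by (rule difference_quotients[OF t, of j]) blast
  have "compact (g ` cball 0 R)" by (intro compact_continuous_image continuous_on_subset[OF g]) auto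
  from compact_imp_bounded[OF this] obtain K where "\<forall>y\<in>g ` cball 0 R. norm y \<le> K" unfolding bounded_iff by blast
  then have K: "norm (g x) \<le> K" if "x \<in> cball 0 R" for x using that by blast
  note [measurable] = test_fun_measurable[OF q(2)] test_fun_measurable[OF test_fun_pd[OF t]] continuous_lebesgue_measurable[OF g]
  show ?thesis
  proof (rule integral_dominated_convergence)
    show "integrable lebesgue (\<lambda>x. K * L * indicator (cball (0::real ^ 'd) R) x :: real)"
      using lmeasurable_cball[of "0::real ^ 'd" R]
      by (intro integrable_mult_right integrable_real_indicator) (auto simp: fmeasurable_def)
    show "AE x in lebesgue. norm (g x *\<^sub>R q n x) \<le> K * L * indicator (cball 0 R) x" for n
    proof (rule AE_I2)
      fix x
      show "norm (g x *\<^sub>R q n x) \<le> K * L * indicator (cball 0 R) x"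
      proof (cases "x \<in> cball 0 R")
        case True
        then have "norm (g x) * norm (q n x) \<le> K * L"
          using q(1)[of n x] K[OF True] by (intro mult_mono) (auto intro: order_trans[OF norm_ge_zero])
        then show ?thesis using True by simp
      next
        case False
        then show ?thesis using q(1)[of n x] by simp
      qed
    qed
  qed (auto intro!: AE_I2 tendsto_intros q(3))
qed

text \<open>By translation invariance all difference quotients have integral zero.\<close>

lemma integral_pd_zero:
  fixes \<psi> :: "real ^ 'd::finite \<Rightarrow> 'b::euclidean_space"
  assumes t: "test_fun UNIV \<psi>" shows "(\<integral>x. pd j \<psi> x \<partial>lebesgue) = 0"
proof -
  have [measurable]: "\<psi> \<in> borel_measurable borel"
    by (intro borel_measurable_continuous_onI smooth_continuous test_fun_smooth t)
  have shift: "test_fun UNIV (\<lambda>x. \<psi> (x + a))" for a using test_fun_affine[OF t, of 1 a] by simp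
  have eq: "(\<integral>x. \<psi> (x + a) \<partial>lebesgue) = (\<integral>x. \<psi> x \<partial>lebesgue)" for a
  proof -
    have "(\<integral>x. \<psi> x \<partial>lborel) = (\<integral>x. \<psi> x \<partial>(distr lborel borel ((+) a)))" by (simp add: lborel_distr_plus)
    also have "\<dots> = (\<integral>x. \<psi> (a + x) \<partial>lborel)" by (rule integral_distr) measurable
    finally show ?thesis by (simp add: integral_completion add.commute)
  qed
  have "(\<integral>x. 1 *\<^sub>R ((\<psi> (x + inverse (real (Suc n)) *\<^sub>R axis j 1) - \<psi> x) /\<^sub>R inverse (real (Suc n))) \<partial>lebesgue) = 0" for n
    by (simp add: eq test_fun_integrable[OF shift] test_fun_integrable[OF t])
  moreover have "(\<lambda>n. \<integral>x. 1 *\<^sub>R ((\<psi> (x + inverse (real (Suc n)) *\<^sub>R axis j 1) - \<psi> x) /\<^sub>R inverse (real (Suc n))) \<partial>lebesgue)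
      \<longlonglongrightarrow> (\<integral>x. 1 *\<^sub>R pd j \<psi> x \<partial>lebesgue)"
    by (rule difference_quotient_integral[OF t]) simp
  ultimately show ?thesis by (simp only: LIMSEQ_const_iff scaleR_one)
qed

lemma smooth_integration_by_parts:
  fixes \<phi> :: "real ^ 'd::finite \<Rightarrow> real" and F :: "real ^ 'd \<Rightarrow> 'b::euclidean_space"
  assumes t: "test_fun UNIV \<phi>" and F: "smooth F"
  shows "(\<integral>x. pd j \<phi> x *\<^sub>R F x \<partial>lebesgue) = - (\<integral>x. \<phi> x *\<^sub>R pd j F x \<partial>lebesgue)"
proof -
  have pd: "pd j (\<lambda>x. \<phi> x *\<^sub>R F x) = (\<lambda>x. pd j \<phi> x *\<^sub>R F x + \<phi> x *\<^sub>R pd j F x)"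
    by (rule ext, rule pd_scaleR) (auto intro: smooth_differentiable test_fun_smooth t F)
  have "0 = (\<integral>x. pd j \<phi> x *\<^sub>R F x + \<phi> x *\<^sub>R pd j F x \<partial>lebesgue)"
    using integral_pd_zero[OF test_fun_scaleR[OF t F], of j] by (simp add: pd)
  also have "\<dots> = (\<integral>x. pd j \<phi> x *\<^sub>R F x \<partial>lebesgue) + (\<integral>x. \<phi> x *\<^sub>R pd j F x \<partial>lebesgue)"
    by (intro Bochner_Integration.integral_add test_fun_integrable test_fun_scaleR test_fun_pd t F smooth_pd)
  finally show ?thesis by (simp add: eq_neg_iff_add_eq_0)
qed

lemma smooth_has_weak_pd:
  assumes "smooth F" "L2 UNIV F" "L2 UNIV (pd j F)"
  shows "has_weak_pd UNIV j F (pd j F)"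
  unfolding has_weak_pd_UNIV using assms smooth_integration_by_parts by blast

lemma test_fun_has_weak_pd:
  fixes \<phi> :: "real ^ 'd::finite \<Rightarrow> 'b::euclidean_space"
  shows "test_fun UNIV \<phi> \<Longrightarrow> has_weak_pd UNIV j \<phi> (pd j \<phi>)"
  by (intro smooth_has_weak_pd test_fun_smooth test_fun_L2 test_fun_pd)

lemma test_fun_sobolev:
  fixes \<phi> :: "real ^ 'd::finite \<Rightarrow> 'b::euclidean_space"
  shows "test_fun UNIV \<phi> \<Longrightarrow> \<phi> \<in> sobolev k UNIV"
proof (induction k arbitrary: \<phi>)
  case 0
  then show ?case by (simp add: test_fun_L2)
next
  case (Suc k)
  show ?case by (rule sobolev_Suc_I[OF test_fun_L2[OF Suc.prems] test_fun_has_weak_pd[OF Suc.prems]])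
    (rule Suc.IH[OF test_fun_pd[OF Suc.prems]])
qed

text \<open>Smoothness as defined does not contain the symmetry of second derivatives. It follows weakly, since difference quotients in one direction commute with the derivative in another.\<close>

lemma pd_commute_AE:
  fixes f :: "real ^ 'd::finite \<Rightarrow> 'b::euclidean_space"
  assumes t: "test_fun UNIV f"
  shows "AE x in lebesgue. pd i (pd j f) x = pd j (pd i f) x"
proof -
  have L: "L2 UNIV (pd a (pd b f))" for a b by (intro test_fun_L2 test_fun_pd t)
  have "AE x in lebesgue. (pd i (pd j f) - pd j (pd i f)) x = 0"
  proof (rule fundamental_lemma[OF L2_diff[OF L L]])
    fix \<phi> :: "real ^ 'd \<Rightarrow> real" assume p: "test_fun UNIV \<phi>"
    define q where "q g n x = (g (x + inverse (real (Suc n)) *\<^sub>R axis i 1) - g x) /\<^sub>R inverse (real (Suc n))"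
      for g :: "real ^ 'd \<Rightarrow> 'b" and n x
    have qt: "test_fun UNIV (q f n)" for n
      unfolding q_def[abs_def] by (rule difference_quotients[OF t, of i]) blast
    have sh: "(\<lambda>x. f (x + a)) differentiable (at x)" for a x
      using smooth_differentiable[OF test_fun_smooth[OF test_fun_affine[OF t, of 1 a]]] by simp
    have comm: "pd j (q f n) = q (pd j f) n" for n
    proof (rule ext)
      fix x
      let ?a = "inverse (real (Suc n)) *\<^sub>R axis i 1 :: real ^ 'd"
      have d: "f differentiable (at y)" for y by (rule smooth_differentiable[OF test_fun_smooth[OF t]])
      have dm: "(\<lambda>x. (-1) *\<^sub>R f x) differentiable (at x)" by (intro differentiable_scaleR d differentiable_const)
      have "pd j (\<lambda>x. (f (x + ?a) + (-1) *\<^sub>R f x) /\<^sub>R inverse (real (Suc n))) x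
          = (pd j (\<lambda>x. f (x + ?a)) x + (-1) *\<^sub>R pd j f x) /\<^sub>R inverse (real (Suc n))"
        by (subst pd_bounded_linear[OF bounded_linear_scaleR_right differentiable_add[OF sh dm]])
          (simp only: pd_add[OF sh dm] pd_bounded_linear[OF bounded_linear_scaleR_right d])
      moreover have "pd j (\<lambda>x. f (x + ?a)) x = pd j f (x + ?a)"
        using pd_affine[OF d, where r = 1 and a = ?a and x = x and j = j] by simp
      ultimately show "pd j (q f n) x = q (pd j f) n x" by (simp add: q_def[abs_def])
    qed
    have "(\<integral>x. pd j \<phi> x *\<^sub>R q f n x \<partial>lebesgue) = - (\<integral>x. \<phi> x *\<^sub>R q (pd j f) n x \<partial>lebesgue)" for n
      unfolding comm[symmetric] by (rule smooth_integration_by_parts[OF p test_fun_smooth[OF qt]])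
    moreover have "(\<lambda>n. \<integral>x. pd j \<phi> x *\<^sub>R q f n x \<partial>lebesgue) \<longlonglongrightarrow> (\<integral>x. pd j \<phi> x *\<^sub>R pd i f x \<partial>lebesgue)"
      unfolding q_def by (intro difference_quotient_integral t smooth_continuous smooth_pd test_fun_smooth p)
    moreover have "(\<lambda>n. - (\<integral>x. \<phi> x *\<^sub>R q (pd j f) n x \<partial>lebesgue)) \<longlonglongrightarrow> - (\<integral>x. \<phi> x *\<^sub>R pd i (pd j f) x \<partial>lebesgue)"
      unfolding q_def by (intro tendsto_minus difference_quotient_integral test_fun_pd t smooth_continuous test_fun_smooth p)
    ultimately have "(\<integral>x. pd j \<phi> x *\<^sub>R pd i f x \<partial>lebesgue) = - (\<integral>x. \<phi> x *\<^sub>R pd i (pd j f) x \<partial>lebesgue)"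
      by (simp only: LIMSEQ_unique)
    moreover have "(\<integral>x. pd j \<phi> x *\<^sub>R pd i f x \<partial>lebesgue) = - (\<integral>x. \<phi> x *\<^sub>R pd j (pd i f) x \<partial>lebesgue)"
      by (rule smooth_integration_by_parts[OF p smooth_pd[OF test_fun_smooth[OF t]]])
    ultimately show "(\<integral>x. \<phi> x *\<^sub>R (pd i (pd j f) - pd j (pd i f)) x \<partial>lebesgue) = 0"
      by (simp add: scaleR_diff_right L2_scaleR_integrable[OF test_fun_L2[OF p] L])
  qed
  then show ?thesis by (rule eventually_mono) simp
qed

lemma lborel_reflect: "lborel = distr lborel borel (\<lambda>x::'a::euclidean_space. t - x)"
proof -
  have "lborel = density (distr lborel borel (\<lambda>x::'a. t + (-1) *\<^sub>R x)) (\<lambda>_. ennreal (\<bar>-1::real\<bar> ^ DIM('a)))"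
    by (rule lborel_affine) simp
  then show ?thesis by (simp add: density_1)
qed

lemma lborel_translate: "lborel = distr lborel borel (\<lambda>x::'a::euclidean_space. x - t)"
proof -
  have "(+) (- t) = (\<lambda>x. x - t)" by auto
  then show ?thesis using lborel_distr_plus[of "- t"] by (simp only:)
qed

definition mollifier :: "(real ^ 'd::finite \<Rightarrow> real) \<Rightarrow> bool" where
  "mollifier \<eta> \<longleftrightarrow> test_fun UNIV \<eta> \<and> (\<forall>x. 0 \<le> \<eta> x) \<and> (\<integral>x. \<eta> x \<partial>lebesgue) = 1"

lemma mollifierD:
  assumes "mollifier \<eta>"
  shows mollifier_test_fun: "test_fun UNIV \<eta>" and mollifier_nonneg: "0 \<le> \<eta> x"
    and mollifier_integral: "(\<integral>x. \<eta> x \<partial>lebesgue) = 1"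
  using assms by (auto simp: mollifier_def)

lemma test_fun_borel: "test_fun UNIV \<eta> \<Longrightarrow> \<eta> \<in> borel_measurable borel"
  by (intro borel_measurable_continuous_onI smooth_continuous test_fun_smooth)

lemma mollifier_reflect_integral:
  assumes m: "mollifier \<eta>" shows "(\<integral>y. \<eta> (x - y) \<partial>lebesgue) = 1"
proof -
  note [measurable] = test_fun_borel[OF mollifier_test_fun[OF m]]
  have "(\<integral>y. \<eta> y \<partial>lborel) = (\<integral>y. \<eta> y \<partial>(distr lborel borel (\<lambda>y. x - y)))"
    using lborel_reflect[of x] by simp
  also have "\<dots> = (\<integral>y. \<eta> (x - y) \<partial>lborel)" by (rule integral_distr) measurable
  finally show ?thesis using mollifier_integral[OF m] by (simp add: integral_completion)
qed

lemma mollifier_translate_nn_integral: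
  assumes m: "mollifier \<eta>" shows "(\<integral>\<^sup>+x. ennreal (\<eta> (x - y)) \<partial>lborel) = 1"
proof -
  note [measurable] = test_fun_borel[OF mollifier_test_fun[OF m]]
  have "(\<integral>\<^sup>+x. ennreal (\<eta> x) \<partial>lebesgue) = ennreal (\<integral>x. \<eta> x \<partial>lebesgue)"
    by (rule nn_integral_eq_integral) (auto simp: mollifierD[OF m] test_fun_integrable)
  then have "1 = (\<integral>\<^sup>+x. ennreal (\<eta> x) \<partial>lborel)" by (simp add: mollifier_integral[OF m] nn_integral_completion)
  also have "\<dots> = (\<integral>\<^sup>+x. ennreal (\<eta> x) \<partial>(distr lborel borel (\<lambda>x. x - y)))"
    using lborel_translate[of y] by simp
  also have "\<dots> = (\<integral>\<^sup>+x. ennreal (\<eta> (x - y)) \<partial>lborel)" by (rule nn_integral_distr) measurable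
  finally show ?thesis by simp
qed

text \<open>Cauchy-Schwarz for the probability density given by the kernel.\<close>

lemma conv_pointwise_bound:
  fixes f :: "real ^ 'd::finite \<Rightarrow> 'b::euclidean_space"
  assumes m: "mollifier \<eta>" and f: "L2 UNIV f"
  shows "ennreal ((norm (conv \<eta> f x))\<^sup>2) \<le> (\<integral>\<^sup>+y. ennreal (\<eta> (x - y) * (norm (f y))\<^sup>2) \<partial>lebesgue)"
proof -
  note t = mollifier_test_fun[OF m] and nn = mollifier_nonneg[OF m]
  have r [measurable]: "(\<lambda>y. \<eta> (x - y)) \<in> borel_measurable lebesgue"
    by (rule test_fun_measurable[OF test_fun_reflect[OF t]])
  have fm [measurable]: "f \<in> borel_measurable lebesgue" by (rule L2_measurable[OF f])
  define p where "p y = sqrt (\<eta> (x - y))" for y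
  define q where "q y = sqrt (\<eta> (x - y)) *\<^sub>R f y" for y
  have p2: "(norm (p y))\<^sup>2 = \<eta> (x - y)" and q2: "(norm (q y))\<^sup>2 = \<eta> (x - y) * (norm (f y))\<^sup>2" for y
    using nn by (auto simp: p_def q_def power_mult_distrib)
  have pm [measurable]: "p \<in> borel_measurable lebesgue" and qm [measurable]: "q \<in> borel_measurable lebesgue"
    unfolding p_def q_def by measurable
  have pL: "L2 UNIV p" unfolding L2_UNIV p2 using pm test_fun_integrable[OF test_fun_reflect[OF t]] by simp
  obtain K where K: "0 < K" "\<And>x. norm (\<eta> x) \<le> K" using test_fun_norm_bound[OF t] by blast
  have qL: "L2 UNIV q"
  proof (rule L2_bound[OF f qm, where K = "sqrt K"])
    show "AE y in lebesgue. norm (q y) \<le> sqrt K * norm (f y)"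
      using K nn by (intro AE_I2) (auto simp: q_def intro!: mult_right_mono real_sqrt_le_mono)
  qed
  have "norm (conv \<eta> f x) \<le> (\<integral>y. norm (\<eta> (x - y) *\<^sub>R f y) \<partial>lebesgue)"
    unfolding conv_def by (rule integral_norm_bound)
  also have "\<dots> = (\<integral>y. norm (p y) * norm (q y) \<partial>lebesgue)"
  proof (rule Bochner_Integration.integral_cong[OF refl])
    fix y
    have "sqrt (\<eta> (x - y)) * sqrt (\<eta> (x - y)) = \<eta> (x - y)" using nn by simp
    then show "norm (\<eta> (x - y) *\<^sub>R f y) = norm (p y) * norm (q y)"
      using nn[of "x - y"] by (simp add: p_def q_def mult.assoc[symmetric])
  qed
  finally have "(norm (conv \<eta> f x))\<^sup>2 \<le> (\<integral>y. norm (p y) * norm (q y) \<partial>lebesgue)\<^sup>2" by (intro power_mono) auto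
  also have "\<dots> \<le> l2ip p p * l2ip q q" by (rule l2_cauchy_schwarz[OF pL qL])
  also have "l2ip p p = 1"
    unfolding l2ip_def power2_norm_eq_inner[symmetric] p2 by (rule mollifier_reflect_integral[OF m])
  finally have "(norm (conv \<eta> f x))\<^sup>2 \<le> l2ip q q" by simp
  then have "ennreal ((norm (conv \<eta> f x))\<^sup>2) \<le> ennreal (l2ip q q)" by (rule ennreal_leI)
  also have "\<dots> = (\<integral>\<^sup>+y. ennreal (\<eta> (x - y) * (norm (f y))\<^sup>2) \<partial>lebesgue)"
    using l2_nn_integral[OF qL] by (simp add: q2)
  finally show ?thesis .
qed

text \<open>Tonelli applied to the pointwise bound; the kernel has unit mass in either variable.\<close>

lemma conv_L2_contraction:
  fixes f :: "real ^ 'd::finite \<Rightarrow> 'b::euclidean_space"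
  assumes m: "mollifier \<eta>" and f: "L2 UNIV f"
  shows conv_L2: "L2 UNIV (conv \<eta> f)" and conv_l2ip_le: "l2ip (conv \<eta> f) (conv \<eta> f) \<le> l2ip f f"
proof -
  note t = mollifier_test_fun[OF m]
  note [measurable] = test_fun_borel[OF t]
  obtain g where g [measurable]: "g \<in> borel_measurable borel" and fg: "AE x in lebesgue. f x = g x"
    using borel_representative[OF L2_measurable[OF f]] by blast
  have gL: "L2 UNIV g" by (rule L2_cong_AE[OF f fg])
  have eq: "conv \<eta> f = conv \<eta> g" by (rule conv_cong_AE[OF fg])
  have meas: "conv \<eta> g \<in> borel_measurable lebesgue" by (rule smooth_measurable[OF conv_smooth[OF t gL]])
  have "(\<integral>\<^sup>+x. ennreal ((norm (conv \<eta> g x))\<^sup>2) \<partial>lebesgue) \<le> (\<integral>\<^sup>+x. (\<integral>\<^sup>+y. ennreal (\<eta> (x - y) * (norm (g y))\<^sup>2) \<partial>lebesgue) \<partial>lebesgue)"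
    by (intro nn_integral_mono conv_pointwise_bound m gL)
  also have "\<dots> = (\<integral>\<^sup>+x. (\<integral>\<^sup>+y. ennreal (\<eta> (x - y) * (norm (g y))\<^sup>2) \<partial>lborel) \<partial>lborel)"
    by (simp add: nn_integral_completion)
  also have "\<dots> = (\<integral>\<^sup>+y. (\<integral>\<^sup>+x. ennreal (\<eta> (x - y) * (norm (g y))\<^sup>2) \<partial>lborel) \<partial>lborel)"
    by (rule lborel_pair.Fubini') measurable
  also have "\<dots> = (\<integral>\<^sup>+y. ennreal ((norm (g y))\<^sup>2) \<partial>lborel)"
  proof (rule nn_integral_cong)
    fix y
    have "(\<integral>\<^sup>+x. ennreal (\<eta> (x - y) * (norm (g y))\<^sup>2) \<partial>lborel) = (\<integral>\<^sup>+x. ennreal (\<eta> (x - y)) * ennreal ((norm (g y))\<^sup>2) \<partial>lborel)"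
      by (simp add: ennreal_mult mollifier_nonneg[OF m])
    also have "\<dots> = (\<integral>\<^sup>+x. ennreal (\<eta> (x - y)) \<partial>lborel) * ennreal ((norm (g y))\<^sup>2)"
      by (rule nn_integral_multc) measurable
    finally show "(\<integral>\<^sup>+x. ennreal (\<eta> (x - y) * (norm (g y))\<^sup>2) \<partial>lborel) = ennreal ((norm (g y))\<^sup>2)"
      by (simp add: mollifier_translate_nn_integral[OF m])
  qed
  also have "\<dots> = ennreal (l2ip g g)" using l2_nn_integral[OF gL] by (simp add: nn_integral_completion)
  finally have le: "(\<integral>\<^sup>+x. ennreal ((norm (conv \<eta> g x))\<^sup>2) \<partial>lebesgue) \<le> ennreal (l2ip g g)" .
  have L: "L2 UNIV (conv \<eta> g)" unfolding L2_UNIV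
  proof
    show "integrable lebesgue (\<lambda>x. (norm (conv \<eta> g x))\<^sup>2)"
      using meas order_le_less_trans[OF le] by (intro integrableI_nonneg) auto
  qed (rule meas)
  then show "L2 UNIV (conv \<eta> f)" by (simp add: eq)
  have "l2ip (conv \<eta> g) (conv \<eta> g) \<le> l2ip g g"
    using le l2_nn_integral[OF L] by (simp add: l2ip_nonneg)
  also have "l2ip g g = l2ip f f" by (rule l2ip_cong_AE) (use fg in \<open>auto elim: eventually_mono\<close>)
  finally show "l2ip (conv \<eta> f) (conv \<eta> f) \<le> l2ip f f" by (simp add: eq)
qed

definition moll :: "nat \<Rightarrow> real ^ 'd::finite \<Rightarrow> real" where
  "moll n x = box_bump 1 (- (inverse (real (Suc n)) *\<^sub>R One)) (inverse (real (Suc n)) *\<^sub>R One) x /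
     (\<integral>x. box_bump 1 (- (inverse (real (Suc n)) *\<^sub>R One)) (inverse (real (Suc n)) *\<^sub>R (One :: real ^ 'd)) x \<partial>lebesgue)"

lemma moll_mollifier: "mollifier (moll n :: real ^ 'd::finite \<Rightarrow> real)"
proof -
  define B where "B = box_bump 1 (- (inverse (real (Suc n)) *\<^sub>R One)) (inverse (real (Suc n)) *\<^sub>R (One :: real ^ 'd))"
  have t: "test_fun UNIV B" unfolding B_def by (rule box_bump_test_fun) simp
  have nn: "0 \<le> B x" for x unfolding B_def by (rule box_bump_bounds)
  have I: "0 < (\<integral>x. B x \<partial>lebesgue)"
  proof (rule ccontr)
    assume "\<not> ?thesis"
    moreover have "0 \<le> (\<integral>x. B x \<partial>lebesgue)" by (rule integral_nonneg_AE) (simp add: nn)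
    ultimately have "(\<integral>x. B x \<partial>lebesgue) = 0" by linarith
    then have "AE x in lebesgue. B x = 0"
      using integral_nonneg_eq_0_iff_AE[of lebesgue B] test_fun_integrable[OF t] nn by simp
    then have "AE x in lebesgue. x \<notin> box (- (inverse (real (Suc n)) *\<^sub>R One)) (inverse (real (Suc n)) *\<^sub>R (One :: real ^ 'd))"
      unfolding B_def using box_bump_nonzero[of 1] by (auto elim!: eventually_mono)
    then have "negligible (box (- (inverse (real (Suc n)) *\<^sub>R One)) (inverse (real (Suc n)) *\<^sub>R (One :: real ^ 'd)))"
      unfolding negligible_iff_null_sets by (subst AE_iff_null_sets) auto
    then show False
      using open_not_negligible[OF open_box] by (force simp: box_ne_empty)
  qed
  have m: "moll n = (\<lambda>x. (inverse (\<integral>x. B x \<partial>lebesgue)) *\<^sub>R B x)"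
    unfolding moll_def B_def by (auto simp: divide_inverse)
  show ?thesis unfolding mollifier_def m
    using I nn test_fun_bounded_linear[OF bounded_linear_scaleR_right t] by simp
qed

lemma moll_support:
  assumes "moll n (x :: real ^ 'd::finite) \<noteq> 0"
  shows "norm x \<le> inverse (real (Suc n)) * real CARD('d)"
proof -
  have "x \<in> box (- (inverse (real (Suc n)) *\<^sub>R One)) (inverse (real (Suc n)) *\<^sub>R (One :: real ^ 'd))"
    using assms box_bump_nonzero[of 1 _ _ x] by (auto simp: moll_def)
  then have M: "\<bar>x \<bullet> j\<bar> \<le> inverse (real (Suc n))" if "j \<in> Basis" for j
    using that unfolding mem_box by (auto simp: abs_le_iff less_imp_le)
  have "\<bar>x $ i\<bar> \<le> inverse (real (Suc n))" for i
    using M[of "axis i 1"] by (simp add: axis_in_Basis_iff inner_axis)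
  then have "(\<Sum>i\<in>UNIV. \<bar>x $ i\<bar>) \<le> (\<Sum>i\<in>(UNIV::'d set). inverse (real (Suc n)))" by (intro sum_mono)
  then show ?thesis using norm_le_l1_cart[of x] by (simp add: mult.commute)
qed

lemma conv_moll_test_fun_tendsto:
  fixes \<phi> :: "real ^ 'd::finite \<Rightarrow> 'b::euclidean_space"
  assumes t: "test_fun UNIV \<phi>"
  shows "(\<lambda>n. l2ip (conv (moll n) \<phi> - \<phi>) (conv (moll n) \<phi> - \<phi>)) \<longlonglongrightarrow> 0"
proof -
  obtain L where L: "0 < L" "\<And>x y. norm (\<phi> x - \<phi> y) \<le> L * norm (x - y)" using test_fun_gradient_bound[OF t] by metis
  obtain R where R: "0 < R" "\<And>x. R < norm x \<Longrightarrow> \<phi> x = 0" using test_fun_supportE[OF t] by blast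
  define h where "h n = inverse (real (Suc n)) * real CARD('d)" for n
  define S where "S = R + real CARD('d)"
  have h: "0 \<le> h n" "h n \<le> real CARD('d)" for n by (auto simp: h_def field_simps)
  define V where "V = (\<integral>x. indicator (cball (0::real ^ 'd) S) x \<partial>lebesgue :: real)"
  have pt: "norm (conv (moll n) \<phi> x - \<phi> x) \<le> L * h n * indicator (cball 0 S) x" for n x
  proof -
    note m = moll_mollifier[of n, where 'd='d]
    note T = mollifier_test_fun[OF m]
    have I: "integrable lebesgue (\<lambda>y. moll n (x - y))" by (rule test_fun_integrable[OF test_fun_reflect[OF T]])
    have "\<phi> x = (\<integral>y. moll n (x - y) *\<^sub>R \<phi> x \<partial>lebesgue)"
      using mollifier_reflect_integral[OF m, of x] I by simp
    then have "conv (moll n) \<phi> x - \<phi> x = (\<integral>y. moll n (x - y) *\<^sub>R \<phi> y \<partial>lebesgue) - (\<integral>y. moll n (x - y) *\<^sub>R \<phi> x \<partial>lebesgue)"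
      by (simp add: conv_def)
    also have "\<dots> = (\<integral>y. moll n (x - y) *\<^sub>R \<phi> y - moll n (x - y) *\<^sub>R \<phi> x \<partial>lebesgue)"
      by (rule Bochner_Integration.integral_diff[symmetric])
        (intro conv_integrable[OF T test_fun_L2[OF t]], use I in simp)
    finally have eq: "conv (moll n) \<phi> x - \<phi> x = (\<integral>y. moll n (x - y) *\<^sub>R (\<phi> y - \<phi> x) \<partial>lebesgue)"
      by (simp add: scaleR_diff_right)
    have b: "norm (moll n (x - y) *\<^sub>R (\<phi> y - \<phi> x)) \<le> moll n (x - y) * (L * h n)" for y
    proof (cases "moll n (x - y) = 0")
      case False
      then have "norm (x - y) \<le> h n" using moll_support[OF False] by (simp add: h_def)
      then have "norm (\<phi> y - \<phi> x) \<le> L * h n"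
        using L(2)[of y x] L(1) by (smt (verit, best) mult_left_mono norm_minus_commute)
      then show ?thesis using mollifier_nonneg[OF m, of "x - y"] by (simp add: mult_left_mono)
    qed simp
    have "norm (conv (moll n) \<phi> x - \<phi> x) \<le> (\<integral>y. moll n (x - y) * (L * h n) \<partial>lebesgue)"
      unfolding eq by (rule Bochner_Integration.integral_norm_bound_integral) (use I b in \<open>auto simp: scaleR_diff_right intro!: conv_integrable[OF T test_fun_L2[OF t]]\<close>)
    also have "\<dots> = L * h n" using mollifier_reflect_integral[OF m, of x] by simp
    finally have 1: "norm (conv (moll n) \<phi> x - \<phi> x) \<le> L * h n" .
    have "conv (moll n) \<phi> x - \<phi> x = 0" if S: "S < norm x"
    proof -
      have "moll n (x - y) *\<^sub>R (\<phi> y - \<phi> x) = 0" for y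
      proof (cases "moll n (x - y) = 0")
        case False
        have "norm (x - y) \<le> real CARD('d)"
          using order_trans[OF moll_support[OF False]] h(2)[of n] unfolding h_def by blast
        then have "R < norm y" using norm_triangle_sub[of x y] S by (simp add: S_def)
        moreover have "R < norm x" using S by (simp add: S_def)
        ultimately show ?thesis using R(2) by simp
      qed simp
      then show ?thesis by (simp only: eq Bochner_Integration.integral_zero)
    qed
    then show ?thesis using 1 by (cases "norm x \<le> S") (auto simp: not_le)
  qed
  have ci: "integrable lebesgue (indicator (cball (0::real ^ 'd) S) :: _ \<Rightarrow> real)"
    using lmeasurable_cball[of "0::real ^ 'd" S] by (intro integrable_real_indicator) (auto simp: fmeasurable_def)
  have le: "l2ip (conv (moll n) \<phi> - \<phi>) (conv (moll n) \<phi> - \<phi>) \<le> (L * h n)\<^sup>2 * V" for n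
  proof -
    have D: "L2 UNIV (conv (moll n) \<phi> - \<phi>)" by (intro L2_diff conv_L2 moll_mollifier test_fun_L2 t)
    have "l2ip (conv (moll n) \<phi> - \<phi>) (conv (moll n) \<phi> - \<phi>) \<le> (\<integral>x. (L * h n)\<^sup>2 * indicator (cball (0::real ^ 'd) S) x \<partial>lebesgue)"
      unfolding l2ip_def power2_norm_eq_inner[symmetric]
    proof (rule integral_mono)
      show "integrable lebesgue (\<lambda>x. (norm ((conv (moll n) \<phi> - \<phi>) x))\<^sup>2)" by (rule L2_integrable[OF D])
      show "(norm ((conv (moll n) \<phi> - \<phi>) x))\<^sup>2 \<le> (L * h n)\<^sup>2 * indicator (cball (0::real ^ 'd) S) x" for x
      proof -
        have "(norm ((conv (moll n) \<phi> - \<phi>) x))\<^sup>2 \<le> (L * h n * indicator (cball 0 S) x)\<^sup>2"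
          using pt[of n x] by (intro power_mono) auto
        also have "\<dots> = (L * h n)\<^sup>2 * indicator (cball (0::real ^ 'd) S) x" by (simp add: indicator_def)
        finally show ?thesis .
      qed
    qed (use ci in auto)
    then show ?thesis using ci by (simp add: V_def)
  qed
  have "(\<lambda>n. (L * h n)\<^sup>2 * V) \<longlonglongrightarrow> (L * (0 * real CARD('d)))\<^sup>2 * V"
    unfolding h_def by (intro tendsto_intros LIMSEQ_inverse_real_of_nat)
  then have "(\<lambda>n. (L * h n)\<^sup>2 * V) \<longlonglongrightarrow> 0" by simp
  then show ?thesis
    by (rule tendsto_sandwich[OF _ _ tendsto_const, rotated 2]) (auto simp: l2ip_nonneg intro!: always_eventually le)
qed

text \<open>Approximate by a test function; mollification does not increase the error, and for test functions convergence is uniform with supports in a fixed ball.\<close>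

lemma conv_moll_tendsto_L2:
  fixes f :: "real ^ 'd::finite \<Rightarrow> 'b::euclidean_space"
  assumes f: "L2 UNIV f"
  shows "(\<lambda>n. l2ip (conv (moll n) f - f) (conv (moll n) f - f)) \<longlonglongrightarrow> 0"
proof (rule LIMSEQ_I)
  fix e :: real assume e: "0 < e"
  obtain \<phi> where t: "test_fun UNIV \<phi>" and p: "l2ip (f - \<phi>) (f - \<phi>) < e / 10"
    using test_fun_dense_L2[OF f, of "e / 10"] e by auto
  have pL: "L2 UNIV \<phi>" by (rule test_fun_L2[OF t])
  have "0 < e / 10" using e by simp
  then obtain N where N: "\<And>n. N \<le> n \<Longrightarrow> l2ip (conv (moll n) \<phi> - \<phi>) (conv (moll n) \<phi> - \<phi>) < e / 10"
    using order_tendstoD(2)[OF conv_moll_test_fun_tendsto[OF t]] unfolding eventually_sequentially by meson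
  have "l2ip (conv (moll n) f - f) (conv (moll n) f - f) < e" if n: "N \<le> n" for n
  proof -
    note m = moll_mollifier[of n, where 'd='d]
    define a where "a = conv (moll n) (f - \<phi>)"
    define b where "b = conv (moll n) \<phi> - \<phi>"
    define c where "c = f - \<phi>"
    have L: "L2 UNIV a" "L2 UNIV b" "L2 UNIV c" unfolding a_def b_def c_def by (intro conv_L2[OF m] L2_diff f pL)+
    have "conv (moll n) f - f = (a - c) + b"
      unfolding a_def b_def c_def by (simp add: conv_diff[OF mollifier_test_fun[OF m] f pL])
    then have "l2ip (conv (moll n) f - f) (conv (moll n) f - f) \<le> 2 * (l2ip (a - c) (a - c) + l2ip b b)"
      using l2.ip_sum_bound[of "a - c" b] L by (simp add: L2_diff)
    moreover have "l2ip (a - c) (a - c) \<le> 2 * (l2ip a a + l2ip c c)"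
      using l2.ip_diff_self[of a c] l2.ip_quad[of a c 1] l2ip_nonneg[of "a + c"] L by simp
    moreover have "l2ip a a \<le> l2ip c c" unfolding a_def c_def by (rule conv_l2ip_le[OF m L2_diff[OF f pL]])
    moreover have "l2ip c c < e / 10" "l2ip b b < e / 10" using p N[OF n] by (simp_all add: b_def c_def)
    moreover have "X < e" if "X \<le> 2 * (Z + V)" "Z \<le> 2 * (W + U)" "W \<le> U" "U < e / 10" "V < e / 10" for X Z V W U
      using that unfolding distrib_left by linarith
    ultimately show ?thesis by blast
  qed
  then show "\<exists>N. \<forall>n\<ge>N. norm (l2ip (conv (moll n) f - f) (conv (moll n) f - f) - 0) < e"
    by (intro exI[of _ N]) (simp add: l2ip_nonneg)
qed

lemma conv_has_weak_pd:
  fixes f :: "real ^ 'd::finite \<Rightarrow> 'b::euclidean_space"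
  assumes m: "mollifier \<eta>" and w: "has_weak_pd UNIV j f g"
  shows "has_weak_pd UNIV j (conv \<eta> f) (conv \<eta> g)" "pd j (conv \<eta> f) = conv \<eta> g"
proof -
  note t = mollifier_test_fun[OF m]
  have f: "L2 UNIV f" and g: "L2 UNIV g" using w by (auto simp: has_weak_pd_UNIV)
  show p: "pd j (conv \<eta> f) = conv \<eta> g" using pd_conv[OF t f] conv_weak_pd[OF t w] by simp
  show "has_weak_pd UNIV j (conv \<eta> f) (conv \<eta> g)"
    using smooth_has_weak_pd[OF conv_smooth[OF t f] conv_L2[OF m f], of j] conv_L2[OF m g] by (simp add: p)
qed

lemma conv_sobolev:
  fixes f :: "real ^ 'd::finite \<Rightarrow> 'b::euclidean_space"
  assumes m: "mollifier \<eta>" shows "f \<in> sobolev k UNIV \<Longrightarrow> conv \<eta> f \<in> sobolev k UNIV"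
proof (induction k arbitrary: f)
  case 0
  then show ?case by (simp add: conv_L2[OF m])
next
  case (Suc k)
  show ?case
    by (rule sobolev_Suc_I[OF conv_L2[OF m sobolev_L2[OF Suc.prems]] conv_has_weak_pd(1)[OF m wpd_has_weak_pd[OF Suc.prems]]])
      (rule Suc.IH[OF wpd_sobolev[OF Suc.prems]])
qed

lemma has_weak_pd_diff:
  assumes "has_weak_pd UNIV j f g" "has_weak_pd UNIV j f' g'"
  shows "has_weak_pd UNIV j (f - f') (g - g')"
  using has_weak_pd_add[OF assms(1) has_weak_pd_scaleR[OF assms(2), of "-1"]] by simp

lemma sip_wpd_eq:
  assumes "has_weak_pd UNIV j f g"
  shows "sip k (wpd UNIV j f) (wpd UNIV j f) = sip k g g"
  by (rule sip_cong_AE[OF wpd_unique[OF assms] wpd_unique[OF assms]])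

text \<open>Mollification commutes with weak differentiation.\<close>

lemma conv_moll_tendsto_sobolev:
  fixes f :: "real ^ 'd::finite \<Rightarrow> 'b::euclidean_space"
  shows "f \<in> sobolev k UNIV \<Longrightarrow> (\<lambda>n. sip k (conv (moll n) f - f) (conv (moll n) f - f)) \<longlonglongrightarrow> 0"
proof (induction k arbitrary: f)
  case 0
  have "L2 UNIV f" using 0 by simp
  from conv_moll_tendsto_L2[OF this] show "(\<lambda>n. sip 0 (conv (moll n) f - f) (conv (moll n) f - f)) \<longlonglongrightarrow> 0"
    by (simp only: sip_0)
next
  case (Suc k)
  have "sip k (wpd UNIV j (conv (moll n) f - f)) (wpd UNIV j (conv (moll n) f - f))
      = sip k (conv (moll n) (wpd UNIV j f) - wpd UNIV j f) (conv (moll n) (wpd UNIV j f) - wpd UNIV j f)" for n j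
    by (rule sip_wpd_eq[OF has_weak_pd_diff[OF conv_has_weak_pd(1)[OF moll_mollifier]]])
      (rule wpd_has_weak_pd[OF Suc.prems])+
  then have "(\<lambda>n. sip (Suc k) (conv (moll n) f - f) (conv (moll n) f - f)) \<longlonglongrightarrow> 0 + (\<Sum>j\<in>(UNIV::'d set). 0)"
    by (simp only: sip_Suc) (intro tendsto_intros conv_moll_tendsto_L2 sobolev_L2[OF Suc.prems] Suc.IH wpd_sobolev[OF Suc.prems])
  then show "(\<lambda>n. sip (Suc k) (conv (moll n) f - f) (conv (moll n) f - f)) \<longlonglongrightarrow> 0" by (simp only: sum.neutral_const add_0)
qed

section \<open>Cut-off\<close>

definition cut :: "(real ^ 'd::finite \<Rightarrow> real) \<Rightarrow> nat \<Rightarrow> (real ^ 'd \<Rightarrow> 'b::euclidean_space) \<Rightarrow> real ^ 'd \<Rightarrow> 'b" where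
  "cut \<omega> n F x = \<omega> (inverse (real (Suc n)) *\<^sub>R x) *\<^sub>R F x"

lemma cut_test_fun:
  assumes "test_fun UNIV \<omega>" "smooth F" shows "test_fun UNIV (cut \<omega> n F)"
proof -
  have "test_fun UNIV (\<lambda>x. \<omega> (inverse (real (Suc n)) *\<^sub>R x + 0))" by (rule test_fun_affine[OF assms(1)]) simp
  then show ?thesis unfolding cut_def[abs_def] using assms(2) by (intro test_fun_scaleR) simp_all
qed

lemma pd_cut:
  fixes F :: "real ^ 'd::finite \<Rightarrow> 'b::euclidean_space"
  assumes t: "test_fun UNIV \<omega>" and F: "smooth F"
  shows "pd j (cut \<omega> n F) = inverse (real (Suc n)) *\<^sub>R cut (pd j \<omega>) n F + cut \<omega> n (pd j F)"
proof (rule ext)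
  fix x
  have d: "\<omega> differentiable (at y)" for y by (rule smooth_differentiable[OF test_fun_smooth[OF t]])
  have dd: "(\<lambda>x. \<omega> (inverse (real (Suc n)) *\<^sub>R x)) differentiable (at x)"
  proof -
    have "test_fun UNIV (\<lambda>x. \<omega> (inverse (real (Suc n)) *\<^sub>R x + 0))" by (rule test_fun_affine[OF t]) simp
    from smooth_differentiable[OF test_fun_smooth[OF this], of x] show ?thesis by (simp only: add_0_right)
  qed
  have "pd j (\<lambda>x. \<omega> (inverse (real (Suc n)) *\<^sub>R x)) x = inverse (real (Suc n)) *\<^sub>R pd j \<omega> (inverse (real (Suc n)) *\<^sub>R x)"
    using pd_affine[OF d, where r = "inverse (real (Suc n))" and x = x and a = 0 and j = j] by (simp only: add_0_right)
  then show "pd j (cut \<omega> n F) x = (inverse (real (Suc n)) *\<^sub>R cut (pd j \<omega>) n F + cut \<omega> n (pd j F)) x"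
    unfolding cut_def[abs_def] using pd_scaleR[OF dd smooth_differentiable[OF F], of j] by simp
qed

lemma cut_tendsto_L2:
  fixes F :: "real ^ 'd::finite \<Rightarrow> 'b::euclidean_space"
  assumes t: "test_fun UNIV \<omega>" and F: "L2 UNIV F" "smooth F"
  shows "(\<lambda>n. l2ip (cut \<omega> n F - \<omega> 0 *\<^sub>R F) (cut \<omega> n F - \<omega> 0 *\<^sub>R F)) \<longlonglongrightarrow> 0"
proof -
  obtain K where K: "0 < K" "\<And>x. norm (\<omega> x) \<le> K" using test_fun_norm_bound[OF t] by blast
  have "(\<lambda>n. \<integral>x. (norm ((cut \<omega> n F - \<omega> 0 *\<^sub>R F) x))\<^sup>2 \<partial>lebesgue) \<longlonglongrightarrow> integral\<^sup>L lebesgue (\<lambda>x::real ^ 'd. 0)"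
  proof (rule integral_dominated_convergence)
    show "integrable lebesgue (\<lambda>x. (2 * K)\<^sup>2 * (norm (F x))\<^sup>2)" using L2_integrable[OF F(1)] by simp
    show "(\<lambda>x. (norm ((cut \<omega> n F - \<omega> 0 *\<^sub>R F) x))\<^sup>2) \<in> borel_measurable lebesgue" for n
      using L2_measurable[OF L2_diff[OF test_fun_L2[OF cut_test_fun[OF t F(2)]] L2_scaleR[OF F(1)]]] by measurable
    show "AE x in lebesgue. norm ((norm ((cut \<omega> n F - \<omega> 0 *\<^sub>R F) x))\<^sup>2) \<le> (2 * K)\<^sup>2 * (norm (F x))\<^sup>2" for n
    proof (rule AE_I2)
      fix x
      have "norm ((cut \<omega> n F - \<omega> 0 *\<^sub>R F) x) = \<bar>\<omega> (inverse (real (Suc n)) *\<^sub>R x) - \<omega> 0\<bar> * norm (F x)"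
        by (simp add: cut_def scaleR_diff_left[symmetric])
      also have "\<dots> \<le> (2 * K) * norm (F x)"
        using K(2)[of "inverse (real (Suc n)) *\<^sub>R x"] K(2)[of 0] by (intro mult_right_mono) auto
      finally have "(norm ((cut \<omega> n F - \<omega> 0 *\<^sub>R F) x))\<^sup>2 \<le> ((2 * K) * norm (F x))\<^sup>2" by (intro power_mono) auto
      then show "norm ((norm ((cut \<omega> n F - \<omega> 0 *\<^sub>R F) x))\<^sup>2) \<le> (2 * K)\<^sup>2 * (norm (F x))\<^sup>2"
        by (simp add: power_mult_distrib)
    qed
    show "AE x in lebesgue. (\<lambda>n. (norm ((cut \<omega> n F - \<omega> 0 *\<^sub>R F) x))\<^sup>2) \<longlonglongrightarrow> 0"
    proof (rule AE_I2)
      fix x :: "real ^ 'd"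
      have "(\<lambda>n. inverse (real (Suc n)) *\<^sub>R x) \<longlonglongrightarrow> 0 *\<^sub>R x"
        by (intro tendsto_scaleR LIMSEQ_inverse_real_of_nat tendsto_const)
      then have "(\<lambda>n. \<omega> (inverse (real (Suc n)) *\<^sub>R x)) \<longlonglongrightarrow> \<omega> (0 *\<^sub>R x)"
        using smooth_continuous[OF test_fun_smooth[OF t]]
        by (intro continuous_on_tendsto_compose[of UNIV \<omega>]) auto
      then have "(\<lambda>n. (norm (\<omega> (inverse (real (Suc n)) *\<^sub>R x) *\<^sub>R F x - \<omega> 0 *\<^sub>R F x))\<^sup>2) \<longlonglongrightarrow> (norm (\<omega> (0 *\<^sub>R x) *\<^sub>R F x - \<omega> 0 *\<^sub>R F x))\<^sup>2"
        by (intro tendsto_intros)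
      then show "(\<lambda>n. (norm ((cut \<omega> n F - \<omega> 0 *\<^sub>R F) x))\<^sup>2) \<longlonglongrightarrow> 0" by (simp add: cut_def)
    qed
  qed simp
  then show ?thesis by (simp add: l2ip_def power2_norm_eq_inner)
qed

text \<open>The Leibniz rule gives an additional term that carries the derivative of the rescaled cut-off function, which is of the order of the inverse scale.\<close>

lemma cut_tendsto_sobolev:
  fixes f :: "real ^ 'd::finite \<Rightarrow> 'b::euclidean_space"
  assumes m: "mollifier \<eta>" and "test_fun UNIV \<omega>" "f \<in> sobolev k UNIV"
  shows "(\<lambda>n. sip k (cut \<omega> n (conv \<eta> f) - \<omega> 0 *\<^sub>R conv \<eta> f) (cut \<omega> n (conv \<eta> f) - \<omega> 0 *\<^sub>R conv \<eta> f)) \<longlonglongrightarrow> 0"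
  using assms(2,3)
proof (induction k arbitrary: f \<omega>)
  case 0
  have "L2 UNIV f" using 0 by simp
  from cut_tendsto_L2[OF 0(1) conv_L2[OF m this] conv_smooth[OF mollifier_test_fun[OF m] this]]
  show "(\<lambda>n. sip 0 (cut \<omega> n (conv \<eta> f) - \<omega> 0 *\<^sub>R conv \<eta> f) (cut \<omega> n (conv \<eta> f) - \<omega> 0 *\<^sub>R conv \<eta> f)) \<longlonglongrightarrow> 0"
    by (simp only: sip_0)
next
  case (Suc k)
  define F where "F = conv \<eta> f"
  define D where "D n = cut \<omega> n F - \<omega> 0 *\<^sub>R F" for n
  have fL: "L2 UNIV f" by (rule sobolev_L2[OF Suc.prems(2)])
  have Fs: "smooth F" unfolding F_def by (rule conv_smooth[OF mollifier_test_fun[OF m] fL])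
  have FL: "L2 UNIV F" unfolding F_def by (rule conv_L2[OF m fL])
  have FS: "F \<in> sobolev k UNIV" unfolding F_def by (rule conv_sobolev[OF m sobolev_Suc_D[OF Suc.prems(2)]])
  have w: "has_weak_pd UNIV j F (conv \<eta> (wpd UNIV j f))" and p: "pd j F = conv \<eta> (wpd UNIV j f)" for j
    unfolding F_def using conv_has_weak_pd[OF m wpd_has_weak_pd[OF Suc.prems(2)]] by auto
  have Gs: "smooth (conv \<eta> (wpd UNIV j f))" for j using smooth_pd[OF Fs, of j] by (simp add: p)
  have "(\<lambda>n. sip k (wpd UNIV j (D n)) (wpd UNIV j (D n))) \<longlonglongrightarrow> 0" for j
  proof -
    define G where "G = conv \<eta> (wpd UNIV j f)"
    define A where "A n = inverse (real (Suc n)) *\<^sub>R cut (pd j \<omega>) n F" for n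
    define B where "B n = cut \<omega> n G - \<omega> 0 *\<^sub>R G" for n
    have tp: "test_fun UNIV (pd j \<omega>)" by (rule test_fun_pd[OF Suc.prems(1)])
    have GS: "G \<in> sobolev k UNIV" unfolding G_def by (rule conv_sobolev[OF m wpd_sobolev[OF Suc.prems(2)]])
    have cS: "cut (pd j \<omega>) n F \<in> sobolev k UNIV" for n by (rule test_fun_sobolev[OF cut_test_fun[OF tp Fs]])
    have AS: "A n \<in> sobolev k UNIV" for n unfolding A_def by (rule sobolev_scaleR[OF cS])
    have BS: "B n \<in> sobolev k UNIV" for n unfolding B_def G_def
      by (intro sobolev_diff sobolev_scaleR GS[unfolded G_def] test_fun_sobolev cut_test_fun Suc.prems Gs)
    have Dw: "has_weak_pd UNIV j (D n) (A n + B n)" for n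
    proof -
      have "has_weak_pd UNIV j (cut \<omega> n F) (A n + cut \<omega> n G)"
        using test_fun_has_weak_pd[OF cut_test_fun[OF Suc.prems(1) Fs], of j n] by (simp add: pd_cut[OF Suc.prems(1) Fs] p A_def G_def)
      from has_weak_pd_diff[OF this has_weak_pd_scaleR[OF w, where r = "\<omega> 0"]]
      show ?thesis by (simp add: D_def B_def G_def add_diff_eq)
    qed
    have Bl: "(\<lambda>n. sip k (B n) (B n)) \<longlonglongrightarrow> 0"
      unfolding B_def G_def by (rule Suc.IH[OF Suc.prems(1) wpd_sobolev[OF Suc.prems(2)]])
    define E where "E n = cut (pd j \<omega>) n F - pd j \<omega> 0 *\<^sub>R F" for n
    have ES: "E n \<in> sobolev k UNIV" for n unfolding E_def by (rule sobolev_diff[OF cS sobolev_scaleR[OF FS]])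
    have El: "(\<lambda>n. sip k (E n) (E n)) \<longlonglongrightarrow> 0"
      unfolding E_def F_def by (rule Suc.IH[OF tp sobolev_Suc_D[OF Suc.prems(2)]])
    have Ab: "sip k (A n) (A n) \<le> (inverse (real (Suc n)))\<^sup>2 * (2 * (sip k (E n) (E n) + sip k (pd j \<omega> 0 *\<^sub>R F) (pd j \<omega> 0 *\<^sub>R F)))" for n
    proof -
      have "sip k (E n + pd j \<omega> 0 *\<^sub>R F) (E n + pd j \<omega> 0 *\<^sub>R F) \<le> 2 * (sip k (E n) (E n) + sip k (pd j \<omega> 0 *\<^sub>R F) (pd j \<omega> 0 *\<^sub>R F))"
        by (rule sob.ip_sum_bound[OF ES sobolev_scaleR[OF FS]])
      moreover have "E n + pd j \<omega> 0 *\<^sub>R F = cut (pd j \<omega>) n F" unfolding E_def by (rule diff_add_cancel)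
      ultimately have b: "sip k (cut (pd j \<omega>) n F) (cut (pd j \<omega>) n F) \<le> 2 * (sip k (E n) (E n) + sip k (pd j \<omega> 0 *\<^sub>R F) (pd j \<omega> 0 *\<^sub>R F))"
        by (simp only:)
      have "sip k (A n) (A n) = (inverse (real (Suc n)))\<^sup>2 * sip k (cut (pd j \<omega>) n F) (cut (pd j \<omega>) n F)"
        unfolding A_def by (simp only: sob.ip_scale[OF cS] sob.ip_scale_right[OF cS] power2_eq_square mult.assoc)
      then show ?thesis using mult_left_mono[OF b, of "(inverse (real (Suc n)))\<^sup>2"] by (simp only: zero_le_power2)
    qed
    have "(\<lambda>n. (inverse (real (Suc n)))\<^sup>2 * (2 * (sip k (E n) (E n) + sip k (pd j \<omega> 0 *\<^sub>R F) (pd j \<omega> 0 *\<^sub>R F))))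
        \<longlonglongrightarrow> 0\<^sup>2 * (2 * (0 + sip k (pd j \<omega> 0 *\<^sub>R F) (pd j \<omega> 0 *\<^sub>R F)))"
      by (intro tendsto_intros El LIMSEQ_inverse_real_of_nat)
    then have "(\<lambda>n. (inverse (real (Suc n)))\<^sup>2 * (2 * (sip k (E n) (E n) + sip k (pd j \<omega> 0 *\<^sub>R F) (pd j \<omega> 0 *\<^sub>R F)))) \<longlonglongrightarrow> 0" by simp
    then have Al: "(\<lambda>n. sip k (A n) (A n)) \<longlonglongrightarrow> 0"
      by (rule tendsto_sandwich[OF _ _ tendsto_const, rotated 2]) (intro always_eventually allI Ab sip_nonneg)+
    show ?thesis unfolding sip_wpd_eq[OF Dw] by (rule sob.ip_tendsto_zero_add[OF AS BS Al Bl])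
  qed
  moreover have "(\<lambda>n. l2ip (D n) (D n)) \<longlonglongrightarrow> 0" unfolding D_def by (rule cut_tendsto_L2[OF Suc.prems(1) FL Fs])
  ultimately have "(\<lambda>n. sip (Suc k) (D n) (D n)) \<longlonglongrightarrow> 0 + (\<Sum>j\<in>(UNIV::'d set). 0)"
    by (simp only: sip_Suc) (intro tendsto_intros)
  then show "(\<lambda>n. sip (Suc k) (cut \<omega> n (conv \<eta> f) - \<omega> 0 *\<^sub>R conv \<eta> f) (cut \<omega> n (conv \<eta> f) - \<omega> 0 *\<^sub>R conv \<eta> f)) \<longlonglongrightarrow> 0"
    by (simp only: sum.neutral_const add_0 D_def F_def)
qed

text \<open>Mollify to obtain a smooth function, then cut off.\<close>

theorem test_fun_dense_sobolev:
  fixes f :: "real ^ 'd::finite \<Rightarrow> 'b::euclidean_space"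
  assumes f: "f \<in> sobolev k UNIV" and e: "0 < e"
  shows "\<exists>\<phi>. test_fun UNIV \<phi> \<and> sip k (\<phi> - f) (\<phi> - f) < e"
proof -
  have e4: "0 < e / 4" using e by simp
  obtain N where N: "sip k (conv (moll N) f - f) (conv (moll N) f - f) < e / 4"
    using order_tendstoD(2)[OF conv_moll_tendsto_sobolev[OF f] e4] unfolding eventually_sequentially by (meson order_refl)
  define F where "F = conv (moll N) f"
  have m: "mollifier (moll N :: real ^ 'd \<Rightarrow> real)" by (rule moll_mollifier)
  have FS: "F \<in> sobolev k UNIV" unfolding F_def by (rule conv_sobolev[OF m f])
  have Fs: "smooth F" unfolding F_def by (rule conv_smooth[OF mollifier_test_fun[OF m] sobolev_L2[OF f]])
  define \<omega> where "\<omega> = box_bump 1 (- One) (One :: real ^ 'd)"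
  have t: "test_fun UNIV \<omega>" unfolding \<omega>_def by (rule box_bump_test_fun) simp
  have "(0 :: real ^ 'd) \<in> box (- One) One" by (simp add: mem_box)
  then have c: "\<omega> 0 \<noteq> 0" unfolding \<omega>_def using box_bump_nonzero[of 1 "- One" "One :: real ^ 'd" 0] by simp
  have "0 < e / 4 * (\<omega> 0)\<^sup>2" using e4 c by simp
  then obtain n where n: "sip k (cut \<omega> n F - \<omega> 0 *\<^sub>R F) (cut \<omega> n F - \<omega> 0 *\<^sub>R F) < e / 4 * (\<omega> 0)\<^sup>2"
    using order_tendstoD(2)[OF cut_tendsto_sobolev[OF m t f]] unfolding eventually_sequentially F_def by (meson order_refl)
  define \<phi> where "\<phi> = inverse (\<omega> 0) *\<^sub>R cut \<omega> n F"
  have tp: "test_fun UNIV \<phi>"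
    unfolding \<phi>_def scaleR_fun_def by (rule test_fun_bounded_linear[OF bounded_linear_scaleR_right cut_test_fun[OF t Fs]])
  have D: "cut \<omega> n F - \<omega> 0 *\<^sub>R F \<in> sobolev k UNIV"
    by (intro sobolev_diff sobolev_scaleR FS test_fun_sobolev cut_test_fun t Fs)
  have "\<phi> - F = inverse (\<omega> 0) *\<^sub>R (cut \<omega> n F - \<omega> 0 *\<^sub>R F)" using c by (simp add: \<phi>_def scaleR_diff_right)
  then have "sip k (\<phi> - F) (\<phi> - F) = (inverse (\<omega> 0))\<^sup>2 * sip k (cut \<omega> n F - \<omega> 0 *\<^sub>R F) (cut \<omega> n F - \<omega> 0 *\<^sub>R F)"
    by (simp add: sob.ip_scale[OF D] sob.ip_scale_right[OF D] power2_eq_square)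
  also have "\<dots> < (inverse (\<omega> 0))\<^sup>2 * (e / 4 * (\<omega> 0)\<^sup>2)" using n c by (intro mult_strict_left_mono) auto
  also have "\<dots> = e / 4" using c by (simp add: power2_eq_square field_simps)
  finally have 1: "sip k (\<phi> - F) (\<phi> - F) < e / 4" .
  have "sip k ((\<phi> - F) + (F - f)) ((\<phi> - F) + (F - f)) \<le> 2 * (sip k (\<phi> - F) (\<phi> - F) + sip k (F - f) (F - f))"
    by (rule sob.ip_sum_bound) (intro sobolev_diff FS f test_fun_sobolev tp)+
  then have "sip k (\<phi> - f) (\<phi> - f) < e" using 1 N by (simp add: F_def)
  then show ?thesis using tp by blast
qed

section \<open>Minor symmetries of the effective tensors\<close>

lemma integral_lebesgue_on_cong_AE:
  fixes f g :: "'a::euclidean_space \<Rightarrow> 'b::euclidean_space"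
  assumes S: "S \<in> sets lebesgue" and eq: "AE x in lebesgue_on S. f x = g x"
  shows "integral\<^sup>L (lebesgue_on S) f = integral\<^sup>L (lebesgue_on S) g"
proof -
  have "AE x in lebesgue. x \<in> S \<longrightarrow> f x = g x" using eq S by (simp add: AE_restrict_space_iff)
  then have "AE x in lebesgue. indicator S x *\<^sub>R f x = indicator S x *\<^sub>R g x"
    by (rule eventually_mono) (auto simp: indicator_def)
  then show ?thesis using S by (simp add: integral_restrict_space integral_lebesgue_cong_AE)
qed

lemma wpd_cong_on:
  assumes S: "S \<in> sets lebesgue" and L: "L2 S f" "L2 S g" and eq: "AE x in lebesgue_on S. f x = g x"
  shows "wpd S j f = wpd S j g"
proof -
  have "(\<integral>x. p x *\<^sub>R f x \<partial>lebesgue_on S) = (\<integral>x. p x *\<^sub>R g x \<partial>lebesgue_on S)" for p :: "_ \<Rightarrow> real"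
    by (rule integral_lebesgue_on_cong_AE[OF S]) (use eq in \<open>auto elim: eventually_mono\<close>)
  then have "has_weak_pd S j f = has_weak_pd S j g" using L by (intro ext) (simp add: has_weak_pd_def)
  then show ?thesis by (simp add: wpd_def)
qed

locale cell_problem =
  fixes M :: "'d::finite cell_model"
  assumes cell: "periodicity_cell M" and material: "material M" and cells: "cell_functions M"
begin

abbreviation "Y \<equiv> lebesgue_on (Ycell M)"

lemma Y_sets: "Ycell M \<in> sets lebesgue"
  using cell by (simp add: periodicity_cell_def)

lemma elast_sym: "AE y in Y. \<forall>i j k p. elast M i j k p y = elast M j i k p y \<and> elast M i j k p y = elast M i j p k y"
  using material unfolding material_def by (auto elim!: eventually_mono)

text \<open>Cell functions whose defining functionals agree are equal almost everywhere. All minor symmetries of the effective tensors in the superscript indices are instances.\<close>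

lemma unique_cell_solution_eq:
  assumes "unique_cell_solution M w F" "unique_cell_solution M w' F'" "\<And>v. F v = F' v"
  shows "AE y in Y. w' y = w y" "cd M w' = cd M w"
proof -
  have w: "w \<in> H1per M" "w' \<in> H1per M" using assms by (auto simp: unique_cell_solution_def)
  show eq: "AE y in Y. w' y = w y" using assms unfolding unique_cell_solution_def by simp
  have "L2 (Ycell M) v" if "v \<in> H1per M" for v using that by (auto simp: H1per_def sobolev.simps One_nat_def)
  then show "cd M w' = cd M w"
    unfolding cd_def[abs_def] using wpd_cong_on[OF Y_sets _ _ eq] w by simp
qed

lemma avg_cong: "AE y in Y. f y = g y \<Longrightarrow> avg M f = avg M g"
  by (simp add: avg_def integral_lebesgue_on_cong_AE[OF Y_sets])

lemma chi1_eqs: "unique_cell_solution M (chi1 M k l) (\<lambda>v.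
    - (\<integral>y. (\<Sum>(r,s)\<in>UNIV. elast M k l r s y * cd M v r s y) \<partial>Y))"
  and chi2_eqs: "unique_cell_solution M (chi2 M k l m) (\<lambda>v.
    (\<integral>y. (\<Sum>r\<in>UNIV. (S0 M k l m r y - C0 M k l m r) * v y $ r) -
       (\<Sum>(p,r,s)\<in>UNIV. chi1 M k l y $ p * elast M p m r s y * cd M v r s y) \<partial>Y))"
  and chi3_eqs: "unique_cell_solution M (chi3 M k l m n) (\<lambda>v.
    (\<integral>y. (\<Sum>r\<in>UNIV. (S1 M k l m r n y - C1 M r n k l m) * v y $ r) -
       (\<Sum>(p,r,s)\<in>UNIV. chi2 M k l m y $ p * elast M p n r s y * cd M v r s y) \<partial>Y))"
  using cells unfolding cell_functions_def by blast+

lemma chi1_swap: "AE y in Y. chi1 M l k y = chi1 M k l y" "cd M (chi1 M l k) = cd M (chi1 M k l)"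
proof -
  have "- (\<integral>y. (\<Sum>(r,s)\<in>UNIV. elast M k l r s y * cd M v r s y) \<partial>Y) = - (\<integral>y. (\<Sum>(r,s)\<in>UNIV. elast M l k r s y * cd M v r s y) \<partial>Y)" for v
  proof (subst integral_lebesgue_on_cong_AE[OF Y_sets])
    show "AE y in Y. (\<Sum>(r,s)\<in>UNIV. elast M k l r s y * cd M v r s y) = (\<Sum>(r,s)\<in>UNIV. elast M l k r s y * cd M v r s y)"
      using elast_sym by (rule eventually_mono) (metis (no_types, lifting))
  qed simp
  from unique_cell_solution_eq[OF chi1_eqs chi1_eqs this]
  show "AE y in Y. chi1 M l k y = chi1 M k l y" "cd M (chi1 M l k) = cd M (chi1 M k l)" .
qed

lemma S0_swap: "AE y in Y. \<forall>i j. S0 M k l j i y = S0 M k l i j y" "AE y in Y. \<forall>i j. S0 M l k i j y = S0 M k l i j y"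
proof -
  show "AE y in Y. \<forall>i j. S0 M k l j i y = S0 M k l i j y"
    using elast_sym
  proof (rule eventually_mono)
    fix y assume "\<forall>i j k p. elast M i j k p y = elast M j i k p y \<and> elast M i j k p y = elast M i j p k y"
    then have e: "elast M j i p q y = elast M i j p q y" for i j p q by blast
    show "\<forall>i j. S0 M k l j i y = S0 M k l i j y"
      by (simp add: S0_def e)
  qed
  show "AE y in Y. \<forall>i j. S0 M l k i j y = S0 M k l i j y"
    using elast_sym by (rule eventually_mono) (simp add: S0_def chi1_swap(2)[of l k])
qed

lemma C0_swap: "C0 M j i k l = C0 M i j k l" "C0 M i j l k = C0 M i j k l"
  unfolding C0_def using S0_swap[of k l] by (auto intro!: avg_cong elim: eventually_mono)

lemma chi2_swap: "AE y in Y. chi2 M l k m y = chi2 M k l m y" "cd M (chi2 M l k m) = cd M (chi2 M k l m)"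
proof -
  have "(\<integral>y. (\<Sum>r\<in>UNIV. (S0 M k l m r y - C0 M k l m r) * v y $ r) -
       (\<Sum>(p,r,s)\<in>UNIV. chi1 M k l y $ p * elast M p m r s y * cd M v r s y) \<partial>Y) =
    (\<integral>y. (\<Sum>r\<in>UNIV. (S0 M l k m r y - C0 M l k m r) * v y $ r) -
       (\<Sum>(p,r,s)\<in>UNIV. chi1 M l k y $ p * elast M p m r s y * cd M v r s y) \<partial>Y)" for v
    by (rule integral_lebesgue_on_cong_AE[OF Y_sets])
      (use chi1_swap(1)[of l k] S0_swap(2)[of l k] in \<open>eventually_elim, simp add: C0_swap(1)[of l k]\<close>)
  from unique_cell_solution_eq[OF chi2_eqs chi2_eqs this]
  show "AE y in Y. chi2 M l k m y = chi2 M k l m y" "cd M (chi2 M l k m) = cd M (chi2 M k l m)" .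
qed

lemma S1_swap: "AE y in Y. \<forall>i j. S1 M k l m j i y = S1 M k l m i j y" "AE y in Y. \<forall>i j. S1 M l k m i j y = S1 M k l m i j y"
proof -
  show "AE y in Y. \<forall>i j. S1 M k l m j i y = S1 M k l m i j y"
    using elast_sym
  proof (rule eventually_mono)
    fix y assume "\<forall>i j k p. elast M i j k p y = elast M j i k p y \<and> elast M i j k p y = elast M i j p k y"
    then have e: "elast M j i p q y = elast M i j p q y" for i j p q by blast
    show "\<forall>i j. S1 M k l m j i y = S1 M k l m i j y"
      by (simp add: S1_def e)
  qed
  show "AE y in Y. \<forall>i j. S1 M l k m i j y = S1 M k l m i j y"
    using chi1_swap(1)[of l k] by (rule eventually_mono) (simp add: S1_def chi2_swap(2)[of l k])
qed

lemma C1_swap: "C1 M j i k l m = C1 M i j k l m" "C1 M i j l k m = C1 M i j k l m"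
  unfolding C1_def using S1_swap[of k l m] by (auto intro!: avg_cong elim: eventually_mono)

lemma chi3_swap: "cd M (chi3 M l k m n) = cd M (chi3 M k l m n)"
proof -
  have "(\<integral>y. (\<Sum>r\<in>UNIV. (S1 M k l m r n y - C1 M r n k l m) * v y $ r) -
       (\<Sum>(p,r,s)\<in>UNIV. chi2 M k l m y $ p * elast M p n r s y * cd M v r s y) \<partial>Y) =
    (\<integral>y. (\<Sum>r\<in>UNIV. (S1 M l k m r n y - C1 M r n l k m) * v y $ r) -
       (\<Sum>(p,r,s)\<in>UNIV. chi2 M l k m y $ p * elast M p n r s y * cd M v r s y) \<partial>Y)" for v
    by (rule integral_lebesgue_on_cong_AE[OF Y_sets])
      (use chi2_swap(1)[of l k m] S1_swap(2)[of l k m] in \<open>eventually_elim, simp add: C1_swap(2)[of _ _ l k]\<close>)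
  from unique_cell_solution_eq(2)[OF chi3_eqs chi3_eqs this]
  show "cd M (chi3 M l k m n) = cd M (chi3 M k l m n)" .
qed

text \<open>The symmetry in the first pair is that of the elasticity tensor; in the second pair it comes from the cell functions.\<close>

lemma C2_swap: "C2 M j i n k l m = C2 M i j n k l m" "C2 M i j n l k m = C2 M i j n k l m"
proof -
  show "C2 M j i n k l m = C2 M i j n k l m" unfolding C2_def
    by (rule avg_cong) (use elast_sym in \<open>rule eventually_mono\<close>, metis (no_types, lifting))
  show "C2 M i j n l k m = C2 M i j n k l m" unfolding C2_def
    by (rule avg_cong) (use chi2_swap(1)[of l k m] in \<open>rule eventually_mono\<close>, simp add: chi3_swap[of l k])
qed

lemma A2_swap: "A2 M \<theta> j i n k l m = A2 M \<theta> i j n k l m" "A2 M \<theta> i j n l k m = A2 M \<theta> i j n k l m"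
  unfolding A2_def by (simp_all add: C0_swap(1)[of i j] C0_swap(2)[of _ _ i j] C0_swap(2)[of _ _ k l] C2_swap(1)[of i j] C2_swap(2)[of _ _ _ k l])

end

section \<open>Contraction of vanishing forms with symmetric tensors\<close>

lemma sum_delta_left: "(\<Sum>j\<in>(UNIV::'d::finite set). (if j = n then 1 else 0) * f j) = (f n :: real)"
  by (simp add: if_distrib[of "\<lambda>x. x * _"] cong: if_cong)

text \<open>Polarization: a quadratic form that vanishes identically has an antisymmetric coefficient matrix.\<close>

lemma contract2:
  fixes c t :: "'d::finite \<Rightarrow> 'd \<Rightarrow> real"
  assumes c: "\<And>\<xi>::'d \<Rightarrow> real. (\<Sum>j\<in>UNIV. \<Sum>l\<in>UNIV. c j l * \<xi> j * \<xi> l) = 0"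
    and t: "\<And>j l. t j l = t l j"
  shows "(\<Sum>j\<in>UNIV. \<Sum>l\<in>UNIV. c j l * t j l) = 0"
proof -
  define e where "e n j = (if j = n then 1 else 0 :: real)" for n j :: 'd
  have F: "(\<Sum>j\<in>UNIV. \<Sum>l\<in>UNIV. c j l * e n j * e m l) = c n m" for n m
  proof -
    have "(\<Sum>j\<in>UNIV. \<Sum>l\<in>UNIV. c j l * e n j * e m l) = (\<Sum>j\<in>UNIV. e n j * (\<Sum>l\<in>UNIV. e m l * c j l))"
      by (simp add: sum_distrib_left mult_ac)
    then show ?thesis by (simp only: e_def sum_delta_left)
  qed
  have "(\<Sum>j\<in>UNIV. \<Sum>l\<in>UNIV. c j l * (e n j + e m j) * (e n l + e m l)) = c n n + c n m + c m n + c m m" for n m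
    by (simp add: distrib_left distrib_right sum.distrib F)
  then have anti: "c n m + c m n = 0" for n m using c[of "\<lambda>j. e n j + e m j"] c[of "e n"] c[of "e m"] F by simp
  have "(\<Sum>j\<in>UNIV. \<Sum>l\<in>UNIV. c j l * t j l) = (\<Sum>j\<in>UNIV. \<Sum>l\<in>UNIV. c l j * t j l)"
    by (subst sum.swap) (simp add: t)
  then have "2 * (\<Sum>j\<in>UNIV. \<Sum>l\<in>UNIV. c j l * t j l) = (\<Sum>j\<in>UNIV. \<Sum>l\<in>UNIV. (c j l + c l j) * t j l)"
    by (simp add: distrib_right sum.distrib)
  then show ?thesis by (simp add: anti)
qed

text \<open>Polarization, for forms of degree three.\<close>

lemma contract3:
  fixes c t :: "'d::finite \<Rightarrow> 'd \<Rightarrow> 'd \<Rightarrow> real"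
  assumes c: "\<And>\<xi>::'d \<Rightarrow> real. (\<Sum>j\<in>UNIV. \<Sum>l\<in>UNIV. \<Sum>m\<in>UNIV. c j l m * \<xi> j * \<xi> l * \<xi> m) = 0"
    and t: "\<And>j l m. t j l m = t l j m" "\<And>j l m. t j l m = t j m l"
  shows "(\<Sum>j\<in>UNIV. \<Sum>l\<in>UNIV. \<Sum>m\<in>UNIV. c j l m * t j l m) = 0"
proof -
  have "(\<Sum>l\<in>UNIV. \<Sum>m\<in>UNIV. (c n l m + c l n m + c l m n) * t n l m) = 0" for n
  proof (rule contract2)
    fix \<xi> :: "'d \<Rightarrow> real"
    define e where "e j = (if j = n then 1 else 0 :: real)" for j
    have "((\<lambda>s. \<Sum>j\<in>UNIV. \<Sum>l\<in>UNIV. \<Sum>m\<in>UNIV. c j l m * (\<xi> j + s * e j) * (\<xi> l + s * e l) * (\<xi> m + s * e m))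
      has_real_derivative (\<Sum>j\<in>UNIV. \<Sum>l\<in>UNIV. \<Sum>m\<in>UNIV. c j l m * (e j * \<xi> l * \<xi> m + \<xi> j * e l * \<xi> m + \<xi> j * \<xi> l * e m))) (at 0)"
      by (auto intro!: derivative_eq_intros sum.cong simp: algebra_simps)
    then have "((\<lambda>s. 0) has_real_derivative (\<Sum>j\<in>UNIV. \<Sum>l\<in>UNIV. \<Sum>m\<in>UNIV. c j l m * (e j * \<xi> l * \<xi> m + \<xi> j * e l * \<xi> m + \<xi> j * \<xi> l * e m))) (at 0)"
      by (simp only: c)
    then have 0: "(\<Sum>j\<in>UNIV. \<Sum>l\<in>UNIV. \<Sum>m\<in>UNIV. c j l m * (e j * \<xi> l * \<xi> m + \<xi> j * e l * \<xi> m + \<xi> j * \<xi> l * e m)) = 0"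
      using DERIV_unique[OF _ DERIV_const] by blast
    have "(\<Sum>j\<in>UNIV. \<Sum>l\<in>UNIV. \<Sum>m\<in>UNIV. c j l m * (e j * \<xi> l * \<xi> m + \<xi> j * e l * \<xi> m + \<xi> j * \<xi> l * e m))
      = (\<Sum>j\<in>UNIV. e j * (\<Sum>l\<in>UNIV. \<Sum>m\<in>UNIV. c j l m * \<xi> l * \<xi> m))
      + (\<Sum>j\<in>UNIV. \<Sum>l\<in>UNIV. e l * (\<Sum>m\<in>UNIV. c j l m * \<xi> j * \<xi> m))
      + (\<Sum>j\<in>UNIV. \<Sum>l\<in>UNIV. \<Sum>m\<in>UNIV. e m * (c j l m * \<xi> j * \<xi> l))"
      by (simp add: sum_distrib_left distrib_left sum.distrib mult_ac)
    also have "\<dots> = (\<Sum>l\<in>UNIV. \<Sum>m\<in>UNIV. (c n l m + c l n m + c l m n) * \<xi> l * \<xi> m)"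
      by (simp add: e_def sum_delta_left sum.distrib distrib_right del: mult_if_delta)
    finally show "(\<Sum>l\<in>UNIV. \<Sum>m\<in>UNIV. (c n l m + c l n m + c l m n) * \<xi> l * \<xi> m) = 0" using 0 by simp
  qed (rule t)
  then have "0 = (\<Sum>n\<in>UNIV. \<Sum>l\<in>UNIV. \<Sum>m\<in>UNIV. (c n l m + c l n m + c l m n) * t n l m)" by simp
  also have "\<dots> = (\<Sum>n\<in>UNIV. \<Sum>l\<in>UNIV. \<Sum>m\<in>UNIV. c n l m * t n l m)
      + (\<Sum>n\<in>UNIV. \<Sum>l\<in>UNIV. \<Sum>m\<in>UNIV. c l n m * t l n m) + (\<Sum>n\<in>UNIV. \<Sum>l\<in>UNIV. \<Sum>m\<in>UNIV. c l m n * t l m n)"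
  proof -
    have "t n l m = t l n m" "t n l m = t l m n" for n l m using t by metis+
    then show ?thesis by (simp add: distrib_right sum.distrib)
  qed
  also have "(\<Sum>n\<in>UNIV. \<Sum>l\<in>UNIV. \<Sum>m\<in>UNIV. c l n m * t l n m) = (\<Sum>n\<in>UNIV. \<Sum>l\<in>UNIV. \<Sum>m\<in>UNIV. c n l m * t n l m)"
    by (rule sum.swap)
  also have "(\<Sum>n\<in>UNIV. \<Sum>l\<in>UNIV. \<Sum>m\<in>UNIV. c l m n * t l m n) = (\<Sum>l\<in>UNIV. \<Sum>n\<in>UNIV. \<Sum>m\<in>UNIV. c l m n * t l m n)"
    by (rule sum.swap)
  also have "\<dots> = (\<Sum>l\<in>UNIV. \<Sum>m\<in>UNIV. \<Sum>n\<in>UNIV. c l m n * t l m n)"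
    by (intro sum.cong refl sum.swap)
  finally show ?thesis by simp
qed

text \<open>Differentiating the identity in direction \<open>n\<close> reduces the degree by one; symmetry of \<open>t\<close> identifies the four resulting terms.\<close>

lemma contract4:
  fixes c t :: "'d::finite \<Rightarrow> 'd \<Rightarrow> 'd \<Rightarrow> 'd \<Rightarrow> real"
  assumes c: "\<And>\<xi>::'d \<Rightarrow> real. (\<Sum>j\<in>UNIV. \<Sum>k\<in>UNIV. \<Sum>l\<in>UNIV. \<Sum>m\<in>UNIV. c j k l m * \<xi> j * \<xi> k * \<xi> l * \<xi> m) = 0"
    and t: "\<And>j k l m. t j k l m = t k j l m" "\<And>j k l m. t j k l m = t j l k m" "\<And>j k l m. t j k l m = t j k m l"
  shows "(\<Sum>j\<in>UNIV. \<Sum>k\<in>UNIV. \<Sum>l\<in>UNIV. \<Sum>m\<in>UNIV. c j k l m * t j k l m) = 0"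
proof -
  have "(\<Sum>k\<in>UNIV. \<Sum>l\<in>UNIV. \<Sum>m\<in>UNIV. (c n k l m + c k n l m + c k l n m + c k l m n) * t n k l m) = 0" for n
  proof (rule contract3)
    fix \<xi> :: "'d \<Rightarrow> real"
    define e where "e j = (if j = n then 1 else 0 :: real)" for j
    let ?D = "\<Sum>j\<in>UNIV. \<Sum>k\<in>UNIV. \<Sum>l\<in>UNIV. \<Sum>m\<in>UNIV. c j k l m *
      (e j * \<xi> k * \<xi> l * \<xi> m + \<xi> j * e k * \<xi> l * \<xi> m + \<xi> j * \<xi> k * e l * \<xi> m + \<xi> j * \<xi> k * \<xi> l * e m)"
    have "((\<lambda>s. \<Sum>j\<in>UNIV. \<Sum>k\<in>UNIV. \<Sum>l\<in>UNIV. \<Sum>m\<in>UNIV. c j k l m * (\<xi> j + s * e j) * (\<xi> k + s * e k) * (\<xi> l + s * e l) * (\<xi> m + s * e m))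
      has_real_derivative ?D) (at 0)"
      by (auto intro!: derivative_eq_intros sum.cong simp: algebra_simps)
    then have "((\<lambda>s. 0) has_real_derivative ?D) (at 0)" by (simp only: c)
    then have 0: "?D = 0" using DERIV_unique[OF _ DERIV_const] by blast
    have "?D = (\<Sum>j\<in>UNIV. e j * (\<Sum>k\<in>UNIV. \<Sum>l\<in>UNIV. \<Sum>m\<in>UNIV. c j k l m * \<xi> k * \<xi> l * \<xi> m))
      + (\<Sum>j\<in>UNIV. \<Sum>k\<in>UNIV. e k * (\<Sum>l\<in>UNIV. \<Sum>m\<in>UNIV. c j k l m * \<xi> j * \<xi> l * \<xi> m))
      + (\<Sum>j\<in>UNIV. \<Sum>k\<in>UNIV. \<Sum>l\<in>UNIV. e l * (\<Sum>m\<in>UNIV. c j k l m * \<xi> j * \<xi> k * \<xi> m))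
      + (\<Sum>j\<in>UNIV. \<Sum>k\<in>UNIV. \<Sum>l\<in>UNIV. \<Sum>m\<in>UNIV. e m * (c j k l m * \<xi> j * \<xi> k * \<xi> l))"
      by (simp add: sum_distrib_left distrib_left sum.distrib mult_ac)
    also have "\<dots> = (\<Sum>k\<in>UNIV. \<Sum>l\<in>UNIV. \<Sum>m\<in>UNIV. (c n k l m + c k n l m + c k l n m + c k l m n) * \<xi> k * \<xi> l * \<xi> m)"
      by (simp add: e_def sum_delta_left sum.distrib distrib_right)
    finally show "(\<Sum>k\<in>UNIV. \<Sum>l\<in>UNIV. \<Sum>m\<in>UNIV. (c n k l m + c k n l m + c k l n m + c k l m n) * \<xi> k * \<xi> l * \<xi> m) = 0" using 0 by simp
  qed (rule t(2,3))+
  then have "0 = (\<Sum>n\<in>UNIV. \<Sum>k\<in>UNIV. \<Sum>l\<in>UNIV. \<Sum>m\<in>UNIV. (c n k l m + c k n l m + c k l n m + c k l m n) * t n k l m)" by simp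
  also have "\<dots> = (\<Sum>n\<in>UNIV. \<Sum>k\<in>UNIV. \<Sum>l\<in>UNIV. \<Sum>m\<in>UNIV. c n k l m * t n k l m)
      + (\<Sum>n\<in>UNIV. \<Sum>k\<in>UNIV. \<Sum>l\<in>UNIV. \<Sum>m\<in>UNIV. c k n l m * t k n l m)
      + (\<Sum>n\<in>UNIV. \<Sum>k\<in>UNIV. \<Sum>l\<in>UNIV. \<Sum>m\<in>UNIV. c k l n m * t k l n m)
      + (\<Sum>n\<in>UNIV. \<Sum>k\<in>UNIV. \<Sum>l\<in>UNIV. \<Sum>m\<in>UNIV. c k l m n * t k l m n)"
  proof -
    have "t n k l m = t k n l m" "t n k l m = t k l n m" "t n k l m = t k l m n" for n k l m using t by metis+
    then show ?thesis by (simp add: distrib_right sum.distrib)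
  qed
  also have "(\<Sum>n\<in>UNIV. \<Sum>k\<in>UNIV. \<Sum>l\<in>UNIV. \<Sum>m\<in>UNIV. c k n l m * t k n l m) = (\<Sum>n\<in>UNIV. \<Sum>k\<in>UNIV. \<Sum>l\<in>UNIV. \<Sum>m\<in>UNIV. c n k l m * t n k l m)"
    by (rule sum.swap)
  also have "(\<Sum>n\<in>UNIV. \<Sum>k\<in>UNIV. \<Sum>l\<in>UNIV. \<Sum>m\<in>UNIV. c k l n m * t k l n m) = (\<Sum>k\<in>UNIV. \<Sum>n\<in>UNIV. \<Sum>l\<in>UNIV. \<Sum>m\<in>UNIV. c k l n m * t k l n m)"
    by (rule sum.swap)
  also have "\<dots> = (\<Sum>k\<in>UNIV. \<Sum>l\<in>UNIV. \<Sum>n\<in>UNIV. \<Sum>m\<in>UNIV. c k l n m * t k l n m)"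
    by (intro sum.cong refl sum.swap)
  also have "(\<Sum>n\<in>UNIV. \<Sum>k\<in>UNIV. \<Sum>l\<in>UNIV. \<Sum>m\<in>UNIV. c k l m n * t k l m n) = (\<Sum>k\<in>UNIV. \<Sum>n\<in>UNIV. \<Sum>l\<in>UNIV. \<Sum>m\<in>UNIV. c k l m n * t k l m n)"
    by (rule sum.swap)
  also have "\<dots> = (\<Sum>k\<in>UNIV. \<Sum>l\<in>UNIV. \<Sum>n\<in>UNIV. \<Sum>m\<in>UNIV. c k l m n * t k l m n)"
    by (intro sum.cong refl sum.swap)
  also have "\<dots> = (\<Sum>k\<in>UNIV. \<Sum>l\<in>UNIV. \<Sum>m\<in>UNIV. \<Sum>n\<in>UNIV. c k l m n * t k l m n)"
    by (intro sum.cong refl sum.swap)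
  finally show ?thesis by simp
qed

section \<open>Bounded bilinear forms on Sobolev spaces\<close>

text \<open>Bounded linear maps into \<open>L\<^sup>2\<close>, linear up to null sets; the norm bound is one, which suffices for components of derivatives.\<close>

definition l2op :: "nat \<Rightarrow> ('d::finite field \<Rightarrow> real ^ 'd \<Rightarrow> real) \<Rightarrow> bool" where
  "l2op k D \<longleftrightarrow> (\<forall>U\<in>sobolev k UNIV. L2 UNIV (D U) \<and> l2ip (D U) (D U) \<le> sip k U U) \<and>
     (\<forall>U\<in>sobolev k UNIV. \<forall>V\<in>sobolev k UNIV. \<forall>a. AE x in lebesgue. D (a *\<^sub>R U + V) x = (a *\<^sub>R D U + D V) x)"

text \<open>The bound is squared to avoid square roots.\<close>

definition bform :: "nat \<Rightarrow> ('d::finite field \<Rightarrow> 'd field \<Rightarrow> real) \<Rightarrow> bool" where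
  "bform k b \<longleftrightarrow> (\<forall>U\<in>sobolev k UNIV. \<forall>V\<in>sobolev k UNIV. \<forall>W\<in>sobolev k UNIV. \<forall>a.
       b (a *\<^sub>R U + V) W = a * b U W + b V W \<and> b W (a *\<^sub>R U + V) = a * b W U + b W V) \<and>
     (\<exists>K\<ge>0. \<forall>U\<in>sobolev k UNIV. \<forall>W\<in>sobolev k UNIV. (b U W)\<^sup>2 \<le> K * (sip k U U * sip k W W))"

lemma bformD:
  assumes "bform k b" "U \<in> sobolev k UNIV" "V \<in> sobolev k UNIV" "W \<in> sobolev k UNIV"
  shows bform_left: "b (a *\<^sub>R U + V) W = a * b U W + b V W" and bform_right: "b W (a *\<^sub>R U + V) = a * b W U + b W V"
  using assms unfolding bform_def by blast+

lemma bformI: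
  assumes "\<And>U V W a. U \<in> sobolev k UNIV \<Longrightarrow> V \<in> sobolev k UNIV \<Longrightarrow> W \<in> sobolev k UNIV \<Longrightarrow> b (a *\<^sub>R U + V) W = a * b U W + b V W"
    and "\<And>U V W a. U \<in> sobolev k UNIV \<Longrightarrow> V \<in> sobolev k UNIV \<Longrightarrow> W \<in> sobolev k UNIV \<Longrightarrow> b W (a *\<^sub>R U + V) = a * b W U + b W V"
    and "0 \<le> K" "\<And>U W. U \<in> sobolev k UNIV \<Longrightarrow> W \<in> sobolev k UNIV \<Longrightarrow> (b U W)\<^sup>2 \<le> K * (sip k U U * sip k W W)"
  shows "bform k b"
  unfolding bform_def using assms by blast

lemma bform_bound:
  assumes "bform k b"
  obtains K where "0 \<le> K" "\<And>U W. U \<in> sobolev k UNIV \<Longrightarrow> W \<in> sobolev k UNIV \<Longrightarrow> (b U W)\<^sup>2 \<le> K * (sip k U U * sip k W W)"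
  using assms unfolding bform_def by blast

lemma bform_l2ip:
  assumes D: "l2op k D" and E: "l2op k E"
  shows "bform k (\<lambda>U W. l2ip (D W) (E U))"
  unfolding bform_def
proof (intro conjI ballI allI exI[of _ 1])
  fix U V W :: "'a field" and a :: real assume S: "U \<in> sobolev k UNIV" "V \<in> sobolev k UNIV" "W \<in> sobolev k UNIV"
  have L: "L2 UNIV (D X)" "L2 UNIV (E X)" if "X \<in> sobolev k UNIV" for X using D E that by (auto simp: l2op_def)
  have ax: "AE x in lebesgue. D (a *\<^sub>R U + V) x = (a *\<^sub>R D U + D V) x" "AE x in lebesgue. E (a *\<^sub>R U + V) x = (a *\<^sub>R E U + E V) x"
    using D E S unfolding l2op_def by blast+
  show "l2ip (D W) (E (a *\<^sub>R U + V)) = a * l2ip (D W) (E U) + l2ip (D W) (E V)"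
    using l2ip_cong_AE[OF AE_I2[OF refl] ax(2), of "D W"] L S
    by (simp only: l2.ip_add_right l2.ip_scale_right L2_scaleR mem_Collect_eq)
  show "l2ip (D (a *\<^sub>R U + V)) (E W) = a * l2ip (D U) (E W) + l2ip (D V) (E W)"
    using l2ip_cong_AE[OF ax(1) AE_I2[OF refl], of "E W"] L S
    by (simp only: l2.ip_add l2.ip_scale L2_scaleR mem_Collect_eq)
  have "(l2ip (D W) (E U))\<^sup>2 \<le> l2ip (D W) (D W) * l2ip (E U) (E U)"
    by (rule l2.ip_cauchy_schwarz) (use L S in auto)
  also have "\<dots> \<le> sip k W W * sip k U U"
    using D E S unfolding l2op_def by (intro mult_mono) (auto simp: l2ip_nonneg sip_nonneg)
  finally show "(l2ip (D W) (E U))\<^sup>2 \<le> 1 * (sip k U U * sip k W W)" by (simp add: mult.commute)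
qed simp

lemma bform_zero: "bform k (\<lambda>U W. 0)"
  unfolding bform_def by (auto intro!: exI[of _ 0])

lemma bform_cmult: assumes "bform k b" shows "bform k (\<lambda>U W. c * b U W)"
proof -
  obtain K where K: "0 \<le> K" "\<And>U W. U \<in> sobolev k UNIV \<Longrightarrow> W \<in> sobolev k UNIV \<Longrightarrow> (b U W)\<^sup>2 \<le> K * (sip k U U * sip k W W)"
    using bform_bound[OF assms] by blast
  have "(c * b U W)\<^sup>2 \<le> (c\<^sup>2 * K) * (sip k U U * sip k W W)" if "U \<in> sobolev k UNIV" "W \<in> sobolev k UNIV" for U W
    using mult_left_mono[OF K(2)[OF that], of "c\<^sup>2"] by (simp add: power_mult_distrib mult.assoc)
  moreover have "0 \<le> c\<^sup>2 * K" using K by simp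
  ultimately show ?thesis
  proof (intro bformI)
    fix U V W :: "'a field" and a :: real
    assume S: "U \<in> sobolev k UNIV" "V \<in> sobolev k UNIV" "W \<in> sobolev k UNIV"
    show "c * b (a *\<^sub>R U + V) W = a * (c * b U W) + c * b V W"
      by (simp only: bform_left[OF assms S] distrib_left mult.left_commute)
    show "c * b W (a *\<^sub>R U + V) = a * (c * b W U) + c * b W V"
      by (simp only: bform_right[OF assms S] distrib_left mult.left_commute)
  qed
qed

lemma bform_add: assumes "bform k b" "bform k b'" shows "bform k (\<lambda>U W. b U W + b' U W)"
proof -
  obtain K where K: "0 \<le> K" "\<And>U W. U \<in> sobolev k UNIV \<Longrightarrow> W \<in> sobolev k UNIV \<Longrightarrow> (b U W)\<^sup>2 \<le> K * (sip k U U * sip k W W)"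
    using bform_bound[OF assms(1)] by blast
  obtain K' where K': "0 \<le> K'" "\<And>U W. U \<in> sobolev k UNIV \<Longrightarrow> W \<in> sobolev k UNIV \<Longrightarrow> (b' U W)\<^sup>2 \<le> K' * (sip k U U * sip k W W)"
    using bform_bound[OF assms(2)] by blast
  have "(b U W + b' U W)\<^sup>2 \<le> (2 * K + 2 * K') * (sip k U U * sip k W W)" if "U \<in> sobolev k UNIV" "W \<in> sobolev k UNIV" for U W
  proof -
    have "(b U W + b' U W)\<^sup>2 \<le> 2 * (b U W)\<^sup>2 + 2 * (b' U W)\<^sup>2"
      using zero_le_power2[of "b U W - b' U W"] by (simp add: power2_eq_square algebra_simps)
    then show ?thesis using K(2)[OF that] K'(2)[OF that] by (simp add: algebra_simps)
  qed
  moreover have "0 \<le> 2 * K + 2 * K'" using K K' by simp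
  ultimately show ?thesis
  proof (intro bformI)
    fix U V W :: "'a field" and a :: real
    assume S: "U \<in> sobolev k UNIV" "V \<in> sobolev k UNIV" "W \<in> sobolev k UNIV"
    show "b (a *\<^sub>R U + V) W + b' (a *\<^sub>R U + V) W = a * (b U W + b' U W) + (b V W + b' V W)"
      using bform_left[OF assms(1) S] bform_left[OF assms(2) S] by (simp only: distrib_left)
    show "b W (a *\<^sub>R U + V) + b' W (a *\<^sub>R U + V) = a * (b W U + b' W U) + (b W V + b' W V)"
      using bform_right[OF assms(1) S] bform_right[OF assms(2) S] by (simp only: distrib_left)
  qed
qed

lemma bform_sum: "finite A \<Longrightarrow> (\<And>i. i \<in> A \<Longrightarrow> bform k (b i)) \<Longrightarrow> bform k (\<lambda>U W. \<Sum>i\<in>A. b i U W)"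
  by (induction A rule: finite_induct) (auto intro: bform_zero bform_add)

lemma bform_flip: "bform k b \<Longrightarrow> bform k (\<lambda>U W. b W U)"
  unfolding bform_def by (metis (no_types, lifting) mult.commute)

definition fform :: "nat \<Rightarrow> ('d::finite field \<Rightarrow> real) \<Rightarrow> bool" where
  "fform k g \<longleftrightarrow> (\<forall>U\<in>sobolev k UNIV. \<forall>W\<in>sobolev k UNIV. \<forall>a. g (a *\<^sub>R U + W) = a * g U + g W) \<and>
     (\<exists>K\<ge>0. \<forall>U\<in>sobolev k UNIV. (g U)\<^sup>2 \<le> K * sip k U U)"

lemma fform_linear:
  "fform k g \<Longrightarrow> U \<in> sobolev k UNIV \<Longrightarrow> W \<in> sobolev k UNIV \<Longrightarrow> g (a *\<^sub>R U + W) = a * g U + g W"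
  unfolding fform_def by blast

lemma fform_bound:
  assumes "fform k g" obtains K where "0 \<le> K" "\<And>U. U \<in> sobolev k UNIV \<Longrightarrow> (g U)\<^sup>2 \<le> K * sip k U U"
  using assms unfolding fform_def by blast

lemma fform_diff:
  assumes g: "fform k g" and U: "U \<in> sobolev k UNIV" and W: "W \<in> sobolev k UNIV"
  shows "g (U - W) = g U - g W"
  using fform_linear[OF g W U, of "-1"] by simp

lemma bform_fform:
  assumes b: "bform k b" and W: "W \<in> sobolev k UNIV"
  shows "fform k (\<lambda>U. b U W)" and "fform k (b W)"
proof -
  obtain K where K: "0 \<le> K" "\<And>U W. U \<in> sobolev k UNIV \<Longrightarrow> W \<in> sobolev k UNIV \<Longrightarrow> (b U W)\<^sup>2 \<le> K * (sip k U U * sip k W W)"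
    using bform_bound[OF b] by blast
  have "0 \<le> K * sip k W W" using K(1) by (simp add: sip_nonneg)
  moreover have "(b U W)\<^sup>2 \<le> (K * sip k W W) * sip k U U" "(b W U)\<^sup>2 \<le> (K * sip k W W) * sip k U U"
    if "U \<in> sobolev k UNIV" for U
    using K(2)[OF that W] K(2)[OF W that] by (simp_all add: mult_ac)
  ultimately have "\<exists>K\<ge>0. \<forall>U\<in>sobolev k UNIV. (b U W)\<^sup>2 \<le> K * sip k U U" "\<exists>K\<ge>0. \<forall>U\<in>sobolev k UNIV. (b W U)\<^sup>2 \<le> K * sip k U U"
    by blast+
  then show "fform k (\<lambda>U. b U W)" "fform k (b W)"
    unfolding fform_def using bformD[OF b _ _ W] by blast+
qed

text \<open>Density of the test fields.\<close>

lemma fform_vanishing: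
  assumes g: "fform k g" and z: "\<And>\<phi>. test_fun UNIV \<phi> \<Longrightarrow> g \<phi> = 0" and U: "U \<in> sobolev k UNIV"
  shows "g U = 0"
proof (rule ccontr)
  assume ne: "g U \<noteq> 0"
  obtain K where K: "0 \<le> K" "\<And>U. U \<in> sobolev k UNIV \<Longrightarrow> (g U)\<^sup>2 \<le> K * sip k U U"
    using fform_bound[OF g] by blast
  obtain \<phi> where p: "test_fun UNIV \<phi>" "sip k (\<phi> - U) (\<phi> - U) < (g U)\<^sup>2 / (K + 1)"
    using test_fun_dense_sobolev[OF U, of "(g U)\<^sup>2 / (K + 1)"] ne K(1) by auto
  have pS: "\<phi> \<in> sobolev k UNIV" by (rule test_fun_sobolev[OF p(1)])
  have "(g U)\<^sup>2 \<le> K * sip k (\<phi> - U) (\<phi> - U)"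
    using K(2)[OF sobolev_diff[OF pS U]] fform_diff[OF g pS U] z[OF p(1)] by simp
  also have "\<dots> \<le> (K + 1) * sip k (\<phi> - U) (\<phi> - U)"
    by (rule mult_right_mono) (auto simp: sip_nonneg)
  also have "\<dots> < (K + 1) * ((g U)\<^sup>2 / (K + 1))" using p(2) K(1) by (intro mult_strict_left_mono) auto
  finally show False using K(1) by simp
qed

lemma bform_vanishing:
  assumes b: "bform k b" and z: "\<And>\<phi>. test_fun UNIV \<phi> \<Longrightarrow> b \<phi> W = 0" and U: "U \<in> sobolev k UNIV" and W: "W \<in> sobolev k UNIV"
  shows "b U W = 0"
  by (rule fform_vanishing[OF bform_fform(1)[OF b W] z U])

lemma bform_eqI:
  assumes b: "bform k b" and b': "bform k b'"
    and eq: "\<And>\<phi> \<psi>. test_fun UNIV \<phi> \<Longrightarrow> test_fun UNIV \<psi> \<Longrightarrow> b \<phi> \<psi> = b' \<phi> \<psi>"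
    and U: "U \<in> sobolev k UNIV" and W: "W \<in> sobolev k UNIV"
  shows "b U W = b' U W"
proof -
  define d where "d U W = b U W + (-1) * b' U W" for U W
  have d: "bform k d" unfolding d_def[abs_def] by (intro bform_add bform_cmult b b')
  have "d \<phi> W = 0" if p: "test_fun UNIV \<phi>" for \<phi>
  proof (rule bform_vanishing[OF bform_flip[OF d] _ W test_fun_sobolev[OF p]])
    show "d \<phi> \<psi> = 0" if "test_fun UNIV \<psi>" for \<psi> using eq[OF p that] by (simp add: d_def)
  qed
  then have "d U W = 0" by (rule bform_vanishing[OF d _ U W])
  then show ?thesis by (simp add: d_def)
qed

subsection \<open>Components of fields and of their derivatives\<close>

definition g0 :: "'d::finite field \<Rightarrow> 'd \<Rightarrow> real ^ 'd \<Rightarrow> real" where "g0 U i x = U x $ i"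
definition g1 :: "'d::finite \<Rightarrow> 'd field \<Rightarrow> 'd \<Rightarrow> real ^ 'd \<Rightarrow> real" where "g1 j U i x = wpd UNIV j U x $ i"
definition g2 :: "'d::finite \<Rightarrow> 'd \<Rightarrow> 'd field \<Rightarrow> 'd \<Rightarrow> real ^ 'd \<Rightarrow> real" where "g2 n j U i x = wpd UNIV n (wpd UNIV j U) x $ i"

lemma component_l2:
  fixes f :: "'d::finite field"
  assumes f: "L2 UNIV f" shows "L2 UNIV (\<lambda>x. f x $ i)" "l2ip (\<lambda>x. f x $ i) (\<lambda>x. f x $ i) \<le> l2ip f f"
proof -
  note [measurable] = L2_measurable[OF f]
  show L: "L2 UNIV (\<lambda>x. f x $ i)"
  proof (rule L2_bound[OF f, where K = 1])
    show "(\<lambda>x. f x $ i) \<in> borel_measurable lebesgue" by (rule measurable_compose[OF L2_measurable[OF f]]) simp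
  qed (use component_le_norm_cart in auto)
  show "l2ip (\<lambda>x. f x $ i) (\<lambda>x. f x $ i) \<le> l2ip f f"
    unfolding l2ip_def using L f
  proof (intro integral_mono L2_inner_integrable)
    fix x show "f x $ i \<bullet> f x $ i \<le> f x \<bullet> f x"
      using component_le_norm_cart[of "f x" i] by (simp add: power2_norm_eq_inner[symmetric] abs_le_square_iff[symmetric] power2_eq_square[symmetric])
  qed auto
qed

lemma wpd_lin:
  assumes "U \<in> sobolev (Suc k) UNIV" "V \<in> sobolev (Suc k) UNIV"
  shows "AE x in lebesgue. wpd UNIV j (a *\<^sub>R U + V) x = (a *\<^sub>R wpd UNIV j U + wpd UNIV j V) x"
  by (rule wpd_unique[OF has_weak_pd_add[OF has_weak_pd_scaleR[OF wpd_has_weak_pd[OF assms(1)]] wpd_has_weak_pd[OF assms(2)]]])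

lemma l2op_g0: "l2op k (\<lambda>U. g0 U i)"
  unfolding l2op_def g0_def
  using component_l2[OF sobolev_L2] order_trans[OF component_l2(2)[OF sobolev_L2] sip_ge_l2ip] by auto

lemma l2op_g1: "l2op (Suc k) (\<lambda>U. g1 j U i)"
  unfolding l2op_def g1_def
proof (intro conjI ballI allI)
  fix U :: "'a field" assume U: "U \<in> sobolev (Suc k) UNIV"
  have L: "L2 UNIV (wpd UNIV j U)" by (rule sobolev_L2[OF wpd_sobolev[OF U]])
  show "L2 UNIV (\<lambda>x. wpd UNIV j U x $ i)" by (rule component_l2[OF L])
  show "l2ip (\<lambda>x. wpd UNIV j U x $ i) (\<lambda>x. wpd UNIV j U x $ i) \<le> sip (Suc k) U U"
    by (rule order_trans[OF component_l2(2)[OF L] order_trans[OF sip_ge_l2ip sip_ge_wpd]])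
  fix V :: "'a field" and a :: real assume V: "V \<in> sobolev (Suc k) UNIV"
  show "AE x in lebesgue. wpd UNIV j (a *\<^sub>R U + V) x $ i = (a *\<^sub>R (\<lambda>x. wpd UNIV j U x $ i) + (\<lambda>x. wpd UNIV j V x $ i)) x"
    using wpd_lin[OF U V, where j = j and a = a] by (rule eventually_mono) simp
qed

lemma l2op_g2: "l2op (Suc (Suc k)) (\<lambda>U. g2 n j U i)"
  unfolding l2op_def g2_def
proof (intro conjI ballI allI)
  fix U :: "'a field" assume U: "U \<in> sobolev (Suc (Suc k)) UNIV"
  have L: "L2 UNIV (wpd UNIV n (wpd UNIV j U))" by (rule sobolev_L2[OF wpd_sobolev[OF wpd_sobolev[OF U]]])
  show "L2 UNIV (\<lambda>x. wpd UNIV n (wpd UNIV j U) x $ i)" by (rule component_l2[OF L])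
  show "l2ip (\<lambda>x. wpd UNIV n (wpd UNIV j U) x $ i) (\<lambda>x. wpd UNIV n (wpd UNIV j U) x $ i) \<le> sip (Suc (Suc k)) U U"
    by (rule order_trans[OF component_l2(2)[OF L] order_trans[OF order_trans[OF sip_ge_l2ip sip_ge_wpd] sip_ge_wpd]])
  fix V :: "'a field" and a :: real assume V: "V \<in> sobolev (Suc (Suc k)) UNIV"
  have "wpd UNIV n (wpd UNIV j (a *\<^sub>R U + V)) = wpd UNIV n (a *\<^sub>R wpd UNIV j U + wpd UNIV j V)"
    by (rule wpd_cong[OF wpd_lin[OF U V]])
  moreover have "AE x in lebesgue. wpd UNIV n (a *\<^sub>R wpd UNIV j U + wpd UNIV j V) x
      = (a *\<^sub>R wpd UNIV n (wpd UNIV j U) + wpd UNIV n (wpd UNIV j V)) x"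
    by (rule wpd_lin[OF wpd_sobolev[OF U] wpd_sobolev[OF V]])
  ultimately have "AE x in lebesgue. wpd UNIV n (wpd UNIV j (a *\<^sub>R U + V)) x
      = (a *\<^sub>R wpd UNIV n (wpd UNIV j U) + wpd UNIV n (wpd UNIV j V)) x" by (simp only:)
  then show "AE x in lebesgue. wpd UNIV n (wpd UNIV j (a *\<^sub>R U + V)) x $ i
      = (a *\<^sub>R (\<lambda>x. wpd UNIV n (wpd UNIV j U) x $ i) + (\<lambda>x. wpd UNIV n (wpd UNIV j V) x $ i)) x"
    by (rule eventually_mono) simp
qed

text \<open>Weak derivatives of test fields may be replaced by classical ones.\<close>

lemma test_components:
  fixes \<psi> :: "'d::finite field"
  assumes t: "test_fun UNIV \<psi>"
  shows "AE x in lebesgue. g1 j \<psi> i x = pd j (\<lambda>x. \<psi> x $ i) x" "AE x in lebesgue. g2 n j \<psi> i x = pd n (pd j (\<lambda>x. \<psi> x $ i)) x"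
proof -
  have c: "pd j f x $ i = pd j (\<lambda>x. f x $ i) x" if "test_fun UNIV f" for f :: "'d field" and x j
    by (rule pd_bounded_linear[OF bounded_linear_vec_nth smooth_differentiable[OF test_fun_smooth[OF that]], symmetric])
  have w: "AE x in lebesgue. wpd UNIV j \<psi> x = pd j \<psi> x" by (rule wpd_unique[OF test_fun_has_weak_pd[OF t]])
  then show "AE x in lebesgue. g1 j \<psi> i x = pd j (\<lambda>x. \<psi> x $ i) x"
    by (rule eventually_mono) (simp add: g1_def c[OF t])
  have "wpd UNIV n (wpd UNIV j \<psi>) = wpd UNIV n (pd j \<psi>)" by (rule wpd_cong[OF w])
  moreover have "AE x in lebesgue. wpd UNIV n (pd j \<psi>) x = pd n (pd j \<psi>) x"
    by (rule wpd_unique[OF test_fun_has_weak_pd[OF test_fun_pd[OF t]]])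
  moreover have "pd j (\<lambda>x. \<psi> x $ i) = (\<lambda>x. pd j \<psi> x $ i)" by (rule ext) (simp add: c[OF t])
  ultimately show "AE x in lebesgue. g2 n j \<psi> i x = pd n (pd j (\<lambda>x. \<psi> x $ i)) x"
    by (auto simp: g2_def c[OF test_fun_pd[OF t]] elim: eventually_mono)
qed

lemma l2ip_weak_pd:
  fixes f :: "real ^ 'd::finite \<Rightarrow> real" and U :: "'d field"
  assumes f: "test_fun UNIV f" and w: "has_weak_pd UNIV j U V"
  shows "l2ip f (\<lambda>x. V x $ k) = - l2ip (pd j f) (\<lambda>x. U x $ k)"
  using has_weak_pd_bounded_linear[OF bounded_linear_vec_nth w, of k] f unfolding has_weak_pd_UNIV
  by (simp add: l2ip_def)

lemma l2ip_g1: "test_fun UNIV f \<Longrightarrow> U \<in> sobolev (Suc k) UNIV \<Longrightarrow> l2ip f (g1 l U i) = - l2ip (pd l f) (g0 U i)"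
  unfolding g1_def[abs_def] g0_def[abs_def] by (rule l2ip_weak_pd[OF _ wpd_has_weak_pd])

lemma l2ip_g2: "test_fun UNIV f \<Longrightarrow> U \<in> sobolev (Suc (Suc k)) UNIV \<Longrightarrow> l2ip f (g2 m l U i) = l2ip (pd l (pd m f)) (g0 U i)"
  using l2ip_weak_pd[of f m "wpd UNIV l U" "wpd UNIV m (wpd UNIV l U)" i] l2ip_g1[of "pd m f" U "Suc k" l i]
  by (simp add: g1_def[abs_def] g2_def[abs_def] wpd_has_weak_pd[OF wpd_sobolev] test_fun_pd del: sobolev_Suc_iff)

lemma l2ip_by_parts:
  fixes f g :: "real ^ 'd::finite \<Rightarrow> real"
  assumes "test_fun UNIV f" "test_fun UNIV g"
  shows "l2ip (pd j f) g = - l2ip f (pd j g)"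
  using smooth_integration_by_parts[OF assms(1) test_fun_smooth[OF assms(2)], of j] by (simp add: l2ip_def)

lemma l2ip_pd_commute:
  fixes f :: "real ^ 'd::finite \<Rightarrow> real"
  assumes "test_fun UNIV f"
  shows "l2ip (pd i (pd j f)) g = l2ip (pd j (pd i f)) g" "l2ip g (pd i (pd j f)) = l2ip g (pd j (pd i f))"
  by (auto intro!: l2ip_cong_AE pd_commute_AE assms)

lemma pair2_sym:
  fixes f g :: "real ^ 'd::finite \<Rightarrow> real"
  assumes f: "test_fun UNIV f" and g: "test_fun UNIV g"
  shows "l2ip (pd j f) (pd l g) = l2ip (pd l f) (pd j g)"
  using l2ip_by_parts[OF test_fun_pd[OF f] g, of l j] l2ip_by_parts[OF test_fun_pd[OF f] g, of j l] l2ip_pd_commute(1)[OF f, of l j g]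
  by simp

lemma pair3_sym:
  fixes f g :: "real ^ 'd::finite \<Rightarrow> real"
  assumes f: "test_fun UNIV f" and g: "test_fun UNIV g"
  shows "l2ip (pd j f) (pd m (pd l g)) = l2ip (pd l f) (pd m (pd j g))"
    "l2ip (pd j f) (pd m (pd l g)) = l2ip (pd j f) (pd l (pd m g))"
    "l2ip (pd j g) (pd m (pd l f)) = - l2ip (pd j f) (pd m (pd l g))"
proof -
  show 2: "l2ip (pd j f) (pd m (pd l g)) = l2ip (pd j f) (pd l (pd m g))" for j m l by (rule l2ip_pd_commute(2)[OF g])
  have "l2ip (pd j f) (pd l (pd m g)) = l2ip (pd l f) (pd j (pd m g))" by (rule pair2_sym[OF f test_fun_pd[OF g]])
  then show 1: "l2ip (pd j f) (pd m (pd l g)) = l2ip (pd l f) (pd m (pd j g))"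
    using 2[of j m l] 2[of l m j] by simp
  have "l2ip (pd j g) (pd m (pd l f)) = - l2ip (pd m (pd j g)) (pd l f)"
    using l2ip_by_parts[OF test_fun_pd[OF g] test_fun_pd[OF f], of m j l] by simp
  then show "l2ip (pd j g) (pd m (pd l f)) = - l2ip (pd j f) (pd m (pd l g))"
    using 1 by (simp add: l2ip_commute)
qed

text \<open>The derivative indices can be permuted freely: within one factor because derivatives commute, and between the factors by two integrations by parts.\<close>

lemma pair4_sym:
  fixes f g :: "real ^ 'd::finite \<Rightarrow> real"
  assumes f: "test_fun UNIV f" and g: "test_fun UNIV g"
  shows "l2ip (pd n (pd j f)) (pd m (pd l g)) = l2ip (pd j (pd n f)) (pd m (pd l g))"
    "l2ip (pd n (pd j f)) (pd m (pd l g)) = l2ip (pd l (pd j f)) (pd m (pd n g))"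
    "l2ip (pd n (pd j f)) (pd m (pd l g)) = l2ip (pd n (pd j f)) (pd l (pd m g))"
  by (rule l2ip_pd_commute(1)[OF f], rule pair3_sym(1)[OF test_fun_pd[OF f] g], rule l2ip_pd_commute(2)[OF g])

section \<open>The homogenized forms\<close>

lemma sum_case_prod: "sum (case_prod f) (UNIV :: ('a::finite \<times> 'b::finite) set) = (\<Sum>a\<in>UNIV. sum (f a) UNIV)"
  by (simp add: sum.cartesian_product flip: UNIV_Times_UNIV)

text \<open>The form of \<open>Q\<close> with full gradients instead of strains, and with the integral distributed over the sum.\<close>

definition Bq :: "'d::finite cell_model \<Rightarrow> real \<Rightarrow> real \<Rightarrow> 'd field \<Rightarrow> 'd field \<Rightarrow> real" where
  "Bq M ell \<theta> U W =
    (\<Sum>i\<in>UNIV. \<Sum>j\<in>UNIV. \<Sum>k\<in>UNIV. \<Sum>l\<in>UNIV. C0 M i j k l * l2ip (g1 j W i) (g1 l U k))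
    + ell * (\<Sum>i\<in>UNIV. \<Sum>j\<in>UNIV. \<Sum>k\<in>UNIV. \<Sum>l\<in>UNIV. \<Sum>m\<in>UNIV. C1 M i j k l m * l2ip (g1 j W i) (g2 m l U k))
    + ell\<^sup>2 * (\<Sum>i\<in>UNIV. \<Sum>j\<in>UNIV. \<Sum>n\<in>UNIV. \<Sum>k\<in>UNIV. \<Sum>l\<in>UNIV. \<Sum>m\<in>UNIV. A2 M \<theta> i j n k l m * l2ip (g2 n j W i) (g2 m l U k))"

definition Br :: "'d::finite cell_model \<Rightarrow> real \<Rightarrow> real \<Rightarrow> 'd field \<Rightarrow> 'd field \<Rightarrow> real" where
  "Br M ell \<theta> U W = rho0 M * (
    (\<Sum>i\<in>UNIV. l2ip (g0 W i) (g0 U i))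
    + ell * (\<Sum>i\<in>UNIV. \<Sum>k\<in>UNIV. \<Sum>l\<in>UNIV. B1 M i k l * l2ip (g0 W i) (g1 l U k))
    + ell\<^sup>2 * (\<Sum>i\<in>UNIV. \<Sum>l\<in>UNIV. \<Sum>k\<in>UNIV. \<Sum>m\<in>UNIV. J2 M \<theta> i l k m * l2ip (g1 l W i) (g1 m U k)))"

lemma Bq_bform: "bform (Suc (Suc k)) (Bq M ell \<theta>)"
  unfolding Bq_def[abs_def] by (intro bform_add bform_cmult bform_sum bform_l2ip l2op_g1 l2op_g2 finite)

lemma Br_bform: "bform (Suc k) (Br M ell \<theta>)"
  unfolding Br_def[abs_def] by (intro bform_add bform_cmult bform_sum bform_l2ip l2op_g0 l2op_g1 finite)

lemma sum_symmetrize: "(\<Sum>i\<in>(UNIV::'d::finite set). \<Sum>j\<in>UNIV. (h i j + h j i) / 2) = (\<Sum>i\<in>UNIV. \<Sum>j\<in>UNIV. h i j :: real)"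
proof -
  have "(\<Sum>i\<in>(UNIV::'d set). \<Sum>j\<in>UNIV. h j i) = (\<Sum>i\<in>UNIV. \<Sum>j\<in>UNIV. h i j)" by (rule sum.swap)
  then show ?thesis by (simp add: sum.distrib sum_divide_distrib[symmetric])
qed

lemma L2_g: 
  shows L2_g0: "U \<in> sobolev k UNIV \<Longrightarrow> L2 UNIV (g0 U i)"
    and L2_g1: "U \<in> sobolev (Suc k) UNIV \<Longrightarrow> L2 UNIV (g1 j U i)"
    and L2_g2: "U \<in> sobolev (Suc (Suc k)) UNIV \<Longrightarrow> L2 UNIV (g2 n j U i)"
  using l2op_g0[of k i] l2op_g1[of k j i] l2op_g2[of k n j i] unfolding l2op_def by blast+

lemma strain_eq: "strain U x i j = (g1 j U i x + g1 i U j x) / 2"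
  by (simp add: strain_def grad_def g1_def)

lemma strain_grad_eq:
  assumes U: "U \<in> sobolev (Suc (Suc k)) UNIV"
  shows "AE x in lebesgue. strain_grad U x i j n = (g2 n j U i x + g2 n i U j x) / 2"
proof -
  have w: "has_weak_pd UNIV n (g1 a U b) (g2 n a U b)" for a b
    unfolding g1_def[abs_def] g2_def[abs_def]
    by (rule has_weak_pd_bounded_linear[OF bounded_linear_vec_nth wpd_has_weak_pd[OF wpd_sobolev[OF U]]])
  have "has_weak_pd UNIV n ((1/2) *\<^sub>R (g1 j U i + g1 i U j)) ((1/2) *\<^sub>R (g2 n j U i + g2 n i U j))"
    by (intro has_weak_pd_scaleR has_weak_pd_add w)
  moreover have "(\<lambda>y. strain U y i j) = (1/2) *\<^sub>R (g1 j U i + g1 i U j)" by (rule ext) (simp add: strain_eq)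
  ultimately have "AE x in lebesgue. wpd UNIV n (\<lambda>y. strain U y i j) x = ((1/2) *\<^sub>R (g2 n j U i + g2 n i U j)) x"
    by (metis wpd_unique)
  then show ?thesis by (rule eventually_mono) (simp add: strain_grad_def)
qed

lemma (in cell_problem) e_dens_components:
  fixes a b :: "'d \<Rightarrow> 'd \<Rightarrow> real" and a2 b2 :: "'d \<Rightarrow> 'd \<Rightarrow> 'd \<Rightarrow> real"
  shows "e_dens M ell \<theta> (\<lambda>i j. (a i j + a j i) / 2) (\<lambda>i j n. (a2 i j n + a2 j i n) / 2)
      (\<lambda>i j. (b i j + b j i) / 2) (\<lambda>i j n. (b2 i j n + b2 j i n) / 2)
    = (\<Sum>i\<in>UNIV. \<Sum>j\<in>UNIV. \<Sum>k\<in>UNIV. \<Sum>l\<in>UNIV. C0 M i j k l * (a i j * b k l))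
    + ell * (\<Sum>i\<in>UNIV. \<Sum>j\<in>UNIV. \<Sum>k\<in>UNIV. \<Sum>l\<in>UNIV. \<Sum>m\<in>UNIV. C1 M i j k l m * (a i j * b2 k l m))
    + ell\<^sup>2 * (\<Sum>i\<in>UNIV. \<Sum>j\<in>UNIV. \<Sum>n\<in>UNIV. \<Sum>k\<in>UNIV. \<Sum>l\<in>UNIV. \<Sum>m\<in>UNIV. A2 M \<theta> i j n k l m * (a2 i j n * b2 k l m))"
proof -
  define R0 where "R0 i j = (\<Sum>k\<in>UNIV. \<Sum>l\<in>UNIV. C0 M i j k l * b k l)" for i j
  define R1 where "R1 i j = (\<Sum>k\<in>UNIV. \<Sum>l\<in>UNIV. \<Sum>m\<in>UNIV. C1 M i j k l m * b2 k l m)" for i j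
  define R2 where "R2 i j n = (\<Sum>k\<in>UNIV. \<Sum>l\<in>UNIV. \<Sum>m\<in>UNIV. A2 M \<theta> i j n k l m * b2 k l m)" for i j n
  have R0: "(\<Sum>k\<in>UNIV. \<Sum>l\<in>UNIV. C0 M i j k l * ((b k l + b l k) / 2)) = R0 i j" for i j
    unfolding R0_def by (subst sum_symmetrize[symmetric]) (simp add: C0_swap(2)[of i j] distrib_left)
  have R1: "(\<Sum>k\<in>UNIV. \<Sum>l\<in>UNIV. \<Sum>m\<in>UNIV. C1 M i j k l m * ((b2 k l m + b2 l k m) / 2)) = R1 i j" for i j
    unfolding R1_def by (subst sum_symmetrize[symmetric])
      (simp add: C1_swap(2)[of i j] distrib_left sum.distrib sum_divide_distrib add_divide_distrib)
  have R2: "(\<Sum>k\<in>UNIV. \<Sum>l\<in>UNIV. \<Sum>m\<in>UNIV. A2 M \<theta> i j n k l m * ((b2 k l m + b2 l k m) / 2)) = R2 i j n" for i j n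
    unfolding R2_def by (subst sum_symmetrize[symmetric])
      (simp add: A2_swap(2)[of _ i j n] distrib_left sum.distrib sum_divide_distrib add_divide_distrib)
  have s0: "R0 j i = R0 i j" and s1: "R1 j i = R1 i j" and s2: "R2 j i n = R2 i j n" for i j n
    unfolding R0_def R1_def R2_def by (simp_all add: C0_swap(1)[of i j] C1_swap(1)[of i j] A2_swap(1)[of _ i j])
  have "e_dens M ell \<theta> (\<lambda>i j. (a i j + a j i) / 2) (\<lambda>i j n. (a2 i j n + a2 j i n) / 2)
      (\<lambda>i j. (b i j + b j i) / 2) (\<lambda>i j n. (b2 i j n + b2 j i n) / 2)
    = (\<Sum>i\<in>UNIV. \<Sum>j\<in>UNIV. ((a i j + a j i) / 2) * R0 i j)
    + ell * (\<Sum>i\<in>UNIV. \<Sum>j\<in>UNIV. ((a i j + a j i) / 2) * R1 i j)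
    + ell\<^sup>2 * (\<Sum>i\<in>UNIV. \<Sum>j\<in>UNIV. \<Sum>n\<in>UNIV. ((a2 i j n + a2 j i n) / 2) * R2 i j n)"
    unfolding e_dens_def sum_case_prod R0[symmetric] R1[symmetric] R2[symmetric] sum_distrib_left
    by (simp only: mult.assoc)
  also have "(\<Sum>i\<in>UNIV. \<Sum>j\<in>UNIV. ((a i j + a j i) / 2) * R0 i j) = (\<Sum>i\<in>UNIV. \<Sum>j\<in>UNIV. a i j * R0 i j)"
    by (subst sum_symmetrize[symmetric, of "\<lambda>i j. a i j * R0 i j"]) (simp add: s0 distrib_right add_divide_distrib)
  also have "(\<Sum>i\<in>UNIV. \<Sum>j\<in>UNIV. ((a i j + a j i) / 2) * R1 i j) = (\<Sum>i\<in>UNIV. \<Sum>j\<in>UNIV. a i j * R1 i j)"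
    by (subst sum_symmetrize[symmetric, of "\<lambda>i j. a i j * R1 i j"]) (simp add: s1 distrib_right add_divide_distrib)
  also have "(\<Sum>i\<in>UNIV. \<Sum>j\<in>UNIV. \<Sum>n\<in>UNIV. ((a2 i j n + a2 j i n) / 2) * R2 i j n) = (\<Sum>i\<in>UNIV. \<Sum>j\<in>UNIV. \<Sum>n\<in>UNIV. a2 i j n * R2 i j n)"
    by (subst sum_symmetrize[symmetric, of "\<lambda>i j. \<Sum>n\<in>UNIV. a2 i j n * R2 i j n"])
      (simp add: s2 distrib_right sum.distrib sum_divide_distrib add_divide_distrib)
  finally show ?thesis unfolding R0_def R1_def R2_def sum_distrib_left by (simp only: mult.left_commute)
qed

lemma integral_sums_l2:
  assumes "\<And>i. i \<in> A \<Longrightarrow> integrable lebesgue (f i)"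
  shows "(\<integral>x. (\<Sum>i\<in>A. f i x) \<partial>lebesgue) = (\<Sum>i\<in>A. integral\<^sup>L lebesgue (f i))"
  by (rule Bochner_Integration.integral_sum) (use assms in auto)

text \<open>The minor symmetries allow the symmetrized gradient in the energy density to be replaced by the gradient.\<close>

lemma (in cell_problem) Qform_eq:
  assumes U: "U \<in> sobolev (Suc (Suc 0)) UNIV" and W: "W \<in> sobolev (Suc (Suc 0)) UNIV"
  shows "Qform M ell \<theta> U W = Bq M ell \<theta> U W"
proof -
  have sg: "AE x in lebesgue. \<forall>i j n. strain_grad X x i j n = (g2 n j X i x + g2 n i X j x) / 2"
    if "X \<in> sobolev (Suc (Suc 0)) UNIV" for X :: "'d field"
    by (intro eventually_all_finite strain_grad_eq[OF that])
  let ?F = "\<lambda>x. (\<Sum>i\<in>UNIV. \<Sum>j\<in>UNIV. \<Sum>k\<in>UNIV. \<Sum>l\<in>UNIV. C0 M i j k l * (g1 j W i x * g1 l U k x))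
    + ell * (\<Sum>i\<in>UNIV. \<Sum>j\<in>UNIV. \<Sum>k\<in>UNIV. \<Sum>l\<in>UNIV. \<Sum>m\<in>UNIV. C1 M i j k l m * (g1 j W i x * g2 m l U k x))
    + ell\<^sup>2 * (\<Sum>i\<in>UNIV. \<Sum>j\<in>UNIV. \<Sum>n\<in>UNIV. \<Sum>k\<in>UNIV. \<Sum>l\<in>UNIV. \<Sum>m\<in>UNIV. A2 M \<theta> i j n k l m * (g2 n j W i x * g2 m l U k x))"
  have "Qform M ell \<theta> U W = integral\<^sup>L lebesgue ?F"
    unfolding Qform_def
  proof (rule integral_lebesgue_cong_AE)
    show "AE x in lebesgue. e_dens M ell \<theta> (strain W x) (strain_grad W x) (strain U x) (strain_grad U x) = ?F x"
      using sg[OF U] sg[OF W]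
    proof eventually_elim
      case (elim x)
      have "strain W x = (\<lambda>i j. (g1 j W i x + g1 i W j x) / 2)" "strain U x = (\<lambda>i j. (g1 j U i x + g1 i U j x) / 2)"
        by (intro ext strain_eq)+
      moreover have "strain_grad W x = (\<lambda>i j n. (g2 n j W i x + g2 n i W j x) / 2)"
        "strain_grad U x = (\<lambda>i j n. (g2 n j U i x + g2 n i U j x) / 2)"
        using elim by (auto intro!: ext)
      ultimately show ?case
        using e_dens_components[of ell \<theta> "\<lambda>i j. g1 j W i x" "\<lambda>i j n. g2 n j W i x" "\<lambda>i j. g1 j U i x" "\<lambda>i j n. g2 n j U i x"]
        by (simp only:)
    qed
  qed
  also have "\<dots> = Bq M ell \<theta> U W"
  proof -
    have I: "integrable lebesgue (\<lambda>x. f x * g x)" if "L2 UNIV f" "L2 UNIV g" for f g :: "real ^ 'd \<Rightarrow> real"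
      using L2_inner_integrable[OF that] by simp
    note L = L2_g1[OF U] L2_g2[OF U] L2_g1[OF W] L2_g2[OF W]
    show ?thesis unfolding Bq_def l2ip_def
      by (simp add: Bochner_Integration.integral_add integral_sums_l2 Bochner_Integration.integrable_sum
        integrable_mult_right I L)
  qed
  finally show ?thesis .
qed

lemma Rform_eq:
  assumes U: "U \<in> sobolev (Suc 0) UNIV" and W: "W \<in> sobolev (Suc 0) UNIV"
  shows "Rform M ell \<theta> U W = Br M ell \<theta> U W"
proof -
  have I: "integrable lebesgue (\<lambda>x. f x * g x)" if "L2 UNIV f" "L2 UNIV g" for f g :: "real ^ 'a \<Rightarrow> real"
    using L2_inner_integrable[OF that] by simp
  note L = L2_g0[OF U] L2_g1[OF U] L2_g0[OF W] L2_g1[OF W]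
  have "Rform M ell \<theta> U W = (\<integral>x. rho0 M * ((\<Sum>i\<in>UNIV. g0 W i x * g0 U i x)
    + ell * (\<Sum>i\<in>UNIV. \<Sum>k\<in>UNIV. \<Sum>l\<in>UNIV. B1 M i k l * (g0 W i x * g1 l U k x))
    + ell\<^sup>2 * (\<Sum>i\<in>UNIV. \<Sum>l\<in>UNIV. \<Sum>k\<in>UNIV. \<Sum>m\<in>UNIV. J2 M \<theta> i l k m * (g1 l W i x * g1 m U k x))) \<partial>lebesgue)"
    unfolding Rform_def k_dens_def sum_case_prod by (simp add: grad_def g0_def g1_def mult_ac)
  also have "\<dots> = Br M ell \<theta> U W" unfolding Br_def l2ip_def
    by (simp add: Bochner_Integration.integral_add integral_sums_l2 Bochner_Integration.integrable_sum
        integrable_mult_right I L)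
  finally show ?thesis .
qed

subsection \<open>The forms represent the operators\<close>

lemma dist_of_l2ip: "dist_of (\<lambda>x. U x $ k) f = l2ip f (g0 U k)"
  by (simp add: dist_of_def l2ip_def g0_def mult.commute)

text \<open>Each distributional derivative acts on the test field; half of them are moved back to \<open>U\<close>.\<close>

lemma Qop_eq:
  assumes U: "U \<in> sobolev (Suc (Suc 0)) UNIV" and t: "test_fun UNIV \<phi>"
  shows "vdist (Qop M ell \<theta> U) \<phi> = Bq M ell \<theta> U \<phi>"
proof -
  define f where "f i = (\<lambda>x. \<phi> x $ i)" for i
  have f: "test_fun UNIV (f i)" for i unfolding f_def by (rule test_fun_component[OF t])
  note tc = test_components[OF t, folded f_def]
  have 1: "l2ip (g1 j \<phi> i) (g1 l U k) = - l2ip (pd l (pd j (f i))) (g0 U k)" for i j k l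
    using l2ip_cong_AE[OF tc(1) AE_I2[OF refl]] l2ip_g1[OF test_fun_pd[OF f] U] by metis
  have 2: "l2ip (g1 j \<phi> i) (g2 m l U k) = l2ip (pd m (pd l (pd j (f i)))) (g0 U k)" for i j k l m
    using l2ip_cong_AE[OF tc(1) AE_I2[OF refl]] l2ip_g2[OF test_fun_pd[OF f] U] l2ip_pd_commute(1)[OF test_fun_pd[OF f]] by metis
  have 3: "l2ip (g2 n j \<phi> i) (g2 m l U k) = l2ip (pd m (pd l (pd n (pd j (f i))))) (g0 U k)" for i j k l m n
    using l2ip_cong_AE[OF tc(2) AE_I2[OF refl]] l2ip_g2[OF test_fun_pd[OF test_fun_pd[OF f]] U]
      l2ip_pd_commute(1)[OF test_fun_pd[OF test_fun_pd[OF f]]] by metis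
  show ?thesis
    unfolding Bq_def vdist_def Qop_def dpd_def dist_of_l2ip sum_case_prod 1 2 3 f_def[symmetric]
    by (simp add: sum.distrib sum_subtractf sum_negf sum_distrib_left)
qed

lemma Rop_eq:
  assumes U: "U \<in> sobolev (Suc 0) UNIV" and t: "test_fun UNIV \<phi>"
  shows "vdist (Rop M ell \<theta> U) \<phi> = Br M ell \<theta> U \<phi>"
proof -
  define f where "f i = (\<lambda>x. \<phi> x $ i)" for i
  have f: "test_fun UNIV (f i)" for i unfolding f_def by (rule test_fun_component[OF t])
  note tc = test_components[OF t, folded f_def]
  have g0: "g0 \<phi> i = f i" for i by (rule ext) (simp add: g0_def f_def)
  have 1: "l2ip (f i) (g1 l U k) = - l2ip (pd l (f i)) (g0 U k)" for i k l by (rule l2ip_g1[OF f U])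
  have 2: "l2ip (g1 l \<phi> i) (g1 m U k) = - l2ip (pd m (pd l (f i))) (g0 U k)" for i k l m
    using l2ip_cong_AE[OF tc(1) AE_I2[OF refl]] l2ip_g1[OF test_fun_pd[OF f] U] by metis
  show ?thesis
    unfolding Br_def vdist_def Rop_def dpd_def dist_of_l2ip sum_case_prod 1 2 g0 f_def[symmetric]
    by (simp add: sum.distrib sum_subtractf sum_negf sum_distrib_left distrib_left right_diff_distrib)
qed

subsection \<open>Symmetry of the forms\<close>

lemma Qsym_parts:
  "Re (Qsym M ell \<theta> \<xi> i k) = (\<Sum>j\<in>UNIV. \<Sum>l\<in>UNIV. C0 M i j k l * \<xi> $ j * \<xi> $ l)
     + ell\<^sup>2 * (\<Sum>j\<in>UNIV. \<Sum>n\<in>UNIV. \<Sum>l\<in>UNIV. \<Sum>m\<in>UNIV. A2 M \<theta> i j n k l m * \<xi> $ j * \<xi> $ n * \<xi> $ l * \<xi> $ m)"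
  "Im (Qsym M ell \<theta> \<xi> i k) = ell * (\<Sum>j\<in>UNIV. \<Sum>l\<in>UNIV. \<Sum>m\<in>UNIV. C1 M i j k l m * \<xi> $ j * \<xi> $ l * \<xi> $ m)"
  unfolding Qsym_def sum_case_prod isym_def
  by (simp_all add: sum_negf flip: of_real_power)

lemma Rsym_parts:
  "Re (Rsym M ell \<theta> \<xi> i k) = rho0 M * (kd i k + ell\<^sup>2 * (\<Sum>l\<in>UNIV. \<Sum>m\<in>UNIV. J2 M \<theta> i l k m * \<xi> $ l * \<xi> $ m))"
  "Im (Rsym M ell \<theta> \<xi> i k) = rho0 M * (ell * (\<Sum>l\<in>UNIV. B1 M i k l * \<xi> $ l))"
  unfolding Rsym_def sum_case_prod isym_def
  by (simp_all add: sum_negf flip: of_real_power)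

locale homogenized = cell_problem M for M :: "'d::finite cell_model" +
  fixes ell \<theta> :: real
  assumes ell: "0 < ell" and weight: "admissible_weight M ell \<theta>"
begin

lemma hermitian:
  assumes "\<xi> \<noteq> 0"
  shows "Qsym M ell \<theta> \<xi> i k = cnj (Qsym M ell \<theta> \<xi> k i)" "Rsym M ell \<theta> \<xi> i k = cnj (Rsym M ell \<theta> \<xi> k i)"
  using weight assms unfolding admissible_weight_def herm_pos_def_def by blast+

text \<open>If the mean density vanished, so would the symbol of \<open>R\<close>, which is positive definite.\<close>

lemma rho0_nonzero: "rho0 M \<noteq> 0"
proof
  assume 0: "rho0 M = 0"
  obtain \<xi> :: "real ^ 'd" where x: "\<xi> \<noteq> 0" using zero_neq_one[where 'a = "real ^ 'd"] by metis
  have "herm_pos_def (Rsym M ell \<theta> \<xi>)" using weight x unfolding admissible_weight_def by blast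
  moreover have "(\<lambda>_ :: 'd. 1 :: complex) \<noteq> 0" by (auto simp: fun_eq_iff)
  ultimately have "0 < Re (\<Sum>(i,k)\<in>UNIV. cnj ((\<lambda>_. 1) i) * Rsym M ell \<theta> \<xi> i k * (\<lambda>_. 1) k)"
    unfolding herm_pos_def_def by blast
  moreover have "Rsym M ell \<theta> \<xi> i k = 0" for i k by (simp add: Rsym_def 0)
  ultimately show False by simp
qed

text \<open>The Hermitian symmetry of the symbol, separated into its real and imaginary parts and, within the real part, into its homogeneous components.\<close>

lemma Q_symbol_symmetry:
  fixes \<xi> :: "'d \<Rightarrow> real"
  shows "(\<Sum>j\<in>UNIV. \<Sum>l\<in>UNIV. (C0 M i j k l - C0 M k j i l) * \<xi> j * \<xi> l) = 0"
    "(\<Sum>j\<in>UNIV. \<Sum>l\<in>UNIV. \<Sum>m\<in>UNIV. (C1 M i j k l m + C1 M k j i l m) * \<xi> j * \<xi> l * \<xi> m) = 0"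
    "(\<Sum>j\<in>UNIV. \<Sum>n\<in>UNIV. \<Sum>l\<in>UNIV. \<Sum>m\<in>UNIV. (A2 M \<theta> i j n k l m - A2 M \<theta> k j n i l m) * \<xi> j * \<xi> n * \<xi> l * \<xi> m) = 0"
proof -
  define P where "P r = (\<Sum>j\<in>UNIV. \<Sum>l\<in>UNIV. (C0 M i j k l - C0 M k j i l) * (r * \<xi> j) * (r * \<xi> l))" for r
  define S where "S r = (\<Sum>j\<in>UNIV. \<Sum>n\<in>UNIV. \<Sum>l\<in>UNIV. \<Sum>m\<in>UNIV. (A2 M \<theta> i j n k l m - A2 M \<theta> k j n i l m) * (r * \<xi> j) * (r * \<xi> n) * (r * \<xi> l) * (r * \<xi> m))" for r
  have PS: "P r + ell\<^sup>2 * S r = 0" for r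
  proof (cases "(\<chi> j. r * \<xi> j) = (0 :: real ^ 'd)")
    case True
    then have "r * \<xi> j = 0" for j by (metis vec_lambda_beta zero_index)
    then show ?thesis by (simp only: P_def S_def) simp
  next
    case False
    have "Re (Qsym M ell \<theta> (\<chi> j. r * \<xi> j) i k) = Re (Qsym M ell \<theta> (\<chi> j. r * \<xi> j) k i)"
      using arg_cong[OF hermitian(1)[OF False, of i k], of Re] by simp
    then show ?thesis
      unfolding Qsym_parts P_def S_def by (simp add: left_diff_distrib sum_subtractf right_diff_distrib)
  qed
  \<comment> \<open>Comparing the frequencies \<open>\<xi>\<close> and \<open>2 \<xi>\<close> separates the terms of degree two and four.\<close>
  have P2: "P 2 = 4 * P 1" and S2: "S 2 = 16 * S 1"
    unfolding P_def S_def by (simp_all add: sum_distrib_left mult_ac)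
  have "4 * P 1 + 16 * (ell\<^sup>2 * S 1) = 0" using PS[of 2] unfolding P2 S2 by simp
  then have "P 1 = 0" "ell\<^sup>2 * S 1 = 0" using PS[of 1] by linarith+
  then have "P 1 = 0" "S 1 = 0" using ell by auto
  then show "(\<Sum>j\<in>UNIV. \<Sum>l\<in>UNIV. (C0 M i j k l - C0 M k j i l) * \<xi> j * \<xi> l) = 0"
    "(\<Sum>j\<in>UNIV. \<Sum>n\<in>UNIV. \<Sum>l\<in>UNIV. \<Sum>m\<in>UNIV. (A2 M \<theta> i j n k l m - A2 M \<theta> k j n i l m) * \<xi> j * \<xi> n * \<xi> l * \<xi> m) = 0"
    by (simp_all add: P_def S_def)
  show "(\<Sum>j\<in>UNIV. \<Sum>l\<in>UNIV. \<Sum>m\<in>UNIV. (C1 M i j k l m + C1 M k j i l m) * \<xi> j * \<xi> l * \<xi> m) = 0"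
  proof (cases "(\<chi> j. \<xi> j) = (0 :: real ^ 'd)")
    case True
    then have "\<xi> j = 0" for j by (simp add: vec_eq_iff)
    then show ?thesis by simp
  next
    case False
    have "Im (Qsym M ell \<theta> (\<chi> j. \<xi> j) i k) = - Im (Qsym M ell \<theta> (\<chi> j. \<xi> j) k i)"
      using arg_cong[OF hermitian(1)[OF False, of i k], of Im] by simp
    then have "ell * (\<Sum>j\<in>UNIV. \<Sum>l\<in>UNIV. \<Sum>m\<in>UNIV. (C1 M i j k l m + C1 M k j i l m) * \<xi> j * \<xi> l * \<xi> m) = 0"
      unfolding Qsym_parts by (simp add: distrib_right distrib_left sum.distrib)
    then show ?thesis using ell by simp
  qed
qed

lemma R_symbol_symmetry:
  fixes \<xi> :: "'d \<Rightarrow> real"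
  shows "B1 M k i l = - B1 M i k l"
    "(\<Sum>l\<in>UNIV. \<Sum>m\<in>UNIV. (J2 M \<theta> i l k m - J2 M \<theta> k l i m) * \<xi> l * \<xi> m) = 0"
proof -
  have "(axis l 1 :: real ^ 'd) \<noteq> 0" by simp
  from arg_cong[OF hermitian(2)[OF this, of i k], of Im]
  have "rho0 M * (ell * (\<Sum>n\<in>UNIV. B1 M i k n * axis l 1 $ n)) = - (rho0 M * (ell * (\<Sum>n\<in>UNIV. B1 M k i n * axis l 1 $ n)))"
    by (simp only: Rsym_parts cnj.simps)
  then have "(rho0 M * ell) * ((\<Sum>n\<in>UNIV. B1 M i k n * axis l 1 $ n) + (\<Sum>n\<in>UNIV. B1 M k i n * axis l 1 $ n)) = 0"
    by (simp add: distrib_left mult.assoc)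
  then have "(\<Sum>n\<in>UNIV. B1 M i k n * axis l 1 $ n) = - (\<Sum>n\<in>UNIV. B1 M k i n * axis l 1 $ n)"
    using ell rho0_nonzero by (simp only: mult_eq_0_iff eq_neg_iff_add_eq_0) simp
  moreover have "(\<Sum>n\<in>UNIV. B1 M p q n * axis l 1 $ n) = B1 M p q l" for p q
    using sum_delta_left[of l "B1 M p q"] by (simp add: axis_def mult.commute)
  ultimately show "B1 M k i l = - B1 M i k l" by simp
  show "(\<Sum>l\<in>UNIV. \<Sum>m\<in>UNIV. (J2 M \<theta> i l k m - J2 M \<theta> k l i m) * \<xi> l * \<xi> m) = 0"
  proof (cases "(\<chi> j. \<xi> j) = (0 :: real ^ 'd)")
    case True
    then have "\<xi> j = 0" for j by (simp add: vec_eq_iff)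
    then show ?thesis by simp
  next
    case False
    have "kd i k = kd k i" by (simp add: kd_def)
    then show ?thesis using arg_cong[OF hermitian(2)[OF False, of i k], of Re] ell rho0_nonzero
      by (simp add: Rsym_parts left_diff_distrib sum_subtractf)
  qed
qed

text \<open>On test fields, exchanging the arguments transposes the coefficients in \<open>i\<close> and \<open>k\<close>; the difference is a contraction of vanishing symbols with tensors symmetric in the derivative indices. The form of odd order changes sign twice. Density does the rest.\<close>

lemma Bq_sym:
  assumes "U \<in> sobolev (Suc (Suc 0)) UNIV" "W \<in> sobolev (Suc (Suc 0)) UNIV"
  shows "Bq M ell \<theta> U W = Bq M ell \<theta> W U"
proof (rule bform_eqI[OF Bq_bform bform_flip[OF Bq_bform] _ assms])
  fix \<phi> \<psi> :: "'d field" assume t: "test_fun UNIV \<phi>" "test_fun UNIV \<psi>"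
  define f where "f i = (\<lambda>x. \<psi> x $ i)" for i
  define g where "g i = (\<lambda>x. \<phi> x $ i)" for i
  have f: "test_fun UNIV (f i)" and g: "test_fun UNIV (g i)" for i
    unfolding f_def g_def by (rule test_fun_component[OF t(2)], rule test_fun_component[OF t(1)])
  note tf = test_components[OF t(2), folded f_def] and tg = test_components[OF t(1), folded g_def]
  note cg = l2ip_cong_AE[OF tf(1) tg(1)] l2ip_cong_AE[OF tf(1) tg(2)] l2ip_cong_AE[OF tf(2) tg(2)]
    l2ip_cong_AE[OF tg(1) tf(1)] l2ip_cong_AE[OF tg(1) tf(2)] l2ip_cong_AE[OF tg(2) tf(2)]
  define T2 where "T2 i k j l = l2ip (pd j (f i)) (pd l (g k))" for i k j l
  define T3 where "T3 i k j l m = l2ip (pd j (f i)) (pd m (pd l (g k)))" for i k j l m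
  define T4 where "T4 i k j n l m = l2ip (pd n (pd j (f i))) (pd m (pd l (g k)))" for i k j n l m
  have T2': "l2ip (pd j (g i)) (pd l (f k)) = T2 k i j l" for i j k l
    unfolding T2_def using pair2_sym[OF f g] by (simp add: l2ip_commute)
  have T3': "l2ip (pd j (g i)) (pd m (pd l (f k))) = - T3 k i j l m" for i j k l m
    unfolding T3_def by (rule pair3_sym(3)[OF f g])
  have T4': "l2ip (pd n (pd j (g i))) (pd m (pd l (f k))) = T4 k i j n l m" for i j k l m n
    unfolding T4_def using pair4_sym[OF f g] by (metis l2ip_commute)
  have A: "(\<Sum>j\<in>UNIV. \<Sum>l\<in>UNIV. C0 M i j k l * T2 i k j l) = (\<Sum>j\<in>UNIV. \<Sum>l\<in>UNIV. C0 M k j i l * T2 i k j l)" for i k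
    using contract2[of "\<lambda>j l. C0 M i j k l - C0 M k j i l" "T2 i k", OF Q_symbol_symmetry(1)] pair2_sym[OF f g]
    by (simp add: T2_def left_diff_distrib sum_subtractf)
  have B: "(\<Sum>j\<in>UNIV. \<Sum>l\<in>UNIV. \<Sum>m\<in>UNIV. C1 M i j k l m * T3 i k j l m) = (\<Sum>j\<in>UNIV. \<Sum>l\<in>UNIV. \<Sum>m\<in>UNIV. C1 M k j i l m * - T3 i k j l m)" for i k
    using contract3[of "\<lambda>j l m. C1 M i j k l m + C1 M k j i l m" "T3 i k", OF Q_symbol_symmetry(2)] pair3_sym(1,2)[OF f g]
    by (simp add: T3_def distrib_right sum.distrib sum_negf)
  have C: "(\<Sum>j\<in>UNIV. \<Sum>n\<in>UNIV. \<Sum>l\<in>UNIV. \<Sum>m\<in>UNIV. A2 M \<theta> i j n k l m * T4 i k j n l m)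
      = (\<Sum>j\<in>UNIV. \<Sum>n\<in>UNIV. \<Sum>l\<in>UNIV. \<Sum>m\<in>UNIV. A2 M \<theta> k j n i l m * T4 i k j n l m)" for i k
  proof -
    have "(\<Sum>j\<in>UNIV. \<Sum>n\<in>UNIV. \<Sum>l\<in>UNIV. \<Sum>m\<in>UNIV. (A2 M \<theta> i j n k l m - A2 M \<theta> k j n i l m) * T4 i k j n l m) = 0"
      by (rule contract4[where t = "T4 i k", OF Q_symbol_symmetry(3)]; unfold T4_def)
        (rule pair4_sym(1)[OF f g], rule pair4_sym(2)[OF f g], rule pair4_sym(3)[OF f g])
    then show ?thesis by (simp add: left_diff_distrib sum_subtractf)
  qed
  have s3: "(\<Sum>i\<in>UNIV. \<Sum>j\<in>UNIV. \<Sum>k\<in>UNIV. F i j k) = (\<Sum>i\<in>UNIV. \<Sum>k\<in>UNIV. \<Sum>j\<in>UNIV. F i j k)" for F :: "'d \<Rightarrow> 'd \<Rightarrow> 'd \<Rightarrow> real"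
    by (intro sum.cong refl sum.swap)
  have s4: "(\<Sum>i\<in>UNIV. \<Sum>j\<in>UNIV. \<Sum>n\<in>UNIV. \<Sum>k\<in>UNIV. F i j n k) = (\<Sum>i\<in>UNIV. \<Sum>k\<in>UNIV. \<Sum>j\<in>UNIV. \<Sum>n\<in>UNIV. F i j n k)" for F :: "'d \<Rightarrow> 'd \<Rightarrow> 'd \<Rightarrow> 'd \<Rightarrow> real"
  proof -
    have "(\<Sum>i\<in>UNIV. \<Sum>j\<in>UNIV. \<Sum>n\<in>UNIV. \<Sum>k\<in>UNIV. F i j n k) = (\<Sum>i\<in>UNIV. \<Sum>j\<in>UNIV. \<Sum>k\<in>UNIV. \<Sum>n\<in>UNIV. F i j n k)"
      by (intro sum.cong refl sum.swap)
    then show ?thesis by (rule trans) (rule s3)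
  qed
  have L: "Bq M ell \<theta> \<phi> \<psi> = (\<Sum>i\<in>UNIV. \<Sum>k\<in>UNIV. \<Sum>j\<in>UNIV. \<Sum>l\<in>UNIV. C0 M i j k l * T2 i k j l)
    + ell * (\<Sum>i\<in>UNIV. \<Sum>k\<in>UNIV. \<Sum>j\<in>UNIV. \<Sum>l\<in>UNIV. \<Sum>m\<in>UNIV. C1 M i j k l m * T3 i k j l m)
    + ell\<^sup>2 * (\<Sum>i\<in>UNIV. \<Sum>k\<in>UNIV. \<Sum>j\<in>UNIV. \<Sum>n\<in>UNIV. \<Sum>l\<in>UNIV. \<Sum>m\<in>UNIV. A2 M \<theta> i j n k l m * T4 i k j n l m)"
    unfolding Bq_def cg T2_def T3_def T4_def
    by (rule arg_cong2[where f = "(+)", OF arg_cong2[where f = "(+)", OF s3 arg_cong[where f = "(*) ell", OF s3]]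
        arg_cong[where f = "(*) (ell\<^sup>2)", OF s4]])
  have R: "Bq M ell \<theta> \<psi> \<phi> = (\<Sum>i\<in>UNIV. \<Sum>k\<in>UNIV. \<Sum>j\<in>UNIV. \<Sum>l\<in>UNIV. C0 M i j k l * T2 k i j l)
    + ell * (\<Sum>i\<in>UNIV. \<Sum>k\<in>UNIV. \<Sum>j\<in>UNIV. \<Sum>l\<in>UNIV. \<Sum>m\<in>UNIV. C1 M i j k l m * - T3 k i j l m)
    + ell\<^sup>2 * (\<Sum>i\<in>UNIV. \<Sum>k\<in>UNIV. \<Sum>j\<in>UNIV. \<Sum>n\<in>UNIV. \<Sum>l\<in>UNIV. \<Sum>m\<in>UNIV. A2 M \<theta> i j n k l m * T4 k i j n l m)"
    unfolding Bq_def cg T2' T3' T4'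
    by (rule arg_cong2[where f = "(+)", OF arg_cong2[where f = "(+)", OF s3 arg_cong[where f = "(*) ell", OF s3]]
        arg_cong[where f = "(*) (ell\<^sup>2)", OF s4]])
  have a: "(\<Sum>i\<in>UNIV. \<Sum>k\<in>UNIV. \<Sum>j\<in>UNIV. \<Sum>l\<in>UNIV. C0 M i j k l * T2 i k j l) = (\<Sum>i\<in>UNIV. \<Sum>k\<in>UNIV. \<Sum>j\<in>UNIV. \<Sum>l\<in>UNIV. C0 M i j k l * T2 k i j l)"
    by (rule trans, rule sum.cong[OF refl], rule sum.cong[OF refl], rule A, rule sum.swap)
  have b: "(\<Sum>i\<in>UNIV. \<Sum>k\<in>UNIV. \<Sum>j\<in>UNIV. \<Sum>l\<in>UNIV. \<Sum>m\<in>UNIV. C1 M i j k l m * T3 i k j l m) = (\<Sum>i\<in>UNIV. \<Sum>k\<in>UNIV. \<Sum>j\<in>UNIV. \<Sum>l\<in>UNIV. \<Sum>m\<in>UNIV. C1 M i j k l m * - T3 k i j l m)"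
    by (rule trans, rule sum.cong[OF refl], rule sum.cong[OF refl], rule B, rule sum.swap)
  have c: "(\<Sum>i\<in>UNIV. \<Sum>k\<in>UNIV. \<Sum>j\<in>UNIV. \<Sum>n\<in>UNIV. \<Sum>l\<in>UNIV. \<Sum>m\<in>UNIV. A2 M \<theta> i j n k l m * T4 i k j n l m) = (\<Sum>i\<in>UNIV. \<Sum>k\<in>UNIV. \<Sum>j\<in>UNIV. \<Sum>n\<in>UNIV. \<Sum>l\<in>UNIV. \<Sum>m\<in>UNIV. A2 M \<theta> i j n k l m * T4 k i j n l m)"
    by (rule trans, rule sum.cong[OF refl], rule sum.cong[OF refl], rule C, rule sum.swap)
  show "Bq M ell \<theta> \<phi> \<psi> = Bq M ell \<theta> \<psi> \<phi>"
    by (simp only: L R a b c)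
qed

lemma Br_sym:
  assumes "U \<in> sobolev (Suc 0) UNIV" "W \<in> sobolev (Suc 0) UNIV"
  shows "Br M ell \<theta> U W = Br M ell \<theta> W U"
proof (rule bform_eqI[OF Br_bform bform_flip[OF Br_bform] _ assms])
  fix \<phi> \<psi> :: "'d field" assume t: "test_fun UNIV \<phi>" "test_fun UNIV \<psi>"
  define f where "f i = (\<lambda>x. \<psi> x $ i)" for i
  define g where "g i = (\<lambda>x. \<phi> x $ i)" for i
  have f: "test_fun UNIV (f i)" and g: "test_fun UNIV (g i)" for i
    unfolding f_def g_def by (rule test_fun_component[OF t(2)], rule test_fun_component[OF t(1)])
  have f0: "g0 \<psi> i = f i" and h0: "g0 \<phi> i = g i" for i by (auto simp: g0_def f_def g_def)
  note tf = test_components[OF t(2), folded f_def] and tg = test_components[OF t(1), folded g_def]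
  note cg = l2ip_cong_AE[OF AE_I2[OF refl] tg(1)] l2ip_cong_AE[OF tf(1) tg(1)]
    l2ip_cong_AE[OF AE_I2[OF refl] tf(1)] l2ip_cong_AE[OF tg(1) tf(1)]
    l2ip_cong_AE[OF tf(1) AE_I2[OF refl]] l2ip_cong_AE[OF tg(1) AE_I2[OF refl]]
  have T1: "l2ip (g i) (pd l (f k)) = - l2ip (f k) (pd l (g i))" for i k l
    using l2ip_by_parts[OF f g, of l k i] by (simp add: l2ip_commute)
  have T2: "l2ip (pd l (g i)) (pd m (f k)) = l2ip (pd l (f k)) (pd m (g i))" for i k l m
    using pair2_sym[OF f g, of l k m i] by (simp add: l2ip_commute)
  have C: "(\<Sum>l\<in>UNIV. \<Sum>m\<in>UNIV. J2 M \<theta> i l k m * l2ip (pd l (f i)) (pd m (g k)))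
      = (\<Sum>l\<in>UNIV. \<Sum>m\<in>UNIV. J2 M \<theta> k l i m * l2ip (pd l (f i)) (pd m (g k)))" for i k
    using contract2[of "\<lambda>l m. J2 M \<theta> i l k m - J2 M \<theta> k l i m" "\<lambda>l m. l2ip (pd l (f i)) (pd m (g k))", OF R_symbol_symmetry(2)] pair2_sym[OF f g]
    by (simp add: left_diff_distrib sum_subtractf)
  have s3: "(\<Sum>i\<in>UNIV. \<Sum>l\<in>UNIV. \<Sum>k\<in>UNIV. F i l k) = (\<Sum>i\<in>UNIV. \<Sum>k\<in>UNIV. \<Sum>l\<in>UNIV. F i l k)" for F :: "'d \<Rightarrow> 'd \<Rightarrow> 'd \<Rightarrow> real"
    by (intro sum.cong refl sum.swap)
  have L: "Br M ell \<theta> \<phi> \<psi> = rho0 M * ((\<Sum>i\<in>UNIV. l2ip (f i) (g i))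
      + ell * (\<Sum>i\<in>UNIV. \<Sum>k\<in>UNIV. \<Sum>l\<in>UNIV. B1 M i k l * l2ip (f i) (pd l (g k)))
      + ell\<^sup>2 * (\<Sum>i\<in>UNIV. \<Sum>k\<in>UNIV. \<Sum>l\<in>UNIV. \<Sum>m\<in>UNIV. J2 M \<theta> k l i m * l2ip (pd l (f i)) (pd m (g k))))"
    unfolding C[symmetric] Br_def f0 h0 cg by (rule arg_cong[where f = "\<lambda>z. rho0 M * (_ + ell\<^sup>2 * z)", OF s3])
  have R: "Br M ell \<theta> \<psi> \<phi> = rho0 M * ((\<Sum>i\<in>UNIV. l2ip (f i) (g i))
      + ell * (\<Sum>i\<in>UNIV. \<Sum>k\<in>UNIV. \<Sum>l\<in>UNIV. B1 M k i l * l2ip (f k) (pd l (g i)))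
      + ell\<^sup>2 * (\<Sum>i\<in>UNIV. \<Sum>k\<in>UNIV. \<Sum>l\<in>UNIV. \<Sum>m\<in>UNIV. J2 M \<theta> i l k m * l2ip (pd l (f k)) (pd m (g i))))"
  proof -
    have "B1 M i k l * l2ip (g i) (pd l (f k)) = B1 M k i l * l2ip (f k) (pd l (g i))" for i k l
      using R_symbol_symmetry(1)[of i k l] T1[of i l k] by simp
    moreover have "l2ip (g i) (f i) = l2ip (f i) (g i)" for i by (rule l2ip_commute)
    ultimately show ?thesis unfolding Br_def f0 h0 cg T2
      by (simp only:) (rule arg_cong[where f = "\<lambda>z. rho0 M * (_ + ell\<^sup>2 * z)", OF s3])
  qed
  show "Br M ell \<theta> \<phi> \<psi> = Br M ell \<theta> \<psi> \<phi>"
    unfolding L R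
    by (rule arg_cong[where f = "(*) (rho0 M)", OF arg_cong2[where f = "(+)", OF arg_cong2[where f = "(+)", OF refl
        arg_cong[where f = "(*) ell", OF sum.swap]] arg_cong[where f = "(*) (ell\<^sup>2)", OF sum.swap]]])
qed

end

section \<open>The phase space as a Hilbert space\<close>

declare sobolev_Suc_iff [simp del] sip_Suc [simp del]

definition hip :: "'d::finite state \<Rightarrow> 'd state \<Rightarrow> real" where
  "hip u w = sip (Suc (Suc 0)) (fst u) (fst w) + sip (Suc 0) (snd u) (snd w)"

lemma H2_eq: "H2 = sobolev (Suc (Suc 0)) UNIV" and H1_eq: "H1 = sobolev (Suc 0) UNIV"
  by (simp_all add: numeral_2_eq_2)

lemma Hspace_iff: "u \<in> Hspace \<longleftrightarrow> fst u \<in> sobolev (Suc (Suc 0)) UNIV \<and> snd u \<in> sobolev (Suc 0) UNIV"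
  unfolding Hspace_def H2_eq H1_eq by (cases u) simp

lemma Hspace_subspace: "subspace (Hspace :: 'd::finite state set)"
  unfolding subspace_def
  by (auto simp only: Hspace_iff fst_zero snd_zero fst_add snd_add fst_scaleR snd_scaleR
      sobolev_zero intro!: sobolev_add sobolev_scaleR)

interpretation hs: semi_inner "Hspace :: 'd::finite state set" hip
  by standard (auto simp: hip_def Hspace_subspace Hspace_iff sip_add_left sip_scaleR_left distrib_left sip_nonneg
      intro: sip_commute arg_cong2[where f = "(+)"])

text \<open>Identifying states that are equal almost everywhere therefore turns the seminorm into a norm.\<close>

lemma state_eq_iff_hip:
  assumes "u \<in> Hspace" "w \<in> Hspace"
  shows "state_eq u w \<longleftrightarrow> hip (u - w) (u - w) = 0"
proof
  assume e: "state_eq u w"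
  have 0: "sip k (f - g) (f - g) = 0" if "AE x in lebesgue. f x = g x" for k and f g :: "'a field"
  proof -
    have "AE x in lebesgue. (f - g) x = (0 :: 'a field) x" using that by auto
    then have "sip k (f - g) (f - g) = sip k 0 (0 :: 'a field)" by (intro sip_cong_AE)
    then show ?thesis using sob.ip_scale[OF sobolev_zero, of k 0 "0 :: 'a field"] by simp
  qed
  show "hip (u - w) (u - w) = 0" using e by (simp add: hip_def state_eq_def 0)
next
  assume z: "hip (u - w) (u - w) = 0"
  have d: "u - w \<in> Hspace" using Hspace_subspace assms by (rule subspace_diff)
  have "sip (Suc (Suc 0)) (fst (u - w)) (fst (u - w)) = 0" "sip (Suc 0) (snd (u - w)) (snd (u - w)) = 0"
    using z sip_nonneg[of "Suc (Suc 0)" "fst (u - w)"] sip_nonneg[of "Suc 0" "snd (u - w)"]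
    unfolding hip_def by linarith+
  from sip_zero_AE[OF _ this(1)] sip_zero_AE[OF _ this(2)] show "state_eq u w"
    using d by (simp add: Hspace_iff state_eq_def)
qed

lemma state_eq_refl: "state_eq u u"
  by (simp add: state_eq_def)

lemma state_eq_sym: "state_eq u w \<Longrightarrow> state_eq w u"
  by (auto simp: state_eq_def)

lemma state_eq_trans: "state_eq u v \<Longrightarrow> state_eq v w \<Longrightarrow> state_eq u w"
  unfolding state_eq_def by (auto elim: eventually_elim2)

lemma Hspace_cong: "u \<in> Hspace \<Longrightarrow> state_eq u w \<Longrightarrow> w \<in> Hspace"
  unfolding Hspace_iff state_eq_def
  using sobolev_cong_AE[of "fst u" _ "fst w"] sobolev_cong_AE[of "snd u" _ "snd w"] by blast

text \<open>A partial equivalence: the quotient type consists of classes of states in the energy space only.\<close>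

definition hrel :: "'d::finite state \<Rightarrow> 'd state \<Rightarrow> bool" where
  "hrel u w \<longleftrightarrow> u \<in> Hspace \<and> w \<in> Hspace \<and> state_eq u w"

quotient_type (overloaded) 'd hs = "'d::finite state" / partial: hrel
proof (rule part_equivpI)
  show "\<exists>x. hrel x x"
    by (rule exI[of _ 0]) (simp add: hrel_def state_eq_refl subspace_0[OF Hspace_subspace])
qed (auto simp: hrel_def symp_def transp_def intro: state_eq_sym state_eq_trans)

definition mk :: "'d::finite state \<Rightarrow> 'd hs" where "mk = abs_hs"
definition rep :: "'d::finite hs \<Rightarrow> 'd state" where "rep = rep_hs"

lemma rep_in [simp]: "rep x \<in> Hspace"
  using Quotient_rep_reflp[OF Quotient_hs, of x] by (simp add: hrel_def rep_def)

lemma mk_rep [simp]: "mk (rep x) = x"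
  unfolding mk_def rep_def by (rule Quotient_abs_rep[OF Quotient_hs])

lemma mk_eq_iff: "u \<in> Hspace \<Longrightarrow> w \<in> Hspace \<Longrightarrow> mk u = mk w \<longleftrightarrow> state_eq u w"
  using Quotient_rel[OF Quotient_hs, of u w] by (auto simp: mk_def hrel_def state_eq_refl)

lemma rep_mk: "u \<in> Hspace \<Longrightarrow> state_eq (rep (mk u)) u"
  using mk_eq_iff[of "rep (mk u)" u] by simp

lemma hip_cong:
  assumes "state_eq u u'" "state_eq w w'" shows "hip u w = hip u' w'"
  using assms unfolding hip_def state_eq_def by (intro arg_cong2[where f = "(+)"] sip_cong_AE) blast+

lemma state_eq_add: "state_eq u u' \<Longrightarrow> state_eq w w' \<Longrightarrow> state_eq (u + w) (u' + w')"
  unfolding state_eq_def by (auto elim: eventually_elim2)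

lemma state_eq_scaleR: "state_eq u u' \<Longrightarrow> state_eq (r *\<^sub>R u) (r *\<^sub>R u')"
  unfolding state_eq_def by (auto elim: eventually_mono)

instantiation hs :: (finite) real_inner
begin

definition zero_hs :: "'a hs" where "zero_hs = mk 0"
definition plus_hs :: "'a hs \<Rightarrow> 'a hs \<Rightarrow> 'a hs" where "plus_hs x y = mk (rep x + rep y)"
definition scaleR_hs :: "real \<Rightarrow> 'a hs \<Rightarrow> 'a hs" where "scaleR_hs r x = mk (r *\<^sub>R rep x)"
definition uminus_hs :: "'a hs \<Rightarrow> 'a hs" where "uminus_hs x = mk (- 1 *\<^sub>R rep x)"
definition minus_hs :: "'a hs \<Rightarrow> 'a hs \<Rightarrow> 'a hs" where "minus_hs x y = mk (rep x + - 1 *\<^sub>R rep y)"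
definition inner_hs :: "'a hs \<Rightarrow> 'a hs \<Rightarrow> real" where "inner_hs x y = hip (rep x) (rep y)"
definition norm_hs :: "'a hs \<Rightarrow> real" where "norm_hs x = sqrt (inner x x)"
definition sgn_hs :: "'a hs \<Rightarrow> 'a hs" where "sgn_hs x = scaleR (inverse (norm x)) x"
definition dist_hs :: "'a hs \<Rightarrow> 'a hs \<Rightarrow> real" where "dist_hs x y = norm (x - y)"
definition uniformity_hs :: "('a hs \<times> 'a hs) filter" where
  "uniformity_hs = (INF e\<in>{0<..}. principal {(x, y). dist x y < e})"
definition open_hs :: "'a hs set \<Rightarrow> bool" where
  "open_hs U = (\<forall>x\<in>U. \<forall>\<^sub>F (x', y) in uniformity. x' = x \<longrightarrow> y \<in> U)"

lemma mk_add: "u \<in> Hspace \<Longrightarrow> w \<in> Hspace \<Longrightarrow> mk u + mk w = mk (u + w)"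
  unfolding plus_hs_def by (subst mk_eq_iff) (auto intro: state_eq_add rep_mk hs.in_X)

lemma mk_scaleR: "u \<in> Hspace \<Longrightarrow> r *\<^sub>R mk u = mk (r *\<^sub>R u)"
  unfolding scaleR_hs_def by (subst mk_eq_iff) (auto intro: state_eq_scaleR rep_mk hs.in_X)

lemma mk_uminus: "u \<in> Hspace \<Longrightarrow> - mk u = mk (- 1 *\<^sub>R u)"
  unfolding uminus_hs_def by (subst mk_eq_iff) (auto intro: state_eq_scaleR[of _ _ "- 1", simplified] rep_mk hs.in_X(2)[of _ "- 1", simplified])

lemma mk_diff: "u \<in> Hspace \<Longrightarrow> w \<in> Hspace \<Longrightarrow> mk u - mk w = mk (u - w)"
proof -
  assume i: "u \<in> Hspace" "w \<in> Hspace"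
  have "state_eq (rep (mk u) + - 1 *\<^sub>R rep (mk w)) (u + - 1 *\<^sub>R w)"
    by (intro state_eq_add state_eq_scaleR rep_mk i)
  moreover have "rep (mk u) + - 1 *\<^sub>R rep (mk w) \<in> Hspace" by (intro hs.in_X(1,2) rep_in)
  ultimately show "mk u - mk w = mk (u - w)"
    unfolding minus_hs_def using hs.in_X(3)[OF i] by (subst mk_eq_iff) simp_all
qed

lemma inner_mk: "u \<in> Hspace \<Longrightarrow> w \<in> Hspace \<Longrightarrow> inner (mk u) (mk w) = hip u w"
  unfolding inner_hs_def by (intro hip_cong rep_mk)

lemma hs_cases: obtains u where "u \<in> Hspace" "x = mk u"
  using rep_in[of x] mk_rep[of x] by metis

instance
proof
  fix x y z :: "'a hs" and r s :: real
  obtain u where u: "u \<in> Hspace" "x = mk u" by (rule hs_cases)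
  obtain v where v: "v \<in> Hspace" "y = mk v" by (rule hs_cases)
  obtain w where w: "w \<in> Hspace" "z = mk w" by (rule hs_cases)
  note i = u(1) v(1) w(1) hs.in_X mk_add mk_scaleR mk_uminus mk_diff inner_mk
  show "x + y + z = x + (y + z)" "x + y = y + x" "0 + x = x"
    "r *\<^sub>R (x + y) = r *\<^sub>R x + r *\<^sub>R y" "(r + s) *\<^sub>R x = r *\<^sub>R x + s *\<^sub>R x" "r *\<^sub>R s *\<^sub>R x = (r * s) *\<^sub>R x" "1 *\<^sub>R x = x"
    by (simp_all add: u(2) v(2) w(2) i zero_hs_def add_ac scaleR_add_left scaleR_add_right)
  show "- x + x = 0" using hs.in_X(2)[OF u(1), of "- 1"] by (simp add: u(2) zero_hs_def i del: scaleR_minus_left)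
  show "x - y = x + - y" using hs.in_X(2)[OF v(1), of "- 1"] by (simp add: u(2) v(2) i)
  show "inner x y = inner y x" unfolding inner_hs_def by (rule hs.ip_commute)
  show "inner (x + y) z = inner x z + inner y z" "inner (r *\<^sub>R x) y = r * inner x y" "0 \<le> inner x x"
    by (simp_all add: u(2) v(2) w(2) i hs.ip_add hs.ip_scale hs.ip_nonneg)
  show "inner x x = 0 \<longleftrightarrow> x = 0"
    using state_eq_iff_hip[OF u(1) hs.in_X(4)] mk_eq_iff[OF u(1) hs.in_X(4)]
    by (simp add: u(2) i zero_hs_def)
  show "norm x = sqrt (inner x x)" "sgn x = inverse (norm x) *\<^sub>R x" "dist x y = norm (x - y)"
    by (rule norm_hs_def sgn_hs_def dist_hs_def)+
  show "(uniformity :: ('a hs \<times> 'a hs) filter) = (INF e\<in>{0<..}. principal {(x, y). dist x y < e})"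
    by (rule uniformity_hs_def)
  show "open U = (\<forall>x\<in>U. \<forall>\<^sub>F (x', y) in uniformity. x' = x \<longrightarrow> y \<in> U)" for U :: "'a hs set"
    by (rule open_hs_def)
qed

end

lemma mk_zero: "mk 0 = 0"
  by (simp add: zero_hs_def)

lemma norm_mk: "u \<in> Hspace \<Longrightarrow> (norm (mk u))\<^sup>2 = hip u u"
  using inner_mk[of u u] by (simp add: power2_norm_eq_inner)

instance hs :: (finite) banach
proof
  fix X :: "nat \<Rightarrow> 'a hs" assume C: "Cauchy X"
  define r where "r n = rep (X n)" for n
  have r: "r n \<in> Hspace" "X n = mk (r n)" for n by (simp_all add: r_def)
  have c: "\<exists>N. \<forall>m\<ge>N. \<forall>n\<ge>N. hip (r m - r n) (r m - r n) < e" if "0 < e" for e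
  proof -
    obtain N where N: "\<And>m n. N \<le> m \<Longrightarrow> N \<le> n \<Longrightarrow> norm (X m - X n) < sqrt e"
      using C \<open>0 < e\<close> unfolding Cauchy_iff by (metis real_sqrt_gt_zero)
    have "hip (r m - r n) (r m - r n) < e" if "N \<le> m" "N \<le> n" for m n
    proof -
      have "(norm (X m - X n))\<^sup>2 < (sqrt e)\<^sup>2" using N[OF that] by (intro power_strict_mono) auto
      then show ?thesis using \<open>0 < e\<close> by (simp add: r(2) mk_diff r(1) norm_mk hs.in_X)
    qed
    then show ?thesis by blast
  qed
  have "\<exists>g. g \<in> sobolev (Suc (Suc 0)) UNIV \<and> (\<lambda>n. sip (Suc (Suc 0)) (fst (r n) - g) (fst (r n) - g)) \<longlonglongrightarrow> 0"
  proof (rule sobolev_complete)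
    show "\<exists>N. \<forall>m\<ge>N. \<forall>n\<ge>N. sip (Suc (Suc 0)) (fst (r m) - fst (r n)) (fst (r m) - fst (r n)) < e" if "0 < e" for e
      using c[OF that] sip_nonneg unfolding hip_def fst_diff snd_diff
      by (meson add_strict_increasing2 le_less_trans add_increasing2 order_refl)
  qed (use r(1) Hspace_iff in blast)
  then obtain g where g: "g \<in> sobolev (Suc (Suc 0)) UNIV"
    "(\<lambda>n. sip (Suc (Suc 0)) (fst (r n) - g) (fst (r n) - g)) \<longlonglongrightarrow> 0" by blast
  have "\<exists>h. h \<in> sobolev (Suc 0) UNIV \<and> (\<lambda>n. sip (Suc 0) (snd (r n) - h) (snd (r n) - h)) \<longlonglongrightarrow> 0"
  proof (rule sobolev_complete)
    show "\<exists>N. \<forall>m\<ge>N. \<forall>n\<ge>N. sip (Suc 0) (snd (r m) - snd (r n)) (snd (r m) - snd (r n)) < e" if "0 < e" for e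
      using c[OF that] sip_nonneg unfolding hip_def fst_diff snd_diff
      by (meson add_strict_increasing2 le_less_trans add_increasing order_refl)
  qed (use r(1) Hspace_iff in blast)
  then obtain h where h: "h \<in> sobolev (Suc 0) UNIV"
    "(\<lambda>n. sip (Suc 0) (snd (r n) - h) (snd (r n) - h)) \<longlonglongrightarrow> 0" by blast
  have gh: "(g, h) \<in> Hspace" using g(1) h(1) by (simp add: Hspace_iff)
  have "(\<lambda>n. (norm (X n - mk (g, h)))\<^sup>2) \<longlonglongrightarrow> 0"
    using tendsto_add[OF g(2) h(2)] by (simp add: r(2) mk_diff r(1) gh norm_mk hs.in_X hip_def)
  then have "(\<lambda>n. sqrt ((norm (X n - mk (g, h)))\<^sup>2)) \<longlonglongrightarrow> sqrt 0" by (rule tendsto_real_sqrt)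
  then have "(\<lambda>n. X n - mk (g, h)) \<longlonglongrightarrow> 0" by (simp add: tendsto_norm_zero_iff)
  then show "convergent X" using LIM_zero_iff convergent_def by blast
qed

definition hform :: "('d::finite state \<Rightarrow> 'd state \<Rightarrow> real) \<Rightarrow> bool" where
  "hform b \<longleftrightarrow> (\<forall>u\<in>Hspace. \<forall>v\<in>Hspace. \<forall>w\<in>Hspace. \<forall>a.
       b (a *\<^sub>R u + v) w = a * b u w + b v w \<and> b w (a *\<^sub>R u + v) = a * b w u + b w v) \<and>
     (\<exists>K\<ge>0. \<forall>u\<in>Hspace. \<forall>w\<in>Hspace. (b u w)\<^sup>2 \<le> K * (hip u u * hip w w))"

text \<open>On the quotient through representatives; the choice does not matter for bounded forms (\<open>lift_form_mk\<close>).\<close>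

definition lift_form :: "('d::finite state \<Rightarrow> 'd state \<Rightarrow> real) \<Rightarrow> 'd hs \<Rightarrow> 'd hs \<Rightarrow> real" where
  "lift_form b x y = b (rep x) (rep y)"

text \<open>A form bounded by the seminorm does not see null sets.\<close>

lemma hform_cong:
  assumes b: "hform b" and i: "u \<in> Hspace" "w \<in> Hspace" "state_eq u u'" "state_eq w w'"
  shows "b u w = b u' w'"
proof -
  obtain K where K: "\<And>u w. u \<in> Hspace \<Longrightarrow> w \<in> Hspace \<Longrightarrow> (b u w)\<^sup>2 \<le> K * (hip u u * hip w w)"
    using b unfolding hform_def by blast
  have i': "u' \<in> Hspace" "w' \<in> Hspace" using Hspace_cong i by blast+
  have 1: "b u w - b u' w = b (u - u') w"
  proof -
    have "b ((-1) *\<^sub>R u' + u) w = (-1) * b u' w + b u w" using b i i' unfolding hform_def by blast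
    then show ?thesis by simp
  qed
  have 2: "b u' w - b u' w' = b u' (w - w')"
  proof -
    have "b u' ((-1) *\<^sub>R w' + w) = (-1) * b u' w' + b u' w" using b i i' unfolding hform_def by blast
    then show ?thesis by simp
  qed
  have "(b (u - u') w)\<^sup>2 \<le> 0" "(b u' (w - w'))\<^sup>2 \<le> 0"
    using K[of "u - u'" w] K[of u' "w - w'"] i i' state_eq_iff_hip[of u u'] state_eq_iff_hip[of w w']
    by (simp_all add: hs.in_X)
  then show ?thesis using 1 2 by simp
qed

lemma lift_form_mk: "hform b \<Longrightarrow> u \<in> Hspace \<Longrightarrow> w \<in> Hspace \<Longrightarrow> lift_form b (mk u) (mk w) = b u w"
  unfolding lift_form_def by (rule hform_cong) (auto intro: rep_mk)

lemma lift_form_bilinear: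
  fixes b :: "'d::finite state \<Rightarrow> 'd state \<Rightarrow> real"
  assumes b: "hform b" shows "bounded_bilinear (lift_form b)"
proof -
  obtain K where K: "0 \<le> K" "\<And>u w. u \<in> Hspace \<Longrightarrow> w \<in> Hspace \<Longrightarrow> (b u w)\<^sup>2 \<le> K * (hip u u * hip w w)"
    using b unfolding hform_def by blast
  have lin: "lift_form b (a *\<^sub>R x + y) z = a * lift_form b x z + lift_form b y z"
    "lift_form b z (a *\<^sub>R x + y) = a * lift_form b z x + lift_form b z y" for a x y z
  proof -
    obtain u where u: "u \<in> Hspace" "x = mk u" by (rule hs_cases)
    obtain v where v: "v \<in> Hspace" "y = mk v" by (rule hs_cases)
    obtain w where w: "w \<in> Hspace" "z = mk w" by (rule hs_cases)
    have "b (a *\<^sub>R u + v) w = a * b u w + b v w \<and> b w (a *\<^sub>R u + v) = a * b w u + b w v"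
      using b u(1) v(1) w(1) unfolding hform_def by blast
    then show "lift_form b (a *\<^sub>R x + y) z = a * lift_form b x z + lift_form b y z"
      "lift_form b z (a *\<^sub>R x + y) = a * lift_form b z x + lift_form b z y"
      using u(1) v(1) w(1) by (simp_all add: u(2) v(2) w(2) mk_scaleR mk_add lift_form_mk[OF b] hs.in_X)
  qed
  have z: "lift_form b 0 z = 0" "lift_form b z 0 = 0" for z
    using lin(1)[where a = 1 and x = 0 and y = 0 and z = z] lin(2)[where a = 1 and x = 0 and y = 0 and z = z] by simp_all
  have bd: "norm (lift_form b x y) \<le> norm x * norm y * sqrt K" for x y
  proof -
    have "(lift_form b x y)\<^sup>2 \<le> K * ((norm x)\<^sup>2 * (norm y)\<^sup>2)"
      using K(2)[OF rep_in rep_in, of x y] norm_mk[OF rep_in, of x] norm_mk[OF rep_in, of y] by (simp add: lift_form_def)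
    also have "\<dots> = (norm x * norm y * sqrt K)\<^sup>2" using K(1) by (simp add: power_mult_distrib)
    finally show ?thesis using K(1) abs_le_square_iff[of "lift_form b x y" "norm x * norm y * sqrt K"] by simp
  qed
  show ?thesis
  proof
    show "\<exists>K. \<forall>x y. norm (lift_form b x y) \<le> norm x * norm y * K" using bd by blast
  qed (use lin[where a = 1] lin[where y = 0] z in simp_all)
qed

lemma hform_sum:
  fixes b\<^sub>1 :: "'d::finite field \<Rightarrow> 'd field \<Rightarrow> real"
  assumes 1: "bform (Suc (Suc 0)) b\<^sub>1" and 2: "bform (Suc 0) b\<^sub>2"
  shows "hform (\<lambda>u w. b\<^sub>1 (fst u) (fst w) + b\<^sub>2 (snd u) (snd w))"
proof -
  obtain K\<^sub>1 where K1: "0 \<le> K\<^sub>1" "\<And>U W. U \<in> sobolev (Suc (Suc 0)) UNIV \<Longrightarrow> W \<in> sobolev (Suc (Suc 0)) UNIV \<Longrightarrow>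
      (b\<^sub>1 U W)\<^sup>2 \<le> K\<^sub>1 * (sip (Suc (Suc 0)) U U * sip (Suc (Suc 0)) W W)" using bform_bound[OF 1] by blast
  obtain K\<^sub>2 where K2: "0 \<le> K\<^sub>2" "\<And>U W. U \<in> sobolev (Suc 0) UNIV \<Longrightarrow> W \<in> sobolev (Suc 0) UNIV \<Longrightarrow>
      (b\<^sub>2 U W)\<^sup>2 \<le> K\<^sub>2 * (sip (Suc 0) U U * sip (Suc 0) W W)" using bform_bound[OF 2] by blast
  have real_bd: "(x + y)\<^sup>2 \<le> (2 * (K\<^sub>1 + K\<^sub>2)) * ((p + q) * (r + s))"
    if "x\<^sup>2 \<le> K\<^sub>1 * (p * r)" "y\<^sup>2 \<le> K\<^sub>2 * (q * s)" "0 \<le> p" "0 \<le> q" "0 \<le> r" "0 \<le> s" for x y p q r s :: real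
  proof -
    have "(x + y)\<^sup>2 \<le> 2 * (x\<^sup>2 + y\<^sup>2)" 
      using sum_squares_bound[of x y] by (simp add: power2_sum)
    also have "\<dots> \<le> 2 * (K\<^sub>1 * ((p + q) * (r + s)) + K\<^sub>2 * ((p + q) * (r + s)))"
      using that K1(1) K2(1) by (intro mult_left_mono add_mono order_trans[OF that(1)] order_trans[OF that(2)] mult_mono) auto
    finally show ?thesis by (simp add: algebra_simps)
  qed
  show ?thesis
    unfolding hform_def
  proof (intro conjI ballI allI exI[of _ "2 * (K\<^sub>1 + K\<^sub>2)"])
    fix u w :: "'d state" assume "u \<in> Hspace" "w \<in> Hspace"
    then show "(b\<^sub>1 (fst u) (fst w) + b\<^sub>2 (snd u) (snd w))\<^sup>2 \<le> 2 * (K\<^sub>1 + K\<^sub>2) * (hip u u * hip w w)"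
      unfolding hip_def by (intro real_bd K1 K2 sip_nonneg) (auto simp: Hspace_iff)
  qed (use K1 K2 in \<open>auto simp: Hspace_iff bformD[OF 1] bformD[OF 2] distrib_left\<close>)
qed

section \<open>Functionals on the phase space\<close>

lemma fform_cong:
  assumes g: "fform k g" and U: "U \<in> sobolev k UNIV" and e: "AE x in lebesgue. U x = U' x"
  shows "g U = g U'"
proof -
  obtain K where K: "\<And>U. U \<in> sobolev k UNIV \<Longrightarrow> (g U)\<^sup>2 \<le> K * sip k U U" using fform_bound[OF g] by blast
  have U': "U' \<in> sobolev k UNIV" by (rule sobolev_cong_AE[OF U e])
  have "AE x in lebesgue. (U - U') x = (0 :: 'a field) x" using e by auto
  then have "sip k (U - U') (U - U') = sip k 0 (0 :: 'a field)" by (intro sip_cong_AE)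
  then have "sip k (U - U') (U - U') = 0" using sob.ip_scale[OF sobolev_zero, of k 0 "0 :: 'a field"] by simp
  then have "g (U - U') = 0" using K[OF sobolev_diff[OF U U']] by simp
  then show ?thesis using fform_diff[OF g U U'] by simp
qed

lemma bform_cong:
  assumes b: "bform k b" and i: "U \<in> sobolev k UNIV" "W \<in> sobolev k UNIV"
    and e: "AE x in lebesgue. U x = U' x" "AE x in lebesgue. W x = W' x"
  shows "b U W = b U' W'"
  using fform_cong[OF bform_fform(1)[OF b i(2)] i(1) e(1)]
    fform_cong[OF bform_fform(2)[OF b sobolev_cong_AE[OF i(1) e(1)]] i(2) e(2)] by simp

lemma fform_lift:
  fixes g\<^sub>1 g\<^sub>2 :: "'d::finite field \<Rightarrow> real"
  assumes 1: "fform (Suc (Suc 0)) g\<^sub>1" and 2: "fform (Suc 0) g\<^sub>2"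
  shows "bounded_linear (\<lambda>x. g\<^sub>1 (fst (rep x)) + g\<^sub>2 (snd (rep x)))"
    and "u \<in> Hspace \<Longrightarrow> g\<^sub>1 (fst (rep (mk u))) + g\<^sub>2 (snd (rep (mk u))) = g\<^sub>1 (fst u) + g\<^sub>2 (snd u)"
proof -
  define G where "G x = g\<^sub>1 (fst (rep x)) + g\<^sub>2 (snd (rep x))" for x
  show mk: "g\<^sub>1 (fst (rep (mk u))) + g\<^sub>2 (snd (rep (mk u))) = g\<^sub>1 (fst u) + g\<^sub>2 (snd u)" if "u \<in> Hspace" for u
  proof -
    have e: "AE x in lebesgue. fst (rep (mk u)) x = fst u x" "AE x in lebesgue. snd (rep (mk u)) x = snd u x"
      using rep_mk[OF that] by (auto simp: state_eq_def)
    have "rep (mk u) \<in> Hspace" by simp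
    then show ?thesis
      unfolding Hspace_iff using fform_cong[OF 1 _ e(1)] fform_cong[OF 2 _ e(2)] by metis
  qed
  have lin: "G (a *\<^sub>R x + y) = a * G x + G y" for a x y
  proof -
    obtain u where u: "u \<in> Hspace" "x = mk u" by (rule hs_cases)
    obtain v where v: "v \<in> Hspace" "y = mk v" by (rule hs_cases)
    have m: "G (mk w) = g\<^sub>1 (fst w) + g\<^sub>2 (snd w)" if "w \<in> Hspace" for w using mk[OF that] by (simp add: G_def)
    have i: "a *\<^sub>R u + v \<in> Hspace" by (intro hs.in_X u v)
    show ?thesis
      using u(1) v(1) unfolding u(2) v(2) mk_scaleR[OF u(1)] mk_add[OF hs.in_X(2)[OF u(1)] v(1)] m[OF i] m[OF u(1)] m[OF v(1)]
      by (simp add: Hspace_iff fform_linear[OF 1] fform_linear[OF 2] distrib_left)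
  qed
  obtain K\<^sub>1 where K1: "0 \<le> K\<^sub>1" "\<And>U. U \<in> sobolev (Suc (Suc 0)) UNIV \<Longrightarrow> (g\<^sub>1 U)\<^sup>2 \<le> K\<^sub>1 * sip (Suc (Suc 0)) U U"
    using fform_bound[OF 1] by blast
  obtain K\<^sub>2 where K2: "0 \<le> K\<^sub>2" "\<And>U. U \<in> sobolev (Suc 0) UNIV \<Longrightarrow> (g\<^sub>2 U)\<^sup>2 \<le> K\<^sub>2 * sip (Suc 0) U U"
    using fform_bound[OF 2] by blast
  have bd: "\<bar>G x\<bar> \<le> norm x * sqrt (2 * (K\<^sub>1 + K\<^sub>2))" for x
  proof -
    have r: "fst (rep x) \<in> sobolev (Suc (Suc 0)) UNIV" "snd (rep x) \<in> sobolev (Suc 0) UNIV"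
      using rep_in[of x] by (auto simp: Hspace_iff)
    have "(G x)\<^sup>2 \<le> 2 * ((g\<^sub>1 (fst (rep x)))\<^sup>2 + (g\<^sub>2 (snd (rep x)))\<^sup>2)"
      unfolding G_def using sum_squares_bound[of "g\<^sub>1 (fst (rep x))" "g\<^sub>2 (snd (rep x))"] by (simp add: power2_sum)
    also have "\<dots> \<le> 2 * (K\<^sub>1 * hip (rep x) (rep x) + K\<^sub>2 * hip (rep x) (rep x))"
      using r by (intro mult_left_mono add_mono order_trans[OF K1(2)] order_trans[OF K2(2)])
        (auto simp: hip_def sip_nonneg K1(1) K2(1) intro!: mult_left_mono)
    also have "\<dots> = (norm x * sqrt (2 * (K\<^sub>1 + K\<^sub>2)))\<^sup>2"
      using K1(1) K2(1) norm_mk[OF rep_in, of x] by (simp add: power_mult_distrib algebra_simps)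
    finally show ?thesis
      using K1(1) K2(1) abs_le_square_iff[of "G x" "norm x * sqrt (2 * (K\<^sub>1 + K\<^sub>2))"] by simp
  qed
  have "bounded_linear G"
  proof (rule bounded_linear_intro)
    show "G (x + y) = G x + G y" for x y using lin[of 1 x y] by simp
    show "G (r *\<^sub>R x) = r *\<^sub>R G x" for r x using lin[of r x 0] lin[of 1 0 0] by simp
    show "norm (G x) \<le> norm x * sqrt (2 * (K\<^sub>1 + K\<^sub>2))" for x using bd[of x] by simp
  qed
  then show "bounded_linear (\<lambda>x. g\<^sub>1 (fst (rep x)) + g\<^sub>2 (snd (rep x)))" by (simp add: G_def[abs_def])
qed

text \<open>The dual of \<open>H\<^sup>1\<close> in the squared form of the bound.\<close>

lemma Hm1_iff: "f \<in> Hm1 \<longleftrightarrow> fform (Suc 0) f"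
proof -
  have n: "H1norm W = sqrt (sip (Suc 0) W W)" for W :: "'a field"
    by (simp add: sobolev_norm_def sip_self)
  have "(\<exists>K. \<forall>W\<in>H1. \<bar>f W\<bar> \<le> K * H1norm W) \<longleftrightarrow> (\<exists>K\<ge>0. \<forall>U\<in>H1. (f U)\<^sup>2 \<le> K * sip (Suc 0) U U)"
  proof
    assume "\<exists>K. \<forall>W\<in>H1. \<bar>f W\<bar> \<le> K * H1norm W"
    then obtain K where K: "\<And>W. W \<in> H1 \<Longrightarrow> \<bar>f W\<bar> \<le> K * sqrt (sip (Suc 0) W W)" unfolding n by blast
    have "(f W)\<^sup>2 \<le> K\<^sup>2 * sip (Suc 0) W W" if "W \<in> H1" for W
      using power_mono[OF K[OF that] abs_ge_zero, of 2] by (simp add: power_mult_distrib sip_nonneg)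
    then show "\<exists>K\<ge>0. \<forall>U\<in>H1. (f U)\<^sup>2 \<le> K * sip (Suc 0) U U" by (intro exI[of _ "K\<^sup>2"]) simp
  next
    assume "\<exists>K\<ge>0. \<forall>U\<in>H1. (f U)\<^sup>2 \<le> K * sip (Suc 0) U U"
    then obtain K where K: "\<And>W. W \<in> H1 \<Longrightarrow> (f W)\<^sup>2 \<le> K * sip (Suc 0) W W" by blast
    have "\<bar>f W\<bar> \<le> sqrt K * H1norm W" if "W \<in> H1" for W
      using real_sqrt_le_mono[OF K[OF that]] unfolding n by (simp add: real_sqrt_mult)
    then show "\<exists>K. \<forall>W\<in>H1. \<bar>f W\<bar> \<le> K * H1norm W" by blast
  qed
  then show ?thesis unfolding Hm1_def fform_def H1_eq by blast
qed

section \<open>The evolution operator\<close>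

context homogenized
begin

lemmas Bq_bd = Bq_bform[of 0 M ell \<theta>] and Br_bd = Br_bform[of 0 M ell \<theta>]

lemma Br_bd2: "bform (Suc (Suc 0)) (Br M ell \<theta>)"
  by (rule Br_bform)

text \<open>The energy product for \<open>\<tau> = 1\<close>; the value \<open>\<tau> = \<kappa>\<^sup>2\<close> occurs in the resolvent equation.\<close>

definition Ef :: "real \<Rightarrow> 'd state \<Rightarrow> 'd state \<Rightarrow> real" where
  "Ef \<tau> u w = \<tau> * Bq M ell \<theta> (fst u) (fst w) + Br M ell \<theta> (fst u) (fst w) + Br M ell \<theta> (snd u) (snd w)"

lemma Ef_hform: "hform (Ef \<tau>)"
  using hform_sum[OF bform_add[OF bform_cmult[OF Bq_bd, of \<tau>] Br_bd2] Br_bd] by (simp add: Ef_def[abs_def])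

lemma Hip_eq:
  assumes "u \<in> Hspace" "w \<in> Hspace" shows "Hip M ell \<theta> u w = Ef 1 u w"
  using assms unfolding Hspace_iff Hip_def Ef_def
  by (simp add: Qform_eq Rform_eq sobolev_Suc_D[of _ "Suc 0"])

lemma coercivity_constants:
  obtains c\<^sub>1 c\<^sub>2 where "0 < c\<^sub>1" "0 < c\<^sub>2"
    "\<And>U. U \<in> sobolev (Suc (Suc 0)) UNIV \<Longrightarrow> c\<^sub>1 * (sip (Suc (Suc 0)) U U - l2ip U U) \<le> Bq M ell \<theta> U U"
    "\<And>U. U \<in> sobolev (Suc (Suc 0)) UNIV \<Longrightarrow> 0 \<le> Bq M ell \<theta> U U"
    "\<And>W. W \<in> sobolev (Suc 0) UNIV \<Longrightarrow> c\<^sub>2 * sip (Suc 0) W W \<le> Br M ell \<theta> W W"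
proof -
  have n: "(sobolev_norm k UNIV W)\<^sup>2 = sip k W W" for k and W :: "'d field"
    using sip_nonneg[of k W] by (simp add: sobolev_norm_def sip_self[symmetric])
  have q: "Qform M ell \<theta> U U = Bq M ell \<theta> U U" if "U \<in> H2" for U using that Qform_eq H2_eq by metis
  have r: "Rform M ell \<theta> U U = Br M ell \<theta> U U" if "U \<in> H1" for U using that Rform_eq H1_eq by metis
  note w = weight[unfolded admissible_weight_def]
  have "\<exists>c>0. \<forall>U\<in>H2. Qform M ell \<theta> U U \<ge> c * ((H2norm U)\<^sup>2 - (L2norm U)\<^sup>2) \<and> c * ((H2norm U)\<^sup>2 - (L2norm U)\<^sup>2) \<ge> 0"
    "\<exists>c>0. \<forall>W\<in>H1. Rform M ell \<theta> W W \<ge> c * (H1norm W)\<^sup>2" "\<forall>U\<in>H2. Qform M ell \<theta> U U \<ge> 0"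
    by (rule w[THEN conjunct2, THEN conjunct2, THEN conjunct2, THEN conjunct2, THEN conjunct2, THEN conjunct1],
      rule w[THEN conjunct2, THEN conjunct2, THEN conjunct2, THEN conjunct2, THEN conjunct2, THEN conjunct2],
      rule w[THEN conjunct2, THEN conjunct1])
  then obtain c\<^sub>1 c\<^sub>2 where "0 < c\<^sub>1" "\<forall>U\<in>H2. c\<^sub>1 * (sip 2 U U - sip 0 U U) \<le> Bq M ell \<theta> U U"
    "0 < c\<^sub>2" "\<forall>W\<in>H1. c\<^sub>2 * sip 1 W W \<le> Br M ell \<theta> W W" "\<forall>U\<in>H2. 0 \<le> Bq M ell \<theta> U U"
    unfolding n using q r by metis
  then show ?thesis using that[of c\<^sub>1 c\<^sub>2] by (simp add: H2_eq H1_eq numeral_2_eq_2)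
qed

lemma Bq_nonneg: "U \<in> sobolev (Suc (Suc 0)) UNIV \<Longrightarrow> 0 \<le> Bq M ell \<theta> U U"
  using coercivity_constants by metis

lemma Ef_equiv_form:
  assumes t: "0 < \<tau>" shows "\<exists>c. equiv_form (lift_form (Ef \<tau>)) c"
proof -
  obtain c\<^sub>1 c\<^sub>2 where c: "0 < c\<^sub>1" "0 < c\<^sub>2"
    "\<And>U. U \<in> sobolev (Suc (Suc 0)) UNIV \<Longrightarrow> c\<^sub>1 * (sip (Suc (Suc 0)) U U - l2ip U U) \<le> Bq M ell \<theta> U U"
    "\<And>U. U \<in> sobolev (Suc (Suc 0)) UNIV \<Longrightarrow> 0 \<le> Bq M ell \<theta> U U"
    "\<And>W. W \<in> sobolev (Suc 0) UNIV \<Longrightarrow> c\<^sub>2 * sip (Suc 0) W W \<le> Br M ell \<theta> W W"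
    using coercivity_constants by blast
  \<comment> \<open>Using only the fraction \<open>s\<close> of \<open>Q\<close>, the \<open>L\<^sup>2\<close> term subtracted in its lower bound is at most the lower bound of \<open>R\<close>.\<close>
  define s where "s = min \<tau> (c\<^sub>2 / c\<^sub>1)"
  have s: "0 < s" "s \<le> \<tau>" "s * c\<^sub>1 \<le> c\<^sub>2" using t c(1,2) by (auto simp: s_def min_def field_simps)
  have sc: "0 < s * c\<^sub>1" using s(1) c(1) by simp
  have co: "s * c\<^sub>1 * hip u u \<le> Ef \<tau> u u" if "u \<in> Hspace" for u :: "'d state"
  proof -
    have U: "fst u \<in> sobolev (Suc (Suc 0)) UNIV" "fst u \<in> sobolev (Suc 0) UNIV" "snd u \<in> sobolev (Suc 0) UNIV"
      using that sobolev_Suc_D by (auto simp: Hspace_iff)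
    have "s * c\<^sub>1 * (sip (Suc (Suc 0)) (fst u) (fst u) - l2ip (fst u) (fst u)) \<le> s * Bq M ell \<theta> (fst u) (fst u)"
      using mult_left_mono[OF c(3)[OF U(1)], of s] s(1) by (simp add: mult.assoc)
    also have "\<dots> \<le> \<tau> * Bq M ell \<theta> (fst u) (fst u)" by (rule mult_right_mono[OF s(2) c(4)[OF U(1)]])
    finally have 1: "s * c\<^sub>1 * sip (Suc (Suc 0)) (fst u) (fst u) - s * c\<^sub>1 * l2ip (fst u) (fst u) \<le> \<tau> * Bq M ell \<theta> (fst u) (fst u)"
      by (simp only: right_diff_distrib)
    have r: "s * c\<^sub>1 * sip (Suc 0) W W \<le> Br M ell \<theta> W W" if "W \<in> sobolev (Suc 0) UNIV" for W
      using mult_right_mono[OF s(3) sip_nonneg, of "Suc 0" W] c(5)[OF that] by linarith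
    have "s * c\<^sub>1 * l2ip (fst u) (fst u) \<le> s * c\<^sub>1 * sip (Suc 0) (fst u) (fst u)"
      using sc by (intro mult_left_mono sip_ge_l2ip) simp
    then show ?thesis
      using 1 r[OF U(2)] r[OF U(3)] unfolding Ef_def hip_def distrib_left by linarith
  qed
  have "equiv_form (lift_form (Ef \<tau>)) (s * c\<^sub>1)"
  proof (rule equiv_form.intro)
    show "bounded_bilinear (lift_form (Ef \<tau>))" by (rule lift_form_bilinear[OF Ef_hform])
    fix x y :: "'d hs"
    have "rep x \<in> Hspace" "rep y \<in> Hspace" by simp_all
    then show "lift_form (Ef \<tau>) x y = lift_form (Ef \<tau>) y x"
      unfolding lift_form_def Ef_def Hspace_iff
      using Bq_sym[of "fst (rep x)" "fst (rep y)"] Br_sym[of "snd (rep x)" "snd (rep y)"]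
        Br_sym[of "fst (rep x)" "fst (rep y)"] sobolev_Suc_D[of "fst (rep x)" "Suc 0"] sobolev_Suc_D[of "fst (rep y)" "Suc 0"]
      by simp
    show "s * c\<^sub>1 * (norm x)\<^sup>2 \<le> lift_form (Ef \<tau>) x x"
      using co[of "rep x"] norm_mk[of "rep x"] by (simp add: lift_form_def)
  qed (rule sc)
  then show ?thesis by blast
qed

lemma Br_zero_AE:
  assumes z: "z \<in> sobolev (Suc 0) UNIV" and 0: "\<And>\<phi>. test_fun UNIV \<phi> \<Longrightarrow> Br M ell \<theta> z \<phi> = 0"
  shows "AE x in lebesgue. z x = 0"
proof -
  obtain c where "0 < c" "c * sip (Suc 0) z z \<le> Br M ell \<theta> z z" using coercivity_constants z by metis
  moreover have "Br M ell \<theta> z z = 0" by (rule fform_vanishing[OF bform_fform(2)[OF Br_bd z] 0 z])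
  ultimately have "sip (Suc 0) z z = 0" using sip_nonneg[of "Suc 0" z] by (simp add: mult_le_0_iff)
  then show ?thesis by (rule sip_zero_AE[OF z])
qed

text \<open>Test fields suffice to determine an element of \<open>H\<^sup>1\<close>, by density and coercivity.\<close>

lemma Br_unique:
  assumes z: "z \<in> sobolev (Suc 0) UNIV" "z' \<in> sobolev (Suc 0) UNIV"
    and e: "\<And>\<phi>. test_fun UNIV \<phi> \<Longrightarrow> Br M ell \<theta> z \<phi> = Br M ell \<theta> z' \<phi>"
  shows "AE x in lebesgue. z x = z' x"
proof -
  have "AE x in lebesgue. (z - z') x = 0"
  proof (rule Br_zero_AE[OF sobolev_diff[OF z]])
    fix \<phi> :: "'d field" assume t: "test_fun UNIV \<phi>"
    show "Br M ell \<theta> (z - z') \<phi> = 0"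
      using fform_diff[OF bform_fform(1)[OF Br_bd test_fun_sobolev[OF t]] z] e[OF t] by simp
  qed
  then show ?thesis by auto
qed

text \<open>The Riesz theorem on the quotient, stated for fields.\<close>

lemma state_riesz:
  assumes t: "0 < \<tau>" and 1: "fform (Suc (Suc 0)) g\<^sub>1" and 2: "fform (Suc 0) g\<^sub>2"
  shows "\<exists>u\<in>Hspace. \<forall>w\<in>Hspace. Ef \<tau> u w = g\<^sub>1 (fst w) + g\<^sub>2 (snd w)"
proof -
  obtain c where "equiv_form (lift_form (Ef \<tau>)) c" using Ef_equiv_form[OF t] by blast
  then interpret e: equiv_form "lift_form (Ef \<tau>)" c .
  obtain x where x: "\<And>y. lift_form (Ef \<tau>) x y = g\<^sub>1 (fst (rep y)) + g\<^sub>2 (snd (rep y))"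
    using e.riesz[OF fform_lift(1)[OF 1 2]] by blast
  have "Ef \<tau> (rep x) w = g\<^sub>1 (fst w) + g\<^sub>2 (snd w)" if "w \<in> Hspace" for w
    using x[of "mk w"] fform_lift(2)[OF 1 2 that] lift_form_mk[OF Ef_hform rep_in that, of \<tau> x] by simp
  then show ?thesis using rep_in by blast
qed

lemma fform_zero: "fform k (\<lambda>W. 0)"
  by (auto simp: fform_def)

text \<open>Solvability of the equation for \<open>R\<close>: the second component of the Riesz representative in the energy space.\<close>

lemma Br_riesz:
  assumes "fform (Suc 0) f"
  shows "\<exists>z\<in>sobolev (Suc 0) UNIV. \<forall>W\<in>sobolev (Suc 0) UNIV. Br M ell \<theta> z W = f W"
proof -
  obtain u where u: "u \<in> Hspace" "\<And>w. w \<in> Hspace \<Longrightarrow> Ef 1 u w = 0 + f (snd w)"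
    using state_riesz[OF zero_less_one fform_zero assms] by blast
  have z: "Bq M ell \<theta> (fst u) 0 = 0" "Br M ell \<theta> (fst u) 0 = 0"
    using u(1) fform_diff[OF bform_fform(2)[OF Bq_bd] sobolev_zero sobolev_zero, of "fst u"]
      fform_diff[OF bform_fform(2)[OF Br_bd2] sobolev_zero sobolev_zero, of "fst u"] by (auto simp: Hspace_iff)
  have "Br M ell \<theta> (snd u) W = f W" if "W \<in> sobolev (Suc 0) UNIV" for W
    using u(2)[of "(0, W)"] that z by (simp add: Hspace_iff Ef_def sobolev_zero)
  then show ?thesis using u(1) by (auto simp: Hspace_iff)
qed

lemma Rinv:
  assumes f: "f \<in> Hm1"
  shows Rinv_H1: "Rinv M ell \<theta> f \<in> sobolev (Suc 0) UNIV"
    and Rinv_eq: "W \<in> sobolev (Suc 0) UNIV \<Longrightarrow> Br M ell \<theta> (Rinv M ell \<theta> f) W = f W"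
proof -
  let ?P = "\<lambda>z. z \<in> H1 \<and> (\<forall>W\<in>H1. Rform M ell \<theta> z W = f W)"
  have "\<exists>z. ?P z" using Br_riesz f unfolding Hm1_iff H1_eq by (metis Rform_eq)
  then have "?P (Rinv M ell \<theta> f)" unfolding Rinv_def by (rule someI_ex)
  then show "Rinv M ell \<theta> f \<in> sobolev (Suc 0) UNIV"
    "W \<in> sobolev (Suc 0) UNIV \<Longrightarrow> Br M ell \<theta> (Rinv M ell \<theta> f) W = f W"
    using Rform_eq[of "Rinv M ell \<theta> f" W] unfolding H1_eq by auto
qed

lemma fform_Suc:
  assumes "fform (Suc 0) g" shows "fform (Suc (Suc 0)) (g :: 'd field \<Rightarrow> real)"
proof -
  obtain K where K: "0 \<le> K" "\<And>U. U \<in> sobolev (Suc 0) UNIV \<Longrightarrow> (g U)\<^sup>2 \<le> K * sip (Suc 0) U U"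
    using fform_bound[OF assms] by blast
  have m: "sip (Suc 0) U U \<le> sip (Suc (Suc 0)) U U" for U :: "'d field"
    by (auto simp: sip_Suc intro!: sum_mono sip_ge_l2ip sum_nonneg sip_nonneg l2ip_nonneg)
  have "(g U)\<^sup>2 \<le> K * sip (Suc (Suc 0)) U U" if "U \<in> sobolev (Suc (Suc 0)) UNIV" for U
    using K(2)[OF sobolev_Suc_D[OF that]] mult_left_mono[OF m K(1), of U] by linarith
  then show ?thesis unfolding fform_def using K(1) fform_linear[OF assms] sobolev_Suc_D by blast
qed

text \<open>A functional that agrees on test fields with the distribution \<open>Q U\<close> agrees with the form on all of \<open>H\<^sup>2\<close>.\<close>

lemma test_eq_H2:
  assumes "fform (Suc (Suc 0)) g" "U \<in> sobolev (Suc (Suc 0)) UNIV" "\<And>\<phi>. test_fun UNIV \<phi> \<Longrightarrow> g \<phi> = Bq M ell \<theta> U \<phi>"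
    "W \<in> sobolev (Suc (Suc 0)) UNIV"
  shows "g W = Bq M ell \<theta> U W"
proof -
  obtain K where K: "0 \<le> K" "\<And>U. U \<in> sobolev (Suc (Suc 0)) UNIV \<Longrightarrow> (g U)\<^sup>2 \<le> K * sip (Suc (Suc 0)) U U"
    using fform_bound[OF assms(1)] by blast
  note q = bform_fform(2)[OF Bq_bd assms(2)]
  obtain L where L: "0 \<le> L" "\<And>W. W \<in> sobolev (Suc (Suc 0)) UNIV \<Longrightarrow> (Bq M ell \<theta> U W)\<^sup>2 \<le> L * sip (Suc (Suc 0)) W W"
    using fform_bound[OF q] by blast
  have "fform (Suc (Suc 0)) (\<lambda>W. g W - Bq M ell \<theta> U W)"
    unfolding fform_def
  proof (intro conjI ballI allI exI[of _ "2 * (K + L)"])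
    fix V :: "'d field" assume V: "V \<in> sobolev (Suc (Suc 0)) UNIV"
    have "(g V - Bq M ell \<theta> U V)\<^sup>2 \<le> 2 * ((g V)\<^sup>2 + (Bq M ell \<theta> U V)\<^sup>2)"
      using sum_squares_bound[of "g V" "- Bq M ell \<theta> U V"] by (simp add: power2_diff)
    then show "(g V - Bq M ell \<theta> U V)\<^sup>2 \<le> 2 * (K + L) * sip (Suc (Suc 0)) V V"
      using K(2)[OF V] L(2)[OF V] by (simp add: distrib_right distrib_left)
  qed (use K L in \<open>auto simp: fform_linear[OF assms(1)] fform_linear[OF q] right_diff_distrib\<close>)
  from fform_vanishing[OF this _ assms(4)] show ?thesis using assms(3) by simp
qed

text \<open>The domain and the operator in variational terms: \<open>z = R\<^sup>-\<^sup>1 Q U\<close> is characterized by \<open>R(z, W) = Q(U, W)\<close> for \<open>W\<close> in \<open>H\<^sup>2\<close>. This description, with its converse \<open>DA_I\<close>, replaces the definition through extended distributions from here on.\<close>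

lemma DA_D:
  assumes "u \<in> DA M ell \<theta>"
  shows "fst u \<in> sobolev (Suc (Suc 0)) UNIV" "snd u \<in> sobolev (Suc (Suc 0)) UNIV"
    "snd (Aop M ell \<theta> u) \<in> sobolev (Suc 0) UNIV"
    "W \<in> sobolev (Suc (Suc 0)) UNIV \<Longrightarrow> Br M ell \<theta> (snd (Aop M ell \<theta> u)) W = Bq M ell \<theta> (fst u) W"
proof -
  have d: "fst u \<in> H2" "snd u \<in> H2" "in_Hm1 (Qop M ell \<theta> (fst u))" using assms by (auto simp: DA_def)
  then show U: "fst u \<in> sobolev (Suc (Suc 0)) UNIV" "snd u \<in> sobolev (Suc (Suc 0)) UNIV" by (auto simp: H2_eq)
  let ?f = "Hm1_of (Qop M ell \<theta> (fst u))"
  have "dist_extends (Qop M ell \<theta> (fst u)) ?f"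
    using d(3) unfolding in_Hm1_def Hm1_of_def by (rule someI_ex)
  then have f: "?f \<in> Hm1" "\<And>\<phi>. test_fun UNIV \<phi> \<Longrightarrow> ?f \<phi> = Bq M ell \<theta> (fst u) \<phi>"
    using Qop_eq[OF U(1)] by (auto simp: dist_extends_def)
  have s: "snd (Aop M ell \<theta> u) = Rinv M ell \<theta> ?f" by (simp add: Aop_def)
  show "snd (Aop M ell \<theta> u) \<in> sobolev (Suc 0) UNIV" unfolding s by (rule Rinv_H1[OF f(1)])
  assume W: "W \<in> sobolev (Suc (Suc 0)) UNIV"
  have "Br M ell \<theta> (snd (Aop M ell \<theta> u)) W = ?f W" unfolding s by (rule Rinv_eq[OF f(1) sobolev_Suc_D[OF W]])
  also have "\<dots> = Bq M ell \<theta> (fst u) W"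
    by (rule test_eq_H2[OF fform_Suc[OF f(1)[unfolded Hm1_iff]] U(1) f(2) W])
  finally show "Br M ell \<theta> (snd (Aop M ell \<theta> u)) W = Bq M ell \<theta> (fst u) W" .
qed

text \<open>The functional \<open>R(z, \<sqdot>)\<close> is itself the required extension of \<open>Q U\<close> to \<open>H\<^sup>1\<close>.\<close>

lemma DA_I:
  assumes U: "fst u \<in> sobolev (Suc (Suc 0)) UNIV" "snd u \<in> sobolev (Suc (Suc 0)) UNIV" and z: "z \<in> sobolev (Suc 0) UNIV"
    and e: "\<And>W. W \<in> sobolev (Suc (Suc 0)) UNIV \<Longrightarrow> Br M ell \<theta> z W = Bq M ell \<theta> (fst u) W"
  shows "u \<in> DA M ell \<theta>" and "state_eq (Aop M ell \<theta> u) (- snd u, z)"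
proof -
  have "dist_extends (Qop M ell \<theta> (fst u)) (Br M ell \<theta> z)"
    using bform_fform(2)[OF Br_bd z] Qop_eq[OF U(1)] e[OF test_fun_sobolev]
    unfolding dist_extends_def Hm1_iff by simp
  then have "in_Hm1 (Qop M ell \<theta> (fst u))" unfolding in_Hm1_def by blast
  then show d: "u \<in> DA M ell \<theta>" using U unfolding DA_def H2_eq by (cases u) simp
  have "AE x in lebesgue. snd (Aop M ell \<theta> u) x = z x"
    using DA_D(4)[OF d test_fun_sobolev] e[OF test_fun_sobolev] by (intro Br_unique DA_D(3)[OF d] z) simp
  then show "state_eq (Aop M ell \<theta> u) (- snd u, z)" by (simp add: state_eq_def Aop_def)
qed

lemma fst_Aop: "fst (Aop M ell \<theta> u) = - snd u"
  by (simp add: Aop_def)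

lemma DA_Hspace: "u \<in> DA M ell \<theta> \<Longrightarrow> u \<in> Hspace" and Aop_Hspace: "u \<in> DA M ell \<theta> \<Longrightarrow> Aop M ell \<theta> u \<in> Hspace"
  using DA_D(1)[of u] sobolev_Suc_D[OF DA_D(2), of u] sobolev_minus[OF DA_D(2), of u] DA_D(3)[of u]
  by (auto simp: Hspace_iff fst_Aop)

lemma DA_linear:
  assumes u: "u \<in> DA M ell \<theta>" and w: "w \<in> DA M ell \<theta>"
  shows "a *\<^sub>R u + w \<in> DA M ell \<theta>"
    and "state_eq (Aop M ell \<theta> (a *\<^sub>R u + w)) (a *\<^sub>R Aop M ell \<theta> u + Aop M ell \<theta> w)"
proof -
  have e: "Br M ell \<theta> (a *\<^sub>R snd (Aop M ell \<theta> u) + snd (Aop M ell \<theta> w)) W = Bq M ell \<theta> (fst (a *\<^sub>R u + w)) W"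
    if W: "W \<in> sobolev (Suc (Suc 0)) UNIV" for W
    using DA_D(4)[OF u W] DA_D(4)[OF w W] bform_left[OF Br_bd DA_D(3)[OF u] DA_D(3)[OF w] sobolev_Suc_D[OF W]]
      bform_left[OF Bq_bd DA_D(1)[OF u] DA_D(1)[OF w] W] by simp
  have i: "fst (a *\<^sub>R u + w) \<in> sobolev (Suc (Suc 0)) UNIV" "snd (a *\<^sub>R u + w) \<in> sobolev (Suc (Suc 0)) UNIV"
    "a *\<^sub>R snd (Aop M ell \<theta> u) + snd (Aop M ell \<theta> w) \<in> sobolev (Suc 0) UNIV"
    unfolding fst_add snd_add fst_scaleR snd_scaleR by (intro sobolev_add sobolev_scaleR DA_D u w)+
  show "a *\<^sub>R u + w \<in> DA M ell \<theta>" by (rule DA_I(1)[OF i e])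
  have "(- snd (a *\<^sub>R u + w), a *\<^sub>R snd (Aop M ell \<theta> u) + snd (Aop M ell \<theta> w)) = a *\<^sub>R Aop M ell \<theta> u + Aop M ell \<theta> w"
    by (simp add: prod_eq_iff fst_Aop)
  then show "state_eq (Aop M ell \<theta> (a *\<^sub>R u + w)) (a *\<^sub>R Aop M ell \<theta> u + Aop M ell \<theta> w)"
    using DA_I(2)[OF i e] by simp
qed

lemma DA_cong:
  assumes u: "u \<in> DA M ell \<theta>" and e: "state_eq u w"
  shows "w \<in> DA M ell \<theta>" and "state_eq (Aop M ell \<theta> u) (Aop M ell \<theta> w)"
proof -
  have e': "AE x in lebesgue. fst u x = fst w x" "AE x in lebesgue. snd u x = snd w x" using e by (auto simp: state_eq_def)
  have i: "fst w \<in> sobolev (Suc (Suc 0)) UNIV" "snd w \<in> sobolev (Suc (Suc 0)) UNIV"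
    using sobolev_cong_AE[OF DA_D(1)[OF u] e'(1)] sobolev_cong_AE[OF DA_D(2)[OF u] e'(2)] by blast+
  have q: "Br M ell \<theta> (snd (Aop M ell \<theta> u)) W = Bq M ell \<theta> (fst w) W" if W: "W \<in> sobolev (Suc (Suc 0)) UNIV" for W
    using DA_D(4)[OF u W] fform_cong[OF bform_fform(1)[OF Bq_bd W] DA_D(1)[OF u] e'(1)] by simp
  show "w \<in> DA M ell \<theta>" by (rule DA_I(1)[OF i DA_D(3)[OF u] q])
  have "state_eq (Aop M ell \<theta> u) (- snd w, snd (Aop M ell \<theta> u))"
    using e'(2) by (auto simp: state_eq_def fst_Aop)
  then show "state_eq (Aop M ell \<theta> u) (Aop M ell \<theta> w)"
    using state_eq_sym[OF DA_I(2)[OF i DA_D(3)[OF u] q]] by (rule state_eq_trans)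
qed

lemma DA_zero: "0 \<in> DA M ell \<theta>"
proof (rule DA_I(1)[where z = 0])
  fix W :: "'d field" assume W: "W \<in> sobolev (Suc (Suc 0)) UNIV"
  show "Br M ell \<theta> 0 W = Bq M ell \<theta> (fst 0) W"
    using fform_diff[OF bform_fform(1)[OF Bq_bd W] sobolev_zero sobolev_zero]
      fform_diff[OF bform_fform(1)[OF Br_bd2 W] sobolev_zero sobolev_zero] by simp
qed (simp_all add: sobolev_zero)

text \<open>Elimination of \<open>V = (U - f\<^sub>1) / \<kappa>\<close> from \<open>U - \<kappa> V = f\<^sub>1\<close>, \<open>V + \<kappa> R\<^sup>-\<^sup>1 Q U = f\<^sub>2\<close> gives a coercive problem for \<open>U\<close> with right-hand side \<open>h = f\<^sub>1 + \<kappa> f\<^sub>2\<close>. Domain membership is then automatic, since \<open>z = (f\<^sub>2 - V) / \<kappa>\<close> lies in \<open>H\<^sup>1\<close>.\<close>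

lemma resolvent:
  assumes k: "0 < \<kappa>" and f: "f \<in> Hspace"
  shows "\<exists>u\<in>DA M ell \<theta>. state_eq (u + \<kappa> *\<^sub>R Aop M ell \<theta> u) f"
proof -
  have fi: "fst f \<in> sobolev (Suc (Suc 0)) UNIV" "fst f \<in> sobolev (Suc 0) UNIV" "snd f \<in> sobolev (Suc 0) UNIV"
    using f sobolev_Suc_D by (auto simp: Hspace_iff)
  define h where "h = \<kappa> *\<^sub>R snd f + fst f"
  have h: "h \<in> sobolev (Suc 0) UNIV" unfolding h_def by (intro sobolev_add sobolev_scaleR fi)
  have "\<exists>u\<in>Hspace. \<forall>w\<in>Hspace. Ef (\<kappa>\<^sup>2) u w = Br M ell \<theta> h (fst w) + 0"
    using k by (intro state_riesz[OF _ fform_Suc[OF bform_fform(2)[OF Br_bd h]] fform_zero]) simp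
  then obtain u where u: "u \<in> Hspace" "\<And>w. w \<in> Hspace \<Longrightarrow> Ef (\<kappa>\<^sup>2) u w = Br M ell \<theta> h (fst w) + 0" by blast
  define U where "U = fst u"
  have U: "U \<in> sobolev (Suc (Suc 0)) UNIV" "U \<in> sobolev (Suc 0) UNIV" "snd u \<in> sobolev (Suc 0) UNIV"
    using u(1) sobolev_Suc_D by (auto simp: U_def Hspace_iff)
  have Ue: "\<kappa>\<^sup>2 * Bq M ell \<theta> U W + Br M ell \<theta> U W = Br M ell \<theta> h W" if W: "W \<in> sobolev (Suc (Suc 0)) UNIV" for W
    using u(2)[of "(W, 0)"] W fform_diff[OF bform_fform(2)[OF Br_bd U(3)] sobolev_zero sobolev_zero]
    by (simp add: Hspace_iff Ef_def sobolev_zero U_def)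
  define V where "V = (1 / \<kappa>) *\<^sub>R (U - fst f)"
  define z where "z = (1 / \<kappa>) *\<^sub>R (snd f - V)"
  have V: "V \<in> sobolev (Suc (Suc 0)) UNIV" unfolding V_def by (intro sobolev_diff sobolev_scaleR U fi)
  then have z: "z \<in> sobolev (Suc 0) UNIV" unfolding z_def by (rule sobolev_scaleR[OF sobolev_diff[OF fi(3) sobolev_Suc_D]])
  have kV: "\<kappa> *\<^sub>R V = U - fst f" and kz: "\<kappa> *\<^sub>R z = snd f - V" using k by (simp_all add: V_def z_def)
  have e: "Br M ell \<theta> z W = Bq M ell \<theta> (fst (U, V)) W" if W: "W \<in> sobolev (Suc (Suc 0)) UNIV" for W
  proof -
    note g = bform_fform(1)[OF Br_bd sobolev_Suc_D[OF W]]
    have sc: "Br M ell \<theta> (a *\<^sub>R Y) W = a * Br M ell \<theta> Y W" if "Y \<in> sobolev (Suc 0) UNIV" for a Y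
      using fform_linear[OF g that sobolev_zero] fform_diff[OF g sobolev_zero sobolev_zero] by simp
    have 1: "\<kappa> * Br M ell \<theta> V W = Br M ell \<theta> U W - Br M ell \<theta> (fst f) W"
      using fform_diff[OF g U(2) fi(2)] sc[OF sobolev_Suc_D[OF V], of \<kappa>] by (simp add: kV)
    have 2: "\<kappa> * Br M ell \<theta> z W = Br M ell \<theta> (snd f) W - Br M ell \<theta> V W"
      using fform_diff[OF g fi(3) sobolev_Suc_D[OF V]] sc[OF z, of \<kappa>] by (simp add: kz)
    have 3: "Br M ell \<theta> h W = \<kappa> * Br M ell \<theta> (snd f) W + Br M ell \<theta> (fst f) W"
      unfolding h_def by (rule fform_linear[OF g fi(3) fi(2)])
    have "\<kappa>\<^sup>2 * Br M ell \<theta> z W = \<kappa> * Br M ell \<theta> (snd f) W - \<kappa> * Br M ell \<theta> V W"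
      using arg_cong[OF 2, of "\<lambda>x. \<kappa> * x"] by (simp add: power2_eq_square right_diff_distrib)
    also have "\<dots> = \<kappa>\<^sup>2 * Bq M ell \<theta> U W" using 1 3 Ue[OF W] by simp
    finally show ?thesis using k by simp
  qed
  have i: "fst (U, V) \<in> sobolev (Suc (Suc 0)) UNIV" "snd (U, V) \<in> sobolev (Suc (Suc 0)) UNIV" using U V by simp_all
  have "state_eq ((U, V) + \<kappa> *\<^sub>R Aop M ell \<theta> (U, V)) ((U, V) + \<kappa> *\<^sub>R (- snd (U, V), z))"
    by (intro state_eq_add state_eq_refl state_eq_scaleR DA_I(2)[OF i z e])
  also have "(U, V) + \<kappa> *\<^sub>R (- snd (U, V), z) = f" by (simp add: prod_eq_iff kV kz)
  finally show ?thesis using DA_I(1)[OF i z e] by blast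
qed

text \<open>The terms with \<open>Q\<close> cancel by symmetry. The remaining term stems from \<open>R(U, U')\<close> in the energy product and is the only obstruction to skewness.\<close>

lemma Aop_form:
  assumes u: "u \<in> DA M ell \<theta>"
  shows "Ef 1 (Aop M ell \<theta> u) u = - Br M ell \<theta> (snd u) (fst u)"
    and "- Ef 1 u u \<le> 2 * Ef 1 (Aop M ell \<theta> u) u"
    and "Bq M ell \<theta> (fst (Aop M ell \<theta> u)) (fst u) + Br M ell \<theta> (snd (Aop M ell \<theta> u)) (snd u) = 0"
proof -
  note d = DA_D[OF u] and d1 = sobolev_Suc_D[OF DA_D(1)[OF u]] sobolev_Suc_D[OF DA_D(2)[OF u]]
  have neg: "Bq M ell \<theta> (- snd u) (fst u) = - Bq M ell \<theta> (snd u) (fst u)"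
    "Br M ell \<theta> (- snd u) (fst u) = - Br M ell \<theta> (snd u) (fst u)"
    using fform_diff[OF bform_fform(1)[OF Bq_bd d(1)] sobolev_zero d(2)] fform_diff[OF bform_fform(1)[OF Bq_bd d(1)] sobolev_zero sobolev_zero]
      fform_diff[OF bform_fform(1)[OF Br_bd2 d(1)] sobolev_zero d(2)] fform_diff[OF bform_fform(1)[OF Br_bd2 d(1)] sobolev_zero sobolev_zero]
    by simp_all
  show 1: "Ef 1 (Aop M ell \<theta> u) u = - Br M ell \<theta> (snd u) (fst u)"
    using Bq_sym[OF d(1,2)] by (simp add: Ef_def fst_Aop neg d(4)[OF d(2)])
  show "Bq M ell \<theta> (fst (Aop M ell \<theta> u)) (fst u) + Br M ell \<theta> (snd (Aop M ell \<theta> u)) (snd u) = 0"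
    using Bq_sym[OF d(1,2)] by (simp add: fst_Aop neg d(4)[OF d(2)])
  have "0 \<le> Br M ell \<theta> (snd u - fst u) (snd u - fst u)"
    using coercivity_constants sip_nonneg sobolev_diff[OF d1(2,1)] by (smt (verit) mult_nonneg_nonneg)
  also have "\<dots> = Br M ell \<theta> (snd u) (snd u) + Br M ell \<theta> (fst u) (fst u) - 2 * Br M ell \<theta> (snd u) (fst u)"
    using fform_diff[OF bform_fform(1)[OF Br_bd sobolev_diff[OF d1(2,1)]] d1(2,1)]
      fform_diff[OF bform_fform(2)[OF Br_bd d1(1)] d1(2,1)] fform_diff[OF bform_fform(2)[OF Br_bd d1(2)] d1(2,1)]
      Br_sym[OF d1] by simp
  finally show "- Ef 1 u u \<le> 2 * Ef 1 (Aop M ell \<theta> u) u"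
    using Bq_nonneg[OF d(1)] unfolding 1 by (simp add: Ef_def)
qed

end

section \<open>Paths in the phase space\<close>

text \<open>The difference quotient form in which continuously differentiable paths are defined.\<close>

lemma has_vector_derivative_slope:
  fixes f :: "real \<Rightarrow> 'a::real_normed_vector"
  shows "(f has_vector_derivative f') (at t within S) \<longleftrightarrow>
    ((\<lambda>s. (f s - f t) /\<^sub>R (s - t) - f') \<longlongrightarrow> 0) (at t within S)"
proof -
  have e: "norm (f s - f t - (s - t) *\<^sub>R f') / norm (s - t) = norm ((f s - f t) /\<^sub>R (s - t) - f')" if "s \<noteq> t" for s
  proof -
    have "(f s - f t) /\<^sub>R (s - t) - f' = (f s - f t - (s - t) *\<^sub>R f') /\<^sub>R (s - t)"
      using that by (simp add: scaleR_diff_right)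
    then show ?thesis by (simp add: divide_inverse mult.commute)
  qed
  have "((\<lambda>s. norm (f s - f t - (s - t) *\<^sub>R f') / norm (s - t)) \<longlongrightarrow> 0) (at t within S)
      \<longleftrightarrow> ((\<lambda>s. norm ((f s - f t) /\<^sub>R (s - t) - f')) \<longlongrightarrow> 0) (at t within S)"
    by (rule tendsto_cong, unfold eventually_at_filter, rule always_eventually) (use e in blast)
  then show ?thesis
    unfolding has_vector_derivative_def has_derivative_iff_norm tendsto_norm_zero_iff
    by (simp add: bounded_linear_scaleR_left)
qed

lemma eventually_within: "eventually (\<lambda>s. s \<in> I) (at t within I)"
  by (simp add: eventually_at_filter)

lemma sqrt_tendsto_zero_iff:
  assumes g: "\<And>s. 0 \<le> g s" shows "((\<lambda>s. sqrt (g s)) \<longlongrightarrow> 0) F \<longleftrightarrow> (g \<longlongrightarrow> 0) F"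
proof
  assume "((\<lambda>s. sqrt (g s)) \<longlongrightarrow> 0) F"
  from tendsto_power[OF this, of 2] show "(g \<longlongrightarrow> 0) F" using g by simp
next
  assume "(g \<longlongrightarrow> 0) F" from tendsto_real_sqrt[OF this] show "((\<lambda>s. sqrt (g s)) \<longlongrightarrow> 0) F" by simp
qed

lemma add_tendsto_zero_iff:
  fixes g h :: "'a \<Rightarrow> real"
  assumes g: "\<And>s. 0 \<le> g s" and h: "\<And>s. 0 \<le> h s"
  shows "((\<lambda>s. g s + h s) \<longlongrightarrow> 0) F \<longleftrightarrow> (g \<longlongrightarrow> 0) F \<and> (h \<longlongrightarrow> 0) F"
proof
  assume a: "((\<lambda>s. g s + h s) \<longlongrightarrow> 0) F"
  have "(g \<longlongrightarrow> 0) F" by (rule tendsto_sandwich[OF _ _ tendsto_const a]) (use g h in \<open>auto intro!: always_eventually\<close>)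
  moreover have "(h \<longlongrightarrow> 0) F" by (rule tendsto_sandwich[OF _ _ tendsto_const a]) (use g h in \<open>auto intro!: always_eventually\<close>)
  ultimately show "(g \<longlongrightarrow> 0) F \<and> (h \<longlongrightarrow> 0) F" ..
qed (use tendsto_add[of g 0 F h 0] in simp)

lemma norm_mk_snd: "z \<in> H1 \<Longrightarrow> norm (mk (0, z)) = H1norm z"
  and norm_mk_fst: "z \<in> H2 \<Longrightarrow> norm (mk (z, 0)) = H2norm z"
proof -
  have 0: "sip k 0 (0 :: 'a field) = 0" for k
    using sob.ip_scale[OF sobolev_zero, of k 0 "0 :: 'a field"] by simp
  show "norm (mk (0, z)) = H1norm z" if "z \<in> H1"
  proof -
    have "(norm (mk (0, z)))\<^sup>2 = sip (Suc 0) z z"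
      using that by (subst norm_mk) (simp_all add: Hspace_iff hip_def sobolev_zero 0)
    then show ?thesis by (simp add: sobolev_norm_def sip_self[symmetric] real_sqrt_unique)
  qed
  show "norm (mk (z, 0)) = H2norm z" if "z \<in> H2"
  proof -
    have "(norm (mk (z, 0)))\<^sup>2 = sip (Suc (Suc 0)) z z"
      using that by (subst norm_mk) (simp_all add: Hspace_iff hip_def sobolev_zero 0 H2_eq)
    then show ?thesis by (simp add: sobolev_norm_def sip_self[symmetric] numeral_2_eq_2 real_sqrt_unique)
  qed
qed

lemma H1norm_le_H2norm: "H1norm z \<le> H2norm (z :: 'd::finite field)"
proof -
  have "sip (Suc 0) z z \<le> sip (Suc (Suc 0)) z z"
    by (auto simp: sip_Suc intro!: sum_mono sip_ge_l2ip sum_nonneg sip_nonneg l2ip_nonneg)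
  then show ?thesis by (simp add: sobolev_norm_def sip_self[symmetric] numeral_2_eq_2)
qed

text \<open>Paths in a field space become continuous paths in the quotient under any embedding that does not increase the norm.\<close>

lemma path_continuous_hs:
  assumes p: "C0_path X N I z" and j: "\<And>v w. v \<in> X \<Longrightarrow> w \<in> X \<Longrightarrow> norm (mk (j v) - mk (j w)) \<le> N (v - w)"
  shows "continuous_on I (\<lambda>s. mk (j (z s)))"
  unfolding continuous_on_def
proof
  fix t assume t: "t \<in> I"
  have X: "\<And>s. s \<in> I \<Longrightarrow> z s \<in> X" and l: "((\<lambda>s. N (z s - z t)) \<longlongrightarrow> 0) (at t within I)"
    using p t by (auto simp: C0_path_def)
  have "((\<lambda>s. mk (j (z s)) - mk (j (z t))) \<longlongrightarrow> 0) (at t within I)"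
    by (rule Lim_null_comparison[OF _ l]) (rule eventually_mono[OF eventually_within], rule j, auto intro: X t)
  then show "((\<lambda>s. mk (j (z s))) \<longlongrightarrow> mk (j (z t))) (at t within I)" by (rule LIM_zero_cancel)
qed

lemma mk_snd_diff: "v \<in> H1 \<Longrightarrow> w \<in> H1 \<Longrightarrow> mk (0, v) - mk (0, w) = mk (0, v - w)"
  using mk_diff[of "(0, v)" "(0, w)"] by (simp add: Hspace_iff sobolev_zero)

lemma mk_fst_diff: "v \<in> H2 \<Longrightarrow> w \<in> H2 \<Longrightarrow> mk (v, 0) - mk (w, 0) = mk (v - w, 0)"
  using mk_diff[of "(v, 0)" "(w, 0)"] by (simp add: Hspace_iff sobolev_zero H2_eq)

lemma H1_path_continuous:
  assumes "C0_path H1 H1norm I z" shows "continuous_on I (\<lambda>s. mk (0, z s))"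
  by (rule path_continuous_hs[OF assms, where j = "Pair 0"]) (simp add: mk_snd_diff norm_mk_snd sobolev_diff)

lemma H2_path_continuous:
  assumes p: "C0_path H2 H2norm I z"
  shows "continuous_on I (\<lambda>s. mk (0, z s))" "continuous_on I (\<lambda>s. mk (z s, 0))"
proof -
  have i: "v \<in> H1" if "v \<in> H2" for v :: "'a field" using that sobolev_Suc_D[of v "Suc 0"] by (simp add: H2_eq)
  show "continuous_on I (\<lambda>s. mk (0, z s))"
  proof (rule path_continuous_hs[OF p, where j = "Pair 0"])
    fix v w :: "'a field" assume "v \<in> H2" "w \<in> H2"
    then show "norm (mk (0, v) - mk (0, w)) \<le> H2norm (v - w)"
      using H1norm_le_H2norm[of "v - w"] mk_snd_diff[OF i i] norm_mk_snd[OF sobolev_diff[OF i i]] by metis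
  qed
  show "continuous_on I (\<lambda>s. mk (z s, 0))"
    by (rule path_continuous_hs[OF p, where j = "\<lambda>v. (v, 0)"]) (simp add: mk_fst_diff norm_mk_fst sobolev_diff)
qed

lemma H1_path_derivative:
  assumes p: "C1_path H1 H1norm I z z'" and t: "t \<in> I"
  shows "((\<lambda>s. mk (0, z s)) has_vector_derivative mk (0, z' t)) (at t within I)"
proof -
  have X: "\<And>s. s \<in> I \<Longrightarrow> z s \<in> H1" "\<And>s. s \<in> I \<Longrightarrow> z' s \<in> H1"
    and l: "((\<lambda>s. H1norm ((z s - z t) /\<^sub>R (s - t) - z' t)) \<longlongrightarrow> 0) (at t within I)"
    using p t by (auto simp: C1_path_def C0_path_def)
  have "norm ((mk (0, z s) - mk (0, z t)) /\<^sub>R (s - t) - mk (0, z' t)) \<le> H1norm ((z s - z t) /\<^sub>R (s - t) - z' t)" if s: "s \<in> I" for s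
  proof -
    have i: "(z s - z t) /\<^sub>R (s - t) \<in> H1" "z s - z t \<in> H1" by (intro sobolev_scaleR sobolev_diff X s t)+
    have "(mk (0, z s) - mk (0, z t)) /\<^sub>R (s - t) = mk (0, (z s - z t) /\<^sub>R (s - t))"
      unfolding mk_snd_diff[OF X(1)[OF s] X(1)[OF t]]
      using mk_scaleR[of "(0, z s - z t)" "inverse (s - t)"] i(2) by (simp add: Hspace_iff sobolev_zero)
    then show ?thesis
      using mk_snd_diff[OF i(1) X(2)[OF t]] norm_mk_snd[OF sobolev_diff[OF i(1) X(2)[OF t]]] by simp
  qed
  then show ?thesis
    unfolding has_vector_derivative_slope by (intro Lim_null_comparison[OF eventually_mono[OF eventually_within] l])
qed

section \<open>The evolution equation\<close>

context homogenized
begin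

definition cE :: real where "cE = (SOME c. equiv_form (lift_form (Ef 1)) c)"

definition Dh :: "'d hs set" where "Dh = mk ` DA M ell \<theta>"

definition Ah :: "'d hs \<Rightarrow> 'd hs" where "Ah x = mk (Aop M ell \<theta> (rep x))"

sublocale E: equiv_form "lift_form (Ef 1)" cE
  unfolding cE_def by (rule someI_ex[OF Ef_equiv_form]) simp

lemma rep_DA: "x \<in> Dh \<Longrightarrow> rep x \<in> DA M ell \<theta>"
  unfolding Dh_def using DA_cong(1)[OF _ state_eq_sym[OF rep_mk[OF DA_Hspace]]] by blast

lemma mk_Dh: "u \<in> DA M ell \<theta> \<Longrightarrow> mk u \<in> Dh"
  by (simp add: Dh_def)

lemma Ah_mk:
  assumes u: "u \<in> DA M ell \<theta>" shows "Ah (mk u) = mk (Aop M ell \<theta> u)"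
proof -
  have "state_eq (rep (mk u)) u" by (rule rep_mk[OF DA_Hspace[OF u]])
  then show ?thesis
    unfolding Ah_def using DA_cong[OF u state_eq_sym] mk_eq_iff[OF Aop_Hspace Aop_Hspace[OF u]] state_eq_sym by blast
qed

lemma Dh_cases: assumes "x \<in> Dh" obtains u where "u \<in> DA M ell \<theta>" "x = mk u"
  using assms by (auto simp: Dh_def)

lemma Ah_linear:
  assumes x: "x \<in> Dh" and y: "y \<in> Dh"
  shows "a *\<^sub>R x + y \<in> Dh" and "Ah (a *\<^sub>R x + y) = a *\<^sub>R Ah x + Ah y"
proof -
  obtain u where u: "u \<in> DA M ell \<theta>" "x = mk u" by (rule Dh_cases[OF x])
  obtain w where w: "w \<in> DA M ell \<theta>" "y = mk w" by (rule Dh_cases[OF y])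
  note h = DA_Hspace[OF u(1)] DA_Hspace[OF w(1)] and A = Aop_Hspace[OF u(1)] Aop_Hspace[OF w(1)] and l = DA_linear[OF u(1) w(1)]
  have e: "a *\<^sub>R x + y = mk (a *\<^sub>R u + w)" by (simp add: u(2) w(2) mk_scaleR mk_add h hs.in_X)
  show "a *\<^sub>R x + y \<in> Dh" unfolding e by (rule mk_Dh[OF l(1)])
  have "Ah (a *\<^sub>R x + y) = mk (a *\<^sub>R Aop M ell \<theta> u + Aop M ell \<theta> w)"
    unfolding e Ah_mk[OF l(1)] by (subst mk_eq_iff) (intro Aop_Hspace l hs.in_X A)+
  then show "Ah (a *\<^sub>R x + y) = a *\<^sub>R Ah x + Ah y"
    by (simp add: u(2) w(2) Ah_mk u(1) w(1) mk_scaleR mk_add A hs.in_X)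
qed

lemma Dh_zero: "0 \<in> Dh"
  using mk_Dh[OF DA_zero] by (simp add: mk_zero)

lemma Ah_add: "x \<in> Dh \<Longrightarrow> y \<in> Dh \<Longrightarrow> Ah (x + y) = Ah x + Ah y"
  using Ah_linear(2)[of x y 1] by simp

lemma Ah_zero: "Ah 0 = 0"
  using Ah_add[OF Dh_zero Dh_zero] by simp

lemma Ah_scale: "x \<in> Dh \<Longrightarrow> Ah (r *\<^sub>R x) = r *\<^sub>R Ah x"
  using Ah_linear(2)[OF _ Dh_zero, of x r] by (simp add: Ah_zero)

lemma Dh_subspace: "subspace Dh"
  unfolding subspace_def using Dh_zero Ah_linear(1)[of _ _ 1] Ah_linear(1)[OF _ Dh_zero] by fastforce

lemma Ah_diff: "x \<in> Dh \<Longrightarrow> y \<in> Dh \<Longrightarrow> Ah (x - y) = Ah x - Ah y"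
  using Ah_linear(2)[of y x "-1"] by simp

lemma Ah_mono: "x \<in> Dh \<Longrightarrow> - lift_form (Ef 1) x x \<le> 2 * lift_form (Ef 1) (Ah x) x"
  using Aop_form(2) by (elim Dh_cases) (simp add: Ah_mk lift_form_mk[OF Ef_hform] DA_Hspace Aop_Hspace)

lemma Ah_surj:
  assumes k: "0 < \<kappa>" shows "\<exists>x\<in>Dh. x + \<kappa> *\<^sub>R Ah x = f"
proof -
  obtain u where u: "u \<in> DA M ell \<theta>" "state_eq (u + \<kappa> *\<^sub>R Aop M ell \<theta> u) (rep f)" using resolvent[OF k rep_in] by blast
  have "u + \<kappa> *\<^sub>R Aop M ell \<theta> u \<in> Hspace" by (intro hs.in_X DA_Hspace Aop_Hspace u(1))
  then have "mk (u + \<kappa> *\<^sub>R Aop M ell \<theta> u) = mk (rep f)" using u(2) mk_eq_iff rep_in by blast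
  then have "mk u + \<kappa> *\<^sub>R Ah (mk u) = f"
    using u(1) by (simp add: Ah_mk mk_scaleR mk_add DA_Hspace Aop_Hspace hs.in_X)
  then show ?thesis using mk_Dh[OF u(1)] by blast
qed

sublocale MM: maximal_monotone "lift_form (Ef 1)" cE Dh "\<lambda>x. Ah x + (1/2) *\<^sub>R x"
proof (rule maximal_monotone.intro[OF E.equiv_form_axioms], rule maximal_monotone_axioms.intro)
  show "subspace Dh" by (rule Dh_subspace)
  fix x y f :: "'d hs" and r \<kappa> :: real
  show "Ah (x + y) + (1/2) *\<^sub>R (x + y) = Ah x + (1/2) *\<^sub>R x + (Ah y + (1/2) *\<^sub>R y)" if "x \<in> Dh" "y \<in> Dh"
    using that by (simp add: Ah_add algebra_simps)
  show "Ah (r *\<^sub>R x) + (1/2) *\<^sub>R r *\<^sub>R x = r *\<^sub>R (Ah x + (1/2) *\<^sub>R x)" if "x \<in> Dh"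
    using that by (simp add: Ah_scale algebra_simps)
  show "0 \<le> lift_form (Ef 1) (Ah x + (1/2) *\<^sub>R x) x" if "x \<in> Dh"
    using Ah_mono[OF that] by (simp add: E.add_left E.scaleR_left)
  show "\<exists>x\<in>Dh. x + \<kappa> *\<^sub>R (Ah x + (1/2) *\<^sub>R x) = f" if k: "0 < \<kappa>"
  proof -
    define m where "m = 1 + \<kappa> / 2"
    have m: "0 < m" using k by (simp add: m_def)
    then obtain x where x: "x \<in> Dh" "x + (\<kappa> / m) *\<^sub>R Ah x = (1 / m) *\<^sub>R f" using Ah_surj[of "\<kappa> / m"] k by auto
    have "f = m *\<^sub>R (x + (\<kappa> / m) *\<^sub>R Ah x)" unfolding x(2) using m by simp
    also have "\<dots> = x + \<kappa> *\<^sub>R (Ah x + (1/2) *\<^sub>R x)"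
      using m by (simp add: scaleR_add_right) (simp add: m_def scaleR_add_left algebra_simps)
    finally show ?thesis using x(1) by auto
  qed
qed

lemma Hnorm_eq: "u \<in> Hspace \<Longrightarrow> Hnorm M ell \<theta> u = sqrt (lift_form (Ef 1) (mk u) (mk u))"
  by (simp add: Hnorm_def Hip_eq lift_form_mk[OF Ef_hform])

lemma Hnorm_sq: "u \<in> Hspace \<Longrightarrow> (Hnorm M ell \<theta> u)\<^sup>2 = lift_form (Ef 1) (mk u) (mk u)"
  by (simp add: Hnorm_eq E.nonneg)

lemma Hnorm_tendsto:
  assumes p: "\<And>s. s \<in> I \<Longrightarrow> p s \<in> Hspace"
  shows "((\<lambda>s. Hnorm M ell \<theta> (p s)) \<longlongrightarrow> 0) (at t within I) \<longleftrightarrow> ((\<lambda>s. mk (p s)) \<longlongrightarrow> 0) (at t within I)"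
proof -
  have "((\<lambda>s. Hnorm M ell \<theta> (p s)) \<longlongrightarrow> 0) (at t within I)
      \<longleftrightarrow> ((\<lambda>s. sqrt (lift_form (Ef 1) (mk (p s)) (mk (p s)))) \<longlongrightarrow> 0) (at t within I)"
    by (rule tendsto_cong) (rule eventually_mono[OF eventually_within], rule Hnorm_eq, rule p)
  then show ?thesis by (simp only: sqrt_tendsto_zero_iff E.nonneg MM.form_tendsto_zero_iff)
qed

lemma C0_Hspace:
  "C0_path Hspace (Hnorm M ell \<theta>) I u \<longleftrightarrow> (\<forall>t\<in>I. u t \<in> Hspace) \<and> continuous_on I (\<lambda>s. mk (u s))"
proof -
  have "((\<lambda>s. Hnorm M ell \<theta> (u s - u t)) \<longlongrightarrow> 0) (at t within I) \<longleftrightarrow> ((\<lambda>s. mk (u s)) \<longlongrightarrow> mk (u t)) (at t within I)"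
    if u: "\<forall>t\<in>I. u t \<in> Hspace" and t: "t \<in> I" for t
  proof -
    have "((\<lambda>s. mk (u s - u t)) \<longlongrightarrow> 0) (at t within I) \<longleftrightarrow> ((\<lambda>s. mk (u s) - mk (u t)) \<longlongrightarrow> 0) (at t within I)"
      using u t by (intro tendsto_cong eventually_mono[OF eventually_within]) (simp add: mk_diff)
    moreover have "u s - u t \<in> Hspace" if "s \<in> I" for s using u t that by (intro hs.in_X) auto
    ultimately show ?thesis by (simp only: Hnorm_tendsto LIM_zero_iff)
  qed
  then show ?thesis unfolding C0_path_def continuous_on_def by blast
qed

lemma C1_Hspace:
  "C1_path Hspace (Hnorm M ell \<theta>) I u u' \<longleftrightarrow> C0_path Hspace (Hnorm M ell \<theta>) I u \<and> C0_path Hspace (Hnorm M ell \<theta>) I u' \<and>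
    (\<forall>t\<in>I. ((\<lambda>s. mk (u s)) has_vector_derivative mk (u' t)) (at t within I))"
proof -
  have "((\<lambda>s. Hnorm M ell \<theta> ((u s - u t) /\<^sub>R (s - t) - u' t)) \<longlongrightarrow> 0) (at t within I)
      \<longleftrightarrow> ((\<lambda>s. mk (u s)) has_vector_derivative mk (u' t)) (at t within I)"
    if u: "\<And>t. t \<in> I \<Longrightarrow> u t \<in> Hspace" "\<And>t. t \<in> I \<Longrightarrow> u' t \<in> Hspace" and t: "t \<in> I" for t
  proof -
    have i: "(u s - u t) /\<^sub>R (s - t) \<in> Hspace" "(u s - u t) /\<^sub>R (s - t) - u' t \<in> Hspace" if "s \<in> I" for s
      by (intro hs.in_X u t that)+
    have "mk ((u s - u t) /\<^sub>R (s - t) - u' t) = (mk (u s) - mk (u t)) /\<^sub>R (s - t) - mk (u' t)" if "s \<in> I" for s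
      using i(1)[OF that] u t that by (simp add: mk_diff[symmetric] mk_scaleR[symmetric] hs.in_X)
    then have "((\<lambda>s. mk ((u s - u t) /\<^sub>R (s - t) - u' t)) \<longlongrightarrow> 0) (at t within I)
        \<longleftrightarrow> ((\<lambda>s. (mk (u s) - mk (u t)) /\<^sub>R (s - t) - mk (u' t)) \<longlongrightarrow> 0) (at t within I)"
      by (intro tendsto_cong eventually_mono[OF eventually_within])
    then show ?thesis by (simp only: Hnorm_tendsto[OF i(2)] has_vector_derivative_slope)
  qed
  then show ?thesis unfolding C1_path_def unfolding C0_path_def by blast
qed

text \<open>Convergence in the graph norm is convergence of the path and of its image.\<close>

lemma C0_DA:
  "C0_path (DA M ell \<theta>) (DAnorm M ell \<theta>) I u \<longleftrightarrow>
    (\<forall>t\<in>I. u t \<in> DA M ell \<theta>) \<and> continuous_on I (\<lambda>s. mk (u s)) \<and> continuous_on I (\<lambda>s. Ah (mk (u s)))"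
proof -
  have "((\<lambda>s. DAnorm M ell \<theta> (u s - u t)) \<longlongrightarrow> 0) (at t within I) \<longleftrightarrow>
      ((\<lambda>s. mk (u s)) \<longlongrightarrow> mk (u t)) (at t within I) \<and> ((\<lambda>s. Ah (mk (u s))) \<longlongrightarrow> Ah (mk (u t))) (at t within I)"
    if u: "\<And>t. t \<in> I \<Longrightarrow> u t \<in> DA M ell \<theta>" and t: "t \<in> I" for t
  proof -
    define d where "d s = mk (u s) - mk (u t)" for s
    define a where "a s = Ah (mk (u s)) - Ah (mk (u t))" for s
    have "DAnorm M ell \<theta> (u s - u t) = sqrt (lift_form (Ef 1) (d s) (d s) + lift_form (Ef 1) (a s) (a s))" if s: "s \<in> I" for s
    proof -
      have i: "u s - u t \<in> DA M ell \<theta>" using DA_linear(1)[OF u[OF t] u[OF s], of "-1"] by simp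
      have 1: "d s = mk (u s - u t)" unfolding d_def by (rule mk_diff[OF DA_Hspace[OF u[OF s]] DA_Hspace[OF u[OF t]]])
      have 2: "a s = mk (Aop M ell \<theta> (u s - u t))"
        unfolding a_def Ah_diff[OF mk_Dh[OF u[OF s]] mk_Dh[OF u[OF t]], symmetric] d_def[symmetric] 1 by (rule Ah_mk[OF i])
      show ?thesis unfolding 1 2 DAnorm_def DAip_def
        by (simp add: Hip_eq lift_form_mk[OF Ef_hform] DA_Hspace[OF i] Aop_Hspace[OF i])
    qed
    then have "((\<lambda>s. DAnorm M ell \<theta> (u s - u t)) \<longlongrightarrow> 0) (at t within I) \<longleftrightarrow>
        ((\<lambda>s. sqrt (lift_form (Ef 1) (d s) (d s) + lift_form (Ef 1) (a s) (a s))) \<longlongrightarrow> 0) (at t within I)"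
      by (intro tendsto_cong eventually_mono[OF eventually_within])
    also have "\<dots> \<longleftrightarrow> (d \<longlongrightarrow> 0) (at t within I) \<and> (a \<longlongrightarrow> 0) (at t within I)"
      by (simp add: sqrt_tendsto_zero_iff add_tendsto_zero_iff E.nonneg MM.form_tendsto_zero_iff)
    finally show ?thesis unfolding d_def[abs_def] a_def[abs_def] LIM_zero_iff .
  qed
  then show ?thesis unfolding C0_path_def continuous_on_def by blast
qed

lemma source_Hspace: "G t \<in> Hm1 \<Longrightarrow> source M ell \<theta> G t \<in> Hspace"
  by (simp add: source_def Hspace_iff sobolev_zero Rinv_H1)

text \<open>The operator \<open>A + 1/2\<close> is monotone; the factor \<open>e\<^sup>t\<^sup>/\<^sup>2\<close> removes the shift.\<close>

lemma evolution_exists: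
  assumes T: "0 \<le> T" and x: "x \<in> Dh" and Fc: "continuous_on {0..T} F"
    and reg: "(\<exists>F'. continuous_on {0..T} F' \<and> (\<forall>t\<in>{0..T}. (F has_vector_derivative F' t) (at t within {0..T}))) \<or>
      ((\<forall>t\<in>{0..T}. F t \<in> Dh) \<and> continuous_on {0..T} (\<lambda>t. Ah (F t)))"
  obtains u where "u 0 = x" "\<And>t. t \<in> {0..T} \<Longrightarrow> u t \<in> Dh"
    "\<And>t. t \<in> {0..T} \<Longrightarrow> (u has_vector_derivative F t - Ah (u t)) (at t within {0..T})"
    "continuous_on {0..T} (\<lambda>t. Ah (u t))"
proof -
  \<comment> \<open>The source of the equation for \<open>v = e\<^sup>-\<^sup>t\<^sup>/\<^sup>2 u\<close>.\<close>
  define f where "f t = exp (- t / 2) *\<^sub>R F t" for t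
  have e': "((\<lambda>t. exp (- t / 2)) has_field_derivative - exp (- t / 2) / 2) (at t within S)" for t :: real and S
    by (auto intro!: derivative_eq_intros)
  have e: "((\<lambda>t. exp (t / 2)) has_field_derivative exp (t / 2) / 2) (at t within S)" for t :: real and S
    by (auto intro!: derivative_eq_intros)
  have fc: "continuous_on {0..T} f" unfolding f_def[abs_def] by (intro continuous_intros Fc) simp
  have freg: "(\<exists>f'. continuous_on {0..T} f' \<and> (\<forall>t\<in>{0..T}. (f has_vector_derivative f' t) (at t within {0..T}))) \<or>
      ((\<forall>t\<in>{0..T}. f t \<in> Dh) \<and> continuous_on {0..T} (\<lambda>t. Ah (f t) + (1/2) *\<^sub>R f t))"
    using reg
  proof (elim disjE exE conjE)
    fix F' assume F': "continuous_on {0..T} F'" "\<forall>t\<in>{0..T}. (F has_vector_derivative F' t) (at t within {0..T})"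
    define f' where "f' t = exp (- t / 2) *\<^sub>R F' t + (- exp (- t / 2) / 2) *\<^sub>R F t" for t
    have "continuous_on {0..T} f'" unfolding f'_def[abs_def] by (intro continuous_intros Fc F') simp_all
    moreover have "(f has_vector_derivative f' t) (at t within {0..T})" if "t \<in> {0..T}" for t
      unfolding f_def[abs_def] f'_def using F'(2) that by (intro has_vector_derivative_scaleR e') blast
    ultimately show ?thesis by blast
  next
    assume F: "\<forall>t\<in>{0..T}. F t \<in> Dh" "continuous_on {0..T} (\<lambda>t. Ah (F t))"
    have "continuous_on {0..T} (\<lambda>t. exp (- t / 2) *\<^sub>R Ah (F t) + (1/2) *\<^sub>R f t)"
      by (intro continuous_intros F fc) simp
    then have "continuous_on {0..T} (\<lambda>t. Ah (f t) + (1/2) *\<^sub>R f t)"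
      by (rule continuous_on_eq) (use F(1) in \<open>simp add: f_def Ah_scale\<close>)
    then show ?thesis using F(1) subspace_scale[OF Dh_subspace] by (simp add: f_def)
  qed
  obtain v where v: "v 0 = x" "\<And>t. t \<in> {0..T} \<Longrightarrow> v t \<in> Dh"
    "\<And>t. t \<in> {0..T} \<Longrightarrow> (v has_vector_derivative f t - (Ah (v t) + (1/2) *\<^sub>R v t)) (at t within {0..T})"
    "continuous_on {0..T} (\<lambda>t. Ah (v t) + (1/2) *\<^sub>R v t)"
    using MM.monotone_evolution_exists[OF T x fc freg] by blast
  define u where "u t = exp (t / 2) *\<^sub>R v t" for t
  have Au: "Ah (u t) = exp (t / 2) *\<^sub>R Ah (v t)" if "t \<in> {0..T}" for t
    unfolding u_def by (rule Ah_scale[OF v(2)[OF that]])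
  have vc: "continuous_on {0..T} v" by (rule continuous_on_vector_derivative[OF v(3)])
  show thesis
  proof (rule that[of u])
    show "u 0 = x" by (simp add: u_def v(1))
    show "u t \<in> Dh" if "t \<in> {0..T}" for t unfolding u_def by (rule subspace_scale[OF Dh_subspace v(2)[OF that]])
    show "(u has_vector_derivative F t - Ah (u t)) (at t within {0..T})" if t: "t \<in> {0..T}" for t
    proof -
      have "(u has_vector_derivative exp (t / 2) *\<^sub>R (f t - (Ah (v t) + (1/2) *\<^sub>R v t)) + (exp (t / 2) / 2) *\<^sub>R v t) (at t within {0..T})"
        unfolding u_def[abs_def] by (rule has_vector_derivative_scaleR[OF e v(3)[OF t]])
      moreover have "exp (t / 2) *\<^sub>R f t = F t" by (simp add: f_def exp_add[symmetric])
      ultimately show ?thesis using Au[OF t] by (simp add: algebra_simps)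
    qed
    have "continuous_on {0..T} (\<lambda>t. exp (t / 2) *\<^sub>R ((Ah (v t) + (1/2) *\<^sub>R v t) - (1/2) *\<^sub>R v t))"
      by (intro continuous_intros v(4) vc) simp
    then show "continuous_on {0..T} (\<lambda>t. Ah (u t))"
      by (rule continuous_on_eq) (simp add: Au)
  qed
qed

text \<open>Half of the growth rate \<open>2\<close> comes from Young's inequality for the source, the other half from the defect of monotonicity.\<close>

lemma evolution_bound:
  assumes T: "0 \<le> T" and Fc: "continuous_on {0..T} F"
    and u: "\<And>t. t \<in> {0..T} \<Longrightarrow> u t \<in> Dh" "\<And>t. t \<in> {0..T} \<Longrightarrow> (u has_vector_derivative F t - Ah (u t)) (at t within {0..T})"
    and t: "t \<in> {0..T}"
  shows "lift_form (Ef 1) (u t) (u t) \<le> exp (2 * T) *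
    (lift_form (Ef 1) (u 0) (u 0) + integral {0..T} (\<lambda>s. lift_form (Ef 1) (F s) (F s)))"
proof -
  let ?b = "lift_form (Ef 1)"
  have gc: "continuous_on {0..T} (\<lambda>s. ?b (F s) (F s))" by (intro E.continuous_on Fc)
  have "?b (u t) (u t) \<le> exp (2 * t) * (?b (u 0) (u 0) + integral {0..t} (\<lambda>s. ?b (F s) (F s)))"
  proof (rule gronwall_interval[OF T _ E.energy_derivative[OF u(2)] _ gc E.nonneg t])
    fix s assume s: "s \<in> {0..T}"
    have "2 * ?b (F s - Ah (u s)) (u s) = 2 * ?b (F s) (u s) - 2 * ?b (Ah (u s)) (u s)"
      by (simp add: E.diff_left)
    then show "2 * ?b (F s - Ah (u s)) (u s) \<le> 2 * ?b (u s) (u s) + ?b (F s) (F s)"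
      using E.young[of "F s" "u s"] Ah_mono[OF u(1)[OF s]] by linarith
  qed simp
  also have "\<dots> \<le> exp (2 * T) * (?b (u 0) (u 0) + integral {0..T} (\<lambda>s. ?b (F s) (F s)))"
  proof (rule mult_mono)
    have "{0..t} \<subseteq> {0..T}" using t by auto
    then show "?b (u 0) (u 0) + integral {0..t} (\<lambda>s. ?b (F s) (F s)) \<le> ?b (u 0) (u 0) + integral {0..T} (\<lambda>s. ?b (F s) (F s))"
      using continuous_on_subset[OF gc]
      by (intro add_left_mono integral_subset_le integrable_continuous_interval gc) (auto simp: E.nonneg)
    show "0 \<le> ?b (u 0) (u 0) + integral {0..t} (\<lambda>s. ?b (F s) (F s))"
      by (intro add_nonneg_nonneg E.nonneg integral_nonneg integrable_continuous_interval continuous_on_subset[OF gc] \<open>{0..t} \<subseteq> {0..T}\<close>)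
  qed (use t in auto)
  finally show ?thesis .
qed

end

section \<open>The initial-value problem\<close>

context homogenized
begin

text \<open>Solutions of the initial-value problem are solutions of the abstract evolution equation in the quotient.\<close>

lemma ivp_solution_iff:
  assumes u0: "u0 \<in> DA M ell \<theta>" and T: "0 \<le> T" and G: "\<forall>t\<in>{0..T}. G t \<in> Hm1"
  shows "ivp_solution M ell \<theta> T G u0 u u' \<longleftrightarrow>
    (\<forall>t\<in>{0..T}. u t \<in> DA M ell \<theta> \<and> u' t \<in> Hspace \<and>
      ((\<lambda>s. mk (u s)) has_vector_derivative mk (u' t)) (at t within {0..T}) \<and>
      mk (u' t) = mk (source M ell \<theta> G t) - Ah (mk (u t))) \<and>
    continuous_on {0..T} (\<lambda>t. mk (u' t)) \<and> continuous_on {0..T} (\<lambda>t. Ah (mk (u t))) \<and> mk (u 0) = mk u0"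
    (is "_ \<longleftrightarrow> ?R")
proof -
  have 0: "0 \<in> {0..T}" using T by simp
  have e: "state_eq (u' t + Aop M ell \<theta> (u t)) (source M ell \<theta> G t) \<longleftrightarrow> mk (u' t) = mk (source M ell \<theta> G t) - Ah (mk (u t))"
    if "u t \<in> DA M ell \<theta>" "u' t \<in> Hspace" "t \<in> {0..T}" for t
  proof -
    have "mk (u' t + Aop M ell \<theta> (u t)) = mk (u' t) + Ah (mk (u t))"
      using that by (simp add: Ah_mk mk_add Aop_Hspace)
    then show ?thesis
      using mk_eq_iff[OF hs.in_X(1)[OF that(2) Aop_Hspace[OF that(1)]] source_Hspace[where G = G, OF bspec[OF G that(3)]]]
      by (auto simp: algebra_simps)
  qed
  have i: "state_eq (u 0) u0 \<longleftrightarrow> mk (u 0) = mk u0" if "u 0 \<in> DA M ell \<theta>"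
    using mk_eq_iff[OF DA_Hspace[OF that] DA_Hspace[OF u0]] by simp
  show ?thesis
  proof
    assume "ivp_solution M ell \<theta> T G u0 u u'"
    then show ?R using 0 e i unfolding ivp_solution_def C1_Hspace C0_Hspace C0_DA by blast
  next
    assume R: ?R
    then have "continuous_on {0..T} (\<lambda>t. mk (u t))"
      by (intro continuous_on_vector_derivative[where f' = "\<lambda>t. mk (u' t)"]) blast
    then show "ivp_solution M ell \<theta> T G u0 u u'"
      using R 0 e i DA_Hspace unfolding ivp_solution_def C1_Hspace C0_Hspace C0_DA by blast
  qed
qed

text \<open>For a source with values in \<open>H\<^sup>2\<close>, the pair \<open>(0, z)\<close> lies in the domain and \<open>A (0, z) = (- z, 0)\<close>, whose continuity in the energy space is exactly continuity of \<open>z\<close> in \<open>H\<^sup>2\<close>.\<close>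

lemma solution_exists:
  assumes u0: "u0 \<in> DA M ell \<theta>" and T: "0 \<le> T" and G: "\<forall>t\<in>{0..T}. G t \<in> Hm1"
    and Fc: "continuous_on {0..T} (\<lambda>t. mk (source M ell \<theta> G t))"
    and reg: "(\<exists>z'. C1_path H1 H1norm {0..T} (\<lambda>t. Rinv M ell \<theta> (G t)) z') \<or> C0_path H2 H2norm {0..T} (\<lambda>t. Rinv M ell \<theta> (G t))"
  shows "\<exists>u u'. ivp_solution M ell \<theta> T G u0 u u'"
proof -
  let ?F = "\<lambda>t. mk (source M ell \<theta> G t)"
  have Freg: "(\<exists>F'. continuous_on {0..T} F' \<and> (\<forall>t\<in>{0..T}. (?F has_vector_derivative F' t) (at t within {0..T}))) \<or>
      ((\<forall>t\<in>{0..T}. ?F t \<in> Dh) \<and> continuous_on {0..T} (\<lambda>t. Ah (?F t)))"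
    using reg
  proof (elim disjE exE)
    fix z' assume z: "C1_path H1 H1norm {0..T} (\<lambda>t. Rinv M ell \<theta> (G t)) z'"
    then have "continuous_on {0..T} (\<lambda>s. mk (0, z' s))" by (intro H1_path_continuous) (simp add: C1_path_def)
    then show ?thesis using H1_path_derivative[OF z] unfolding source_def by blast
  next
    assume z: "C0_path H2 H2norm {0..T} (\<lambda>t. Rinv M ell \<theta> (G t))"
    have A: "source M ell \<theta> G t \<in> DA M ell \<theta>" "Ah (?F t) = - mk (Rinv M ell \<theta> (G t), 0)" if t: "t \<in> {0..T}" for t
    proof -
      have H2: "Rinv M ell \<theta> (G t) \<in> sobolev (Suc (Suc 0)) UNIV" using z t unfolding C0_path_def H2_eq by blast
      have e: "Br M ell \<theta> 0 W = Bq M ell \<theta> (fst (source M ell \<theta> G t)) W" if W: "W \<in> sobolev (Suc (Suc 0)) UNIV" for W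
        using fform_diff[OF bform_fform(1)[OF Bq_bd W] sobolev_zero sobolev_zero]
          fform_diff[OF bform_fform(1)[OF Br_bd2 W] sobolev_zero sobolev_zero] by (simp add: source_def)
      have i: "fst (source M ell \<theta> G t) \<in> sobolev (Suc (Suc 0)) UNIV" "snd (source M ell \<theta> G t) \<in> sobolev (Suc (Suc 0)) UNIV"
        using H2 by (simp_all add: source_def sobolev_zero)
      show d: "source M ell \<theta> G t \<in> DA M ell \<theta>" by (rule DA_I(1)[OF i sobolev_zero e])
      have R: "(Rinv M ell \<theta> (G t), 0) \<in> Hspace" using H2 by (simp add: Hspace_iff sobolev_zero)
      have m: "(- Rinv M ell \<theta> (G t), 0) = - 1 *\<^sub>R (Rinv M ell \<theta> (G t), 0 :: 'd field)" by simp
      have R': "(- Rinv M ell \<theta> (G t), 0) \<in> Hspace" using hs.in_X(2)[OF R, of "- 1"] unfolding m[symmetric] .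
      have "snd (source M ell \<theta> G t) = Rinv M ell \<theta> (G t)" by (simp add: source_def)
      then have "state_eq (Aop M ell \<theta> (source M ell \<theta> G t)) (- Rinv M ell \<theta> (G t), 0)"
        using DA_I(2)[OF i sobolev_zero e] by (simp only:)
      then have "Ah (?F t) = mk (- Rinv M ell \<theta> (G t), 0)"
        unfolding Ah_mk[OF d] by (rule iffD2[OF mk_eq_iff[OF Aop_Hspace[OF d] R']])
      then show "Ah (?F t) = - mk (Rinv M ell \<theta> (G t), 0)" unfolding m mk_uminus[OF R] .
    qed
    have "continuous_on {0..T} (\<lambda>t. Ah (?F t))"
      by (rule continuous_on_eq[OF continuous_on_minus[OF H2_path_continuous(2)[OF z]]]) (simp add: A(2))
    then show ?thesis using A(1) mk_Dh by blast
  qed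
  obtain U where U: "U 0 = mk u0" "\<And>t. t \<in> {0..T} \<Longrightarrow> U t \<in> Dh"
    "\<And>t. t \<in> {0..T} \<Longrightarrow> (U has_vector_derivative ?F t - Ah (U t)) (at t within {0..T})"
    "continuous_on {0..T} (\<lambda>t. Ah (U t))"
    using evolution_exists[OF T mk_Dh[OF u0] Fc Freg] by blast
  have "ivp_solution M ell \<theta> T G u0 (\<lambda>t. rep (U t)) (\<lambda>t. rep (?F t - Ah (U t)))"
    unfolding ivp_solution_iff[where G = G, OF u0 T G] mk_rep
    using U rep_DA continuous_on_diff[OF Fc U(4)] by (simp del: atLeastAtMost_iff)
  then show ?thesis by blast
qed

lemma solution_unique:
  assumes u0: "u0 \<in> DA M ell \<theta>" and T: "0 \<le> T" and G: "\<forall>t\<in>{0..T}. G t \<in> Hm1"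
    and u: "ivp_solution M ell \<theta> T G u0 u u'" and w: "ivp_solution M ell \<theta> T G u0 w w'" and t: "t \<in> {0..T}"
  shows "state_eq (u t) (w t)"
proof -
  note us = u[unfolded ivp_solution_iff[where G = G, OF u0 T G]] and ws = w[unfolded ivp_solution_iff[where G = G, OF u0 T G]]
  define x where "x s = mk (u s) - mk (w s)" for s
  have D: "mk (u s) \<in> Dh" "mk (w s) \<in> Dh" if "s \<in> {0..T}" for s using us ws that mk_Dh by blast+
  have "lift_form (Ef 1) (x t) (x t) \<le> exp (2 * T) *
    (lift_form (Ef 1) (x 0) (x 0) + integral {0..T} (\<lambda>s. lift_form (Ef 1) ((\<lambda>s. 0) s) ((\<lambda>s. 0) s)))"
  proof (rule evolution_bound[OF T continuous_on_const _ _ t])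
    fix s assume s: "s \<in> {0..T}"
    show "x s \<in> Dh" unfolding x_def by (rule subspace_diff[OF Dh_subspace D[OF s]])
    have "(x has_vector_derivative mk (u' s) - mk (w' s)) (at s within {0..T})"
      unfolding x_def[abs_def] using us ws s by (intro has_vector_derivative_diff) blast+
    moreover have "mk (u' s) - mk (w' s) = 0 - Ah (x s)"
      using us ws s by (simp add: x_def Ah_diff[OF D[OF s]])
    ultimately show "(x has_vector_derivative 0 - Ah (x s)) (at s within {0..T})" by simp
  qed
  moreover have "x 0 = 0" using us ws by (simp add: x_def)
  ultimately have "lift_form (Ef 1) (x t) (x t) \<le> 0" by (simp add: E.zero_left)
  then have "x t = 0" using E.nonneg[of "x t"] E.zero_iff[of "x t"] by simp
  then have "mk (u t) = mk (w t)" by (simp add: x_def)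
  moreover have "u t \<in> Hspace" "w t \<in> Hspace" using us ws t DA_Hspace by blast+
  ultimately show ?thesis using mk_eq_iff by blast
qed

lemma solution_bound:
  assumes u0: "u0 \<in> DA M ell \<theta>" and T: "0 \<le> T" and G: "\<forall>t\<in>{0..T}. G t \<in> Hm1"
    and Fc: "continuous_on {0..T} (\<lambda>t. mk (source M ell \<theta> G t))"
    and u: "ivp_solution M ell \<theta> T G u0 u u'" and t: "t \<in> {0..T}"
  shows "(Hnorm M ell \<theta> (u t))\<^sup>2 \<le> exp (2 * T) * ((Hnorm M ell \<theta> u0)\<^sup>2 +
    (LBINT s:{0..T}. (Hnorm M ell \<theta> (source M ell \<theta> G s))\<^sup>2))"
proof -
  note us = u[unfolded ivp_solution_iff[where G = G, OF u0 T G]]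
  let ?F = "\<lambda>t. mk (source M ell \<theta> G t)" and ?b = "lift_form (Ef 1)"
  have gc: "continuous_on {0..T} (\<lambda>s. ?b (?F s) (?F s))" by (intro E.continuous_on Fc)
  have "(LBINT s:{0..T}. (Hnorm M ell \<theta> (source M ell \<theta> G s))\<^sup>2) = (LBINT s:{0..T}. ?b (?F s) (?F s))"
    by (rule set_lebesgue_integral_cong, simp, intro allI impI, rule Hnorm_sq, rule source_Hspace[where G = G], rule bspec[OF G])
  also have "\<dots> = integral {0..T} (\<lambda>s. ?b (?F s) (?F s))"
    by (rule set_borel_integral_eq_integral(2)[OF borel_integrable_atLeastAtMost'[OF gc]])
  finally have i: "(LBINT s:{0..T}. (Hnorm M ell \<theta> (source M ell \<theta> G s))\<^sup>2) = integral {0..T} (\<lambda>s. ?b (?F s) (?F s))" .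
  have "?b (mk (u t)) (mk (u t)) \<le> exp (2 * T) * (?b (mk (u 0)) (mk (u 0)) + integral {0..T} (\<lambda>s. ?b (?F s) (?F s)))"
  proof (rule evolution_bound[OF T Fc _ _ t])
    fix s assume s: "s \<in> {0..T}"
    show "mk (u s) \<in> Dh" using us s mk_Dh by blast
    have "((\<lambda>s. mk (u s)) has_vector_derivative mk (u' s)) (at s within {0..T})" "mk (u' s) = ?F s - Ah (mk (u s))"
      using us s by blast+
    then show "((\<lambda>s. mk (u s)) has_vector_derivative ?F s - Ah (mk (u s))) (at s within {0..T})" by simp
  qed
  moreover have "mk (u 0) = mk u0" using us by blast
  moreover have "u t \<in> Hspace" using us t DA_Hspace by blast
  ultimately show ?thesis unfolding i by (simp add: Hnorm_sq DA_Hspace[OF u0])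
qed

lemma solution_pde:
  assumes u0: "u0 \<in> DA M ell \<theta>" and T: "0 \<le> T" and G: "\<forall>t\<in>{0..T}. G t \<in> Hm1"
    and u: "ivp_solution M ell \<theta> T G u0 u u'" and t: "t \<in> {0..T}" and p: "test_fun UNIV \<phi>"
  shows "vdist (Qop M ell \<theta> (fst (u t))) \<phi> + vdist (Rop M ell \<theta> (snd (u' t))) \<phi> = G t \<phi>"
proof -
  have d: "u t \<in> DA M ell \<theta>" and h: "u' t \<in> Hspace"
    using u t unfolding ivp_solution_iff[where G = G, OF u0 T G] by blast+
  note s1 = test_fun_sobolev[OF p, of "Suc 0"] and s2 = test_fun_sobolev[OF p, of "Suc (Suc 0)"]
  have i: "snd (u' t) \<in> sobolev (Suc 0) UNIV" "snd (Aop M ell \<theta> (u t)) \<in> sobolev (Suc 0) UNIV"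
    using h DA_D(3)[OF d] by (auto simp: Hspace_iff)
  have "state_eq (u' t + Aop M ell \<theta> (u t)) (source M ell \<theta> G t)" using u t by (simp add: ivp_solution_def)
  then have e: "AE x in lebesgue. (snd (u' t) + snd (Aop M ell \<theta> (u t))) x = Rinv M ell \<theta> (G t) x"
    by (simp add: state_eq_def source_def)
  note g = bform_fform(1)[OF Br_bd s1]
  have "vdist (Qop M ell \<theta> (fst (u t))) \<phi> + vdist (Rop M ell \<theta> (snd (u' t))) \<phi>
      = Br M ell \<theta> (snd (Aop M ell \<theta> (u t))) \<phi> + Br M ell \<theta> (snd (u' t)) \<phi>"
    by (simp only: Qop_eq[OF DA_D(1)[OF d] p] Rop_eq[OF i(1) p] DA_D(4)[OF d s2])
  also have "\<dots> = Br M ell \<theta> (snd (u' t) + snd (Aop M ell \<theta> (u t))) \<phi>"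
    using fform_linear[OF g i(1) i(2), of 1] by simp
  also have "\<dots> = Br M ell \<theta> (Rinv M ell \<theta> (G t)) \<phi>"
    by (rule fform_cong[OF g sobolev_add[OF i] e])
  also have "\<dots> = G t \<phi>" by (rule Rinv_eq[OF bspec[OF G t] s1])
  finally show ?thesis .
qed

text \<open>The form without \<open>R(U, U')\<close> is not definite, but it is constant along solutions since the operator is skew for it.\<close>

lemma solution_energy:
  assumes u0: "u0 \<in> DA M ell \<theta>" and T: "0 \<le> T" and G: "\<forall>t\<in>{0..T}. G t \<in> Hm1"
    and u: "ivp_solution M ell \<theta> T G u0 u u'" and G0: "\<forall>t\<in>{0..T}. \<forall>W\<in>H1. G t W = 0" and t: "t \<in> {0..T}"
  shows "energy M ell \<theta> (fst (u t)) (fst (u' t)) = energy M ell \<theta> (fst (u 0)) (fst (u' 0))"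
proof -
  note us = u[unfolded ivp_solution_iff[where G = G, OF u0 T G]]
  define e where "e v w = Bq M ell \<theta> (fst v) (fst w) + Br M ell \<theta> (snd v) (snd w)" for v w :: "'d state"
  have e: "hform e" unfolding e_def[abs_def] by (rule hform_sum[OF Bq_bd Br_bd])
  interpret e: bounded_bilinear "lift_form e" by (rule lift_form_bilinear[OF e])
  have en: "energy M ell \<theta> (fst (u s)) (fst (u' s)) = lift_form e (mk (u s)) (mk (u s)) / 2" if s: "s \<in> {0..T}" for s
  proof -
    have d: "u s \<in> DA M ell \<theta>" and h: "u' s \<in> Hspace" using us s by blast+
    have "state_eq (u' s + Aop M ell \<theta> (u s)) (source M ell \<theta> G s)" using u s by (simp add: ivp_solution_def)
    then have f: "AE x in lebesgue. snd (u s) x = fst (u' s) x"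
      by (auto simp: state_eq_def source_def fst_Aop elim!: eventually_mono)
    have i: "fst (u s) \<in> sobolev (Suc (Suc 0)) UNIV" "fst (u' s) \<in> sobolev (Suc 0) UNIV" "snd (u s) \<in> sobolev (Suc 0) UNIV"
      using h DA_D[OF d] sobolev_Suc_D by (auto simp: Hspace_iff)
    have "Br M ell \<theta> (fst (u' s)) (fst (u' s)) = Br M ell \<theta> (snd (u s)) (snd (u s))"
      using bform_cong[OF Br_bd i(3) i(3) f f] by simp
    then show ?thesis
      by (simp add: energy_def Qform_eq[OF i(1) i(1)] Rform_eq[OF i(2) i(2)] lift_form_mk[OF e] DA_Hspace[OF d] e_def add_divide_distrib)
  qed
  have "((\<lambda>s. lift_form e (mk (u s)) (mk (u s))) has_vector_derivative 0) (at s within {0..T})" if s: "s \<in> {0..T}" for s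
  proof -
    have d: "u s \<in> DA M ell \<theta>" using us s by blast
    note dd = DA_D[OF d] and A = Aop_Hspace[OF d] and H = DA_Hspace[OF d]
    have "AE x in lebesgue. Rinv M ell \<theta> (G s) x = 0"
    proof (rule Br_zero_AE[OF Rinv_H1[OF bspec[OF G s]]])
      fix \<phi> :: "'d field" assume p: "test_fun UNIV \<phi>"
      have "G s \<phi> = 0" by (rule bspec[OF bspec[OF G0 s] test_fun_sobolev[OF p]])
      then show "Br M ell \<theta> (Rinv M ell \<theta> (G s)) \<phi> = 0"
        by (simp add: Rinv_eq[OF bspec[OF G s] test_fun_sobolev[OF p]])
    qed
    then have "mk (source M ell \<theta> G s) = mk 0"
      by (intro iffD2[OF mk_eq_iff[OF source_Hspace[where G = G, OF bspec[OF G s]] hs.in_X(4)]])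
        (simp add: state_eq_def source_def)
    then have m: "mk (u' s) = - mk (Aop M ell \<theta> (u s))" using us s by (simp add: mk_zero Ah_mk[OF d])
    have z: "e (Aop M ell \<theta> (u s)) (u s) = 0" unfolding e_def by (rule Aop_form(3)[OF d])
    have "e (u s) (Aop M ell \<theta> (u s)) = e (Aop M ell \<theta> (u s)) (u s)"
      unfolding e_def using A H by (simp add: Hspace_iff Bq_sym[of "fst (u s)"] Br_sym[of "snd (u s)"])
    then have "lift_form e (mk (u s)) (mk (u' s)) + lift_form e (mk (u' s)) (mk (u s)) = 0"
      using z by (simp add: m e.minus_left e.minus_right lift_form_mk[OF e] A H)
    moreover have "((\<lambda>s. mk (u s)) has_vector_derivative mk (u' s)) (at s within {0..T})" using us s by blast
    from e.has_vector_derivative[OF this this]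
    have "((\<lambda>s. lift_form e (mk (u s)) (mk (u s))) has_vector_derivative
      lift_form e (mk (u s)) (mk (u' s)) + lift_form e (mk (u' s)) (mk (u s))) (at s within {0..T})" .
    ultimately show ?thesis by simp
  qed
  then obtain c where "\<And>s. s \<in> {0..T} \<Longrightarrow> lift_form e (mk (u s)) (mk (u s)) = c"
    using has_vector_derivative_zero_constant[OF convex_real_interval(5)] by blast
  then have "lift_form e (mk (u t)) (mk (u t)) = lift_form e (mk (u 0)) (mk (u 0))" using t T by simp
  moreover have "0 \<in> {0..T}" using T by simp
  ultimately show ?thesis using en[OF t] en[of 0] by simp
qed

end

theorem proposition5:
  fixes M :: "'d::finite cell_model"
    and ell \<theta>0 \<theta> T :: real
    and G :: "real \<Rightarrow> 'd field \<Rightarrow> real"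
    and u0 :: "'d state"
  assumes "CARD('d) = 2 \<or> CARD('d) = 3"
    and "periodicity_cell M" and "material M" and "cell_functions M"
    and "ell > 0" and "T > 0"
    and "weight_threshold M \<theta>0" and "\<theta> > \<theta>0"
    and "u0 \<in> DA M ell \<theta>"
    and "\<forall>t\<in>{0..T}. G t \<in> Hm1"
    and "(\<exists>z'. C1_path H1 H1norm {0..T} (\<lambda>t. Rinv M ell \<theta> (G t)) z') \<or>
         C0_path H2 H2norm {0..T} (\<lambda>t. Rinv M ell \<theta> (G t))"
  shows "(\<exists>u u'. ivp_solution M ell \<theta> T G u0 u u') \<and>
     (\<forall>u u' w w'. ivp_solution M ell \<theta> T G u0 u u' \<and> ivp_solution M ell \<theta> T G u0 w w' \<longrightarrow>
        (\<forall>t\<in>{0..T}. state_eq (u t) (w t))) \<and>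
     (\<forall>u u'. ivp_solution M ell \<theta> T G u0 u u' \<longrightarrow>
        (\<forall>t\<in>{0..T}. \<forall>\<phi>. test_fun UNIV \<phi> \<longrightarrow>
           vdist (Qop M ell \<theta> (fst (u t))) \<phi> + vdist (Rop M ell \<theta> (snd (u' t))) \<phi> = G t \<phi>) \<and>
        (if \<forall>t\<in>{0..T}. \<forall>W\<in>H1. G t W = 0
         then \<forall>t\<in>{0..T}. energy M ell \<theta> (fst (u t)) (fst (u' t)) =
                energy M ell \<theta> (fst (u 0)) (fst (u' 0))
         else \<forall>t\<in>{0..T}. (Hnorm M ell \<theta> (u t))\<^sup>2 \<le> exp (2 * T) *
                ((Hnorm M ell \<theta> u0)\<^sup>2 +
                 (LBINT s:{0..T}. (Hnorm M ell \<theta> (source M ell \<theta> G s))\<^sup>2))))"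
proof -
  have adm: "admissible_weight M ell \<theta>"
    using assms(5,7,8) by (simp add: weight_threshold_def)
  interpret homogenized M ell \<theta>
    by unfold_locales (use assms adm in auto)
  have T: "0 \<le> T" using assms(6) by simp
  note G = assms(10)
  have "continuous_on {0..T} (\<lambda>t. mk (0, Rinv M ell \<theta> (G t)))"
    using assms(11)
  proof (elim disjE exE)
    fix z' assume "C1_path H1 H1norm {0..T} (\<lambda>t. Rinv M ell \<theta> (G t)) z'"
    then show ?thesis by (intro H1_path_continuous) (simp add: C1_path_def)
  qed (rule H2_path_continuous(1))
  then have Fc: "continuous_on {0..T} (\<lambda>t. mk (source M ell \<theta> G t))" by (simp add: source_def)
  show ?thesis
  proof (intro conjI allI impI ballI)
    show "\<exists>u u'. ivp_solution M ell \<theta> T G u0 u u'"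
      by (rule solution_exists[where G = G, OF assms(9) T G Fc assms(11)])
  next
    fix u u' w w' t
    assume "ivp_solution M ell \<theta> T G u0 u u' \<and> ivp_solution M ell \<theta> T G u0 w w'" "t \<in> {0..T}"
    then show "state_eq (u t) (w t)" using solution_unique[where G = G, OF assms(9) T G] by blast
  next
    fix u u' t and \<phi> :: "'d field"
    assume "ivp_solution M ell \<theta> T G u0 u u'" "t \<in> {0..T}" "test_fun UNIV \<phi>"
    then show "vdist (Qop M ell \<theta> (fst (u t))) \<phi> + vdist (Rop M ell \<theta> (snd (u' t))) \<phi> = G t \<phi>"
      using solution_pde[where G = G, OF assms(9) T G] by blast
  next
    fix u u' assume u: "ivp_solution M ell \<theta> T G u0 u u'"
    show "if \<forall>t\<in>{0..T}. \<forall>W\<in>H1. G t W = 0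
      then \<forall>t\<in>{0..T}. energy M ell \<theta> (fst (u t)) (fst (u' t)) = energy M ell \<theta> (fst (u 0)) (fst (u' 0))
      else \<forall>t\<in>{0..T}. (Hnorm M ell \<theta> (u t))\<^sup>2 \<le> exp (2 * T) *
        ((Hnorm M ell \<theta> u0)\<^sup>2 + (LBINT s:{0..T}. (Hnorm M ell \<theta> (source M ell \<theta> G s))\<^sup>2))"
    proof (cases "\<forall>t\<in>{0..T}. \<forall>W\<in>H1. G t W = 0")
      case True
      show ?thesis unfolding if_P[OF True] using solution_energy[where G = G, OF assms(9) T G u True] by blast
    next
      case False
      show ?thesis unfolding if_not_P[OF False] using solution_bound[where G = G, OF assms(9) T G Fc u] by blast
    qed
  qed
qed

end
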